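(* Let $E$ be a row-finite directed graph without cycles. The following are equivalent: (1) $C^*(E)$ is Fell; (2) for every $z\in E^\infty$ there exists $n\in\mathbb N$ such that $E|_{z(n)E^{\le\infty}}$ has finitely many splitting pairs of edges; (3) for every $z\in E^\infty$ there exist $n\in\mathbb N$ and a finite $F\subset E^*$ such that for any $x,y\in z(n)E^{\le\infty}$ with $x\sim y$, the pair $(x,y)$ is a monolithic extension of a pair in $F\times F$.
   Context: A directed graph $E=(E^0,E^1,r,s)$ consists of countable sets $E^0$ (vertices), $E^1$ (edges) and maps $r,s:E^1\to E^0$. It is row-finite if $r^{-1}(v)$ is finite for all $v\in E^0$; a source is a vertex $v$ with $r^{-1}(v)=\emptyset$. A finite path is a vertex (length $0$) or a sequence $\alpha=\alpha_1\cdots\alpha_k$ of edges with $s(\alpha_j)=r(\alpha_{j+1})$; $r(\alpha)=r(\alpha_1)$, $s(\alpha)=s(\alpha_k)$, $|\alpha|=k$. Infinite paths $x=x_1x_2\cdots$ are defined similarly, with $r(x)=r(x_1)$, $|x|=\infty$. $E^*$, $E^\infty$ are the sets of finite and infinite paths; paths are concatenated when source and range match. A cycle is a finite path $\alpha$ of non-zero length with $r(\alpha)=s(\alpha)$ and $s(\alpha_i)\ne s(\alpha_j)$ for $i\neq j$. $E^{\le\infty}=E^\infty\cup\{x\in E^*:s(x)\text{ is a source}\}$. $x(0)=r(x)$, $x(p)=s(x_p)$ for $1\le p\le|x|$; $\sigma^p(x)$ is $x$ with its first $p$ edges removed ($\sigma^{|x|}(x)=s(x)$ if $x$ is finite). $vE^{\le\infty}=\{x\in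 E^{\le\infty}:r(x)=v\}$. For $x,y\in E^{\le\infty}$, $x\sim y$ (shift equivalent) means $\sigma^m(x)=\sigma^l(y)$ for some $m,l\in\mathbb N$ with $m\le|x|$, $l\le|y|$. For $\alpha,\beta\in E^*$ with $s(\alpha)=s(\beta)$, a monolithic extension of $(\alpha,\beta)$ is a pair $(\alpha w,\beta w)$ with $w$ a finite or infinite path, $r(w)=s(\alpha)$. A pair of edges $\{f,g\}$ is splitting if $s(f)=s(g)$ and $f\ne g$. For $S\subset E^*\cup E^\infty$, $E|_S$ is the subgraph of $E$ whose edge set $E|_S^1$ consists of the edges $e$ with $e=x_p$ for some $x\in S$, $p\ge1$, and whose vertex set is $r(E|_S^1)\cup s(E|_S^1)$. $C^*(E)$ is the universal $C^*$-algebra generated by mutually orthogonal projections $\{p_v:v\in E^0\}$ and partial isometries $\{s_f:f\in E^1\}$ with $s_f^*s_f=p_{s(f)}$ for all $f$ and $p_v=\sum_{f\in E^1,\,r(f)=v}s_fs_f^*$ for every $v\in E^0$ that is not a source. A $C^*$-algebra $A$ is Fell if for every $\pi\in\widehat A$ there exist a positive $a\in A$ and a neighbourhood $V$ of $\pi$ in $\widehat A$ such that $\sigma(a)$ is a rank-one projection for every $\sigma\in V$. *)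

theory Defs
  imports
    "HOL-Analysis.Analysis"
    "HOL-Algebra.Module"
    "HOL-Library.Extended_Nat"
    "Graph_Theory.Digraph"
begin

section \<open>Directed graphs and their paths\<close>

text \<open>The range map is \<open>head\<close> and the source map is \<open>tail\<close>.\<close>

definition countable_digraph :: "('v, 'e) pre_digraph \<Rightarrow> bool" where
  "countable_digraph E \<longleftrightarrow> wf_digraph E \<and> countable (verts E) \<and> countable (arcs E)"

definition row_finite :: "('v, 'e) pre_digraph \<Rightarrow> bool" where
  "row_finite E \<longleftrightarrow> (\<forall>v \<in> verts E. finite (in_arcs E v))"

definition is_source :: "('v, 'e) pre_digraph \<Rightarrow> 'v \<Rightarrow> bool" where
  "is_source E v \<longleftrightarrow> v \<in> verts E \<and> in_arcs E v = {}"

text \<open>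
  \<open>FinPath v es\<close> is the finite path with range \<open>v\<close> and edge sequence \<open>es\<close>; thus \<open>FinPath v []\<close> is the
  vertex \<open>v\<close> regarded as a path of length 0, and for non-empty \<open>es\<close> the vertex \<open>v\<close> is
  determined by \<open>es\<close>. Consecutive edges satisfy source = range of the next one, so paths run
  in the opposite direction to the walks of \<^theory>\<open>Graph_Theory.Digraph\<close>. Edge sequences are
  indexed from 0 here, so the \<open>p\<close>-th edge (\<open>p \<ge> 1\<close>) sits at position \<open>p - 1\<close>.
\<close>

datatype ('v, 'e) path = FinPath 'v "'e list" | InfPath "nat \<Rightarrow> 'e"

definition finite_paths :: "('v, 'e) pre_digraph \<Rightarrow> ('v, 'e) path set" where
  "finite_paths E = {FinPath v es | v es.
     v \<in> verts E \<and> set es \<subseteq> arcs E \<and> (es \<noteq> [] \<longrightarrow> head E (hd es) = v) \<and>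
     (\<forall>j. Suc j < length es \<longrightarrow> tail E (es ! j) = head E (es ! Suc j))}"

definition infinite_paths :: "('v, 'e) pre_digraph \<Rightarrow> ('v, 'e) path set" where
  "infinite_paths E = {InfPath f | f.
     range f \<subseteq> arcs E \<and> (\<forall>j. tail E (f j) = head E (f (Suc j)))}"

fun path_length :: "('v, 'e) path \<Rightarrow> enat" where
  "path_length (FinPath v es) = enat (length es)"
| "path_length (InfPath f) = \<infinity>"

fun path_edge :: "('v, 'e) path \<Rightarrow> nat \<Rightarrow> 'e" where
  "path_edge (FinPath v es) p = es ! (p - 1)"
| "path_edge (InfPath f) p = f (p - 1)"

fun path_range :: "('v, 'e) pre_digraph \<Rightarrow> ('v, 'e) path \<Rightarrow> 'v" where
  "path_range E (FinPath v es) = v"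
| "path_range E (InfPath f) = head E (f 0)"

definition path_vertex :: "('v, 'e) pre_digraph \<Rightarrow> ('v, 'e) path \<Rightarrow> nat \<Rightarrow> 'v" where
  "path_vertex E x p = (if p = 0 then path_range E x else tail E (path_edge x p))"

text \<open>Infinite paths have no source; this value is never used.\<close>

fun path_source :: "('v, 'e) pre_digraph \<Rightarrow> ('v, 'e) path \<Rightarrow> 'v" where
  "path_source E (FinPath v es) = path_vertex E (FinPath v es) (length es)"
| "path_source E (InfPath f) = undefined"

fun path_shift :: "('v, 'e) pre_digraph \<Rightarrow> nat \<Rightarrow> ('v, 'e) path \<Rightarrow> ('v, 'e) path" where
  "path_shift E p (FinPath v es) = FinPath (path_vertex E (FinPath v es) p) (drop p es)"
| "path_shift E p (InfPath f) = InfPath (\<lambda>i. f (i + p))"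

fun path_append :: "('v, 'e) path \<Rightarrow> ('v, 'e) path \<Rightarrow> ('v, 'e) path" where
  "path_append (FinPath v es) (FinPath w fs) = FinPath v (es @ fs)"
| "path_append (FinPath v es) (InfPath f) = InfPath (\<lambda>i. if i < length es then es ! i else f (i - length es))"
| "path_append (InfPath f) y = InfPath f"

definition is_cycle :: "('v, 'e) pre_digraph \<Rightarrow> ('v, 'e) path \<Rightarrow> bool" where
  "is_cycle E \<alpha> \<longleftrightarrow> (\<exists>v es. \<alpha> = FinPath v es \<and> \<alpha> \<in> finite_paths E \<and> es \<noteq> [] \<and>
     path_range E \<alpha> = path_source E \<alpha> \<and> distinct (map (tail E) es))"

definition boundary_paths :: "('v, 'e) pre_digraph \<Rightarrow> ('v, 'e) path set" where
  "boundary_paths E =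
     infinite_paths E \<union> {x \<in> finite_paths E. is_source E (path_source E x)}"

definition boundary_paths_at :: "('v, 'e) pre_digraph \<Rightarrow> 'v \<Rightarrow> ('v, 'e) path set" where
  "boundary_paths_at E v = {x \<in> boundary_paths E. path_range E x = v}"

definition shift_equivalent ::
    "('v, 'e) pre_digraph \<Rightarrow> ('v, 'e) path \<Rightarrow> ('v, 'e) path \<Rightarrow> bool" where
  "shift_equivalent E x y \<longleftrightarrow>
     (\<exists>m l. enat m \<le> path_length x \<and> enat l \<le> path_length y \<and>
            path_shift E m x = path_shift E l y)"

definition monolithic_extension ::
    "('v, 'e) pre_digraph \<Rightarrow> ('v, 'e) path \<times> ('v, 'e) path \<Rightarrow> ('v, 'e) path \<times> ('v, 'e) path \<Rightarrow> bool"
  where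
  "monolithic_extension E xy ab \<longleftrightarrow> (case ab of (\<alpha>, \<beta>) \<Rightarrow>
     \<alpha> \<in> finite_paths E \<and> \<beta> \<in> finite_paths E \<and> path_source E \<alpha> = path_source E \<beta> \<and>
     (\<exists>w \<in> finite_paths E \<union> infinite_paths E. path_range E w = path_source E \<alpha> \<and>
        xy = (path_append \<alpha> w, path_append \<beta> w)))"

definition path_subgraph ::
    "('v, 'e) pre_digraph \<Rightarrow> ('v, 'e) path set \<Rightarrow> ('v, 'e) pre_digraph" where
  "path_subgraph E S =
     (let F = {path_edge x p | x p. x \<in> S \<and> 1 \<le> p \<and> enat p \<le> path_length x}
      in \<lparr>verts = head E ` F \<union> tail E ` F, arcs = F, tail = tail E, head = head E\<rparr>)"

definition splitting_pairs :: "('v, 'e) pre_digraph \<Rightarrow> 'e set set" where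
  "splitting_pairs E =
     {{f, g} | f g. f \<in> arcs E \<and> g \<in> arcs E \<and> tail E f = tail E g \<and> f \<noteq> g}"


section \<open>C*-algebras\<close>

definition complex_ring :: "complex ring" where
  "complex_ring = \<lparr>carrier = UNIV, mult = (*), one = 1, zero = 0, add = (+)\<rparr>"

text \<open>
  Complex vector spaces are modules over \<open>complex_ring\<close>. The field \<open>one\<close> of an
  algebra is not constrained (C*-algebras need not be unital), and for Hilbert spaces neither
  is \<open>mult\<close>.
\<close>

definition complete_wrt :: "(complex, 'a, 'm) module_scheme \<Rightarrow> ('a \<Rightarrow> real) \<Rightarrow> bool" where
  "complete_wrt M nrm \<longleftrightarrow>
     (\<forall>f :: nat \<Rightarrow> 'a. range f \<subseteq> carrier M \<and>
        (\<forall>\<epsilon>>0. \<exists>N. \<forall>m\<ge>N. \<forall>n\<ge>N. nrm (f m \<ominus>\<^bsub>M\<^esub> f n) < \<epsilon>) \<longrightarrow>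
        (\<exists>l \<in> carrier M. (\<lambda>n. nrm (f n \<ominus>\<^bsub>M\<^esub> l)) \<longlonglongrightarrow> 0))"

definition closed_wrt ::
    "(complex, 'a, 'm) module_scheme \<Rightarrow> ('a \<Rightarrow> real) \<Rightarrow> 'a set \<Rightarrow> bool" where
  "closed_wrt M nrm S \<longleftrightarrow>
     (\<forall>(f :: nat \<Rightarrow> 'a) l. range f \<subseteq> S \<and> l \<in> carrier M \<and>
        (\<lambda>n. nrm (f n \<ominus>\<^bsub>M\<^esub> l)) \<longlonglongrightarrow> 0 \<longrightarrow> l \<in> S)"

record 'a cstar = "(complex, 'a) module" +
  star :: "'a \<Rightarrow> 'a"
  cnorm :: "'a \<Rightarrow> real"

locale cstar_algebra = Module.module complex_ring A for A :: "'a cstar" (structure) +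
  assumes mult_closed: "\<lbrakk>x \<in> carrier A; y \<in> carrier A\<rbrakk> \<Longrightarrow> x \<otimes> y \<in> carrier A"
    and mult_assoc: "\<lbrakk>x \<in> carrier A; y \<in> carrier A; z \<in> carrier A\<rbrakk> \<Longrightarrow>
          (x \<otimes> y) \<otimes> z = x \<otimes> (y \<otimes> z)"
    and mult_add_left: "\<lbrakk>x \<in> carrier A; y \<in> carrier A; z \<in> carrier A\<rbrakk> \<Longrightarrow>
          (x \<oplus> y) \<otimes> z = x \<otimes> z \<oplus> y \<otimes> z"
    and mult_add_right: "\<lbrakk>x \<in> carrier A; y \<in> carrier A; z \<in> carrier A\<rbrakk> \<Longrightarrow>
          z \<otimes> (x \<oplus> y) = z \<otimes> x \<oplus> z \<otimes> y"
    and smult_mult_left: "\<lbrakk>x \<in> carrier A; y \<in> carrier A\<rbrakk> \<Longrightarrow> (c \<odot> x) \<otimes> y = c \<odot> (x \<otimes> y)"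
    and smult_mult_right: "\<lbrakk>x \<in> carrier A; y \<in> carrier A\<rbrakk> \<Longrightarrow> x \<otimes> (c \<odot> y) = c \<odot> (x \<otimes> y)"
    and star_closed: "x \<in> carrier A \<Longrightarrow> star A x \<in> carrier A"
    and star_star: "x \<in> carrier A \<Longrightarrow> star A (star A x) = x"
    and star_add: "\<lbrakk>x \<in> carrier A; y \<in> carrier A\<rbrakk> \<Longrightarrow> star A (x \<oplus> y) = star A x \<oplus> star A y"
    and star_smult: "x \<in> carrier A \<Longrightarrow> star A (c \<odot> x) = cnj c \<odot> star A x"
    and star_mult: "\<lbrakk>x \<in> carrier A; y \<in> carrier A\<rbrakk> \<Longrightarrow> star A (x \<otimes> y) = star A y \<otimes> star A x"
    and norm_nonneg: "x \<in> carrier A \<Longrightarrow> 0 \<le> cnorm A x"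
    and norm_eq_zero: "x \<in> carrier A \<Longrightarrow> cnorm A x = 0 \<longleftrightarrow> x = \<zero>"
    and norm_add: "\<lbrakk>x \<in> carrier A; y \<in> carrier A\<rbrakk> \<Longrightarrow> cnorm A (x \<oplus> y) \<le> cnorm A x + cnorm A y"
    and norm_smult: "x \<in> carrier A \<Longrightarrow> cnorm A (c \<odot> x) = cmod c * cnorm A x"
    and norm_mult: "\<lbrakk>x \<in> carrier A; y \<in> carrier A\<rbrakk> \<Longrightarrow> cnorm A (x \<otimes> y) \<le> cnorm A x * cnorm A y"
    and cstar_identity: "x \<in> carrier A \<Longrightarrow> cnorm A (star A x \<otimes> x) = (cnorm A x)\<^sup>2"
    and norm_complete: "complete_wrt A (cnorm A)"

definition star_hom :: "'a cstar \<Rightarrow> 'b cstar \<Rightarrow> ('a \<Rightarrow> 'b) \<Rightarrow> bool" where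
  "star_hom A B \<phi> \<longleftrightarrow>
     \<phi> \<in> carrier A \<rightarrow> carrier B \<and>
     (\<forall>x \<in> carrier A. \<forall>y \<in> carrier A. \<phi> (x \<oplus>\<^bsub>A\<^esub> y) = \<phi> x \<oplus>\<^bsub>B\<^esub> \<phi> y) \<and>
     (\<forall>c. \<forall>x \<in> carrier A. \<phi> (c \<odot>\<^bsub>A\<^esub> x) = c \<odot>\<^bsub>B\<^esub> \<phi> x) \<and>
     (\<forall>x \<in> carrier A. \<forall>y \<in> carrier A. \<phi> (x \<otimes>\<^bsub>A\<^esub> y) = \<phi> x \<otimes>\<^bsub>B\<^esub> \<phi> y) \<and>
     (\<forall>x \<in> carrier A. \<phi> (star A x) = star B (\<phi> x))"

definition cstar_subalgebra :: "'a cstar \<Rightarrow> 'a set \<Rightarrow> bool" where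
  "cstar_subalgebra A S \<longleftrightarrow>
     submodule S complex_ring A \<and>
     (\<forall>x \<in> S. \<forall>y \<in> S. x \<otimes>\<^bsub>A\<^esub> y \<in> S) \<and>
     (\<forall>x \<in> S. star A x \<in> S) \<and>
     closed_wrt A (cnorm A) S"

definition closed_ideal :: "'a cstar \<Rightarrow> 'a set \<Rightarrow> bool" where
  "closed_ideal A J \<longleftrightarrow>
     submodule J complex_ring A \<and>
     (\<forall>a \<in> carrier A. \<forall>j \<in> J. a \<otimes>\<^bsub>A\<^esub> j \<in> J \<and> j \<otimes>\<^bsub>A\<^esub> a \<in> J) \<and>
     closed_wrt A (cnorm A) J"

definition positive :: "'a cstar \<Rightarrow> 'a \<Rightarrow> bool" where
  "positive A a \<longleftrightarrow> (\<exists>b \<in> carrier A. a = star A b \<otimes>\<^bsub>A\<^esub> b)"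


section \<open>Representations and the spectrum\<close>

record 'h hilbert = "(complex, 'h) module" +
  hinner :: "'h \<Rightarrow> 'h \<Rightarrow> complex"

definition hnorm :: "'h hilbert \<Rightarrow> 'h \<Rightarrow> real" where
  "hnorm H x = sqrt (Re (hinner H x x))"

locale hilbert_space = Module.module complex_ring H for H :: "'h hilbert" (structure) +
  assumes hinner_add: "\<lbrakk>x \<in> carrier H; y \<in> carrier H; z \<in> carrier H\<rbrakk> \<Longrightarrow>
            hinner H (x \<oplus> y) z = hinner H x z + hinner H y z"
    and hinner_smult: "\<lbrakk>x \<in> carrier H; y \<in> carrier H\<rbrakk> \<Longrightarrow>
            hinner H (c \<odot> x) y = c * hinner H x y"
    and hinner_cnj: "\<lbrakk>x \<in> carrier H; y \<in> carrier H\<rbrakk> \<Longrightarrow> hinner H y x = cnj (hinner H x y)"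
    and hinner_nonneg: "x \<in> carrier H \<Longrightarrow> 0 \<le> Re (hinner H x x)"
    and hinner_eq_zero: "\<lbrakk>x \<in> carrier H; hinner H x x = 0\<rbrakk> \<Longrightarrow> x = \<zero>"
    and hnorm_complete: "complete_wrt H (hnorm H)"

definition linear_on :: "'h hilbert \<Rightarrow> 'k hilbert \<Rightarrow> ('h \<Rightarrow> 'k) \<Rightarrow> bool" where
  "linear_on H K T \<longleftrightarrow>
     T \<in> carrier H \<rightarrow> carrier K \<and>
     (\<forall>x \<in> carrier H. \<forall>y \<in> carrier H. T (x \<oplus>\<^bsub>H\<^esub> y) = T x \<oplus>\<^bsub>K\<^esub> T y) \<and>
     (\<forall>c. \<forall>x \<in> carrier H. T (c \<odot>\<^bsub>H\<^esub> x) = c \<odot>\<^bsub>K\<^esub> T x)"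

definition bounded_operator :: "'h hilbert \<Rightarrow> ('h \<Rightarrow> 'h) \<Rightarrow> bool" where
  "bounded_operator H T \<longleftrightarrow>
     linear_on H H T \<and> (\<exists>K. \<forall>x \<in> carrier H. hnorm H (T x) \<le> K * hnorm H x)"

definition representation :: "'a cstar \<Rightarrow> 'h hilbert \<Rightarrow> ('a \<Rightarrow> 'h \<Rightarrow> 'h) \<Rightarrow> bool" where
  "representation A H \<pi> \<longleftrightarrow>
     hilbert_space H \<and>
     (\<forall>a \<in> carrier A. bounded_operator H (\<pi> a)) \<and>
     (\<forall>a \<in> carrier A. \<forall>b \<in> carrier A. \<forall>x \<in> carrier H. \<pi> (a \<oplus>\<^bsub>A\<^esub> b) x = \<pi> a x \<oplus>\<^bsub>H\<^esub> \<pi> b x) \<and>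
     (\<forall>c. \<forall>a \<in> carrier A. \<forall>x \<in> carrier H. \<pi> (c \<odot>\<^bsub>A\<^esub> a) x = c \<odot>\<^bsub>H\<^esub> \<pi> a x) \<and>
     (\<forall>a \<in> carrier A. \<forall>b \<in> carrier A. \<forall>x \<in> carrier H. \<pi> (a \<otimes>\<^bsub>A\<^esub> b) x = \<pi> a (\<pi> b x)) \<and>
     (\<forall>a \<in> carrier A. \<forall>x \<in> carrier H. \<forall>y \<in> carrier H.
        hinner H (\<pi> a x) y = hinner H x (\<pi> (star A a) y))"

text \<open>
  The first condition excludes the zero representation on a space of dimension at most one,
  which has no proper invariant subspaces but is not irreducible by convention.
\<close>

definition irreducible_rep :: "'a cstar \<Rightarrow> 'h hilbert \<Rightarrow> ('a \<Rightarrow> 'h \<Rightarrow> 'h) \<Rightarrow> bool" where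
  "irreducible_rep A H \<pi> \<longleftrightarrow>
     representation A H \<pi> \<and>
     (\<exists>a \<in> carrier A. \<exists>x \<in> carrier H. \<pi> a x \<noteq> \<zero>\<^bsub>H\<^esub>) \<and>
     (\<forall>N. submodule N complex_ring H \<and> closed_wrt H (hnorm H) N \<and>
          (\<forall>a \<in> carrier A. \<forall>x \<in> N. \<pi> a x \<in> N) \<longrightarrow> N = {\<zero>\<^bsub>H\<^esub>} \<or> N = carrier H)"

definition unitarily_equivalent ::
    "'a cstar \<Rightarrow> 'h hilbert \<times> ('a \<Rightarrow> 'h \<Rightarrow> 'h) \<Rightarrow> 'k hilbert \<times> ('a \<Rightarrow> 'k \<Rightarrow> 'k) \<Rightarrow> bool" where
  "unitarily_equivalent A \<pi> \<rho> \<longleftrightarrow>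
     (\<exists>U. linear_on (fst \<pi>) (fst \<rho>) U \<and>
          bij_betw U (carrier (fst \<pi>)) (carrier (fst \<rho>)) \<and>
          (\<forall>x \<in> carrier (fst \<pi>). \<forall>y \<in> carrier (fst \<pi>).
             hinner (fst \<rho>) (U x) (U y) = hinner (fst \<pi>) x y) \<and>
          (\<forall>a \<in> carrier A. \<forall>x \<in> carrier (fst \<pi>). U (snd \<pi> a x) = snd \<rho> a (U x)))"

text \<open>
  To speak of all irreducible representations of an algebra with elements of type \<open>'a\<close>, a type
  for the vectors has to be fixed. The type \<open>'a \<Rightarrow> complex\<close> is large enough: if \<open>\<pi>\<close> is
  irreducible on \<open>H\<close> and \<open>\<xi> \<noteq> 0\<close>, then \<open>{\<pi> a \<xi> | a}\<close> is dense in \<open>H\<close>, so an orthonormal basis of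
  \<open>H\<close> can be indexed by a set of elements of \<open>'a\<close>, and \<open>H\<close> is unitarily equivalent to a closed
  subspace of \<open>\<ell>\<^sup>2('a)\<close>.
\<close>

type_synonym 'a rep = "('a \<Rightarrow> complex) hilbert \<times> ('a \<Rightarrow> ('a \<Rightarrow> complex) \<Rightarrow> ('a \<Rightarrow> complex))"

definition irreps :: "'a cstar \<Rightarrow> 'a rep set" where
  "irreps A = {\<pi>. irreducible_rep A (fst \<pi>) (snd \<pi>)}"

definition spectrum :: "'a cstar \<Rightarrow> 'a rep set set" where
  "spectrum A =
     irreps A // {(\<pi>, \<rho>). \<pi> \<in> irreps A \<and> \<rho> \<in> irreps A \<and> unitarily_equivalent A \<pi> \<rho>}"

definition rep_kernel :: "'a cstar \<Rightarrow> 'a rep \<Rightarrow> 'a set" where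
  "rep_kernel A \<pi> =
     {a \<in> carrier A. \<forall>x \<in> carrier (fst \<pi>). snd \<pi> a x = \<zero>\<^bsub>fst \<pi>\<^esub>}"

definition primitive_ideals :: "'a cstar \<Rightarrow> 'a set set" where
  "primitive_ideals A = rep_kernel A ` irreps A"

text \<open>
  The generating sets are the complements of the hulls of closed ideals; they already form a
  topology.
\<close>

definition hull_kernel_topology :: "'a cstar \<Rightarrow> 'a set topology" where
  "hull_kernel_topology A =
     topology_generated_by {{P \<in> primitive_ideals A. \<not> J \<subseteq> P} | J. closed_ideal A J}"

text \<open>
  Unitarily equivalent representations have the same kernel, so the intersection below is the
  kernel of any member of the class.
\<close>

definition class_kernel :: "'a cstar \<Rightarrow> 'a rep set \<Rightarrow> 'a set" where
  "class_kernel A c = (\<Inter>\<pi>\<in>c. rep_kernel A \<pi>)"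

definition spectrum_topology :: "'a cstar \<Rightarrow> 'a rep set topology" where
  "spectrum_topology A =
     pullback_topology (spectrum A) (class_kernel A) (hull_kernel_topology A)"

definition rank_one_projection :: "'h hilbert \<Rightarrow> ('h \<Rightarrow> 'h) \<Rightarrow> bool" where
  "rank_one_projection H T \<longleftrightarrow>
     bounded_operator H T \<and>
     (\<forall>x \<in> carrier H. T (T x) = T x) \<and>
     (\<forall>x \<in> carrier H. \<forall>y \<in> carrier H. hinner H (T x) y = hinner H x (T y)) \<and>
     (\<exists>\<xi> \<in> carrier H. \<xi> \<noteq> \<zero>\<^bsub>H\<^esub> \<and> T ` carrier H = {c \<odot>\<^bsub>H\<^esub> \<xi> | c. True})"

definition Fell :: "'a cstar \<Rightarrow> bool" where
  "Fell A \<longleftrightarrow>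
     (\<forall>c \<in> spectrum A. \<exists>a \<in> carrier A. \<exists>V \<subseteq> spectrum A.
        positive A a \<and>
        (\<exists>U. openin (spectrum_topology A) U \<and> c \<in> U \<and> U \<subseteq> V) \<and>
        (\<forall>d \<in> V. \<forall>\<sigma> \<in> d. rank_one_projection (fst \<sigma>) (snd \<sigma> a)))"


section \<open>The C*-algebra of a directed graph\<close>

definition ck_family ::
    "('v, 'e) pre_digraph \<Rightarrow> 'a cstar \<Rightarrow> ('v \<Rightarrow> 'a) \<Rightarrow> ('e \<Rightarrow> 'a) \<Rightarrow> bool" where
  "ck_family E A p s \<longleftrightarrow>
     (\<forall>v \<in> verts E. p v \<in> carrier A \<and> p v \<otimes>\<^bsub>A\<^esub> p v = p v \<and> star A (p v) = p v) \<and>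
     (\<forall>v \<in> verts E. \<forall>w \<in> verts E. v \<noteq> w \<longrightarrow> p v \<otimes>\<^bsub>A\<^esub> p w = \<zero>\<^bsub>A\<^esub>) \<and>
     (\<forall>f \<in> arcs E. s f \<in> carrier A \<and> s f \<otimes>\<^bsub>A\<^esub> star A (s f) \<otimes>\<^bsub>A\<^esub> s f = s f) \<and>
     (\<forall>f \<in> arcs E. star A (s f) \<otimes>\<^bsub>A\<^esub> s f = p (tail E f)) \<and>
     (\<forall>v \<in> verts E. \<not> is_source E v \<longrightarrow>
        p v = (\<Oplus>\<^bsub>A\<^esub>f \<in> in_arcs E v. s f \<otimes>\<^bsub>A\<^esub> star A (s f)))"

text \<open>
  \<open>graph_cstar_algebra E A p s\<close>: the C*-algebra \<open>A\<close> is generated by the family \<open>(p, s)\<close>, which is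
  universal among all families satisfying the same relations. The homomorphism \<open>\<phi>\<close> is
  unique since \<open>(p, s)\<close> generates. The type of the elements of the test algebras \<open>B\<close> has to be
  fixed. It suffices to test against the C*-algebra generated by a family; this
  is separable, hence faithfully represented on \<open>\<ell>\<^sup>2(\<nat>)\<close>, and the operators on \<open>\<ell>\<^sup>2(\<nat>)\<close> can be
  taken in the type used below. So the property holds for test algebras of any type.
\<close>

definition graph_cstar_algebra ::
    "('v, 'e) pre_digraph \<Rightarrow> 'a cstar \<Rightarrow> ('v \<Rightarrow> 'a) \<Rightarrow> ('e \<Rightarrow> 'a) \<Rightarrow> bool" where
  "graph_cstar_algebra E A p s \<longleftrightarrow>
     cstar_algebra A \<and> ck_family E A p s \<and>
     (\<forall>S. cstar_subalgebra A S \<and> p ` verts E \<subseteq> S \<and> s ` arcs E \<subseteq> S \<longrightarrow> S = carrier A) \<and>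
     (\<forall>(B :: ((nat \<Rightarrow> complex) \<Rightarrow> nat \<Rightarrow> complex) cstar) q t.
        cstar_algebra B \<and> ck_family E B q t \<longrightarrow>
        (\<exists>\<phi>. star_hom A B \<phi> \<and> (\<forall>v \<in> verts E. \<phi> (p v) = q v) \<and> (\<forall>f \<in> arcs E. \<phi> (s f) = t f)))"

end

theory Submission
  imports Defs
begin

text \<open>
  In a graph without cycles, two distinct paths with the same endpoints diverge at a splitting pair,
  and a path is determined by its endpoints together with the splitting edges on it. This gives the
  equivalence of (2) and (3) at each vertex, and shows that (2) holds iff every infinite path \<open>z\<close>
  passes through a vertex \<open>z(n)\<close> from which no splitting pair can be reached.

  If no splitting pair can be reached from \<open>v\<close>, then every word in the generators compressed by \<open>p\<^sub>v\<close>
  acts in a representation as 0 or as a projection \<open>s\<^sub>\<alpha>s\<^sub>\<alpha>\<^sup>*\<close>. These commute, so \<open>p\<^sub>v\<close> has rank at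
  most one in every irreducible representation. Given an irreducible \<open>\<pi>\<close>, start at a vertex with
  \<open>\<pi>(p\<^sub>v) \<noteq> 0\<close> and keep following edges \<open>f\<close> with \<open>\<pi>(s\<^sub>f) \<noteq> 0\<close>; by (2) this reaches a vertex \<open>v\<close> with
  \<open>\<pi>(p\<^sub>v) \<noteq> 0\<close> from which no splitting pair can be reached, and then \<open>{\<sigma>. \<sigma>(p\<^sub>v) \<noteq> 0}\<close> is the
  required neighbourhood of \<open>\<pi>\<close>.

  Conversely, suppose that splitting pairs can be reached from each \<open>z(n)\<close>. Choose two distinct paths
  from \<open>z(n)\<close> to a common vertex \<open>u\<^sub>n\<close> and \<open>x\<^sub>n \<in> u\<^sub>nE\<^sup>\<le>\<^sup>\<infinity>\<close>, and let \<open>\<pi>\<^sub>x\<close> be the irreducible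
  representation on \<open>\<ell>\<^sup>2\<close> of the shift class of \<open>x\<close>. For \<open>w \<sim> z\<close>, the shift class of \<open>x\<^sub>n\<close> contains
  two distinct paths that agree with \<open>w\<close> on longer and longer initial segments. Absence of cycles
  forces the \<open>2 \<times> 2\<close> matrix of \<open>\<pi>\<^sub>x\<^sub>n(a)\<close> at these paths to converge to \<open>\<langle>\<pi>\<^sub>z(a)\<delta>\<^sub>w, \<delta>\<^sub>w\<rangle> \<cdot> 1\<close>. Hence
  \<open>\<pi>\<^sub>x\<^sub>n\<close> converges to \<open>\<pi>\<^sub>z\<close> while \<open>\<pi>\<^sub>x\<^sub>n(a)\<close> cannot have rank one for large \<open>n\<close>.

  Orthogonality of the ranges of distinct \<open>s\<^sub>f\<close> is used only inside representations on Hilbert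
  spaces, where it follows from Pythagoras; in an abstract C*-algebra it would need the theory of
  positive elements.
\<close>

section \<open>Normed complex vector spaces\<close>

text \<open>Finiteness in (2) turns into emptiness further along the path: finitely many splitting
  edges leave only finitely many paths to their sources, and beyond the longest of these no
  splitting edge can be reached. Both directions of the Fell criterion work with this empty case.
  Density of words is usable because every representation satisfies the uniform bound
  \<open>hnorm H (\<pi> a x) \<le> 2 * cnorm A a * hnorm H x\<close>. It comes from a square root in
  the algebra, found by fixed-point iteration. Convergence is tested on kernels. If an ideal
  contains \<open>j\<close> and \<open>j\<close> survives in the limit, then \<open>j j*\<close> has
  a non-zero diagonal coefficient there, and nearby diagonal coefficients are non-zero too. Rank one
  is refuted by a determinant: a rank-one projection has singular \<open>2 \<times> 2\<close>
  matrices, but here the diagonal has modulus at least 3/4 and the off-diagonal at most 1/4 of the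
  same number. Two types are prescribed: universality is tested on operators over
  \<open>nat \<Rightarrow> complex\<close>, while points of the spectrum act on
  \<open>'a \<Rightarrow> complex\<close>. Orbits are therefore first indexed by naturals and then
  by multiples of a vertex projection.\<close>

lemma complex_ring_simps [simp]:
  "carrier complex_ring = UNIV" "mult complex_ring = (*)" "one complex_ring = 1"
  "zero complex_ring = 0" "add complex_ring = (+)"
  by (simp_all add: complex_ring_def)

lemma cring_complex_ring: "cring complex_ring"
proof (rule cringI)
  show "abelian_group complex_ring"
    by (rule abelian_groupI) (auto intro: exI[of _ "- x" for x])
  show "comm_monoid complex_ring"
    by (rule comm_monoidI) auto
qed (auto simp: algebra_simps)

text \<open>The scalar ring has carrier \<open>UNIV\<close>, so the module laws can be restated
  without membership conditions on scalars.\<close>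

locale complex_vector_space = Module.module complex_ring M for M (structure)
begin

lemma smul_closed [simp, intro]: "x \<in> carrier M \<Longrightarrow> c \<odot> x \<in> carrier M"
  using smult_closed[of c x] by simp

lemma smul_add_left: "x \<in> carrier M \<Longrightarrow> (c + d) \<odot> x = c \<odot> x \<oplus> d \<odot> x"
  using smult_l_distr[of c d x] by simp

lemma smul_add_right:
  "x \<in> carrier M \<Longrightarrow> y \<in> carrier M \<Longrightarrow> c \<odot> (x \<oplus> y) = c \<odot> x \<oplus> c \<odot> y"
  using smult_r_distr[of c x y] by simp

lemma smul_smul: "x \<in> carrier M \<Longrightarrow> c \<odot> (d \<odot> x) = (c * d) \<odot> x"
  using smult_assoc1[of c d x] by simp

lemma smul_one [simp]: "x \<in> carrier M \<Longrightarrow> 1 \<odot> x = x"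
  using smult_one[of x] by simp

lemma smul_zero_left [simp]: "x \<in> carrier M \<Longrightarrow> 0 \<odot> x = \<zero>"
  using smult_l_null[of x] by simp

lemma smul_zero_right [simp]: "c \<odot> \<zero> = \<zero>"
  using smult_r_null[of c] by simp

lemma neg_eq_smul: "x \<in> carrier M \<Longrightarrow> \<ominus> x = (-1) \<odot> x"
proof -
  assume x: "x \<in> carrier M"
  have "(-1) \<odot> x \<oplus> x = (-1 + 1) \<odot> x"
    using x smul_add_left[of x "-1" 1] by simp
  then have "(-1) \<odot> x \<oplus> x = \<zero>" using x by simp
  then show ?thesis using x M.minus_equality by blast
qed

lemma minus_eq_smul: "y \<in> carrier M \<Longrightarrow> x \<ominus> y = x \<oplus> (-1) \<odot> y"
  by (simp add: a_minus_def neg_eq_smul)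

text \<open>Negation is multiplication by -1, so closure under sums and scalars already yields an
  additive subgroup.\<close>

lemma submodule_iff:
  "submodule S complex_ring M \<longleftrightarrow> S \<subseteq> carrier M \<and> \<zero> \<in> S \<and>
     (\<forall>x\<in>S. \<forall>y\<in>S. x \<oplus> y \<in> S) \<and> (\<forall>c. \<forall>x\<in>S. c \<odot> x \<in> S)"
proof
  assume S: "submodule S complex_ring M"
  note E = submoduleE[OF S]
  obtain x where "x \<in> S" using E(2) by blast
  then have "\<zero> \<in> S" using E(4)[of 0 x] E(1) by auto
  then show "S \<subseteq> carrier M \<and> \<zero> \<in> S \<and>
     (\<forall>x\<in>S. \<forall>y\<in>S. x \<oplus> y \<in> S) \<and> (\<forall>c. \<forall>x\<in>S. c \<odot> x \<in> S)"
    using E by auto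
next
  assume "S \<subseteq> carrier M \<and> \<zero> \<in> S \<and>
     (\<forall>x\<in>S. \<forall>y\<in>S. x \<oplus> y \<in> S) \<and> (\<forall>c. \<forall>x\<in>S. c \<odot> x \<in> S)"
  then show "submodule S complex_ring M"
    by (intro submoduleI) (auto simp: neg_eq_smul subset_iff)
qed

lemma minus_zero_iff: "x \<in> carrier M \<Longrightarrow> y \<in> carrier M \<Longrightarrow> x \<ominus> y = \<zero> \<longleftrightarrow> x = y"
  using M.add.inv_solve_right'[of \<zero> x y] by (auto simp: a_minus_def M.r_neg)

lemma add_minus_add:
  "a \<in> carrier M \<Longrightarrow> b \<in> carrier M \<Longrightarrow> c \<in> carrier M \<Longrightarrow> d \<in> carrier M \<Longrightarrow>
   (a \<oplus> b) \<ominus> (c \<oplus> d) = (a \<ominus> c) \<oplus> (b \<ominus> d)"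
  by (simp add: minus_eq_smul smul_add_right M.a_ac)

lemma minus_telescope:
  "x \<in> carrier M \<Longrightarrow> y \<in> carrier M \<Longrightarrow> z \<in> carrier M \<Longrightarrow> x \<ominus> z = (x \<ominus> y) \<oplus> (y \<ominus> z)"
  by (simp add: a_minus_def M.a_assoc[symmetric])
     (simp add: M.a_assoc M.l_neg)

lemma minus_swap: "x \<in> carrier M \<Longrightarrow> y \<in> carrier M \<Longrightarrow> y \<ominus> x = (-1) \<odot> (x \<ominus> y)"
  by (simp add: minus_eq_smul smul_add_right smul_smul M.a_ac)

lemma smul_minus:
  "x \<in> carrier M \<Longrightarrow> y \<in> carrier M \<Longrightarrow> c \<odot> x \<ominus> c \<odot> y = c \<odot> (x \<ominus> y)"
  by (simp add: minus_eq_smul smul_add_right smul_smul)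

lemma minus_closed [simp, intro]: "x \<in> carrier M \<Longrightarrow> y \<in> carrier M \<Longrightarrow> x \<ominus> y \<in> carrier M"
  by (simp add: minus_eq_smul)

lemma minus_zero: "x \<in> carrier M \<Longrightarrow> x \<ominus> \<zero> = x"
  by (simp add: minus_eq_smul)

lemma add_minus_cancel: "x \<in> carrier M \<Longrightarrow> y \<in> carrier M \<Longrightarrow> y \<oplus> (x \<ominus> y) = x"
  by (simp add: a_minus_def M.a_lcomm[of y] M.r_neg)

end

lemma complex_vector_spaceI:
  fixes M :: "(complex, 'a, 'm) module_scheme" (structure)
  assumes "\<And>x y. x \<in> carrier M \<Longrightarrow> y \<in> carrier M \<Longrightarrow> x \<oplus> y \<in> carrier M"
    and "\<zero> \<in> carrier M"
    and "\<And>c x. x \<in> carrier M \<Longrightarrow> c \<odot> x \<in> carrier M"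
    and "\<And>x y z. x \<in> carrier M \<Longrightarrow> y \<in> carrier M \<Longrightarrow> z \<in> carrier M \<Longrightarrow> (x \<oplus> y) \<oplus> z = x \<oplus> (y \<oplus> z)"
    and "\<And>x y. x \<in> carrier M \<Longrightarrow> y \<in> carrier M \<Longrightarrow> x \<oplus> y = y \<oplus> x"
    and "\<And>x. x \<in> carrier M \<Longrightarrow> \<zero> \<oplus> x = x"
    and "\<And>x. x \<in> carrier M \<Longrightarrow> (-1) \<odot> x \<oplus> x = \<zero>"
    and "\<And>c d x. x \<in> carrier M \<Longrightarrow> (c + d) \<odot> x = c \<odot> x \<oplus> d \<odot> x"
    and "\<And>c x y. x \<in> carrier M \<Longrightarrow> y \<in> carrier M \<Longrightarrow> c \<odot> (x \<oplus> y) = c \<odot> x \<oplus> c \<odot> y"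
    and "\<And>c d x. x \<in> carrier M \<Longrightarrow> (c * d) \<odot> x = c \<odot> (d \<odot> x)"
    and "\<And>x. x \<in> carrier M \<Longrightarrow> 1 \<odot> x = x"
  shows "Module.module complex_ring M"
proof (rule Module.moduleI)
  show "cring complex_ring" by (rule cring_complex_ring)
  show "abelian_group M"
  proof (rule abelian_groupI)
    show "\<exists>y\<in>carrier M. y \<oplus> x = \<zero>" if "x \<in> carrier M" for x
      using assms(3,7)[OF that] by blast
  qed (use assms in auto)
qed (use assms in auto)

text \<open>The norm is a parameter and not a record field, so that \<open>hnorm H\<close> and
  \<open>cnorm A\<close> share the results on closures and Cauchy sequences.\<close>

locale normed_vector_space = complex_vector_space M for M (structure) +
  fixes nrm :: "'b \<Rightarrow> real"
  assumes nrm_nonneg [simp]: "x \<in> carrier M \<Longrightarrow> 0 \<le> nrm x"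
    and nrm_eq_0: "x \<in> carrier M \<Longrightarrow> nrm x = 0 \<longleftrightarrow> x = \<zero>"
    and nrm_add: "x \<in> carrier M \<Longrightarrow> y \<in> carrier M \<Longrightarrow> nrm (x \<oplus> y) \<le> nrm x + nrm y"
    and nrm_smul: "x \<in> carrier M \<Longrightarrow> nrm (c \<odot> x) = cmod c * nrm x"
begin

lemma nrm_zero [simp]: "nrm \<zero> = 0"
  by (simp add: nrm_eq_0)

lemma nrm_minus_commute: "x \<in> carrier M \<Longrightarrow> y \<in> carrier M \<Longrightarrow> nrm (x \<ominus> y) = nrm (y \<ominus> x)"
  by (simp add: minus_swap[of x y] nrm_smul)

lemma nrm_triangle:
  "x \<in> carrier M \<Longrightarrow> y \<in> carrier M \<Longrightarrow> z \<in> carrier M \<Longrightarrow> nrm (x \<ominus> z) \<le> nrm (x \<ominus> y) + nrm (y \<ominus> z)"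
  using nrm_add[of "x \<ominus> y" "y \<ominus> z"] minus_telescope[of x y z] by simp

lemma nrm_add_minus_add:
  "a \<in> carrier M \<Longrightarrow> b \<in> carrier M \<Longrightarrow> c \<in> carrier M \<Longrightarrow> d \<in> carrier M \<Longrightarrow>
   nrm ((a \<oplus> b) \<ominus> (c \<oplus> d)) \<le> nrm (a \<ominus> c) + nrm (b \<ominus> d)"
  using nrm_add[of "a \<ominus> c" "b \<ominus> d"] by (simp add: add_minus_add)

lemma nrm_smul_minus:
  "x \<in> carrier M \<Longrightarrow> y \<in> carrier M \<Longrightarrow> nrm (c \<odot> x \<ominus> c \<odot> y) = cmod c * nrm (x \<ominus> y)"
  by (simp add: smul_minus nrm_smul)

lemma nrm_le_add_minus: "x \<in> carrier M \<Longrightarrow> y \<in> carrier M \<Longrightarrow> nrm x \<le> nrm y + nrm (x \<ominus> y)"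
  using nrm_add[of y "x \<ominus> y"] by (simp add: add_minus_cancel)

text \<open>Approximation form of the norm closure; \<open>closed_wrtI\<close> and
  \<open>closed_wrtD\<close> connect it with the sequential notion
  \<open>closed_wrt\<close>.\<close>

definition closure_of_set :: "'b set \<Rightarrow> 'b set" where
  "closure_of_set S = {x \<in> carrier M. \<forall>\<epsilon>>0. \<exists>y\<in>S. nrm (x \<ominus> y) < \<epsilon>}"

lemma closure_superset: "S \<subseteq> carrier M \<Longrightarrow> S \<subseteq> closure_of_set S"
proof
  fix x assume S: "S \<subseteq> carrier M" "x \<in> S"
  then have "nrm (x \<ominus> x) = 0" by (auto simp: minus_zero_iff[THEN iffD2])
  then show "x \<in> closure_of_set S" using S by (force simp: closure_of_set_def)
qed

lemma closed_wrtI: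
  assumes "\<And>x. x \<in> carrier M \<Longrightarrow> (\<And>\<epsilon>. \<epsilon> > 0 \<Longrightarrow> \<exists>y\<in>S. nrm (x \<ominus> y) < \<epsilon>) \<Longrightarrow> x \<in> S"
    and sub: "S \<subseteq> carrier M"
  shows "closed_wrt M nrm S"
  unfolding closed_wrt_def
proof (intro allI impI, elim conjE)
  fix f :: "nat \<Rightarrow> 'b" and l
  assume f: "range f \<subseteq> S" and l: "l \<in> carrier M" and lim: "(\<lambda>n. nrm (f n \<ominus> l)) \<longlonglongrightarrow> 0"
  show "l \<in> S"
  proof (rule assms(1)[OF l])
    fix \<epsilon> :: real assume "\<epsilon> > 0"
    then have "eventually (\<lambda>n. nrm (f n \<ominus> l) < \<epsilon>) sequentially"
      using lim order_tendstoD(2) by blast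
    then obtain n where n: "nrm (f n \<ominus> l) < \<epsilon>" by (auto simp: eventually_sequentially)
    have "f n \<in> S" using f by auto
    then show "\<exists>y\<in>S. nrm (l \<ominus> y) < \<epsilon>"
      using n l sub by (metis nrm_minus_commute subset_iff)
  qed
qed

lemma closed_wrtD:
  assumes cl: "closed_wrt M nrm S" and sub: "S \<subseteq> carrier M" and x: "x \<in> carrier M"
    and "\<And>\<epsilon>. \<epsilon> > 0 \<Longrightarrow> \<exists>y\<in>S. nrm (x \<ominus> y) < \<epsilon>"
  shows "x \<in> S"
proof -
  have "\<forall>n. \<exists>y\<in>S. nrm (x \<ominus> y) < inverse (real (Suc n))"
    using assms(4) by simp
  then obtain f where f: "\<And>n. f n \<in> S" "\<And>n. nrm (x \<ominus> f n) < inverse (real (Suc n))"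
    by metis
  have "(\<lambda>n. nrm (f n \<ominus> x)) \<longlonglongrightarrow> 0"
  proof (rule Lim_null_comparison[OF _ LIMSEQ_inverse_real_of_nat])
    show "\<forall>\<^sub>F n in sequentially. norm (nrm (f n \<ominus> x)) \<le> inverse (real (Suc n))"
      using f x sub by (auto intro!: always_eventually simp: nrm_minus_commute[of _ x] subset_iff less_imp_le)
  qed
  then show ?thesis
    using cl f(1) x unfolding closed_wrt_def by blast
qed

lemma closed_closure_of_set:
  assumes "S \<subseteq> carrier M" shows "closed_wrt M nrm (closure_of_set S)"
proof (rule closed_wrtI)
  fix x assume x: "x \<in> carrier M" and *: "\<And>\<epsilon>. \<epsilon> > 0 \<Longrightarrow> \<exists>y\<in>closure_of_set S. nrm (x \<ominus> y) < \<epsilon>"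
  have "\<exists>y\<in>S. nrm (x \<ominus> y) < \<epsilon>" if e: "\<epsilon> > 0" for \<epsilon>
  proof -
    from e have e2: "\<epsilon>/2 > 0" by simp
    from *[OF e2] obtain y where y: "y \<in> closure_of_set S" "nrm (x \<ominus> y) < \<epsilon>/2" by blast
    then obtain z where z: "z \<in> S" "nrm (y \<ominus> z) < \<epsilon>/2"
      using e2 unfolding closure_of_set_def by blast
    have "nrm (x \<ominus> z) \<le> nrm (x \<ominus> y) + nrm (y \<ominus> z)"
      using x y z assms by (intro nrm_triangle) (auto simp: closure_of_set_def)
    then show ?thesis using y z by (auto intro!: bexI[of _ z])
  qed
  then show "x \<in> closure_of_set S" using x by (auto simp: closure_of_set_def)
qed (auto simp: closure_of_set_def)

lemma submodule_closure_of_set: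
  assumes "submodule S complex_ring M"
  shows "submodule (closure_of_set S) complex_ring M"
  unfolding submodule_iff
proof (intro conjI ballI allI)
  note S = assms[unfolded submodule_iff]
  show "closure_of_set S \<subseteq> carrier M" by (auto simp: closure_of_set_def)
  show "\<zero> \<in> closure_of_set S" using S closure_superset by blast
  fix x y c assume x: "x \<in> closure_of_set S" 
  then have xM: "x \<in> carrier M" by (auto simp: closure_of_set_def)
  show "c \<odot> x \<in> closure_of_set S"
    unfolding closure_of_set_def
  proof (clarsimp simp: xM)
    fix \<epsilon> :: real assume e: "\<epsilon> > 0"
    \<comment> \<open>Adding 1 covers the case \<open>c = 0\<close>.\<close>
    then have "\<epsilon> / (cmod c + 1) > 0" by (simp add: add_nonneg_pos)
    then obtain x' where x': "x' \<in> S" "nrm (x \<ominus> x') < \<epsilon> / (cmod c + 1)"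
      using x unfolding closure_of_set_def by blast
    have "nrm (c \<odot> x \<ominus> c \<odot> x') = cmod c * nrm (x \<ominus> x')" using x' S xM by (auto intro: nrm_smul_minus)
    also have "\<dots> \<le> (cmod c + 1) * nrm (x \<ominus> x')" using x' S xM by (intro mult_right_mono) auto
    also have "\<dots> < \<epsilon>" using x' by (simp add: pos_less_divide_eq add_nonneg_pos mult.commute)
    finally show "\<exists>y\<in>S. nrm (c \<odot> x \<ominus> y) < \<epsilon>" using S x' by blast
  qed
  assume y: "y \<in> closure_of_set S" 
  then have yM: "y \<in> carrier M" by (auto simp: closure_of_set_def)
  show "x \<oplus> y \<in> closure_of_set S"
    unfolding closure_of_set_def
  proof (clarsimp simp: xM yM)
    fix \<epsilon> :: real assume e: "\<epsilon> > 0"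
    obtain x' where x': "x' \<in> S" "nrm (x \<ominus> x') < \<epsilon> / 2"
      using x e unfolding closure_of_set_def by (auto dest: spec[of _ "\<epsilon>/2"])
    obtain y' where y': "y' \<in> S" "nrm (y \<ominus> y') < \<epsilon> / 2"
      using y e unfolding closure_of_set_def by (auto dest: spec[of _ "\<epsilon>/2"])
    have "nrm ((x \<oplus> y) \<ominus> (x' \<oplus> y')) \<le> nrm (x \<ominus> x') + nrm (y \<ominus> y')"
      using x' y' S xM yM by (auto intro: nrm_add_minus_add)
    then show "\<exists>z\<in>S. nrm (x \<oplus> y \<ominus> z) < \<epsilon>" using S x' y' by (intro bexI[of _ "x' \<oplus> y'"]) auto
  qed
qed

lemma Cauchy_geometric:
  assumes compl: "complete_wrt M nrm" and f: "\<And>n. f n \<in> carrier M"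
    and step: "\<And>n. nrm (f (Suc n) \<ominus> f n) \<le> (1/2)^n"
  shows "\<exists>l\<in>carrier M. (\<lambda>n. nrm (f n \<ominus> l)) \<longlonglongrightarrow> 0"
proof -
  have close: "nrm (f (n + k) \<ominus> f n) \<le> 2 * (1/2)^n" for n k
  proof -
    \<comment> \<open>The first factor is the geometric sum
      \<open>1 + 1/2 + ... + (1/2)^(k-1)\<close>; keeping it exact makes the induction
      close.\<close>
    have "nrm (f (n + k) \<ominus> f n) \<le> (2 - 2 * (1/2)^k) * (1/2)^n" for k
    proof (induction k)
      case 0
      then show ?case using f by (simp add: minus_zero_iff[THEN iffD2])
    next
      case (Suc k)
      have "nrm (f (n + Suc k) \<ominus> f n) \<le> nrm (f (n + Suc k) \<ominus> f (n + k)) + nrm (f (n + k) \<ominus> f n)"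
        using f by (intro nrm_triangle) auto
      also have "\<dots> \<le> (1/2)^(n+k) + (2 - 2 * (1/2)^k) * (1/2)^n"
        using Suc step[of "n+k"] by simp
      also have "\<dots> = (2 - 2 * (1/2)^Suc k) * (1/2)^n"
        by (simp add: power_add algebra_simps)
      finally show ?case .
    qed
    from this[of k] show ?thesis
      by (rule order_trans) (simp add: mult_right_mono)
  qed
  have "\<forall>\<epsilon>>0. \<exists>N. \<forall>m\<ge>N. \<forall>n\<ge>N. nrm (f m \<ominus> f n) < \<epsilon>"
  proof (intro allI impI)
    fix \<epsilon> :: real assume "\<epsilon> > 0"
    then obtain N where N: "(1/2)^N < \<epsilon>/4" using real_arch_pow_inv[of "\<epsilon>/4" "1/2"] by auto
    have "nrm (f m \<ominus> f n) < \<epsilon>" if "m \<ge> N" "n \<ge> N" for m n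
    proof -
      have "nrm (f m \<ominus> f n) \<le> nrm (f m \<ominus> f N) + nrm (f N \<ominus> f n)"
        using f by (intro nrm_triangle) auto
      also have "\<dots> \<le> 2 * (1/2)^N + 2 * (1/2)^N"
        using close[of N "m - N"] close[of N "n - N"] that f by (simp add: nrm_minus_commute[of "f N"])
      finally show ?thesis using N by simp
    qed
    then show "\<exists>N. \<forall>m\<ge>N. \<forall>n\<ge>N. nrm (f m \<ominus> f n) < \<epsilon>" by blast
  qed
  then show ?thesis using compl f unfolding complete_wrt_def by blast
qed

end

section \<open>Hilbert spaces, C*-algebras and bounded representations\<close>

context hilbert_space
begin

sublocale complex_vector_space H ..

lemma hinner_zero_left [simp]: "y \<in> carrier H \<Longrightarrow> hinner H \<zero> y = 0"
  using hinner_smult[of \<zero> y 0] by simp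

lemma hinner_zero_right [simp]: "y \<in> carrier H \<Longrightarrow> hinner H y \<zero> = 0"
  using hinner_cnj[of \<zero> y] by simp

lemma hinner_add_right:
  "x \<in> carrier H \<Longrightarrow> y \<in> carrier H \<Longrightarrow> z \<in> carrier H \<Longrightarrow>
   hinner H z (x \<oplus> y) = hinner H z x + hinner H z y"
  using hinner_cnj[of "x \<oplus> y" z] hinner_cnj[of x z] hinner_cnj[of y z] by (simp add: hinner_add)

lemma hinner_smult_right:
  "x \<in> carrier H \<Longrightarrow> y \<in> carrier H \<Longrightarrow> hinner H x (c \<odot> y) = cnj c * hinner H x y"
  using hinner_cnj[of "c \<odot> y" x] hinner_cnj[of y x] by (simp add: hinner_smult)

lemma hinner_minus_left:
  "x \<in> carrier H \<Longrightarrow> y \<in> carrier H \<Longrightarrow> z \<in> carrier H \<Longrightarrow>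
   hinner H (x \<ominus> y) z = hinner H x z - hinner H y z"
  by (simp add: minus_eq_smul hinner_add hinner_smult)

lemma hinner_minus_right:
  "x \<in> carrier H \<Longrightarrow> y \<in> carrier H \<Longrightarrow> z \<in> carrier H \<Longrightarrow>
   hinner H z (x \<ominus> y) = hinner H z x - hinner H z y"
  by (simp add: minus_eq_smul hinner_add_right hinner_smult_right)

lemma hinner_self: "x \<in> carrier H \<Longrightarrow> hinner H x x = complex_of_real ((hnorm H x)\<^sup>2)"
  using hinner_cnj[of x x] hinner_nonneg[of x]
  by (auto simp: hnorm_def complex_eq_iff)

lemma hnorm_sq: "x \<in> carrier H \<Longrightarrow> (hnorm H x)\<^sup>2 = Re (hinner H x x)"
  using hinner_self[of x] by simp

lemma hnorm_nonneg [simp]: "x \<in> carrier H \<Longrightarrow> 0 \<le> hnorm H x"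
  using hinner_nonneg[of x] by (simp add: hnorm_def)

lemma hnorm_eq_0: "x \<in> carrier H \<Longrightarrow> hnorm H x = 0 \<longleftrightarrow> x = \<zero>"
  using hinner_self[of x] hinner_eq_zero[of x] by auto

lemma Cauchy_Schwarz:
  assumes x: "x \<in> carrier H" and y: "y \<in> carrier H"
  shows "cmod (hinner H x y) \<le> hnorm H x * hnorm H y"
proof (cases "y = \<zero>")
  case True
  then show ?thesis using x by simp
next
  case False
  define n where "n = (hnorm H y)\<^sup>2"
  \<comment> \<open>The coefficient of the orthogonal projection of \<open>x\<close> onto
    \<open>y\<close>; the inequality is the non-negativity of the squared norm of
    \<open>x \<ominus> c \<odot> y\<close>.\<close>
  define c where "c = hinner H x y / complex_of_real n"
  have n: "n > 0" using False y hnorm_eq_0[of y] by (simp add: n_def)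
  have yy: "hinner H y y = complex_of_real n" using y by (simp add: hinner_self n_def)
  have yx: "hinner H y x = cnj (hinner H x y)" using x y by (rule hinner_cnj)
  define q where "q = hinner H x y"
  have cy: "c \<odot> y \<in> carrier H" using y by simp
  have "hinner H (x \<ominus> c \<odot> y) (x \<ominus> c \<odot> y)
      = (hinner H x x - hinner H x (c \<odot> y)) - (hinner H (c \<odot> y) x - hinner H (c \<odot> y) (c \<odot> y))"
    using x cy by (simp only: hinner_minus_left hinner_minus_right minus_closed) (simp only: algebra_simps)
  also have "hinner H x (c \<odot> y) = cnj c * q"
    using hinner_smult_right[OF x y, of c] by (simp only: q_def)
  also have "hinner H (c \<odot> y) x = c * cnj q"
    using hinner_smult[OF y x, of c] by (simp only: q_def yx)
  also have "hinner H (c \<odot> y) (c \<odot> y) = c * (cnj c * complex_of_real n)"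
    using hinner_smult[OF y cy, of c] hinner_smult_right[OF y y, of c] by (simp only: yy)
  also have "(hinner H x x - cnj c * q) - (c * cnj q - c * (cnj c * complex_of_real n))
      = hinner H x x - cnj c * q - c * cnj q + c * cnj c * complex_of_real n"
    by (simp only: algebra_simps)
  also have "cnj c * q = complex_of_real ((cmod q)\<^sup>2 / n)"
    unfolding c_def q_def[symmetric] of_real_divide complex_norm_square complex_cnj_divide complex_cnj_complex_of_real
    by (metis mult.commute times_divide_eq_left)
  also have "c * cnj q = complex_of_real ((cmod q)\<^sup>2 / n)"
    unfolding c_def q_def[symmetric] of_real_divide complex_norm_square by (rule times_divide_eq_left)
  also have "c * cnj c * complex_of_real n = complex_of_real ((cmod q)\<^sup>2 / n)"
    unfolding c_def q_def[symmetric] of_real_divide complex_norm_square complex_cnj_divide complex_cnj_complex_of_real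
    using n by (simp only: times_divide_eq_left times_divide_eq_right of_real_eq_0_iff less_irrefl
      nonzero_mult_div_cancel_right divide_divide_eq_left mult.assoc) auto
  also have "hinner H x x = complex_of_real ((hnorm H x)\<^sup>2)"
    using x by (rule hinner_self)
  finally have *: "hinner H (x \<ominus> c \<odot> y) (x \<ominus> c \<odot> y)
    = complex_of_real ((hnorm H x)\<^sup>2) - complex_of_real ((cmod q)\<^sup>2 / n)
      - complex_of_real ((cmod q)\<^sup>2 / n) + complex_of_real ((cmod q)\<^sup>2 / n)" .
  have "0 \<le> Re (hinner H (x \<ominus> c \<odot> y) (x \<ominus> c \<odot> y))"
    using x cy by (intro hinner_nonneg minus_closed)
  then have "0 \<le> (hnorm H x)\<^sup>2 - (cmod q)\<^sup>2 / n"
    unfolding * by simp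
  then have "(cmod q)\<^sup>2 \<le> (hnorm H x)\<^sup>2 * n"
    using n by (simp add: pos_divide_le_eq)
  then have "(cmod (hinner H x y))\<^sup>2 \<le> (hnorm H x * hnorm H y)\<^sup>2"
    by (simp add: n_def q_def power_mult_distrib)
  then show ?thesis
    by (rule power2_le_imp_le) (intro mult_nonneg_nonneg hnorm_nonneg x y)
qed

lemma hnorm_add:
  assumes x: "x \<in> carrier H" and y: "y \<in> carrier H"
  shows "hnorm H (x \<oplus> y) \<le> hnorm H x + hnorm H y"
proof (rule power2_le_imp_le)
  have "(hnorm H (x \<oplus> y))\<^sup>2 = (hnorm H x)\<^sup>2 + 2 * Re (hinner H x y) + (hnorm H y)\<^sup>2"
    using x y hinner_cnj[of x y] by (simp add: hnorm_sq hinner_add hinner_add_right)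
  also have "Re (hinner H x y) \<le> hnorm H x * hnorm H y"
    using Cauchy_Schwarz[OF x y] complex_Re_le_cmod order_trans by blast
  finally show "(hnorm H (x \<oplus> y))\<^sup>2 \<le> (hnorm H x + hnorm H y)\<^sup>2"
    by (simp add: power2_sum)
qed (use x y in auto)

lemma hnorm_smul: "x \<in> carrier H \<Longrightarrow> hnorm H (c \<odot> x) = cmod c * hnorm H x"
proof -
  assume x: "x \<in> carrier H"
  have "hinner H (c \<odot> x) (c \<odot> x) = (c * cnj c) * hinner H x x"
    using x by (simp add: hinner_smult hinner_smult_right)
  then have "Re (hinner H (c \<odot> x) (c \<odot> x)) = (cmod c)\<^sup>2 * Re (hinner H x x)"
    by (simp add: complex_norm_square[symmetric])
  then show ?thesis by (simp add: hnorm_def real_sqrt_mult)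
qed

sublocale normed_vector_space H "hnorm H"
  by unfold_locales (simp_all add: hnorm_eq_0 hnorm_add hnorm_smul)

text \<open>Carries an operator identity over to its adjoint: \<open>PT\<close> and
  \<open>PS\<close> below are obtained in this way from \<open>SP\<close> and
  \<open>TP\<close>.\<close>

lemma hinner_eqI:
  assumes "x \<in> carrier H" "y \<in> carrier H" "\<And>z. z \<in> carrier H \<Longrightarrow> hinner H x z = hinner H y z"
  shows "x = y"
proof -
  have "hinner H (x \<ominus> y) (x \<ominus> y) = 0" using assms by (simp add: hinner_minus_left)
  then show ?thesis using assms hinner_eq_zero[of "x \<ominus> y"] minus_zero_iff by auto
qed

end

section \<open>Norm estimates and a square root in C*-algebras\<close>

context cstar_algebra
begin

sublocale normed_vector_space A "cnorm A"
  by unfold_locales (simp_all add: norm_nonneg norm_eq_zero norm_add norm_smult)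

declare mult_closed [simp, intro] star_closed [simp, intro] star_star [simp]

lemma zero_mult [simp]: "x \<in> carrier A \<Longrightarrow> \<zero> \<otimes> x = \<zero>"
  using smult_mult_left[of \<zero> x 0] by simp

lemma mult_zero [simp]: "x \<in> carrier A \<Longrightarrow> x \<otimes> \<zero> = \<zero>"
  using smult_mult_right[of x \<zero> 0] by simp

lemma star_zero [simp]: "star A \<zero> = \<zero>"
  using star_smult[of \<zero> 0] by simp

lemma mult_minus_left:
  "x \<in> carrier A \<Longrightarrow> y \<in> carrier A \<Longrightarrow> z \<in> carrier A \<Longrightarrow> (x \<ominus> y) \<otimes> z = x \<otimes> z \<ominus> y \<otimes> z"
  by (simp add: minus_eq_smul mult_add_left smult_mult_left)

lemma mult_minus_right:
  "x \<in> carrier A \<Longrightarrow> y \<in> carrier A \<Longrightarrow> z \<in> carrier A \<Longrightarrow> z \<otimes> (x \<ominus> y) = z \<otimes> x \<ominus> z \<otimes> y"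
  by (simp add: minus_eq_smul mult_add_right smult_mult_right)

lemma star_minus:
  "x \<in> carrier A \<Longrightarrow> y \<in> carrier A \<Longrightarrow> star A (x \<ominus> y) = star A x \<ominus> star A y"
  by (simp add: minus_eq_smul star_add star_smult)

text \<open>The C*-identity gives
  \<open>cnorm A x * cnorm A x \<le> cnorm A (star A x) * cnorm A x\<close>; cancel, then apply the
  same to \<open>star A x\<close>.\<close>

lemma norm_star [simp]: "x \<in> carrier A \<Longrightarrow> cnorm A (star A x) = cnorm A x"
proof -
  have *: "cnorm A x \<le> cnorm A (star A x)" if x: "x \<in> carrier A" for x
  proof (cases "cnorm A x = 0")
    case False
    have "cnorm A x * cnorm A x \<le> cnorm A (star A x) * cnorm A x"
      using cstar_identity[OF x] norm_mult[of "star A x" x] x by (simp add: power2_eq_square)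
    then show ?thesis using False norm_nonneg[OF x] by simp
  qed (use that norm_nonneg[of "star A x"] in simp)
  assume "x \<in> carrier A"
  then show ?thesis using *[of x] *[of "star A x"] by simp
qed

lemma norm_mult_minus_mult:
  assumes "a \<in> carrier A" "b \<in> carrier A" "c \<in> carrier A" "d \<in> carrier A"
  shows "cnorm A (a \<otimes> b \<ominus> c \<otimes> d) \<le> cnorm A a * cnorm A (b \<ominus> d) + cnorm A (a \<ominus> c) * cnorm A d"
proof -
  have "cnorm A (a \<otimes> b \<ominus> c \<otimes> d) \<le> cnorm A (a \<otimes> b \<ominus> a \<otimes> d) + cnorm A (a \<otimes> d \<ominus> c \<otimes> d)"
    using assms by (intro nrm_triangle) auto
  also have "a \<otimes> b \<ominus> a \<otimes> d = a \<otimes> (b \<ominus> d)" using assms by (simp add: mult_minus_right)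
  also have "a \<otimes> d \<ominus> c \<otimes> d = (a \<ominus> c) \<otimes> d" using assms by (simp add: mult_minus_left)
  finally show ?thesis
    using norm_mult[of a "b \<ominus> d"] norm_mult[of "a \<ominus> c" d] assms by simp
qed

lemma closure_cstar_subalgebra:
  assumes sub: "submodule S complex_ring A"
    and mult: "\<And>x y. x \<in> S \<Longrightarrow> y \<in> S \<Longrightarrow> x \<otimes> y \<in> S"
    and star: "\<And>x. x \<in> S \<Longrightarrow> star A x \<in> S"
  shows "cstar_subalgebra A (closure_of_set S)"
  unfolding cstar_subalgebra_def
proof (intro conjI ballI)
  have S: "S \<subseteq> carrier A" using sub by (simp add: submodule_iff)
  show "submodule (closure_of_set S) complex_ring A" by (rule submodule_closure_of_set[OF sub])
  show "closed_wrt A (cnorm A) (closure_of_set S)" by (rule closed_closure_of_set[OF S])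
  fix x assume "x \<in> closure_of_set S"
  then have x: "x \<in> carrier A" "\<And>\<epsilon>. \<epsilon> > 0 \<Longrightarrow> \<exists>y\<in>S. cnorm A (x \<ominus> y) < \<epsilon>"
    by (auto simp: closure_of_set_def)
  show "star A x \<in> closure_of_set S"
  proof (clarsimp simp: closure_of_set_def x(1))
    fix \<epsilon> :: real assume "\<epsilon> > 0"
    then obtain x' where x': "x' \<in> S" "cnorm A (x \<ominus> x') < \<epsilon>" using x(2) by blast
    have "cnorm A (star A x \<ominus> star A x') = cnorm A (x \<ominus> x')"
      using x'(1) S x(1) by (simp add: star_minus[symmetric] subset_iff)
    then show "\<exists>y\<in>S. cnorm A (star A x \<ominus> y) < \<epsilon>" using x' star by metis
  qed
  fix y assume "y \<in> closure_of_set S"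
  then have y: "y \<in> carrier A" "\<And>\<epsilon>. \<epsilon> > 0 \<Longrightarrow> \<exists>z\<in>S. cnorm A (y \<ominus> z) < \<epsilon>"
    by (auto simp: closure_of_set_def)
  show "x \<otimes> y \<in> closure_of_set S"
  proof (clarsimp simp: closure_of_set_def x(1) y(1))
    fix \<epsilon> :: real assume e: "\<epsilon> > 0"
    define \<delta> where "\<delta> = \<epsilon> / (2 * (cnorm A x + 1))"
    have x0: "cnorm A x \<ge> 0" using x(1) by simp
    have "\<delta> > 0" unfolding \<delta>_def using e x0 by (intro divide_pos_pos) auto
    then obtain y' where y': "y' \<in> S" "cnorm A (y \<ominus> y') < \<delta>" using y(2) by blast
    \<comment> \<open>The tolerance for \<open>x\<close> can be fixed only after \<open>y'\<close>
      has been chosen, since its error enters multiplied by \<open>cnorm A y'\<close>.\<close>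
    define \<eta> where "\<eta> = \<epsilon> / (2 * (cnorm A y' + 1))"
    have y'c: "y' \<in> carrier A" using y' S by auto
    then have y0: "cnorm A y' \<ge> 0" by simp
    have "\<eta> > 0" unfolding \<eta>_def using e y0 by (intro divide_pos_pos) auto
    then obtain x' where x': "x' \<in> S" "cnorm A (x \<ominus> x') < \<eta>" using x(2) by blast
    have x'c: "x' \<in> carrier A" using x' S by auto
    have "cnorm A x * cnorm A (y \<ominus> y') \<le> cnorm A x * \<delta>"
      using y' x0 by (intro mult_left_mono) auto
    also have "\<dots> < (cnorm A x + 1) * \<delta>" using \<open>\<delta> > 0\<close> by simp
    also have "\<dots> = \<epsilon>/2" unfolding \<delta>_def using x0 by (simp add: field_simps add_nonneg_eq_0_iff)
    finally have 1: "cnorm A x * cnorm A (y \<ominus> y') < \<epsilon>/2" .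
    have "cnorm A (x \<ominus> x') * cnorm A y' \<le> \<eta> * cnorm A y'"
      using x' y0 by (intro mult_right_mono) auto
    also have "\<dots> < \<eta> * (cnorm A y' + 1)" using \<open>\<eta> > 0\<close> by simp
    also have "\<dots> = \<epsilon>/2" unfolding \<eta>_def using y0 by (simp add: field_simps add_nonneg_eq_0_iff)
    finally have 2: "cnorm A (x \<ominus> x') * cnorm A y' < \<epsilon>/2" .
    have "cnorm A (x \<otimes> y \<ominus> x' \<otimes> y') < \<epsilon>"
      using norm_mult_minus_mult[OF x(1) y(1) x'c y'c] 1 2 by linarith
    then show "\<exists>z\<in>S. cnorm A (x \<otimes> y \<ominus> z) < \<epsilon>" using x'(1) y'(1) mult by blast
  qed
qed

text \<open>A solution \<open>y\<close> satisfies \<open>1 - h\<^sup>2 = (1 - y)\<^sup>2\<close> in the unitization of the algebra.\<close>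

lemma square_root_equation:
  assumes h: "h \<in> carrier A" "star A h = h" and small: "cnorm A h \<le> 1/2"
  shows "\<exists>y\<in>carrier A. star A y = y \<and> y = (1/2) \<odot> (h \<otimes> h \<oplus> y \<otimes> y)"
proof -
  define g where "g = h \<otimes> h"
  \<comment> \<open>The solution is a fixed point of \<open>F\<close>. As \<open>g\<close> has norm
    at most 1/4, \<open>F\<close> maps the ball of radius 1/2 into itself, and the iteration starts
    at zero.\<close>
  define F where "F y = (1/2) \<odot> (g \<oplus> y \<otimes> y)" for y
  define f where "f n = (F ^^ n) \<zero>" for n
  have g: "g \<in> carrier A" "star A g = g" using h by (simp_all add: g_def star_mult)
  have "cnorm A g \<le> cnorm A h * cnorm A h" unfolding g_def using h by (simp add: norm_mult)
  also have "\<dots> \<le> (1/2) * (1/2)" using small h by (intro mult_mono) auto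
  finally have ng: "cnorm A g \<le> 1/4" by simp
  have F: "F y \<in> carrier A" if "y \<in> carrier A" for y using that g by (simp add: F_def)
  have f: "f n \<in> carrier A \<and> star A (f n) = f n \<and> cnorm A (f n) \<le> 1/2" for n
  proof (induction n)
    case 0
    then show ?case by (simp add: f_def)
  next
    case (Suc n)
    have fS: "f (Suc n) = (1/2) \<odot> (g \<oplus> f n \<otimes> f n)" by (simp add: f_def F_def)
    have "cnorm A (g \<oplus> f n \<otimes> f n) \<le> cnorm A g + cnorm A (f n) * cnorm A (f n)"
      using Suc g norm_add[of g "f n \<otimes> f n"] norm_mult[of "f n" "f n"] by simp
    also have "cnorm A (f n) * cnorm A (f n) \<le> (1/2) * (1/2)" using Suc by (intro mult_mono) auto
    finally have "cnorm A (g \<oplus> f n \<otimes> f n) \<le> 1/2" using ng by simp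
    then show ?case using Suc g by (simp add: fS star_smult star_add star_mult norm_smult)
  qed
  \<comment> \<open>On the ball of radius 1/2 the two norms add up to at most 1, so \<open>F\<close>
    contracts by the factor 1/2.\<close>
  have Fdiff: "cnorm A (F y \<ominus> F z) \<le> 1/2 * ((cnorm A y + cnorm A z) * cnorm A (y \<ominus> z))"
    if y: "y \<in> carrier A" and z: "z \<in> carrier A" for y z
  proof -
    have "F y \<ominus> F z = (1/2) \<odot> ((g \<oplus> y \<otimes> y) \<ominus> (g \<oplus> z \<otimes> z))"
      unfolding F_def using y z g by (intro smul_minus) auto
    also have "(g \<oplus> y \<otimes> y) \<ominus> (g \<oplus> z \<otimes> z) = (g \<ominus> g) \<oplus> (y \<otimes> y \<ominus> z \<otimes> z)"
      using y z g by (intro add_minus_add) auto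
    also have "g \<ominus> g = \<zero>" using g by (simp add: minus_zero_iff)
    finally have "F y \<ominus> F z = (1/2) \<odot> (y \<otimes> y \<ominus> z \<otimes> z)" using y z by simp
    then show ?thesis
      using norm_mult_minus_mult[of y y z z] y z by (simp add: norm_smult algebra_simps)
  qed
  have step: "cnorm A (f (Suc n) \<ominus> f n) \<le> (1/2)^n" for n
  proof (induction n)
    case 0
    have "f (Suc 0) \<ominus> f 0 = f (Suc 0)" using f by (simp add: f_def minus_zero F g)
    then show ?case using f[of "Suc 0"] by simp
  next
    case (Suc n)
    have "cnorm A (f (Suc (Suc n)) \<ominus> f (Suc n))
        \<le> 1/2 * ((cnorm A (f (Suc n)) + cnorm A (f n)) * cnorm A (f (Suc n) \<ominus> f n))"
      using Fdiff[of "f (Suc n)" "f n"] f[of n] f[of "Suc n"] by (simp add: f_def)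
    also have "\<dots> \<le> 1/2 * (1 * (1/2)^n)"
      using Suc f[of n] f[of "Suc n"] by (intro mult_left_mono mult_mono) auto
    finally show ?case by simp
  qed
  obtain y where y: "y \<in> carrier A" and lim: "(\<lambda>n. cnorm A (f n \<ominus> y)) \<longlonglongrightarrow> 0"
    using Cauchy_geometric[OF norm_complete _ step] f by blast
  have "cnorm A (star A y \<ominus> y) \<le> e" if e: "e > 0" for e
  proof -
    obtain n where n: "cnorm A (f n \<ominus> y) < e/2"
      using order_tendstoD(2)[OF lim, of "e/2"] e unfolding eventually_sequentially by fastforce
    have "cnorm A (star A y \<ominus> y) \<le> cnorm A (star A y \<ominus> f n) + cnorm A (f n \<ominus> y)"
      using y f by (intro nrm_triangle) auto
    also have "star A y \<ominus> f n = star A (y \<ominus> f n)" using f[of n] y by (simp add: star_minus)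
    also have "cnorm A \<dots> = cnorm A (f n \<ominus> y)" using f[of n] y nrm_minus_commute by simp
    finally show ?thesis using n by simp
  qed
  then have "cnorm A (star A y \<ominus> y) \<le> 0"
    by (rule field_le_epsilon) simp
  then have "cnorm A (star A y \<ominus> y) = 0"
    using norm_nonneg[of "star A y \<ominus> y"] y by (meson antisym minus_closed star_closed)
  then have 1: "star A y = y" using y by (simp add: norm_eq_zero minus_zero_iff)
  \<comment> \<open>This null sequence will dominate the constant
    \<open>cnorm A (F y \<ominus> y)\<close>, forcing \<open>F y = y\<close>.\<close>
  have "(\<lambda>n. cnorm A (f (Suc n) \<ominus> y) + 1/2 * ((cnorm A y + 1/2) * cnorm A (f n \<ominus> y))) \<longlonglongrightarrow> 0 + 1/2 * ((cnorm A y + 1/2) * 0)"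
    using lim LIMSEQ_Suc[OF lim] by (intro tendsto_intros)
  moreover have "cnorm A (F y \<ominus> y) \<le> cnorm A (f (Suc n) \<ominus> y) + 1/2 * ((cnorm A y + 1/2) * cnorm A (f n \<ominus> y))" for n
  proof -
    have "cnorm A (F y \<ominus> y) \<le> cnorm A (F y \<ominus> F (f n)) + cnorm A (F (f n) \<ominus> y)"
      using y f F by (intro nrm_triangle) auto
    also have "cnorm A (F y \<ominus> F (f n)) \<le> 1/2 * ((cnorm A y + cnorm A (f n)) * cnorm A (y \<ominus> f n))"
      using Fdiff y f by simp
    also have "\<dots> \<le> 1/2 * ((cnorm A y + 1/2) * cnorm A (f n \<ominus> y))"
      using f[of n] y nrm_minus_commute[of y "f n"] by (intro mult_left_mono mult_mono) auto
    finally show ?thesis by (simp add: f_def)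
  qed
  ultimately have "cnorm A (F y \<ominus> y) \<le> 0"
    by (intro LIMSEQ_le_const[where X="\<lambda>n. cnorm A (f (Suc n) \<ominus> y) + 1/2 * ((cnorm A y + 1/2) * cnorm A (f n \<ominus> y))"]) auto
  then have "cnorm A (F y \<ominus> y) = 0" using norm_nonneg[of "F y \<ominus> y"] F y by (meson antisym minus_closed)
  then have "F y = y" using F y by (simp add: norm_eq_zero minus_zero_iff)
  then show ?thesis using y 1 unfolding F_def g_def by metis
qed

end

section \<open>Uniform boundedness of representations\<close>

locale cstar_representation = A: cstar_algebra A + H: hilbert_space H
  for A :: "'a cstar" and H :: "'h hilbert" +
  fixes \<pi> :: "'a \<Rightarrow> 'h \<Rightarrow> 'h"
  assumes rep: "representation A H \<pi>"
begin

lemma bop: "a \<in> carrier A \<Longrightarrow> bounded_operator H (\<pi> a)"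
  using rep by (auto simp: representation_def)

lemma rep_closed [simp, intro]: "a \<in> carrier A \<Longrightarrow> x \<in> carrier H \<Longrightarrow> \<pi> a x \<in> carrier H"
  using bop[of a] by (auto simp: bounded_operator_def linear_on_def)

lemma rep_add_arg:
  "a \<in> carrier A \<Longrightarrow> x \<in> carrier H \<Longrightarrow> y \<in> carrier H \<Longrightarrow> \<pi> a (x \<oplus>\<^bsub>H\<^esub> y) = \<pi> a x \<oplus>\<^bsub>H\<^esub> \<pi> a y"
  using bop[of a] by (auto simp: bounded_operator_def linear_on_def)

lemma rep_smul_arg:
  "a \<in> carrier A \<Longrightarrow> x \<in> carrier H \<Longrightarrow> \<pi> a (c \<odot>\<^bsub>H\<^esub> x) = c \<odot>\<^bsub>H\<^esub> \<pi> a x"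
  using bop[of a] by (auto simp: bounded_operator_def linear_on_def)

lemma rep_minus_arg:
  "a \<in> carrier A \<Longrightarrow> x \<in> carrier H \<Longrightarrow> y \<in> carrier H \<Longrightarrow> \<pi> a (x \<ominus>\<^bsub>H\<^esub> y) = \<pi> a x \<ominus>\<^bsub>H\<^esub> \<pi> a y"
  by (simp add: H.minus_eq_smul rep_add_arg rep_smul_arg)

lemma rep_zero_arg [simp]: "a \<in> carrier A \<Longrightarrow> \<pi> a \<zero>\<^bsub>H\<^esub> = \<zero>\<^bsub>H\<^esub>"
  using rep_smul_arg[of a "\<zero>\<^bsub>H\<^esub>" 0] by simp

lemma rep_add:
  "a \<in> carrier A \<Longrightarrow> b \<in> carrier A \<Longrightarrow> x \<in> carrier H \<Longrightarrow> \<pi> (a \<oplus>\<^bsub>A\<^esub> b) x = \<pi> a x \<oplus>\<^bsub>H\<^esub> \<pi> b x"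
  using rep by (auto simp: representation_def)

lemma rep_smul:
  "a \<in> carrier A \<Longrightarrow> x \<in> carrier H \<Longrightarrow> \<pi> (c \<odot>\<^bsub>A\<^esub> a) x = c \<odot>\<^bsub>H\<^esub> \<pi> a x"
  using rep by (auto simp: representation_def)

lemma rep_minus:
  "a \<in> carrier A \<Longrightarrow> b \<in> carrier A \<Longrightarrow> x \<in> carrier H \<Longrightarrow> \<pi> (a \<ominus>\<^bsub>A\<^esub> b) x = \<pi> a x \<ominus>\<^bsub>H\<^esub> \<pi> b x"
  by (simp add: A.minus_eq_smul H.minus_eq_smul rep_add rep_smul)

lemma rep_zero [simp]: "x \<in> carrier H \<Longrightarrow> \<pi> \<zero>\<^bsub>A\<^esub> x = \<zero>\<^bsub>H\<^esub>"
  using rep_smul[of "\<zero>\<^bsub>A\<^esub>" x 0] by simp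

lemma rep_mult:
  "a \<in> carrier A \<Longrightarrow> b \<in> carrier A \<Longrightarrow> x \<in> carrier H \<Longrightarrow> \<pi> (a \<otimes>\<^bsub>A\<^esub> b) x = \<pi> a (\<pi> b x)"
  using rep by (auto simp: representation_def)

lemma rep_adjoint:
  "a \<in> carrier A \<Longrightarrow> x \<in> carrier H \<Longrightarrow> y \<in> carrier H \<Longrightarrow>
   hinner H (\<pi> a x) y = hinner H x (\<pi> (star A a) y)"
  using rep by (auto simp: representation_def)

lemma rep_bound_selfadjoint_small:
  assumes h: "h \<in> carrier A" "star A h = h" and small: "cnorm A h \<le> 1/2" and x: "x \<in> carrier H"
  shows "hnorm H (\<pi> h x) \<le> hnorm H x"
proof -
  obtain y where y: "y \<in> carrier A" "star A y = y"
      and eq: "y = (1/2) \<odot>\<^bsub>A\<^esub> (h \<otimes>\<^bsub>A\<^esub> h \<oplus>\<^bsub>A\<^esub> y \<otimes>\<^bsub>A\<^esub> y)"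
    using A.square_root_equation[OF h small] by blast
  define u where "u = \<pi> y x"
  have u: "u \<in> carrier H" using y x by (simp add: u_def)
  have "u = (1/2) \<odot>\<^bsub>H\<^esub> (\<pi> h (\<pi> h x) \<oplus>\<^bsub>H\<^esub> \<pi> y u)"
    unfolding u_def using h y x by (subst eq) (simp add: rep_smul rep_add rep_mult)
  then have "hinner H u x = (1/2) * (hinner H (\<pi> h (\<pi> h x)) x + hinner H (\<pi> y u) x)"
    using h y x u by (metis A.mult_closed H.M.add.m_closed H.hinner_add H.hinner_smult rep_closed)
  also have "hinner H (\<pi> h (\<pi> h x)) x = hinner H (\<pi> h x) (\<pi> h x)"
    using h x rep_adjoint[of h "\<pi> h x" x] by simp
  also have "hinner H (\<pi> y u) x = hinner H u u"
    using y x u rep_adjoint[of y u x] by (simp add: u_def)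
  finally have *: "2 * Re (hinner H u x) = (hnorm H (\<pi> h x))\<^sup>2 + (hnorm H u)\<^sup>2"
    using h x u H.hnorm_sq[of u] H.hnorm_sq[of "\<pi> h x"] by (simp add: complex_eq_iff)
  have "0 \<le> (hnorm H (x \<ominus>\<^bsub>H\<^esub> u))\<^sup>2" by simp
  also have "\<dots> = (hnorm H x)\<^sup>2 - 2 * Re (hinner H u x) + (hnorm H u)\<^sup>2"
    using x u H.hinner_cnj[of u x] by (simp add: H.hnorm_sq H.hinner_minus_left H.hinner_minus_right)
  finally have "(hnorm H (\<pi> h x))\<^sup>2 \<le> (hnorm H x)\<^sup>2" using * by simp
  then show ?thesis using x by (auto intro: power2_le_imp_le)
qed

lemma rep_bound_selfadjoint:
  assumes h: "h \<in> carrier A" "star A h = h" and x: "x \<in> carrier H"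
  shows "hnorm H (\<pi> h x) \<le> 2 * cnorm A h * hnorm H x"
proof (cases "cnorm A h = 0")
  case True
  then have "h = \<zero>\<^bsub>A\<^esub>" using h A.norm_eq_zero by simp
  then show ?thesis using x by simp
next
  case False
  \<comment> \<open>Rescales \<open>h\<close> to norm 1/2, the largest norm that the previous lemma
    admits; this is the origin of the factor 2.\<close>
  define t where "t = 1 / (2 * cnorm A h)"
  have pos: "cnorm A h > 0" using False A.norm_nonneg[OF h(1)] by linarith
  have "hnorm H (\<pi> (complex_of_real t \<odot>\<^bsub>A\<^esub> h) x) \<le> hnorm H x"
    using h pos x by (intro rep_bound_selfadjoint_small) (simp_all add: A.star_smult A.norm_smult t_def norm_divide norm_mult)
  then have "t * hnorm H (\<pi> h x) \<le> hnorm H x"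
    using h x pos by (simp add: rep_smul H.hnorm_smul t_def norm_divide norm_mult)
  then show ?thesis using pos by (simp add: t_def field_simps)
qed

lemma rep_bound:
  assumes a: "a \<in> carrier A" and x: "x \<in> carrier H"
  shows "hnorm H (\<pi> a x) \<le> 2 * cnorm A a * hnorm H x"
proof (rule power2_le_imp_le)
  have "(hnorm H (\<pi> a x))\<^sup>2 = Re (hinner H (\<pi> a x) (\<pi> a x))"
    using a x by (simp add: H.hnorm_sq)
  also have "hinner H (\<pi> a x) (\<pi> a x) = hinner H x (\<pi> (star A a \<otimes>\<^bsub>A\<^esub> a) x)"
    using a x by (simp add: rep_adjoint rep_mult)
  also have "Re \<dots> \<le> hnorm H x * hnorm H (\<pi> (star A a \<otimes>\<^bsub>A\<^esub> a) x)"
    using a x by (intro order_trans[OF complex_Re_le_cmod H.Cauchy_Schwarz]) auto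
  also have "\<dots> \<le> hnorm H x * (2 * (cnorm A a)\<^sup>2 * hnorm H x)"
    using a x rep_bound_selfadjoint[of "star A a \<otimes>\<^bsub>A\<^esub> a" x]
    by (intro mult_left_mono) (auto simp: A.star_mult A.cstar_identity)
  also have "\<dots> \<le> (2 * cnorm A a * hnorm H x)\<^sup>2"
    using A.norm_nonneg[OF a] H.hnorm_nonneg[OF x] by (simp add: power2_eq_square)
  finally show "(hnorm H (\<pi> a x))\<^sup>2 \<le> (2 * cnorm A a * hnorm H x)\<^sup>2" .
qed (use a x in auto)

lemma rep_close:
  assumes "a \<in> carrier A" "b \<in> carrier A" "x \<in> carrier H"
  shows "hnorm H (\<pi> a x \<ominus>\<^bsub>H\<^esub> \<pi> b x) \<le> 2 * cnorm A (a \<ominus>\<^bsub>A\<^esub> b) * hnorm H x"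
  using rep_bound[of "a \<ominus>\<^bsub>A\<^esub> b" x] assms by (simp add: rep_minus)

lemma closed_ideal_kernel:
  "closed_ideal A {a \<in> carrier A. \<forall>x\<in>carrier H. \<pi> a x = \<zero>\<^bsub>H\<^esub>}"
  unfolding closed_ideal_def
proof (intro conjI ballI)
  let ?K = "{a \<in> carrier A. \<forall>x\<in>carrier H. \<pi> a x = \<zero>\<^bsub>H\<^esub>}"
  show "submodule ?K complex_ring A"
    by (auto simp: A.submodule_iff rep_add rep_smul)
  show "closed_wrt A (cnorm A) ?K"
  proof (rule A.closed_wrtI)
    fix a assume a: "a \<in> carrier A" and *: "\<And>\<epsilon>. \<epsilon> > 0 \<Longrightarrow> \<exists>b\<in>?K. cnorm A (a \<ominus>\<^bsub>A\<^esub> b) < \<epsilon>"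
    have "\<pi> a x = \<zero>\<^bsub>H\<^esub>" if x: "x \<in> carrier H" for x
    proof (rule ccontr)
      assume "\<pi> a x \<noteq> \<zero>\<^bsub>H\<^esub>"
      then have pos: "hnorm H (\<pi> a x) > 0"
        using a x H.hnorm_eq_0[of "\<pi> a x"] H.hnorm_nonneg[of "\<pi> a x"] by (simp add: less_le)
      \<comment> \<open>Chosen so that the bound of \<open>rep_close\<close>, taken with
        \<open>hnorm H x + 1\<close>, is exactly \<open>hnorm H (\<pi> a x)\<close>.\<close>
      define \<epsilon> where "\<epsilon> = hnorm H (\<pi> a x) / (2 * (hnorm H x + 1))"
      have x0: "hnorm H x \<ge> 0" using x by simp
      have "\<epsilon> > 0" using pos x0 unfolding \<epsilon>_def by (intro divide_pos_pos) auto
      then obtain b where b: "b \<in> ?K" "cnorm A (a \<ominus>\<^bsub>A\<^esub> b) < \<epsilon>" using * by blast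
      have "hnorm H (\<pi> a x) = hnorm H (\<pi> a x \<ominus>\<^bsub>H\<^esub> \<pi> b x)"
        using b a x by (simp add: H.minus_zero)
      also have "\<dots> \<le> 2 * cnorm A (a \<ominus>\<^bsub>A\<^esub> b) * hnorm H x"
        using b a x by (intro rep_close) auto
      also have "\<dots> \<le> 2 * \<epsilon> * hnorm H x" using b x0 by (intro mult_right_mono) auto
      also have "\<dots> < 2 * \<epsilon> * (hnorm H x + 1)" using \<open>\<epsilon> > 0\<close> by simp
      also have "\<dots> = hnorm H (\<pi> a x)" unfolding \<epsilon>_def using x0 by (simp add: field_simps add_nonneg_eq_0_iff)
      finally show False by simp
    qed
    then show "a \<in> ?K" using a by simp
  qed auto
  fix a j assume "a \<in> carrier A" "j \<in> ?K"
  then show "a \<otimes>\<^bsub>A\<^esub> j \<in> ?K" "j \<otimes>\<^bsub>A\<^esub> a \<in> ?K" by (auto simp: rep_mult)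
qed

end

section \<open>Paths in graphs without cycles\<close>

text \<open>Here \<open>v\<close> is the range and \<open>u\<close> the source, so lists run in the
  direction of the paths. With both endpoints explicit, concatenation and induction need no case
  distinction on empty paths.\<close>

fun path_between :: "('v, 'e) pre_digraph \<Rightarrow> 'v \<Rightarrow> 'e list \<Rightarrow> 'v \<Rightarrow> bool" where
  "path_between E v [] u \<longleftrightarrow> v = u \<and> v \<in> verts E"
| "path_between E v (e # es) u \<longleftrightarrow> e \<in> arcs E \<and> head E e = v \<and> path_between E (tail E e) es u"

text \<open>These are exactly the edges of the subgraph in condition (2); see
  \<open>edge_of_boundary_path\<close>.\<close>

definition edge_reachable :: "('v, 'e) pre_digraph \<Rightarrow> 'v \<Rightarrow> 'e \<Rightarrow> bool" where
  "edge_reachable E v f \<longleftrightarrow> (\<exists>xs. path_between E v (xs @ [f]) (tail E f))"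

text \<open>Members of pairs replace the pairs themselves: finiteness is the same
  (\<open>finite_splitting_iff\<close>), and such edges can be counted along a path.\<close>

definition splitting_edges :: "('v, 'e) pre_digraph \<Rightarrow> 'v \<Rightarrow> 'e set" where
  "splitting_edges E v =
     {f. edge_reachable E v f \<and> (\<exists>g. edge_reachable E v g \<and> tail E f = tail E g \<and> f \<noteq> g)}"

text \<open>
  Adding to every source \<open>v\<close> a loop \<open>Inr v\<close> turns the paths in \<open>E\<^sup>\<le>\<^sup>\<infinity>\<close> uniformly into infinite
  sequences.
\<close>

definition ext_head :: "('v, 'e) pre_digraph \<Rightarrow> 'e + 'v \<Rightarrow> 'v" where
  "ext_head E a = (case a of Inl e \<Rightarrow> head E e | Inr v \<Rightarrow> v)"

definition ext_tail :: "('v, 'e) pre_digraph \<Rightarrow> 'e + 'v \<Rightarrow> 'v" where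
  "ext_tail E a = (case a of Inl e \<Rightarrow> tail E e | Inr v \<Rightarrow> v)"

definition ext_arcs :: "('v, 'e) pre_digraph \<Rightarrow> ('e + 'v) set" where
  "ext_arcs E = Inl ` arcs E \<union> Inr ` {v. is_source E v}"

definition ext_path :: "('v, 'e) pre_digraph \<Rightarrow> (nat \<Rightarrow> 'e + 'v) \<Rightarrow> bool" where
  "ext_path E y \<longleftrightarrow> range y \<subseteq> ext_arcs E \<and> (\<forall>i. ext_tail E (y i) = ext_head E (y (Suc i)))"

lemma ext_head_simps [simp]: "ext_head E (Inl e) = head E e" "ext_head E (Inr v) = v"
  and ext_tail_simps [simp]: "ext_tail E (Inl e) = tail E e" "ext_tail E (Inr v) = v"
  by (simp_all add: ext_head_def ext_tail_def)

locale acyclic_digraph = wf_digraph E for E :: "('v, 'e) pre_digraph" +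
  assumes no_cycle: "\<nexists>\<alpha>. is_cycle E \<alpha>"
begin

lemma path_between_verts: "path_between E v xs u \<Longrightarrow> v \<in> verts E \<and> u \<in> verts E"
  by (induction xs arbitrary: v) auto

lemma path_between_append:
  "path_between E v (xs @ ys) u \<longleftrightarrow> (\<exists>w. path_between E v xs w \<and> path_between E w ys u)"
  by (induction xs arbitrary: v) (auto dest: path_between_verts)

lemma path_between_snoc:
  "path_between E v (xs @ [e]) u \<longleftrightarrow> path_between E v xs (head E e) \<and> e \<in> arcs E \<and> tail E e = u"
  by (auto simp: path_between_append)

lemma path_between_iff:
  "path_between E v es u \<longleftrightarrow> v \<in> verts E \<and> set es \<subseteq> arcs E \<and> (es \<noteq> [] \<longrightarrow> head E (hd es) = v) \<and>
     (\<forall>j. Suc j < length es \<longrightarrow> tail E (es ! j) = head E (es ! Suc j)) \<and>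
     u = (if es = [] then v else tail E (last es))"
proof (induction es arbitrary: v)
  case (Cons e es)
  have "(\<forall>j. Suc j < length (e # es) \<longrightarrow> tail E ((e # es) ! j) = head E ((e # es) ! Suc j)) \<longleftrightarrow>
        (es \<noteq> [] \<longrightarrow> head E (hd es) = tail E e) \<and>
        (\<forall>j. Suc j < length es \<longrightarrow> tail E (es ! j) = head E (es ! Suc j))"
    by (cases es) (auto simp: less_Suc_eq_0_disj nth_Cons split: nat.splits)
  then show ?case using Cons by auto
qed auto

lemma path_source_FinPath: "path_source E (FinPath v es) = (if es = [] then v else tail E (last es))"
  by (simp add: path_vertex_def last_conv_nth)

lemma finite_paths_iff:
  "FinPath v es \<in> finite_paths E \<longleftrightarrow> path_between E v es (path_source E (FinPath v es))"
  unfolding path_between_iff path_source_FinPath by (simp add: finite_paths_def del: path_source.simps)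

lemma path_between_imp_finite_path:
  "path_between E v es u \<Longrightarrow> FinPath v es \<in> finite_paths E \<and> path_source E (FinPath v es) = u"
  by (metis finite_paths_iff path_between_iff path_source_FinPath)

text \<open>A cycle is required to have distinct sources. A closed path in which two edges share a
  source contains a shorter closed path between these edges, so induction on the length reduces to
  genuine cycles.\<close>

lemma closed_path_empty: "path_between E v es v \<Longrightarrow> es = []"
proof (induction es arbitrary: v rule: length_induct)
  case (1 es)
  show ?case
  proof (rule ccontr)
    assume ne: "es \<noteq> []"
    have "\<not> distinct (map (tail E) es)"
    proof
      assume "distinct (map (tail E) es)"
      then have "is_cycle E (FinPath v es)"
        unfolding is_cycle_def using path_between_imp_finite_path[OF 1(2)] ne
        by (auto simp del: path_source.simps)
      then show False using no_cycle by blast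
    qed
    then obtain as bs cs y where "map (tail E) es = as @ [y] @ bs @ [y] @ cs"
      using not_distinct_decomp by blast
    then obtain as' vs where es1: "es = as' @ vs" "map (tail E) vs = y # bs @ y # cs"
      by (auto simp: map_eq_append_conv)
    then obtain a zs where es2: "vs = a # zs" "tail E a = y" "map (tail E) zs = bs @ y # cs"
      by (auto simp: map_eq_Cons_conv)
    then obtain bs' us where es3: "zs = bs' @ us" "map (tail E) us = y # cs"
      by (auto simp: map_eq_append_conv)
    then obtain b cs' where es4: "us = b # cs'" "tail E b = y"
      by (auto simp: map_eq_Cons_conv)
    then have es: "es = as' @ a # bs' @ b # cs'" and ab: "tail E a = tail E b"
      using es1 es2 es3 es4 by simp_all
    have "path_between E (tail E a) (bs' @ [b]) (tail E b)"
      using 1(2) unfolding es by (auto simp: path_between_append dest: path_between_verts)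
    moreover have "length (bs' @ [b]) < length es" by (simp add: es)
    ultimately have "bs' @ [b] = []" using 1(1) ab by metis
    then show False by simp
  qed
qed

text \<open>Common last edges are cancelled until the last edges differ; these share the source
  \<open>u\<close> reached so far. Neither list can be exhausted first, for the rest of the other
  one would be a closed path.\<close>

lemma diverging_edges:
  assumes "path_between E v xs u" "path_between E v ys u" "xs \<noteq> ys"
  shows "\<exists>xs' ys' zs f g. xs = xs' @ f # zs \<and> ys = ys' @ g # zs \<and> tail E f = tail E g \<and> f \<noteq> g"
  using assms
proof (induction xs arbitrary: ys u rule: rev_induct)
  case Nil
  then show ?case using closed_path_empty by auto
next
  case (snoc f xs)
  show ?case
  proof (cases ys rule: rev_cases)
    case Nil
    then show ?thesis using snoc.prems closed_path_empty by auto
  next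
    case (snoc ys' g)
    show ?thesis
    proof (cases "f = g")
      case True
      with snoc snoc.prems snoc.IH[of "head E f" ys'] obtain xs1 ys1 zs f1 g1
        where "xs = xs1 @ f1 # zs" "ys' = ys1 @ g1 # zs" "tail E f1 = tail E g1" "f1 \<noteq> g1"
        by (auto simp: path_between_snoc)
      then show ?thesis using snoc True
        by (intro exI[of _ xs1] exI[of _ ys1] exI[of _ "zs @ [f]"] exI[of _ f1] exI[of _ g1]) auto
    next
      case False
      then show ?thesis using snoc snoc.prems
        by (intro exI[of _ xs] exI[of _ ys'] exI[of _ "[]"] exI[of _ f] exI[of _ g])
           (auto simp: path_between_snoc)
    qed
  qed
qed

lemma edge_reachableI: "path_between E v (xs @ f # ys) u \<Longrightarrow> edge_reachable E v f"
  unfolding edge_reachable_def path_between_append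
  by (auto intro!: exI[of _ xs] simp: path_between_snoc)

lemma diverging_edges_splitting:
  assumes "path_between E v (xs @ f # zs) u" "path_between E v (ys @ g # zs') u'"
    "tail E f = tail E g" "f \<noteq> g"
  shows "f \<in> splitting_edges E v"
  using assms edge_reachableI unfolding splitting_edges_def by blast

lemma no_splitting_unique:
  assumes "splitting_edges E v = {}" "path_between E v xs u" "path_between E v ys u"
  shows "xs = ys"
  using diverging_edges[OF assms(2,3)] diverging_edges_splitting assms by blast

text \<open>A path through two distinct edges with the same source would contain a non-empty closed
  path from that source to itself.\<close>

lemma edge_not_on_diverging_path:
  assumes "path_between E v (ys @ g # zs) u" "tail E f = tail E g" "f \<noteq> g"
  shows "f \<notin> set (ys @ g # zs)"
proof
  assume "f \<in> set (ys @ g # zs)"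
  then consider "f \<in> set ys" | "f \<in> set zs" using assms by auto
  then show False
  proof cases
    case 1
    then obtain as bs where "ys = as @ f # bs" by (auto simp: in_set_conv_decomp)
    then have "path_between E (tail E f) (bs @ [g]) (tail E g)"
      using assms(1) by (auto simp: path_between_append dest: path_between_verts)
    then show False using closed_path_empty assms by auto
  next
    case 2
    then obtain as bs where "zs = as @ f # bs" by (auto simp: in_set_conv_decomp)
    then have "path_between E (tail E g) (as @ [f]) (tail E f)"
      using assms(1) by (auto simp: path_between_append dest: path_between_verts)
    then show False using closed_path_empty assms by auto
  qed
qed

text \<open>A path is determined by its endpoints and the splitting edges that it uses.\<close>

lemma finite_paths_between:
  assumes "finite (splitting_edges E v)"
  shows "finite {xs. path_between E v xs u}"
proof (rule inj_on_finite)
  show "inj_on (\<lambda>xs. set xs \<inter> splitting_edges E v) {xs. path_between E v xs u}"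
  proof (rule inj_onI, rule ccontr)
    fix xs ys
    assume xs: "xs \<in> {xs. path_between E v xs u}" and ys: "ys \<in> {xs. path_between E v xs u}"
      and eq: "set xs \<inter> splitting_edges E v = set ys \<inter> splitting_edges E v" and "xs \<noteq> ys"
    then obtain xs' ys' zs f g where d: "xs = xs' @ f # zs" "ys = ys' @ g # zs" "tail E f = tail E g" "f \<noteq> g"
      using diverging_edges[of v xs u ys] by auto
    have "f \<in> splitting_edges E v"
      using xs ys d diverging_edges_splitting[of v xs' f zs u ys' g zs u] by simp
    then have "f \<in> set ys" using eq d by auto
    then show False using edge_not_on_diverging_path[of v ys' g zs u f] ys d by simp
  qed
  show "(\<lambda>xs. set xs \<inter> splitting_edges E v) ` {xs. path_between E v xs u} \<subseteq> Pow (splitting_edges E v)"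
    by auto
qed (use assms in simp)

lemma finite_paths_to_splitting:
  assumes "finite (splitting_edges E v)"
  shows "finite {xs. \<exists>u\<in>tail E ` splitting_edges E v. path_between E v xs u}"
proof -
  have "{xs. \<exists>u\<in>tail E ` splitting_edges E v. path_between E v xs u} =
        (\<Union>u\<in>tail E ` splitting_edges E v. {xs. path_between E v xs u})" by auto
  then show ?thesis using assms finite_paths_between by simp
qed

lemma splitting_edges_mono:
  assumes "path_between E v xs u" shows "splitting_edges E u \<subseteq> splitting_edges E v"
proof -
  have "edge_reachable E v f" if "edge_reachable E u f" for f
    using that assms unfolding edge_reachable_def
    by (metis append.assoc path_between_append)
  then show ?thesis unfolding splitting_edges_def by blast
qed

text \<open>The n-th edge is stored at index \<open>n - 1\<close>, so its source is the range of the
  edge at index \<open>n\<close>.\<close>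

lemma path_vertex_InfPath: "InfPath f \<in> infinite_paths E \<Longrightarrow> path_vertex E (InfPath f) n = head E (f n)"
  by (cases n) (auto simp: path_vertex_def infinite_paths_def)

lemma infinite_path_segment:
  assumes "InfPath f \<in> infinite_paths E"
  shows "path_between E (head E (f n)) (map f [n..<n+k]) (head E (f (n+k)))"
proof (induction k)
  case 0
  have "f n \<in> arcs E" using assms by (auto simp: infinite_paths_def)
  then show ?case by simp
next
  case (Suc k)
  then show ?case using assms by (auto simp: infinite_paths_def path_between_snoc)
qed

text \<open>A splitting edge still reachable after \<open>N\<close> steps along \<open>z\<close>
  would give a path of length greater than \<open>N\<close> from the starting vertex to the source
  of a splitting edge, but there are only finitely many such paths.\<close>

lemma splitting_edges_vanish:
  assumes z: "InfPath f \<in> infinite_paths E" and fin: "finite (splitting_edges E (head E (f n)))"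
  shows "\<exists>m. splitting_edges E (head E (f m)) = {}"
proof -
  let ?v = "head E (f n)"
  let ?P = "{xs. \<exists>u\<in>tail E ` splitting_edges E ?v. path_between E ?v xs u}"
  \<comment> \<open>If \<open>?P\<close> is empty the value of \<open>Max\<close> is arbitrary; it
    is compared only with a member of the set.\<close>
  define N where "N = Suc (Max (length ` ?P))"
  have "splitting_edges E (head E (f (n + N))) = {}"
  proof (rule ccontr)
    assume "splitting_edges E (head E (f (n + N))) \<noteq> {}"
    then obtain e where e: "e \<in> splitting_edges E (head E (f (n + N)))" by blast
    then have "e \<in> splitting_edges E ?v"
      using splitting_edges_mono[OF infinite_path_segment[OF z]] by blast
    moreover obtain xs where "path_between E (head E (f (n + N))) (xs @ [e]) (tail E e)"
      using e by (auto simp: splitting_edges_def edge_reachable_def)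
    then have "path_between E ?v (map f [n..<n+N] @ xs @ [e]) (tail E e)"
      using infinite_path_segment[OF z, of n N] path_between_append by blast
    ultimately have "map f [n..<n+N] @ xs @ [e] \<in> ?P" by blast
    then have "length (map f [n..<n+N] @ xs @ [e]) \<le> Max (length ` ?P)"
      using finite_paths_to_splitting[OF fin] by (intro Max_ge finite_imageI imageI)
    then show False by (simp add: N_def)
  qed
  then show ?thesis by blast
qed

lemma ext_path_exists: "u \<in> verts E \<Longrightarrow> \<exists>y. ext_path E y \<and> ext_head E (y 0) = u"
proof -
  assume u: "u \<in> verts E"
  \<comment> \<open>One admissible letter for each vertex: the loop at a source, otherwise some edge
    with that range. Iterating its tail produces the path.\<close>
  define c where "c v = (if is_source E v then Inr v else Inl (SOME e. e \<in> in_arcs E v))" for v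
  have c: "c v \<in> ext_arcs E \<and> ext_head E (c v) = v \<and> ext_tail E (c v) \<in> verts E" if "v \<in> verts E" for v
  proof (cases "is_source E v")
    case False
    then have "\<exists>e. e \<in> in_arcs E v" using that by (auto simp: is_source_def)
    then have "(SOME e. e \<in> in_arcs E v) \<in> in_arcs E v" by (rule someI_ex)
    then show ?thesis using False by (auto simp: c_def ext_arcs_def)
  qed (use that in \<open>auto simp: c_def ext_arcs_def\<close>)
  define vx where "vx i = ((\<lambda>v. ext_tail E (c v)) ^^ i) u" for i
  have vx: "vx i \<in> verts E" for i by (induction i) (auto simp: vx_def u c)
  have "ext_path E (\<lambda>i. c (vx i))"
    unfolding ext_path_def
  proof (intro conjI allI)
    show "range (\<lambda>i. c (vx i)) \<subseteq> ext_arcs E" using c vx by auto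
    fix i
    have "ext_tail E (c (vx i)) = vx (Suc i)" by (simp add: vx_def)
    then show "ext_tail E (c (vx i)) = ext_head E (c (vx (Suc i)))" using c vx by metis
  qed
  moreover have "ext_head E (c (vx 0)) = u" using c[OF u] by (simp add: vx_def)
  ultimately show ?thesis by (intro exI[of _ "\<lambda>i. c (vx i)"]) simp
qed

lemma ext_path_segment:
  assumes y: "ext_path E y" and real: "\<And>i. i < k \<Longrightarrow> y (n + i) = Inl (g i)"
  shows "path_between E (ext_head E (y n)) (map g [0..<k]) (ext_head E (y (n + k)))"
  using real
proof (induction k)
  case 0
  have "y n \<in> ext_arcs E" using y by (auto simp: ext_path_def)
  then show ?case by (auto simp: ext_arcs_def is_source_def)
next
  case (Suc k)
  have "y (n + k) = Inl (g k)" using Suc by simp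
  moreover have "y (n + k) \<in> ext_arcs E" "ext_tail E (y (n + k)) = ext_head E (y (n + Suc k))"
    using y by (auto simp: ext_path_def)
  ultimately show ?case using Suc by (auto simp: path_between_snoc ext_arcs_def)
qed

text \<open>An extended path without loops is an infinite path; otherwise the letters before its
  first loop form a finite path ending at a source.\<close>

lemma boundary_path_exists:
  assumes "u \<in> verts E" shows "\<exists>w. w \<in> boundary_paths_at E u"
proof -
  obtain y where y: "ext_path E y" "ext_head E (y 0) = u" using ext_path_exists[OF assms] by blast
  show ?thesis
  proof (cases "\<exists>k v. y k = Inr v")
    case False
    then have real: "y i = Inl (projl (y i))" for i by (metis sum.collapse(1) sum.exhaust_disc sum.collapse(2))
    have "InfPath (\<lambda>i. projl (y i)) \<in> infinite_paths E"
    proof -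
      have "projl (y i) \<in> arcs E" for i
        using y(1) real[of i] by (auto simp: ext_path_def ext_arcs_def image_subset_iff) (metis Inl_inject UNIV_I image_iff old.sum.distinct(1))
      moreover have "tail E (projl (y i)) = head E (projl (y (Suc i)))" for i
        using y(1) real[of i] real[of "Suc i"] by (metis ext_head_simps(1) ext_path_def ext_tail_simps(1))
      ultimately show ?thesis by (auto simp: infinite_paths_def)
    qed
    moreover have "head E (projl (y 0)) = u" using y(2) real[of 0] by (metis ext_head_simps(1))
    ultimately show ?thesis by (auto simp: boundary_paths_at_def boundary_paths_def)
  next
    case True
    define k where "k = (LEAST k. \<exists>v. y k = Inr v)"
    obtain v where v: "y k = Inr v" unfolding k_def using LeastI_ex[OF True] by blast
    have real: "y i = Inl (projl (y i))" if "i < k" for i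
      using not_less_Least[OF that[unfolded k_def]] by (metis sum.collapse(1) sum.collapse(2) sum.exhaust_disc)
    have "path_between E u (map (\<lambda>i. projl (y i)) [0..<k]) v"
      using ext_path_segment[OF y(1), of k 0 "\<lambda>i. projl (y i)"] real v y(2) by simp
    moreover have "is_source E v"
    proof -
      have "y k \<in> ext_arcs E" using y(1) by (auto simp: ext_path_def)
      then show ?thesis using v by (auto simp: ext_arcs_def)
    qed
    ultimately show ?thesis
      using path_between_imp_finite_path[of u "map (\<lambda>i. projl (y i)) [0..<k]" v]
      by (intro exI[of _ "FinPath u (map (\<lambda>i. projl (y i)) [0..<k])"])
         (auto simp: boundary_paths_at_def boundary_paths_def simp del: path_source.simps)
  qed
qed

lemma path_append_boundary:
  assumes xs: "path_between E v xs u" and w: "w \<in> boundary_paths_at E u"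
  shows "path_append (FinPath v xs) w \<in> boundary_paths_at E v"
proof (cases w)
  case (FinPath u' ws)
  then have [simp]: "u' = u" using w by (simp add: boundary_paths_at_def)
  obtain t where t: "path_between E u ws t" "is_source E t"
    using w FinPath by (auto simp: boundary_paths_at_def boundary_paths_def finite_paths_iff infinite_paths_def
       simp del: path_source.simps)
  have "path_between E v (xs @ ws) t" using xs t path_between_append by blast
  then show ?thesis using t FinPath path_between_imp_finite_path
    by (auto simp: boundary_paths_at_def boundary_paths_def simp del: path_source.simps)
next
  case (InfPath f)
  have f: "f i \<in> arcs E" "tail E (f i) = head E (f (Suc i))" "head E (f 0) = u" for i
    using w InfPath by (auto simp: boundary_paths_at_def boundary_paths_def infinite_paths_def finite_paths_def)
  let ?g = "\<lambda>i. if i < length xs then xs ! i else f (i - length xs)"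
  note xsI = xs[unfolded path_between_iff]
  have "?g i \<in> arcs E" for i using xsI f by auto
  moreover have "tail E (?g i) = head E (?g (Suc i))" for i
  proof -
    consider "Suc i < length xs" | "Suc i = length xs" | "Suc i > length xs" by linarith
    then show ?thesis
    proof cases
      case 2
      then have "xs \<noteq> []" by auto
      moreover have "xs ! i = last xs"
        using 2 last_conv_nth[OF \<open>xs \<noteq> []\<close>] by (metis diff_Suc_1)
      ultimately show ?thesis using 2 xsI f by auto
    next
      case 3
      then have "Suc i - length xs = Suc (i - length xs)" by auto
      then show ?thesis using 3 f by auto
    qed (use xsI in auto)
  qed
  moreover have "head E (?g 0) = v" using xsI f by (cases xs) auto
  ultimately have "InfPath ?g \<in> infinite_paths E" "path_range E (InfPath ?g) = v"
    by (simp_all add: infinite_paths_def image_subset_iff)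
  then show ?thesis by (simp add: InfPath boundary_paths_at_def boundary_paths_def)
qed

text \<open>The vertex \<open>u\<close> is arbitrary, because \<open>path_append\<close> discards
  the range stored in a finite second argument.\<close>

lemma path_append_assoc:
  "path_append (FinPath v (xs @ ys)) w = path_append (FinPath v xs) (path_append (FinPath u ys) w)"
  by (cases w) (auto simp: nth_append fun_eq_iff)

lemma path_shift_append:
  assumes xs: "path_between E v xs u" and w: "path_range E w = u" "w \<in> finite_paths E \<union> infinite_paths E"
  shows "path_shift E (length xs) (path_append (FinPath v xs) w) = w"
proof (cases w)
  case (FinPath u' ws)
  then show ?thesis using xs w
    by (auto simp: path_vertex_def path_between_iff nth_append last_conv_nth)
next
  case (InfPath f)
  then show ?thesis by auto
qed

lemma split_path:
  assumes "x \<in> finite_paths E \<union> infinite_paths E" "enat m \<le> path_length x"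
  shows "\<exists>xs. length xs = m \<and> path_between E (path_range E x) xs (path_range E (path_shift E m x)) \<and>
           x = path_append (FinPath (path_range E x) xs) (path_shift E m x) \<and>
           path_shift E m x \<in> finite_paths E \<union> infinite_paths E"
proof (cases x)
  case (FinPath v es)
  then have m: "m \<le> length es" using assms by simp
  obtain u where u: "path_between E v es u" using FinPath assms by (auto simp: finite_paths_iff infinite_paths_def)
  then obtain t where t: "path_between E v (take m es) t" "path_between E t (drop m es) u"
    using path_between_append[of v "take m es" "drop m es" u] by auto
  have "path_vertex E (FinPath v es) m = t"
    using path_between_imp_finite_path[OF t(1)] m by (simp add: path_vertex_def split: if_splits)
  then show ?thesis using FinPath m t path_between_imp_finite_path[OF t(2)]
    by (intro exI[of _ "take m es"]) (auto simp: min_def)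
next
  case (InfPath f)
  then have f: "InfPath f \<in> infinite_paths E" using assms by (auto simp: finite_paths_def)
  have "InfPath (\<lambda>i. f (i + m)) \<in> infinite_paths E" using f by (auto simp: infinite_paths_def)
  moreover have "InfPath f = path_append (FinPath (head E (f 0)) (map f [0..<m])) (InfPath (\<lambda>i. f (i + m)))"
    by auto
  moreover have "path_between E (head E (f 0)) (map f [0..<m]) (head E (f m))"
    using infinite_path_segment[OF f, of 0 m] by simp
  ultimately show ?thesis unfolding InfPath by (intro exI[of _ "map f [0..<m]"]) auto
qed

text \<open>Boundary paths start at every vertex, so every finite path ending in a given edge
  extends to one; conversely an initial segment of a boundary path witnesses reachability.\<close>

lemma edge_of_boundary_path:
  assumes v: "v \<in> verts E"
  shows "arcs (path_subgraph E (boundary_paths_at E v)) = {f. edge_reachable E v f}"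
proof (intro equalityI subsetI)
  fix e assume "e \<in> arcs (path_subgraph E (boundary_paths_at E v))"
  then obtain x p where x: "x \<in> boundary_paths_at E v" and p: "1 \<le> p" "enat p \<le> path_length x"
    and e: "e = path_edge x p" by (auto simp: path_subgraph_def Let_def)
  have "x \<in> finite_paths E \<union> infinite_paths E" "path_range E x = v"
    using x by (auto simp: boundary_paths_at_def boundary_paths_def)
  then obtain xs u where xs: "length xs = p" "path_between E v xs u"
      "x = path_append (FinPath v xs) (path_shift E p x)"
    using split_path[of x p] p by auto
  have "xs \<noteq> []" using xs(1) p by auto
  then have "path_edge (path_append (FinPath v xs) w) p = last xs" for w
    using xs(1) p by (cases w) (auto simp: nth_append last_conv_nth)
  then have "e = last xs" using e xs(3) by metis
  then have "xs = butlast xs @ [e]" using xs(1) p by (metis append_butlast_last_id length_0_conv not_one_le_zero)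
  then show "e \<in> {f. edge_reachable E v f}" using xs(2) edge_reachableI[of v "butlast xs" e "[]" u] by auto
next
  fix e assume "e \<in> {f. edge_reachable E v f}"
  then obtain xs where xs: "path_between E v (xs @ [e]) (tail E e)" by (auto simp: edge_reachable_def)
  then obtain w where w: "w \<in> boundary_paths_at E (tail E e)"
    using boundary_path_exists path_between_verts by blast
  have "path_edge (path_append (FinPath v (xs @ [e])) w) (Suc (length xs)) = e \<and>
        enat (Suc (length xs)) \<le> path_length (path_append (FinPath v (xs @ [e])) w)"
    by (cases w) (auto simp: nth_append)
  then show "e \<in> arcs (path_subgraph E (boundary_paths_at E v))"
    using path_append_boundary[OF xs w] unfolding path_subgraph_def Let_def
    by (auto intro!: exI[of _ "path_append (FinPath v (xs @ [e])) w"] exI[of _ "Suc (length xs)"])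
qed

lemma splitting_pairs_eq:
  assumes "v \<in> verts E"
  shows "splitting_pairs (path_subgraph E (boundary_paths_at E v)) =
    {{f, g} | f g. edge_reachable E v f \<and> edge_reachable E v g \<and> tail E f = tail E g \<and> f \<noteq> g}"
proof -
  have "tail (path_subgraph E S) = tail E" for S by (simp add: path_subgraph_def Let_def)
  then show ?thesis unfolding splitting_pairs_def edge_of_boundary_path[OF assms] by simp
qed

text \<open>The edges lie in the union of the pairs, which are finite sets, and the pairs are
  subsets of the set of edges.\<close>

lemma finite_splitting_iff:
  assumes "v \<in> verts E"
  shows "finite (splitting_pairs (path_subgraph E (boundary_paths_at E v))) \<longleftrightarrow> finite (splitting_edges E v)"
proof
  assume fin: "finite (splitting_pairs (path_subgraph E (boundary_paths_at E v)))"
  have "splitting_edges E v \<subseteq> \<Union> (splitting_pairs (path_subgraph E (boundary_paths_at E v)))"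
    unfolding splitting_pairs_eq[OF assms] splitting_edges_def by blast
  moreover have "finite (\<Union> (splitting_pairs (path_subgraph E (boundary_paths_at E v))))"
    using fin by (rule finite_Union) (auto simp: splitting_pairs_def)
  ultimately show "finite (splitting_edges E v)" using finite_subset by blast
next
  assume fin: "finite (splitting_edges E v)"
  have "splitting_pairs (path_subgraph E (boundary_paths_at E v)) \<subseteq> Pow (splitting_edges E v)"
    unfolding splitting_pairs_eq[OF assms] splitting_edges_def by fastforce
  then show "finite (splitting_pairs (path_subgraph E (boundary_paths_at E v)))"
    using fin by (meson finite_Pow_iff finite_subset)
qed

lemma no_splitting_iff:
  "(\<forall>z\<in>infinite_paths E. \<exists>n.
      finite (splitting_pairs (path_subgraph E (boundary_paths_at E (path_vertex E z n))))) \<longleftrightarrow>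
   (\<forall>f. InfPath f \<in> infinite_paths E \<longrightarrow> (\<exists>n. splitting_edges E (head E (f n)) = {}))"
proof -
  have "(\<exists>n. finite (splitting_pairs (path_subgraph E (boundary_paths_at E (path_vertex E (InfPath f) n))))) \<longleftrightarrow>
        (\<exists>n. splitting_edges E (head E (f n)) = {})" if f: "InfPath f \<in> infinite_paths E" for f
  proof -
    have "f n \<in> arcs E" for n using f by (auto simp: infinite_paths_def)
    then have "head E (f n) \<in> verts E" for n by simp
    then show ?thesis
      using splitting_edges_vanish[OF f]
      by (auto simp: path_vertex_InfPath[OF f] finite_splitting_iff) (metis finite.emptyI)
  qed
  then show ?thesis by (auto simp: infinite_paths_def)
qed

text \<open>The segment between two occurrences of an edge would be a closed path.\<close>

lemma infinite_path_inj:
  assumes f: "InfPath f \<in> infinite_paths E" and "f i = f j" shows "i = j"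
proof -
  have *: "i = j" if "f i = f j" "i \<le> j" for i j
    using closed_path_empty[of "head E (f i)" "map f [i..<i + (j - i)]"] infinite_path_segment[OF f, of i "j - i"] that
    by auto
  show ?thesis using *[of i j] *[of j i] assms(2) by (cases "i \<le> j") auto
qed

text \<open>If \<open>f\<close> were not in \<open>as\<close>, it would lie in the common tail
  \<open>w'\<close>. Since \<open>f\<close> and \<open>g\<close> stand at the same distance before
  \<open>w\<close>, the tail \<open>w'\<close> would contain both at the same position, although
  \<open>f \<noteq> g\<close>. For infinite \<open>w\<close> the alignment of the two factorizations
  relies on an infinite path repeating no edge.\<close>

lemma monolithic_edges:
  assumes w: "w \<in> finite_paths E \<union> infinite_paths E" and fg: "f \<noteq> g"
    and x: "path_append (FinPath v (xs @ [f])) w = path_append (FinPath a as) w'"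
    and y: "path_append (FinPath v (ys @ [g])) w = path_append (FinPath b bs) w'"
  shows "f \<in> set as \<and> g \<in> set bs"
proof (cases w)
  case (FinPath u ws)
  then obtain u' ws' where w': "w' = FinPath u' ws'" using x by (cases w') auto
  have eq: "xs @ f # ws = as @ ws'" "ys @ g # ws = bs @ ws'" using x y FinPath w' by auto
  show ?thesis
  proof (cases "length ws' \<le> length ws")
    case True
    have "length as > length xs" "length bs > length ys"
      using True arg_cong[OF eq(1), of length] arg_cong[OF eq(2), of length] by auto
    then show ?thesis
      using arg_cong[OF eq(1), of "\<lambda>l. l ! length xs"] arg_cong[OF eq(2), of "\<lambda>l. l ! length ys"]
      by (auto simp: nth_append)
  next
    case False
    have l: "length as + length ws' = length xs + Suc (length ws)"
        "length bs + length ws' = length ys + Suc (length ws)"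
      using arg_cong[OF eq(1), of length] arg_cong[OF eq(2), of length] by auto
    have "(as @ ws') ! length xs = f" "(bs @ ws') ! length ys = g"
      using eq by (metis nth_append_length)+
    \<comment> \<open>Both edges are read off from \<open>ws'\<close> at this one position.\<close>
    moreover have "length xs - length as = length ys - length bs" "length as \<le> length xs" "length bs \<le> length ys"
      using l False by auto
    ultimately show ?thesis using fg by (simp add: nth_append)
  qed
next
  case (InfPath \<omega>)
  then have \<omega>: "InfPath \<omega> \<in> infinite_paths E" using w by (auto simp: finite_paths_def)
  obtain \<omega>' where w': "w' = InfPath \<omega>'" using x InfPath by (cases w') auto
  let ?c = "\<lambda>l h (i::nat). if i < length l then l ! i else h (i - length l)"
  have eqx: "?c (xs @ [f]) \<omega> = ?c as \<omega>'" and eqy: "?c (ys @ [g]) \<omega> = ?c bs \<omega>'"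
    using x y InfPath w' by auto
  \<comment> \<open>Far beyond all four prefixes, so that both sides are in their infinite parts and
    no subtraction is truncated.\<close>
  define n where "n = length xs + length ys + length as + length bs + 2"
  have "\<omega> (n + length as - length (xs @ [f])) = \<omega>' n"
  proof -
    have "\<not> n + length as < length (xs @ [f])" "\<not> n + length as < length as" "n + length as - length as = n"
      by (simp_all add: n_def)
    then show ?thesis using fun_cong[OF eqx, of "n + length as"] by (simp only: if_False)
  qed
  moreover have "\<omega> (n + length bs - length (ys @ [g])) = \<omega>' n"
  proof -
    have "\<not> n + length bs < length (ys @ [g])" "\<not> n + length bs < length bs" "n + length bs - length bs = n"
      by (simp_all add: n_def)
    then show ?thesis using fun_cong[OF eqy, of "n + length bs"] by (simp only: if_False)
  qed
  ultimately have "n + length as - length (xs @ [f]) = n + length bs - length (ys @ [g])"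
    using infinite_path_inj[OF \<omega>] by metis
  then have len: "length as + length ys = length bs + length xs" by (auto simp: n_def)
  show ?thesis
  proof (cases "length as > length xs")
    case True
    then have "length bs > length ys" using len by simp
    then show ?thesis using True fun_cong[OF eqx, of "length xs"] fun_cong[OF eqy, of "length ys"]
      by (auto simp: nth_append)
  next
    case False
    then have "\<not> length bs > length ys" using len by simp
    then have "f = \<omega>' (length xs - length as)" "g = \<omega>' (length ys - length bs)"
      using False fun_cong[OF eqx, of "length xs"] fun_cong[OF eqy, of "length ys"] by (auto simp: nth_append)
    moreover have "length xs - length as = length ys - length bs" using len False by auto
    ultimately show ?thesis using fg by simp
  qed
qed

text \<open>Two shift equivalent paths can be cut just after their last divergence, where the
  prefixes end at the source of a splitting pair; finitely many splitting edges allow finitely many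
  such prefixes. Conversely every splitting pair is realized just before a common tail, so its edges
  occur on members of \<open>F\<close>.\<close>

lemma monolithic_iff:
  assumes v: "v \<in> verts E"
  shows "finite (splitting_pairs (path_subgraph E (boundary_paths_at E v))) \<longleftrightarrow>
    (\<exists>F\<subseteq>finite_paths E. finite F \<and>
       (\<forall>x\<in>boundary_paths_at E v. \<forall>y\<in>boundary_paths_at E v. shift_equivalent E x y \<longrightarrow>
          (\<exists>\<alpha>\<in>F. \<exists>\<beta>\<in>F. monolithic_extension E (x, y) (\<alpha>, \<beta>))))" (is "_ \<longleftrightarrow> ?M")
proof
  assume "finite (splitting_pairs (path_subgraph E (boundary_paths_at E v)))"
  then have fin: "finite (splitting_edges E v)" using finite_splitting_iff[OF v] by simp
  \<comment> \<open>The empty path takes care of \<open>x = y\<close>, where there is no divergence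
    to cut at.\<close>
  define P where "P = insert [] {xs. \<exists>u\<in>tail E ` splitting_edges E v. path_between E v xs u}"
  have P: "\<exists>u. path_between E v xs u" if "xs \<in> P" for xs
    using that v by (auto simp: P_def intro: exI[of _ v])
  show ?M
  proof (intro exI[of _ "FinPath v ` P"] conjI ballI impI)
    show "FinPath v ` P \<subseteq> finite_paths E" using P path_between_imp_finite_path by blast
    show "finite (FinPath v ` P)" using finite_paths_to_splitting[OF fin] by (simp add: P_def)
    fix x y assume x: "x \<in> boundary_paths_at E v" and y: "y \<in> boundary_paths_at E v"
      and "shift_equivalent E x y"
    then obtain m l where m: "enat m \<le> path_length x" and l: "enat l \<le> path_length y"
      and eq: "path_shift E m x = path_shift E l y" by (auto simp: shift_equivalent_def)
    define w where "w = path_shift E m x"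
    have x': "x \<in> finite_paths E \<union> infinite_paths E" "path_range E x = v"
      and y': "y \<in> finite_paths E \<union> infinite_paths E" "path_range E y = v"
      using x y by (auto simp: boundary_paths_at_def boundary_paths_def)
    obtain xs where xs: "path_between E v xs (path_range E w)" "x = path_append (FinPath v xs) w"
        and w: "w \<in> finite_paths E \<union> infinite_paths E"
      using split_path[OF x'(1) m] x'(2) unfolding w_def by blast
    obtain ys where ys: "path_between E v ys (path_range E w)" "y = path_append (FinPath v ys) w"
      using split_path[OF y'(1) l] y'(2) unfolding w_def eq by blast
    show "\<exists>\<alpha>\<in>FinPath v ` P. \<exists>\<beta>\<in>FinPath v ` P. monolithic_extension E (x, y) (\<alpha>, \<beta>)"
    proof (cases "xs = ys")
      case True
      \<comment> \<open>Equal prefixes mean \<open>x = y\<close>, so the whole path is a common tail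
        of the vertex \<open>v\<close> with itself.\<close>
      have app: "path_append (FinPath v []) x = x" using x' by (cases x) auto
      have "monolithic_extension E (x, y) (FinPath v [], FinPath v [])"
        unfolding monolithic_extension_def using x' v True app
          trans[OF xs(2) trans[OF _ ys(2)[symmetric]]]
        by (auto simp: finite_paths_iff path_vertex_def intro!: bexI[of _ x])
      then show ?thesis by (auto simp: P_def)
    next
      case False
      then obtain xs' ys' zs f g where d: "xs = xs' @ f # zs" "ys = ys' @ g # zs"
          "tail E f = tail E g" "f \<noteq> g"
        using diverging_edges[OF xs(1) ys(1)] by auto
      have f: "f \<in> splitting_edges E v" and g: "g \<in> splitting_edges E v"
        using diverging_edges_splitting[of v xs' f zs _ ys' g zs] diverging_edges_splitting[of v ys' g zs _ xs' f zs]
          xs(1) ys(1) d by auto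
      have pf: "path_between E v (xs' @ [f]) (tail E f)" and pg: "path_between E v (ys' @ [g]) (tail E f)"
        and pz: "path_between E (tail E f) zs (path_range E w)"
        using xs(1) ys(1) d by (auto simp: path_between_append dest: path_between_verts)
      let ?w = "path_append (FinPath (tail E f) zs) w"
      have eqs: "x = path_append (FinPath v (xs' @ [f])) ?w" "y = path_append (FinPath v (ys' @ [g])) ?w"
        unfolding xs(2) ys(2) d(1,2) path_append_assoc[symmetric] by simp_all
      \<comment> \<open>Exhibiting \<open>?w\<close> as a tail of \<open>x\<close> lets
        \<open>split_path\<close> supply that it is a path.\<close>
      have "\<exists>k. enat k \<le> path_length x \<and> ?w = path_shift E k x"
      proof (intro exI[of _ "length xs' + 1"] conjI)
        show "enat (length xs' + 1) \<le> path_length x" unfolding xs(2) d by (cases w) auto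
        show "?w = path_shift E (length xs' + 1) x"
        proof (cases w)
          case (FinPath u ws)
          then show ?thesis unfolding xs(2) d by (auto simp: path_vertex_def nth_append d(3))
        next
          case (InfPath h)
          then show ?thesis unfolding xs(2) d by (auto simp: nth_append fun_eq_iff)
        qed
      qed
      then have "?w \<in> finite_paths E \<union> infinite_paths E" using split_path[OF x'(1)] by metis
      moreover have "path_range E ?w = tail E f"
        using pz w by (cases w; cases zs) (auto simp: path_between_iff)
      ultimately have "monolithic_extension E (x, y) (FinPath v (xs' @ [f]), FinPath v (ys' @ [g]))"
        unfolding monolithic_extension_def
        using eqs path_between_imp_finite_path[OF pf] path_between_imp_finite_path[OF pg]
        by (auto simp del: path_source.simps)
      moreover have "xs' @ [f] \<in> P" "ys' @ [g] \<in> P" using pf pg f g d unfolding P_def by auto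
      ultimately show ?thesis by blast
    qed
  qed
next
  assume ?M
  then obtain F where F: "F \<subseteq> finite_paths E" "finite F"
    and mono: "\<And>x y. x \<in> boundary_paths_at E v \<Longrightarrow> y \<in> boundary_paths_at E v \<Longrightarrow> shift_equivalent E x y \<Longrightarrow>
       \<exists>\<alpha>\<in>F. \<exists>\<beta>\<in>F. monolithic_extension E (x, y) (\<alpha>, \<beta>)" by blast
  \<comment> \<open>All edges that occur on members of \<open>F\<close>; every splitting pair will
    be a subset of this finite set.\<close>
  define G where "G = (\<Union>\<alpha>\<in>F. case \<alpha> of FinPath a as \<Rightarrow> set as | InfPath h \<Rightarrow> {})"
  have "finite G" unfolding G_def using F(2) by (auto split: path.split)
  have "splitting_pairs (path_subgraph E (boundary_paths_at E v)) \<subseteq> Pow G"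
    unfolding splitting_pairs_eq[OF v]
  proof clarify
    fix f g e assume f: "edge_reachable E v f" and g: "edge_reachable E v g" and t: "tail E f = tail E g"
      and fg: "f \<noteq> g" and e: "e \<in> {f, g}"
    obtain xs ys where xs: "path_between E v (xs @ [f]) (tail E f)" and ys: "path_between E v (ys @ [g]) (tail E f)"
      using f g t by (auto simp: edge_reachable_def)
    \<comment> \<open>Any common continuation makes the two paths shift equivalent, with the
      splitting pair immediately before it.\<close>
    obtain w where w: "w \<in> boundary_paths_at E (tail E f)"
      using boundary_path_exists path_between_verts[OF xs] by blast
    have w': "path_range E w = tail E f" "w \<in> finite_paths E \<union> infinite_paths E"
      using w by (auto simp: boundary_paths_at_def boundary_paths_def)
    let ?x = "path_append (FinPath v (xs @ [f])) w" and ?y = "path_append (FinPath v (ys @ [g])) w"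
    have "shift_equivalent E ?x ?y"
      unfolding shift_equivalent_def
    proof (intro exI conjI)
      show "path_shift E (length (xs @ [f])) ?x = path_shift E (length (ys @ [g])) ?y"
        using path_shift_append[OF xs w'] path_shift_append[OF ys w'] by simp
    qed (cases w; simp)+
    then obtain \<alpha> \<beta> w2 where ab: "\<alpha> \<in> F" "\<beta> \<in> F" and eq: "?x = path_append \<alpha> w2" "?y = path_append \<beta> w2"
      using mono[OF path_append_boundary[OF xs w] path_append_boundary[OF ys w]]
      by (auto simp: monolithic_extension_def)
    have "\<exists>a as. \<gamma> = FinPath a as" if "\<gamma> \<in> F" for \<gamma>
      using subsetD[OF F(1) that] by (auto simp: finite_paths_def)
    then obtain a as b bs where ab': "\<alpha> = FinPath a as" "\<beta> = FinPath b bs"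
      using ab by meson
    have "f \<in> set as \<and> g \<in> set bs"
      using monolithic_edges[OF w'(2) fg eq[unfolded ab']] .
    then have "f \<in> G \<and> g \<in> G"
      unfolding G_def using bexI[OF _ ab(1)] bexI[OF _ ab(2)] by (auto simp: ab')
    then show "e \<in> G" using e by auto
  qed
  then show "finite (splitting_pairs (path_subgraph E (boundary_paths_at E v)))"
    using \<open>finite G\<close> by (meson finite_Pow_iff finite_subset)
qed

end

section \<open>Words in the generators\<close>

text \<open>Adjoints of edges are separate letters, so that words are closed under the adjoint and
  the same word can act in the algebra, in a representation and on paths.\<close>

datatype ('v, 'e) generator = Vertex 'v | Edge 'e | Edge_star 'e

definition generators :: "('v, 'e) pre_digraph \<Rightarrow> ('v, 'e) generator set" where
  "generators E = Vertex ` verts E \<union> Edge ` arcs E \<union> Edge_star ` arcs E"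

fun generator_star :: "('v, 'e) generator \<Rightarrow> ('v, 'e) generator" where
  "generator_star (Vertex v) = Vertex v"
| "generator_star (Edge f) = Edge_star f"
| "generator_star (Edge_star f) = Edge f"

text \<open>Collects the relations and the generation property; universality enters in
  \<open>universal_graph_algebra\<close>, where representations have to be constructed.\<close>

locale graph_algebra = G: acyclic_digraph E + A: cstar_algebra A
  for E :: "('v, 'e) pre_digraph" and A :: "'a cstar" +
  fixes p :: "'v \<Rightarrow> 'a" and s :: "'e \<Rightarrow> 'a"
  assumes family: "ck_family E A p s"
    and generated: "\<And>S. cstar_subalgebra A S \<Longrightarrow> p ` verts E \<subseteq> S \<Longrightarrow> s ` arcs E \<subseteq> S \<Longrightarrow> S = carrier A"
    and row_fin: "row_finite E"
begin

lemma p_closed [simp]: "v \<in> verts E \<Longrightarrow> p v \<in> carrier A"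
  and p_idem: "v \<in> verts E \<Longrightarrow> p v \<otimes>\<^bsub>A\<^esub> p v = p v"
  and star_p [simp]: "v \<in> verts E \<Longrightarrow> star A (p v) = p v"
  and s_closed [simp]: "f \<in> arcs E \<Longrightarrow> s f \<in> carrier A"
  and p_orth: "v \<in> verts E \<Longrightarrow> w \<in> verts E \<Longrightarrow> v \<noteq> w \<Longrightarrow> p v \<otimes>\<^bsub>A\<^esub> p w = \<zero>\<^bsub>A\<^esub>"
  and s_partial: "f \<in> arcs E \<Longrightarrow> s f \<otimes>\<^bsub>A\<^esub> star A (s f) \<otimes>\<^bsub>A\<^esub> s f = s f"
  and s_star_s: "f \<in> arcs E \<Longrightarrow> star A (s f) \<otimes>\<^bsub>A\<^esub> s f = p (tail E f)"
  and p_sum: "v \<in> verts E \<Longrightarrow> \<not> is_source E v \<Longrightarrow>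
      p v = (\<Oplus>\<^bsub>A\<^esub>f \<in> in_arcs E v. s f \<otimes>\<^bsub>A\<^esub> star A (s f))"
proof -
  note * = family[unfolded ck_family_def]
  note ** = * [THEN conjunct2] * [THEN conjunct2, THEN conjunct2]
    * [THEN conjunct2, THEN conjunct2, THEN conjunct2]
  show "v \<in> verts E \<Longrightarrow> p v \<in> carrier A" "v \<in> verts E \<Longrightarrow> p v \<otimes>\<^bsub>A\<^esub> p v = p v"
    "v \<in> verts E \<Longrightarrow> star A (p v) = p v"
    using * [THEN conjunct1] by simp_all
  show "v \<in> verts E \<Longrightarrow> w \<in> verts E \<Longrightarrow> v \<noteq> w \<Longrightarrow> p v \<otimes>\<^bsub>A\<^esub> p w = \<zero>\<^bsub>A\<^esub>"
    using **(1)[THEN conjunct1] by simp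
  show "f \<in> arcs E \<Longrightarrow> s f \<in> carrier A"
    "f \<in> arcs E \<Longrightarrow> s f \<otimes>\<^bsub>A\<^esub> star A (s f) \<otimes>\<^bsub>A\<^esub> s f = s f"
    using **(2)[THEN conjunct1] by simp_all
  show "f \<in> arcs E \<Longrightarrow> star A (s f) \<otimes>\<^bsub>A\<^esub> s f = p (tail E f)"
    using **(3)[THEN conjunct1] by simp
  show "v \<in> verts E \<Longrightarrow> \<not> is_source E v \<Longrightarrow>
      p v = (\<Oplus>\<^bsub>A\<^esub>f \<in> in_arcs E v. s f \<otimes>\<^bsub>A\<^esub> star A (s f))"
    by (rule **(3)[THEN conjunct2, rule_format])
qed

definition gen_elem :: "('v, 'e) generator \<Rightarrow> 'a" where
  "gen_elem g = (case g of Vertex v \<Rightarrow> p v | Edge f \<Rightarrow> s f | Edge_star f \<Rightarrow> star A (s f))"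

lemma gen_elem_simps [simp]:
  "gen_elem (Vertex v) = p v" "gen_elem (Edge f) = s f" "gen_elem (Edge_star f) = star A (s f)"
  by (simp_all add: gen_elem_def)

text \<open>The algebra need not be unital, so words are non-empty; the value at \<open>[]\<close> is junk.\<close>

fun word_elem :: "('v, 'e) generator list \<Rightarrow> 'a" where
  "word_elem [] = \<zero>\<^bsub>A\<^esub>"
| "word_elem [g] = gen_elem g"
| "word_elem (g # h # ws) = gen_elem g \<otimes>\<^bsub>A\<^esub> word_elem (h # ws)"

lemma gen_elem_closed [simp]: "g \<in> generators E \<Longrightarrow> gen_elem g \<in> carrier A"
  by (auto simp: generators_def)

lemma word_elem_closed [simp]: "set ws \<subseteq> generators E \<Longrightarrow> word_elem ws \<in> carrier A"
  by (induction ws rule: word_elem.induct) auto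

lemma word_elem_Cons: "ws \<noteq> [] \<Longrightarrow> word_elem (g # ws) = gen_elem g \<otimes>\<^bsub>A\<^esub> word_elem ws"
  by (cases ws) auto

lemma word_elem_append:
  "set vs \<subseteq> generators E \<Longrightarrow> set ws \<subseteq> generators E \<Longrightarrow> vs \<noteq> [] \<Longrightarrow> ws \<noteq> [] \<Longrightarrow>
   word_elem (vs @ ws) = word_elem vs \<otimes>\<^bsub>A\<^esub> word_elem ws"
proof (induction vs rule: word_elem.induct)
  case (2 g)
  then show ?case by (simp add: word_elem_Cons)
next
  case (3 g h vs)
  then show ?case by (simp add: A.mult_assoc)
qed simp

lemma generator_star_closed [simp]: "g \<in> generators E \<Longrightarrow> generator_star g \<in> generators E"
  by (auto simp: generators_def)

lemma gen_elem_star: "g \<in> generators E \<Longrightarrow> gen_elem (generator_star g) = star A (gen_elem g)"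
  by (auto simp: generators_def)

lemma word_elem_star:
  "set ws \<subseteq> generators E \<Longrightarrow> star A (word_elem ws) = word_elem (rev (map generator_star ws))"
proof (induction ws rule: word_elem.induct)
  case (2 g)
  then show ?case by (simp add: gen_elem_star)
next
  case (3 g h ws)
  let ?r = "rev (map generator_star (h # ws))"
  have r: "set ?r \<subseteq> generators E" using 3 by auto
  have "star A (word_elem (g # h # ws)) = word_elem ?r \<otimes>\<^bsub>A\<^esub> gen_elem (generator_star g)"
    using 3 by (simp add: A.star_mult gen_elem_star)
  also have "\<dots> = word_elem (?r @ [generator_star g])"
    using 3 r word_elem_append[OF r, of "[generator_star g]"] by simp
  finally show ?case by simp
qed simp

text \<open>The *-algebra generated by the family. The inductive form reduces statements that are
  linear in the element to words.\<close>

inductive_set word_span :: "'a set" where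
  zero: "\<zero>\<^bsub>A\<^esub> \<in> word_span"
| word: "set ws \<subseteq> generators E \<Longrightarrow> ws \<noteq> [] \<Longrightarrow> word_elem ws \<in> word_span"
| add: "x \<in> word_span \<Longrightarrow> y \<in> word_span \<Longrightarrow> x \<oplus>\<^bsub>A\<^esub> y \<in> word_span"
| smul: "x \<in> word_span \<Longrightarrow> c \<odot>\<^bsub>A\<^esub> x \<in> word_span"

lemma word_span_closed: "x \<in> word_span \<Longrightarrow> x \<in> carrier A"
  by (induction rule: word_span.induct) auto

lemma word_span_mult: 
  assumes "x \<in> word_span" "y \<in> word_span" shows "x \<otimes>\<^bsub>A\<^esub> y \<in> word_span"
  using assms(1)
proof (induction rule: word_span.induct)
  case zero
  then show ?case using assms(2) word_span_closed by (simp add: word_span.zero)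
next
  case (word ws)
  from assms(2) show ?case
  proof (induction rule: word_span.induct)
    case zero
    then show ?case using word by (simp add: word_span.zero)
  next
    case (word vs)
    then show ?case using \<open>set ws \<subseteq> generators E\<close> \<open>ws \<noteq> []\<close>
      by (auto simp: word_elem_append[symmetric] intro!: word_span.word)
  next
    case (add x y)
    then show ?case using word by (simp add: A.mult_add_right word_span_closed word_span.add)
  next
    case (smul x c)
    then show ?case using word by (simp add: A.smult_mult_right word_span_closed word_span.smul)
  qed
next
  case (add x y)
  then show ?case using assms(2) by (simp add: A.mult_add_left word_span_closed word_span.add)
next
  case (smul x c)
  then show ?case using assms(2) by (simp add: A.smult_mult_left word_span_closed word_span.smul)
qed

lemma word_span_star: "x \<in> word_span \<Longrightarrow> star A x \<in> word_span"
proof (induction rule: word_span.induct)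
  case (word ws)
  then show ?case unfolding word_elem_star[OF word(1)] by (intro word_span.word) auto
qed (simp_all add: A.star_add A.star_smult word_span_closed word_span.intros)

text \<open>The closure of the span is a C*-subalgebra containing the family, hence everything by
  \<open>generated\<close>.\<close>

lemma word_span_dense:
  assumes "a \<in> carrier A" "\<epsilon> > 0"
  shows "\<exists>b\<in>word_span. cnorm A (a \<ominus>\<^bsub>A\<^esub> b) < \<epsilon>"
proof -
  have sub: "word_span \<subseteq> carrier A" using word_span_closed by auto
  have "submodule word_span complex_ring A"
    unfolding A.submodule_iff using sub word_span.intros by auto
  then have "cstar_subalgebra A (A.closure_of_set word_span)"
    by (rule A.closure_cstar_subalgebra) (simp_all add: word_span_mult word_span_star)
  moreover have "p v \<in> word_span" if "v \<in> verts E" for v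
    using word_span.word[of "[Vertex v]"] that by (simp add: generators_def)
  moreover have "s f \<in> word_span" if "f \<in> arcs E" for f
    using word_span.word[of "[Edge f]"] that by (simp add: generators_def)
  ultimately have "A.closure_of_set word_span = carrier A"
    using A.closure_superset[OF sub] by (intro generated) auto
  then show ?thesis using assms by (auto simp: A.closure_of_set_def)
qed

end

section \<open>Words as matrix units in a representation\<close>

locale graph_algebra_rep = graph_algebra E A p s + cstar_representation A H \<pi>
  for E :: "('v, 'e) pre_digraph" and A :: "'a cstar" and p :: "'v \<Rightarrow> 'a" and s :: "'e \<Rightarrow> 'a"
    and H :: "'h hilbert" and \<pi>
begin

abbreviation "P v \<equiv> \<pi> (p v)"
abbreviation "S f \<equiv> \<pi> (s f)"
abbreviation "T f \<equiv> \<pi> (star A (s f))"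

text \<open>The empty word acts as the identity here, whereas \<open>word_elem []\<close> is zero;
  hence \<open>rep_word\<close> asks for a non-empty word.\<close>

definition word_op :: "('v, 'e) generator list \<Rightarrow> 'h \<Rightarrow> 'h" where
  "word_op ws = foldr (\<lambda>g. \<pi> (gen_elem g)) ws"

lemma word_op_simps [simp]: "word_op [] x = x" "word_op (g # ws) x = \<pi> (gen_elem g) (word_op ws x)"
  by (simp_all add: word_op_def)

lemma word_op_append: "word_op (vs @ ws) x = word_op vs (word_op ws x)"
  by (simp add: word_op_def)

lemma word_op_closed [simp]: "set ws \<subseteq> generators E \<Longrightarrow> x \<in> carrier H \<Longrightarrow> word_op ws x \<in> carrier H"
  by (induction ws) auto

lemma rep_word:
  "set ws \<subseteq> generators E \<Longrightarrow> ws \<noteq> [] \<Longrightarrow> x \<in> carrier H \<Longrightarrow> \<pi> (word_elem ws) x = word_op ws x"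
proof (induction ws rule: word_elem.induct)
  case (3 g h ws)
  then show ?case by (simp add: rep_mult del: word_op_simps) simp
qed auto

lemma PP: "v \<in> verts E \<Longrightarrow> x \<in> carrier H \<Longrightarrow> P v (P v x) = P v x"
  using rep_mult[of "p v" "p v" x] by (simp add: p_idem)

lemma P_adjoint: "v \<in> verts E \<Longrightarrow> x \<in> carrier H \<Longrightarrow> y \<in> carrier H \<Longrightarrow> hinner H (P v x) y = hinner H x (P v y)"
  using rep_adjoint[of "p v" x y] by simp

lemma P_orth: "v \<in> verts E \<Longrightarrow> w \<in> verts E \<Longrightarrow> v \<noteq> w \<Longrightarrow> x \<in> carrier H \<Longrightarrow> P v (P w x) = \<zero>\<^bsub>H\<^esub>"
  using rep_mult[of "p v" "p w" x] by (simp add: p_orth)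

lemma S_adjoint: "f \<in> arcs E \<Longrightarrow> x \<in> carrier H \<Longrightarrow> y \<in> carrier H \<Longrightarrow> hinner H (S f x) y = hinner H x (T f y)"
  using rep_adjoint[of "s f" x y] by simp

lemma T_adjoint: "f \<in> arcs E \<Longrightarrow> x \<in> carrier H \<Longrightarrow> y \<in> carrier H \<Longrightarrow> hinner H (T f x) y = hinner H x (S f y)"
  using rep_adjoint[of "star A (s f)" x y] by simp

lemma TS: "f \<in> arcs E \<Longrightarrow> x \<in> carrier H \<Longrightarrow> T f (S f x) = P (tail E f) x"
  using rep_mult[of "star A (s f)" "s f" x] by (simp add: s_star_s)

lemma SP: "f \<in> arcs E \<Longrightarrow> x \<in> carrier H \<Longrightarrow> S f (P (tail E f) x) = S f x"
proof -
  assume f: "f \<in> arcs E" and x: "x \<in> carrier H"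
  have "s f \<otimes>\<^bsub>A\<^esub> p (tail E f) = s f"
    using s_partial[OF f] f by (simp add: A.mult_assoc s_star_s)
  then show ?thesis using rep_mult[of "s f" "p (tail E f)" x] f x by simp
qed

lemma PT: "f \<in> arcs E \<Longrightarrow> x \<in> carrier H \<Longrightarrow> P (tail E f) (T f x) = T f x"
  by (rule H.hinner_eqI) (simp_all add: P_adjoint T_adjoint SP)

lemma hinner_P_sum:
  assumes v: "v \<in> verts E" "\<not> is_source E v" and x: "x \<in> carrier H" and y: "y \<in> carrier H"
  shows "hinner H (P v x) y = (\<Sum>f\<in>in_arcs E v. hinner H (T f x) (T f y))"
proof -
  have "hinner H (\<pi> (\<Oplus>\<^bsub>A\<^esub>f\<in>F. s f \<otimes>\<^bsub>A\<^esub> star A (s f)) x) y = (\<Sum>f\<in>F. hinner H (T f x) (T f y))"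
    if "finite F" "F \<subseteq> arcs E" for F
    using that
  proof (induction rule: finite_induct)
    case empty
    then show ?case using x y by simp
  next
    case (insert f F)
    then have F: "(\<lambda>f. s f \<otimes>\<^bsub>A\<^esub> star A (s f)) \<in> F \<rightarrow> carrier A" and f: "f \<in> arcs E" by auto
    have fs: "(\<Oplus>\<^bsub>A\<^esub>f\<in>F. s f \<otimes>\<^bsub>A\<^esub> star A (s f)) \<in> carrier A" using F by (rule A.M.finsum_closed)
    have "(\<Oplus>\<^bsub>A\<^esub>f\<in>insert f F. s f \<otimes>\<^bsub>A\<^esub> star A (s f))
        = s f \<otimes>\<^bsub>A\<^esub> star A (s f) \<oplus>\<^bsub>A\<^esub> (\<Oplus>\<^bsub>A\<^esub>f\<in>F. s f \<otimes>\<^bsub>A\<^esub> star A (s f))"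
      using insert F by (intro A.M.finsum_insert) auto
    then show ?case using insert x y fs f
      by (simp add: rep_add rep_mult H.hinner_add S_adjoint)
  qed
  moreover have "finite (in_arcs E v)" "in_arcs E v \<subseteq> arcs E"
    using v row_fin by (auto simp: row_finite_def)
  ultimately show ?thesis using p_sum[OF v] by simp
qed

text \<open>Obtained from the Cuntz-Krieger sum before the ranges of the \<open>S f\<close> are
  known to be orthogonal; that orthogonality is then read off by comparing terms.\<close>

lemma hnorm_P_sum:
  assumes v: "v \<in> verts E" "\<not> is_source E v" and x: "x \<in> carrier H"
  shows "(hnorm H (P v x))\<^sup>2 = (\<Sum>f\<in>in_arcs E v. (hnorm H (T f x))\<^sup>2)"
proof -
  have "hinner H (P v x) (P v x) = hinner H (P v x) x"
    using v x P_adjoint[of v "P v x" x] by (simp add: PP)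
  also have "\<dots> = (\<Sum>f\<in>in_arcs E v. hinner H (T f x) (T f x))" using v x by (intro hinner_P_sum)
  finally have "Re (hinner H (P v x) (P v x)) = (\<Sum>f\<in>in_arcs E v. Re (hinner H (T f x) (T f x)))"
    by simp
  then show ?thesis using v x by (simp add: H.hnorm_sq cong: sum.cong_simp)
qed

lemma T_zero_of_P_zero:
  assumes f: "f \<in> arcs E" and x: "x \<in> carrier H" and "P (head E f) x = \<zero>\<^bsub>H\<^esub>"
  shows "T f x = \<zero>\<^bsub>H\<^esub>"
proof -
  let ?v = "head E f"
  have v: "?v \<in> verts E" "\<not> is_source E ?v" using f by (auto simp: is_source_def in_arcs_def)
  have "(\<Sum>g\<in>in_arcs E ?v. (hnorm H (T g x))\<^sup>2) = 0"
    using hnorm_P_sum[OF v x] assms(3) by simp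
  then have "(hnorm H (T f x))\<^sup>2 = 0"
    using row_fin v f by (subst (asm) sum_nonneg_eq_0_iff) (auto simp: row_finite_def)
  then show ?thesis using f x by (simp add: H.hnorm_eq_0)
qed

lemma TP:
  assumes f: "f \<in> arcs E" and x: "x \<in> carrier H"
  shows "T f (P (head E f) x) = T f x"
proof -
  \<comment> \<open>The complementary vector is annihilated by the idempotent
    \<open>P (head E f)\<close>, hence by every summand of its norm identity.\<close>
  have "T f (x \<ominus>\<^bsub>H\<^esub> P (head E f) x) = \<zero>\<^bsub>H\<^esub>"
    using f x by (intro T_zero_of_P_zero) (auto simp: rep_minus_arg PP H.minus_zero_iff)
  then show ?thesis using f x by (simp add: rep_minus_arg H.minus_zero_iff)
qed

lemma PS: "f \<in> arcs E \<Longrightarrow> x \<in> carrier H \<Longrightarrow> P (head E f) (S f x) = S f x"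
  by (rule H.hinner_eqI) (simp_all add: P_adjoint S_adjoint TP)

text \<open>For a common range put \<open>y = S f x\<close>. The term of \<open>f\<close> alone
  already equals the squared norm of \<open>y\<close>, so all other terms of
  \<open>hnorm_P_sum\<close> vanish. For different ranges the vertex projections are
  orthogonal.\<close>

lemma TS_orth:
  assumes f: "f \<in> arcs E" and g: "g \<in> arcs E" and "f \<noteq> g" and x: "x \<in> carrier H"
  shows "T g (S f x) = \<zero>\<^bsub>H\<^esub>"
proof (cases "head E f = head E g")
  case True
  let ?v = "head E f" and ?y = "S f x"
  have v: "?v \<in> verts E" "\<not> is_source E ?v" using f by (auto simp: is_source_def in_arcs_def)
  have fin: "finite (in_arcs E ?v)" using row_fin v by (auto simp: row_finite_def)
  have y: "?y \<in> carrier H" using f x by simp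
  have "(hnorm H ?y)\<^sup>2 = Re (hinner H (P (tail E f) x) (P (tail E f) x))"
    using f x P_adjoint[of "tail E f" "P (tail E f) x" x] H.hinner_cnj[of "P (tail E f) x" x]
    by (simp add: H.hnorm_sq S_adjoint TS PP)
  also have "\<dots> = (hnorm H (T f ?y))\<^sup>2" using f x by (simp add: TS H.hnorm_sq)
  finally have "(hnorm H (T f ?y))\<^sup>2 = (\<Sum>h\<in>in_arcs E ?v. (hnorm H (T h ?y))\<^sup>2)"
    using hnorm_P_sum[OF v y] f x by (simp add: PS)
  also have "\<dots> = (hnorm H (T f ?y))\<^sup>2 + (\<Sum>h\<in>in_arcs E ?v - {f}. (hnorm H (T h ?y))\<^sup>2)"
    using fin f by (intro sum.remove) auto
  finally have "(\<Sum>h\<in>in_arcs E ?v - {f}. (hnorm H (T h ?y))\<^sup>2) = 0" by simp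
  then have "(hnorm H (T g ?y))\<^sup>2 = 0"
    using fin g \<open>f \<noteq> g\<close> True by (subst (asm) sum_nonneg_eq_0_iff) auto
  then show ?thesis using f g x by (simp add: H.hnorm_eq_0)
next
  case False
  have "T g (S f x) = T g (P (head E g) (P (head E f) (S f x)))"
    using f g x by (simp add: TP PS)
  then show ?thesis using False f g x by (simp add: P_orth)
qed

primrec S_path :: "'e list \<Rightarrow> 'h \<Rightarrow> 'h" where
  "S_path [] x = x"
| "S_path (f # fs) x = S f (S_path fs x)"

primrec T_path :: "'e list \<Rightarrow> 'h \<Rightarrow> 'h" where
  "T_path [] x = x"
| "T_path (f # fs) x = T_path fs (T f x)"

text \<open>The element \<open>s\<^sub>\<alpha> s\<^sub>\<beta>\<^sup>*\<close> of a graph algebra.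
  Writing \<open>P u\<close> in the middle makes the case of two empty paths the vertex
  projection.\<close>

definition matrix_unit :: "'e list \<Rightarrow> 'v \<Rightarrow> 'e list \<Rightarrow> 'h \<Rightarrow> 'h" where
  "matrix_unit \<alpha> u \<beta> x = S_path \<alpha> (P u (T_path \<beta> x))"

lemma path_between_arcs: "path_between E v \<alpha> u \<Longrightarrow> set \<alpha> \<subseteq> arcs E"
  by (induction \<alpha> arbitrary: v) auto

lemma S_path_closed [simp]: "set \<alpha> \<subseteq> arcs E \<Longrightarrow> x \<in> carrier H \<Longrightarrow> S_path \<alpha> x \<in> carrier H"
  by (induction \<alpha>) auto

lemma T_path_closed [simp]: "set \<alpha> \<subseteq> arcs E \<Longrightarrow> x \<in> carrier H \<Longrightarrow> T_path \<alpha> x \<in> carrier H"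
  by (induction \<alpha> arbitrary: x) auto

lemma T_path_append: "T_path (\<alpha> @ \<beta>) x = T_path \<beta> (T_path \<alpha> x)"
  by (induction \<alpha> arbitrary: x) auto

lemma S_path_adjoint:
  "set \<alpha> \<subseteq> arcs E \<Longrightarrow> x \<in> carrier H \<Longrightarrow> y \<in> carrier H \<Longrightarrow> hinner H (S_path \<alpha> x) y = hinner H x (T_path \<alpha> y)"
  by (induction \<alpha> arbitrary: y) (auto simp: S_adjoint)

lemma T_path_adjoint:
  "set \<alpha> \<subseteq> arcs E \<Longrightarrow> x \<in> carrier H \<Longrightarrow> y \<in> carrier H \<Longrightarrow> hinner H (T_path \<alpha> x) y = hinner H x (S_path \<alpha> y)"
  by (induction \<alpha> arbitrary: x) (auto simp: T_adjoint)

lemma matrix_unit_closed [simp]: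
  "set \<alpha> \<subseteq> arcs E \<Longrightarrow> set \<beta> \<subseteq> arcs E \<Longrightarrow> u \<in> verts E \<Longrightarrow> x \<in> carrier H \<Longrightarrow> matrix_unit \<alpha> u \<beta> x \<in> carrier H"
  by (simp add: matrix_unit_def)

lemma matrix_unit_adjoint:
  "set \<alpha> \<subseteq> arcs E \<Longrightarrow> set \<beta> \<subseteq> arcs E \<Longrightarrow> u \<in> verts E \<Longrightarrow> x \<in> carrier H \<Longrightarrow> y \<in> carrier H \<Longrightarrow>
   hinner H (matrix_unit \<alpha> u \<beta> x) y = hinner H x (matrix_unit \<beta> u \<alpha> y)"
  by (simp add: matrix_unit_def S_path_adjoint T_path_adjoint P_adjoint)

lemma P_S_path:
  assumes "path_between E v \<alpha> u" "x \<in> carrier H" "w \<in> verts E"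
  shows "P w (S_path \<alpha> (P u x)) = (if w = v then S_path \<alpha> (P u x) else \<zero>\<^bsub>H\<^esub>)"
proof (cases \<alpha>)
  case Nil
  then show ?thesis using assms by (auto simp: PP P_orth)
next
  case (Cons f \<alpha>')
  let ?y = "S_path \<alpha>' (P u x)"
  have f: "f \<in> arcs E" "head E f = v" and y: "?y \<in> carrier H"
    using assms Cons path_between_arcs G.path_between_verts[OF assms(1)] by auto
  have "P w (S f ?y) = P w (P v (S f ?y))" using PS[OF f(1) y] f(2) by simp
  also have "\<dots> = (if w = v then S f ?y else \<zero>\<^bsub>H\<^esub>)"
  proof (cases "w = v")
    case True
    then show ?thesis using f y assms PS[OF f(1) y] by simp
  next
    case False
    moreover have "v \<in> verts E" using f by auto
    ultimately show ?thesis using f y assms P_orth[of w v "S f ?y"] by simp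
  qed
  finally show ?thesis using Cons by simp
qed

lemma T_S_path:
  "path_between E v \<alpha> u \<Longrightarrow> x \<in> carrier H \<Longrightarrow> T_path \<alpha> (S_path \<alpha> (P u x)) = P u x"
proof (induction \<alpha> arbitrary: v)
  case (Cons f \<alpha>)
  then have p: "path_between E (tail E f) \<alpha> u" and f: "f \<in> arcs E" by auto
  have c: "S_path \<alpha> (P u x) \<in> carrier H"
    using p Cons.prems path_between_arcs[OF p] G.path_between_verts[OF p] by simp
  have "T f (S f (S_path \<alpha> (P u x))) = S_path \<alpha> (P u x)"
    using f c P_S_path[OF p Cons.prems(2)] by (simp add: TS)
  then show ?case using Cons.IH[OF p] Cons.prems by simp
qed simp

text \<open>An edge lengthens \<open>\<alpha>\<close>. An adjoint strips the first edge of
  \<open>\<alpha>\<close>, or, if \<open>\<alpha>\<close> is empty, is absorbed at the end of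
  \<open>\<beta>\<close>. Mismatched edges and vertices give zero by orthogonality.\<close>

lemma generator_matrix_unit:
  assumes g: "g \<in> generators E" and \<alpha>: "path_between E v \<alpha> u" and \<beta>: "path_between E w \<beta> u"
  shows "(\<forall>x\<in>carrier H. \<pi> (gen_elem g) (matrix_unit \<alpha> u \<beta> x) = \<zero>\<^bsub>H\<^esub>) \<or>
    (\<exists>v' \<alpha>' u' w' \<beta>'. path_between E v' \<alpha>' u' \<and> path_between E w' \<beta>' u' \<and>
       (\<forall>x\<in>carrier H. \<pi> (gen_elem g) (matrix_unit \<alpha> u \<beta> x) = matrix_unit \<alpha>' u' \<beta>' x))"
proof -
  have arcs: "set \<alpha> \<subseteq> arcs E" "set \<beta> \<subseteq> arcs E" and u: "u \<in> verts E" and v: "v \<in> verts E"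
    using path_between_arcs[OF \<alpha>] path_between_arcs[OF \<beta>] G.path_between_verts[OF \<alpha>] by auto
  have range: "P v' (matrix_unit \<alpha> u \<beta> x) = (if v' = v then matrix_unit \<alpha> u \<beta> x else \<zero>\<^bsub>H\<^esub>)"
    if "x \<in> carrier H" "v' \<in> verts E" for v' x
    unfolding matrix_unit_def using P_S_path[OF \<alpha> _ that(2)] that arcs by simp
  show ?thesis
  proof (cases g)
    case (Vertex v')
    then have "v' \<in> verts E" using g by (auto simp: generators_def)
    then show ?thesis
    proof (cases "v' = v")
      case True
      then show ?thesis using range Vertex \<alpha> \<beta> \<open>v' \<in> verts E\<close>
        by (intro disjI2 exI[of _ v] exI[of _ \<alpha>] exI[of _ u] exI[of _ w] exI[of _ \<beta>]) simp
    qed (use range Vertex in simp)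
  next
    case (Edge f)
    then have f: "f \<in> arcs E" using g by (auto simp: generators_def)
    show ?thesis
    proof (cases "tail E f = v")
      case True
      then have "path_between E (head E f) (f # \<alpha>) u" using f \<alpha> by simp
      then show ?thesis using \<beta> Edge
        by (intro disjI2 exI[of _ "head E f"] exI[of _ "f # \<alpha>"] exI[of _ u] exI[of _ w] exI[of _ \<beta>])
           (simp add: matrix_unit_def)
    next
      case False
      have "S f (matrix_unit \<alpha> u \<beta> x) = \<zero>\<^bsub>H\<^esub>" if "x \<in> carrier H" for x
        using SP[OF f, of "matrix_unit \<alpha> u \<beta> x"] range[OF that, of "tail E f"] False f that arcs u by simp
      then show ?thesis using Edge by simp
    qed
  next
    case (Edge_star f)
    then have f: "f \<in> arcs E" using g by (auto simp: generators_def)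
    show ?thesis
    proof (cases \<alpha>)
      case Nil
      then have "v = u" using \<alpha> by simp
      show ?thesis
      proof (cases "head E f = u")
        case True
        have "path_between E w (\<beta> @ [f]) (tail E f)" using \<beta> True f by (auto simp: G.path_between_snoc)
        moreover have "path_between E (tail E f) [] (tail E f)" using f by simp
        moreover have "T f (matrix_unit \<alpha> u \<beta> x) = matrix_unit [] (tail E f) (\<beta> @ [f]) x" if "x \<in> carrier H" for x
          unfolding matrix_unit_def Nil using True f arcs that TP[OF f, of "T_path \<beta> x"]
          by (simp add: T_path_append PT)
        ultimately show ?thesis unfolding Edge_star gen_elem_simps by blast
      next
        case False
        have "T f (matrix_unit \<alpha> u \<beta> x) = \<zero>\<^bsub>H\<^esub>" if "x \<in> carrier H" for x
          using TP[OF f, of "matrix_unit \<alpha> u \<beta> x"] range[OF that, of "head E f"] False f that arcs u \<open>v = u\<close> by simp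
        then show ?thesis using Edge_star by simp
      qed
    next
      case (Cons f' \<alpha>')
      have f': "f' \<in> arcs E" "path_between E (tail E f') \<alpha>' u" using \<alpha> Cons by auto
      show ?thesis
      proof (cases "f = f'")
        case True
        have "T f (matrix_unit \<alpha> u \<beta> x) = matrix_unit \<alpha>' u \<beta> x" if "x \<in> carrier H" for x
          unfolding matrix_unit_def Cons using True f' arcs that u Cons P_S_path[OF f'(2)]
          by (simp add: TS)
        then show ?thesis using f' \<beta> Edge_star
          by (intro disjI2 exI[of _ "tail E f'"] exI[of _ \<alpha>'] exI[of _ u] exI[of _ w] exI[of _ \<beta>]) simp
      next
        case False
        have "T f (matrix_unit \<alpha> u \<beta> x) = \<zero>\<^bsub>H\<^esub>" if "x \<in> carrier H" for x
          unfolding matrix_unit_def Cons using False f f' arcs that u Cons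
          by (simp add: TS_orth)
        then show ?thesis using Edge_star by simp
      qed
    qed
  qed
qed

lemma word_matrix_unit:
  assumes "set ws \<subseteq> generators E" "ws \<noteq> []"
  shows "(\<forall>x\<in>carrier H. word_op ws x = \<zero>\<^bsub>H\<^esub>) \<or>
    (\<exists>v \<alpha> u w \<beta>. path_between E v \<alpha> u \<and> path_between E w \<beta> u \<and>
       (\<forall>x\<in>carrier H. word_op ws x = matrix_unit \<alpha> u \<beta> x))"
  using assms(2,1)
proof (induction ws rule: list_nonempty_induct)
  case (single g)
  then have "g \<in> generators E" by simp
  then consider v where "g = Vertex v" "v \<in> verts E" | f where "g = Edge f" "f \<in> arcs E"
    | f where "g = Edge_star f" "f \<in> arcs E" by (auto simp: generators_def)
  then show ?case
  proof cases
    case 1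
    then show ?thesis
      by (intro disjI2 exI[of _ v] exI[of _ "[]"]) (simp add: matrix_unit_def)
  next
    case 2
    then show ?thesis
      by (intro disjI2 exI[of _ "head E f"] exI[of _ "[f]"] exI[of _ "tail E f"] exI[of _ "tail E f"] exI[of _ "[]"])
         (simp add: matrix_unit_def SP)
  next
    case 3
    then show ?thesis
      by (intro disjI2 exI[of _ "tail E f"] exI[of _ "[]"] exI[of _ "tail E f"] exI[of _ "head E f"] exI[of _ "[f]"])
         (simp add: matrix_unit_def PT)
  qed
next
  case (cons g ws)
  then have g: "g \<in> generators E" and ws: "set ws \<subseteq> generators E" by auto
  from cons.IH[OF ws] show ?case
  proof (elim disjE exE conjE)
    assume "\<forall>x\<in>carrier H. word_op ws x = \<zero>\<^bsub>H\<^esub>"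
    then show ?thesis using g by simp
  next
    fix v \<alpha> u w \<beta>
    assume "path_between E v \<alpha> u" "path_between E w \<beta> u"
      and eq: "\<forall>x\<in>carrier H. word_op ws x = matrix_unit \<alpha> u \<beta> x"
    from generator_matrix_unit[OF g this(1,2)] show ?thesis using eq by simp
  qed
qed

definition corner :: "'v \<Rightarrow> 'a \<Rightarrow> 'h \<Rightarrow> 'h" where
  "corner v a x = P v (\<pi> a (P v x))"

lemma corner_closed [simp]: "v \<in> verts E \<Longrightarrow> a \<in> carrier A \<Longrightarrow> x \<in> carrier H \<Longrightarrow> corner v a x \<in> carrier H"
  by (simp add: corner_def)

text \<open>Compression by \<open>P v\<close> kills a matrix unit unless both of its paths have
  range \<open>v\<close>. They have the same source \<open>u\<close> anyway, so without splitting
  they coincide.\<close>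

lemma corner_word:
  assumes v: "v \<in> verts E" and ns: "splitting_edges E v = {}"
    and ws: "set ws \<subseteq> generators E" "ws \<noteq> []"
  shows "(\<forall>x\<in>carrier H. corner v (word_elem ws) x = \<zero>\<^bsub>H\<^esub>) \<or>
    (\<exists>\<alpha> u. path_between E v \<alpha> u \<and> (\<forall>x\<in>carrier H. corner v (word_elem ws) x = matrix_unit \<alpha> u \<alpha> x))"
  using word_matrix_unit[OF ws]
proof (elim disjE exE conjE)
  assume "\<forall>x\<in>carrier H. word_op ws x = \<zero>\<^bsub>H\<^esub>"
  then show ?thesis using v ws by (simp add: corner_def rep_word)
next
  fix v1 \<alpha> u v2 \<beta>
  assume \<alpha>: "path_between E v1 \<alpha> u" and \<beta>: "path_between E v2 \<beta> u"
    and eq: "\<forall>x\<in>carrier H. word_op ws x = matrix_unit \<alpha> u \<beta> x"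
  have arcs: "set \<alpha> \<subseteq> arcs E" "set \<beta> \<subseteq> arcs E" and u: "u \<in> verts E"
    using path_between_arcs[OF \<alpha>] path_between_arcs[OF \<beta>] G.path_between_verts[OF \<alpha>] by auto
  have left: "P v (matrix_unit \<alpha> u \<beta> x) = (if v = v1 then matrix_unit \<alpha> u \<beta> x else \<zero>\<^bsub>H\<^esub>)"
    if "x \<in> carrier H" for x
    unfolding matrix_unit_def using P_S_path[OF \<alpha> _ v] that arcs by simp
  have right: "matrix_unit \<alpha> u \<beta> (P v x) = (if v = v2 then matrix_unit \<alpha> u \<beta> x else \<zero>\<^bsub>H\<^esub>)"
    if x: "x \<in> carrier H" for x
  proof (rule H.hinner_eqI)
    fix z assume z: "z \<in> carrier H"
    have "P v (matrix_unit \<beta> u \<alpha> z) = (if v = v2 then matrix_unit \<beta> u \<alpha> z else \<zero>\<^bsub>H\<^esub>)"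
      unfolding matrix_unit_def using P_S_path[OF \<beta> _ v] z arcs by simp
    then show "hinner H (matrix_unit \<alpha> u \<beta> (P v x)) z
        = hinner H (if v = v2 then matrix_unit \<alpha> u \<beta> x else \<zero>\<^bsub>H\<^esub>) z"
      using x z arcs u v by (auto simp: matrix_unit_adjoint P_adjoint)
  qed (use x arcs u v in auto)
  have c: "corner v (word_elem ws) x = (if v = v1 \<and> v = v2 then matrix_unit \<alpha> u \<beta> x else \<zero>\<^bsub>H\<^esub>)"
    if "x \<in> carrier H" for x
    using left[OF that] right[OF that] that v ws eq arcs u by (auto simp: corner_def rep_word)
  show ?thesis
  proof (cases "v = v1 \<and> v = v2")
    case True
    then have "\<alpha> = \<beta>" using G.no_splitting_unique[OF ns] \<alpha> \<beta> by blast
    then have "\<forall>x\<in>carrier H. corner v (word_elem ws) x = matrix_unit \<alpha> u \<alpha> x" using c True by auto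
    moreover have "path_between E v \<alpha> u" using True \<alpha> by simp
    ultimately show ?thesis by blast
  qed (use c in auto)
qed

lemma corner_word_projection:
  assumes v: "v \<in> verts E" and ns: "splitting_edges E v = {}"
    and ws: "set ws \<subseteq> generators E" "ws \<noteq> []" and x: "x \<in> carrier H"
  shows "corner v (word_elem ws) (corner v (word_elem ws) x) = corner v (word_elem ws) x"
    and "y \<in> carrier H \<Longrightarrow> hinner H (corner v (word_elem ws) x) y = hinner H x (corner v (word_elem ws) y)"
proof -
  have m: "matrix_unit \<alpha> u \<alpha> (matrix_unit \<alpha> u \<alpha> x) = matrix_unit \<alpha> u \<alpha> x"
    if \<alpha>: "path_between E v \<alpha> u" for \<alpha> u
    unfolding matrix_unit_def
    using T_S_path[OF \<alpha>] path_between_arcs[OF \<alpha>] G.path_between_verts[OF \<alpha>] x by (simp add: PP)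
  show "corner v (word_elem ws) (corner v (word_elem ws) x) = corner v (word_elem ws) x"
    using corner_word[OF v ns ws] m x path_between_arcs G.path_between_verts
    by (elim disjE exE conjE) (auto simp: )
  show "hinner H (corner v (word_elem ws) x) y = hinner H x (corner v (word_elem ws) y)" if "y \<in> carrier H"
    using corner_word[OF v ns ws] that x path_between_arcs G.path_between_verts
    by (elim disjE exE conjE) (auto simp: matrix_unit_adjoint)
qed

text \<open>
  Products of the self-adjoint corners are again corners of words, hence self-adjoint, and so the
  corners commute.
\<close>

lemma corner_words_commute:
  assumes v: "v \<in> verts E" and ns: "splitting_edges E v = {}"
    and ws: "set ws \<subseteq> generators E" "ws \<noteq> []" and vs: "set vs \<subseteq> generators E" "vs \<noteq> []"
    and x: "x \<in> carrier H"
  shows "corner v (word_elem ws) (corner v (word_elem vs) x) = corner v (word_elem vs) (corner v (word_elem ws) x)"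
proof (rule H.hinner_eqI)
  \<comment> \<open>The letter between the words supplies the inner projection, so that this one
    word has the product of the two corners as its corner.\<close>
  let ?us = "ws @ Vertex v # vs"
  have us: "set ?us \<subseteq> generators E" "?us \<noteq> []" using ws vs v by (auto simp: generators_def)
  have prod: "corner v (word_elem ?us) y = corner v (word_elem ws) (corner v (word_elem vs) y)"
    if "y \<in> carrier H" for y
    using that v ws vs us by (simp add: corner_def rep_word word_op_append PP)
  fix z assume z: "z \<in> carrier H"
  have "hinner H (corner v (word_elem ws) (corner v (word_elem vs) x)) z = hinner H x (corner v (word_elem ?us) z)"
    using prod[OF x] corner_word_projection(2)[OF v ns us x z] by simp
  also have "\<dots> = hinner H x (corner v (word_elem ws) (corner v (word_elem vs) z))"
    using prod[OF z] by simp
  also have "\<dots> = hinner H (corner v (word_elem vs) (corner v (word_elem ws) x)) z"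
    using corner_word_projection(2)[OF v ns ws x] corner_word_projection(2)[OF v ns vs _ z] x z v ws vs by simp
  finally show "hinner H (corner v (word_elem ws) (corner v (word_elem vs) x)) z
    = hinner H (corner v (word_elem vs) (corner v (word_elem ws) x)) z" .
qed (use v ws vs x in auto)

lemma corner_word_span_commute:
  assumes v: "v \<in> verts E" and ns: "splitting_edges E v = {}"
    and ws: "set ws \<subseteq> generators E" "ws \<noteq> []" and x: "x \<in> carrier H" and a: "a \<in> word_span"
  shows "corner v (word_elem ws) (corner v a x) = corner v a (corner v (word_elem ws) x)"
  using a
proof (induction rule: word_span.induct)
  case zero
  then show ?case using v ws x by (simp add: corner_def)
next
  case (word vs)
  then show ?case using corner_words_commute[OF v ns ws] x by simp
next
  case (add a b)
  have "corner v (a \<oplus>\<^bsub>A\<^esub> b) y = corner v a y \<oplus>\<^bsub>H\<^esub> corner v b y" if "y \<in> carrier H" for y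
    using add word_span_closed v that by (simp add: corner_def rep_add rep_add_arg)
  moreover have "corner v (word_elem ws) (y \<oplus>\<^bsub>H\<^esub> z) = corner v (word_elem ws) y \<oplus>\<^bsub>H\<^esub> corner v (word_elem ws) z"
    if "y \<in> carrier H" "z \<in> carrier H" for y z
    using v ws that by (simp add: corner_def rep_add_arg)
  ultimately show ?case using add v ws x word_span_closed by simp
next
  case (smul a c)
  have "corner v (c \<odot>\<^bsub>A\<^esub> a) y = c \<odot>\<^bsub>H\<^esub> corner v a y" if "y \<in> carrier H" for y
    using smul word_span_closed v that by (simp add: corner_def rep_smul rep_smul_arg)
  moreover have "corner v (word_elem ws) (c \<odot>\<^bsub>H\<^esub> y) = c \<odot>\<^bsub>H\<^esub> corner v (word_elem ws) y"
    if "y \<in> carrier H" for y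
    using v ws that by (simp add: corner_def rep_smul_arg)
  ultimately show ?case using smul v ws x word_span_closed by simp
qed

end

section \<open>Vertex projections of rank one\<close>

text \<open>The third assumption says that \<open>y\<close> is orthogonal to
  \<open>x \<ominus> y\<close>, as for the image of \<open>x\<close> under a projection.\<close>

lemma (in hilbert_space) hnorm_le_of_hinner:
  assumes "x \<in> carrier H" "y \<in> carrier H" "hinner H y y = hinner H y x"
  shows "hnorm H y \<le> hnorm H x"
proof (cases "hnorm H y = 0")
  case False
  have "hnorm H y * hnorm H y \<le> hnorm H y * hnorm H x"
    using Cauchy_Schwarz[OF assms(2,1)] assms complex_Re_le_cmod[of "hinner H y x"]
      hnorm_sq[of y] by (simp add: power2_eq_square)
  moreover have "hnorm H y > 0" using False hnorm_nonneg[OF assms(2)] by linarith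
  ultimately show ?thesis by (simp only: mult_le_cancel_left_pos)
qed (use assms in simp)

section \<open>Closed ideals, kernels and classes in the spectrum\<close>

lemma closed_ideal_Inter:
  assumes A: "cstar_algebra A" and "\<J> \<noteq> {}" "\<And>J. J \<in> \<J> \<Longrightarrow> closed_ideal A J"
  shows "closed_ideal A (\<Inter>\<J>)"
proof -
  interpret cstar_algebra A by fact
  show ?thesis
    unfolding closed_ideal_def submodule_iff
  proof (intro conjI ballI allI)
    note J = assms(3)[unfolded closed_ideal_def submodule_iff]
    obtain J0 where "J0 \<in> \<J>" using assms(2) by blast
    then show "\<Inter>\<J> \<subseteq> carrier A" using J[of J0] by blast
    show "\<zero>\<^bsub>A\<^esub> \<in> \<Inter>\<J>" using J by blast
    show "closed_wrt A (cnorm A) (\<Inter>\<J>)"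
      unfolding closed_wrt_def
    proof (intro allI impI InterI, elim conjE)
      fix f :: "nat \<Rightarrow> 'a" and l J
      assume "range f \<subseteq> \<Inter>\<J>" "l \<in> carrier A" "(\<lambda>n. cnorm A (f n \<ominus>\<^bsub>A\<^esub> l)) \<longlonglongrightarrow> 0" "J \<in> \<J>"
      moreover from this have "range f \<subseteq> J" by blast
      ultimately show "l \<in> J" using J unfolding closed_wrt_def by metis
    qed
  qed (use assms(3)[unfolded closed_ideal_def submodule_iff] in auto)
qed

lemma closed_ideal_carrier: "cstar_algebra A \<Longrightarrow> closed_ideal A (carrier A)"
proof -
  assume "cstar_algebra A"
  then interpret cstar_algebra A .
  show ?thesis unfolding closed_ideal_def submodule_iff closed_wrt_def by auto
qed

lemma rep_kernel_closed_ideal: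
  assumes "cstar_algebra A" "\<pi> \<in> irreps A"
  shows "closed_ideal A (rep_kernel A \<pi>)"
proof -
  have "representation A (fst \<pi>) (snd \<pi>)" using assms by (simp add: irreps_def irreducible_rep_def)
  then interpret cstar_representation A "fst \<pi>" "snd \<pi>"
    using assms(1) by (simp add: cstar_representation_def cstar_representation_axioms_def representation_def)
  show ?thesis unfolding rep_kernel_def by (rule closed_ideal_kernel)
qed

lemma hilbert_space_irrep: "\<pi> \<in> irreps A \<Longrightarrow> hilbert_space (fst \<pi>)"
  by (simp add: irreps_def irreducible_rep_def representation_def)

lemma unitarily_equivalent_kernel:
  assumes \<pi>: "\<pi> \<in> irreps A" and \<rho>: "\<rho> \<in> irreps A" and eq: "unitarily_equivalent A \<pi> \<rho>"
  shows "rep_kernel A \<pi> = rep_kernel A \<rho>"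
proof -
  obtain U where lin: "linear_on (fst \<pi>) (fst \<rho>) U"
    and bij: "bij_betw U (carrier (fst \<pi>)) (carrier (fst \<rho>))"
    and inter: "\<And>a x. a \<in> carrier A \<Longrightarrow> x \<in> carrier (fst \<pi>) \<Longrightarrow> U (snd \<pi> a x) = snd \<rho> a (U x)"
    using eq unfolding unitarily_equivalent_def by blast
  interpret H: hilbert_space "fst \<pi>" using hilbert_space_irrep[OF \<pi>] .
  interpret K: hilbert_space "fst \<rho>" using hilbert_space_irrep[OF \<rho>] .
  have zero: "U \<zero>\<^bsub>fst \<pi>\<^esub> = \<zero>\<^bsub>fst \<rho>\<^esub>"
  proof -
    have "U \<zero>\<^bsub>fst \<pi>\<^esub> \<in> carrier (fst \<rho>)" using lin by (auto simp: linear_on_def)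
    moreover have "U (0 \<odot>\<^bsub>fst \<pi>\<^esub> \<zero>\<^bsub>fst \<pi>\<^esub>) = 0 \<odot>\<^bsub>fst \<rho>\<^esub> U \<zero>\<^bsub>fst \<pi>\<^esub>"
      using lin[unfolded linear_on_def, THEN conjunct2, THEN conjunct2] H.M.zero_closed by (simp only:)
    ultimately show ?thesis by simp
  qed
  have "(\<forall>x\<in>carrier (fst \<pi>). snd \<pi> a x = \<zero>\<^bsub>fst \<pi>\<^esub>) \<longleftrightarrow> (\<forall>y\<in>carrier (fst \<rho>). snd \<rho> a y = \<zero>\<^bsub>fst \<rho>\<^esub>)"
    if a: "a \<in> carrier A" for a
  proof -
    have cl: "snd \<pi> a x \<in> carrier (fst \<pi>)" if "x \<in> carrier (fst \<pi>)" for x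
      using \<pi> a that
      by (auto simp: irreps_def irreducible_rep_def representation_def bounded_operator_def linear_on_def)
    have iff: "snd \<pi> a x = \<zero>\<^bsub>fst \<pi>\<^esub> \<longleftrightarrow> snd \<rho> a (U x) = \<zero>\<^bsub>fst \<rho>\<^esub>" if "x \<in> carrier (fst \<pi>)" for x
      using inter[OF a that] zero inj_onD[OF bij_betw_imp_inj_on[OF bij] _ cl[OF that] H.M.zero_closed] by auto
    have image: "U ` carrier (fst \<pi>) = carrier (fst \<rho>)" using bij by (simp add: bij_betw_def)
    show ?thesis unfolding image[symmetric] using iff by blast
  qed
  then show ?thesis unfolding rep_kernel_def by blast
qed

lemma unitarily_equivalent_refl: "\<pi> \<in> irreps A \<Longrightarrow> unitarily_equivalent A \<pi> \<pi>"
  unfolding unitarily_equivalent_def linear_on_def by (intro exI[of _ "\<lambda>x. x"]) (auto simp: bij_betw_def)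

lemma spectrum_class:
  assumes "c \<in> spectrum A"
  shows "\<exists>\<pi>\<in>irreps A. class_kernel A c = rep_kernel A \<pi>"
    and "\<sigma> \<in> c \<Longrightarrow> \<sigma> \<in> irreps A \<and> rep_kernel A \<sigma> = class_kernel A c"
proof -
  obtain \<pi> where \<pi>: "\<pi> \<in> irreps A" "c = {\<sigma>. \<pi> \<in> irreps A \<and> \<sigma> \<in> irreps A \<and> unitarily_equivalent A \<pi> \<sigma>}"
    using assms unfolding spectrum_def quotient_def by auto
  have mem: "\<pi> \<in> c" using \<pi> unitarily_equivalent_refl by blast
  have ker: "rep_kernel A \<sigma> = rep_kernel A \<pi>" if "\<sigma> \<in> c" for \<sigma>
    using that \<pi> unitarily_equivalent_kernel by blast
  then have "class_kernel A c = rep_kernel A \<pi>" using mem unfolding class_kernel_def by blast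
  then show "\<exists>\<pi>\<in>irreps A. class_kernel A c = rep_kernel A \<pi>"
    "\<sigma> \<in> c \<Longrightarrow> \<sigma> \<in> irreps A \<and> rep_kernel A \<sigma> = class_kernel A c"
    using \<pi> ker by auto
qed

lemma spectrum_classI:
  assumes "\<pi> \<in> irreps A"
  obtains c where "c \<in> spectrum A" "\<pi> \<in> c" "class_kernel A c = rep_kernel A \<pi>"
proof -
  let ?c = "{\<sigma>. \<pi> \<in> irreps A \<and> \<sigma> \<in> irreps A \<and> unitarily_equivalent A \<pi> \<sigma>}"
  have "?c \<in> spectrum A" unfolding spectrum_def quotient_def using assms by auto
  moreover have "\<pi> \<in> ?c" using assms unitarily_equivalent_refl by blast
  moreover have "class_kernel A ?c = rep_kernel A \<pi>"
    unfolding class_kernel_def using \<open>\<pi> \<in> ?c\<close> unitarily_equivalent_kernel[OF assms] by blast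
  ultimately show ?thesis using that by blast
qed

context graph_algebra_rep
begin

text \<open>The assumption on \<open>b\<close> rules out that the closed orbit of \<open>x\<close>
  is zero. Approximants are taken from \<open>word_span\<close>, because what follows is proved by
  induction over words.\<close>

lemma irreducible_cyclic:
  assumes irr: "irreducible_rep A H \<pi>" and b: "b \<in> carrier A" and x: "x \<in> carrier H"
    and nz: "\<pi> b x \<noteq> \<zero>\<^bsub>H\<^esub>" and y: "y \<in> carrier H" and e: "\<epsilon> > 0"
  shows "\<exists>a\<in>word_span. hnorm H (y \<ominus>\<^bsub>H\<^esub> \<pi> a x) < \<epsilon>"
proof -
  define N where "N = {\<pi> a x | a. a \<in> carrier A}"
  have N: "N \<subseteq> carrier H" using x by (auto simp: N_def)
  have "\<zero>\<^bsub>H\<^esub> \<in> N" unfolding N_def using x by (auto intro!: exI[of _ "\<zero>\<^bsub>A\<^esub>"])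
  moreover have "u \<oplus>\<^bsub>H\<^esub> w \<in> N" if "u \<in> N" "w \<in> N" for u w
    using that x rep_add[symmetric] unfolding N_def by blast
  moreover have "c \<odot>\<^bsub>H\<^esub> u \<in> N" if "u \<in> N" for c u
    using that x rep_smul[symmetric] unfolding N_def by blast
  ultimately have "submodule N complex_ring H" using N by (simp add: H.submodule_iff)
  then have sub: "submodule (H.closure_of_set N) complex_ring H" by (rule H.submodule_closure_of_set)
  have cl: "closed_wrt H (hnorm H) (H.closure_of_set N)" by (rule H.closed_closure_of_set[OF N])
  have inv: "\<pi> c u \<in> H.closure_of_set N" if c: "c \<in> carrier A" and "u \<in> H.closure_of_set N" for c u
    unfolding H.closure_of_set_def
  proof (intro CollectI conjI allI impI)
    have u: "u \<in> carrier H" "\<And>\<epsilon>. \<epsilon> > 0 \<Longrightarrow> \<exists>w\<in>N. hnorm H (u \<ominus>\<^bsub>H\<^esub> w) < \<epsilon>"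
      using that(2) by (auto simp: H.closure_of_set_def)
    show "\<pi> c u \<in> carrier H" using c u by simp
    fix \<epsilon> :: real assume "\<epsilon> > 0"
    define K where "K = 2 * cnorm A c + 1"
    have K: "K > 0" "2 * cnorm A c \<le> K" using A.norm_nonneg[OF c] by (auto simp: K_def)
    obtain w where w: "w \<in> N" "hnorm H (u \<ominus>\<^bsub>H\<^esub> w) < \<epsilon> / K"
      using u(2)[of "\<epsilon> / K"] \<open>\<epsilon> > 0\<close> K by auto
    obtain a where a: "a \<in> carrier A" "w = \<pi> a x" using w by (auto simp: N_def)
    have uw: "u \<ominus>\<^bsub>H\<^esub> w \<in> carrier H" using u w N by auto
    have "\<pi> c u \<ominus>\<^bsub>H\<^esub> \<pi> c w = \<pi> c (u \<ominus>\<^bsub>H\<^esub> w)" using c u w N by (auto simp: rep_minus_arg)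
    then have "hnorm H (\<pi> c u \<ominus>\<^bsub>H\<^esub> \<pi> c w) \<le> 2 * cnorm A c * hnorm H (u \<ominus>\<^bsub>H\<^esub> w)"
      using rep_bound[OF c uw] by simp
    also have "\<dots> \<le> K * hnorm H (u \<ominus>\<^bsub>H\<^esub> w)" using K uw by (intro mult_right_mono) auto
    also have "\<dots> < \<epsilon>" using w K by (simp add: pos_less_divide_eq mult.commute)
    finally have "hnorm H (\<pi> c u \<ominus>\<^bsub>H\<^esub> \<pi> c w) < \<epsilon>" .
    moreover have "\<pi> c w \<in> N" unfolding N_def using a c x rep_mult[of c a x]
      by (auto intro!: exI[of _ "c \<otimes>\<^bsub>A\<^esub> a"])
    ultimately show "\<exists>w\<in>N. hnorm H (\<pi> c u \<ominus>\<^bsub>H\<^esub> w) < \<epsilon>" by blast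
  qed
  have "H.closure_of_set N = {\<zero>\<^bsub>H\<^esub>} \<or> H.closure_of_set N = carrier H"
    using irr sub cl inv unfolding irreducible_rep_def by blast
  moreover have "\<pi> b x \<in> H.closure_of_set N"
    using H.closure_superset[OF N] b by (auto simp: N_def)
  ultimately have "y \<in> H.closure_of_set N" using nz y by auto
  then obtain w where "w \<in> N" "hnorm H (y \<ominus>\<^bsub>H\<^esub> w) < \<epsilon>/2"
    using e half_gt_zero[OF e] unfolding H.closure_of_set_def by blast
  then obtain a where a: "a \<in> carrier A" "hnorm H (y \<ominus>\<^bsub>H\<^esub> \<pi> a x) < \<epsilon>/2" by (auto simp: N_def)
  \<comment> \<open>One factor 2 comes from \<open>rep_close\<close>, the other from spending only
    half of \<open>\<epsilon>\<close>.\<close>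
  define K where "K = 4 * (hnorm H x + 1)"
  have x0: "hnorm H x \<ge> 0" using x by simp
  then have K: "K > 0" by (simp add: K_def)
  obtain d where d: "d \<in> word_span" "cnorm A (a \<ominus>\<^bsub>A\<^esub> d) < \<epsilon> / K"
    using word_span_dense[OF a(1), of "\<epsilon> / K"] e K by auto
  have dA: "d \<in> carrier A" using d word_span_closed by simp
  have "hnorm H (\<pi> a x \<ominus>\<^bsub>H\<^esub> \<pi> d x) \<le> 2 * cnorm A (a \<ominus>\<^bsub>A\<^esub> d) * hnorm H x"
    using a dA x by (intro rep_close)
  also have "\<dots> \<le> 2 * (\<epsilon> / K) * (hnorm H x + 1)"
    using d x0 a dA e K by (intro mult_mono) auto
  also have "\<dots> = \<epsilon>/2" using K unfolding K_def by (simp add: field_simps)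
  finally have "hnorm H (y \<ominus>\<^bsub>H\<^esub> \<pi> d x) < \<epsilon>"
    using H.nrm_triangle[of y "\<pi> a x" "\<pi> d x"] a dA x y by simp
  then show ?thesis using d by blast
qed

lemma hnorm_P_le: "v \<in> verts E \<Longrightarrow> x \<in> carrier H \<Longrightarrow> hnorm H (P v x) \<le> hnorm H x"
  using P_adjoint[of v "P v x" x] by (intro H.hnorm_le_of_hinner) (auto simp: PP)

text \<open>A Schur argument: the corner \<open>Q\<close> is a projection commuting with all
  corners. If \<open>y = Q x\<close> is non-zero, irreducibility approximates \<open>x\<close> by
  corners applied to \<open>y\<close>. These vectors are fixed by \<open>Q\<close>, hence so is
  \<open>x\<close>, and the scalar is 0 or 1.\<close>

lemma corner_word_scalar:
  assumes irr: "irreducible_rep A H \<pi>"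
    and v: "v \<in> verts E" and ns: "splitting_edges E v = {}"
    and ws: "set ws \<subseteq> generators E" "ws \<noteq> []" and x: "x \<in> carrier H" "P v x = x"
  shows "\<exists>c. corner v (word_elem ws) x = c \<odot>\<^bsub>H\<^esub> x"
proof (cases "corner v (word_elem ws) x = \<zero>\<^bsub>H\<^esub>")
  case True
  then show ?thesis using x by (intro exI[of _ 0]) simp
next
  case False
  define Q where "Q = corner v (word_elem ws)"
  define y where "y = Q x"
  have Q: "Q z \<in> carrier H" if "z \<in> carrier H" for z using that v ws by (simp add: Q_def)
  have y: "y \<in> carrier H" "P v y = y" "Q y = y" "y \<noteq> \<zero>\<^bsub>H\<^esub>"
    using x v ws False corner_word_projection(1)[OF v ns ws x(1)]
    unfolding y_def Q_def by (simp_all add: PP corner_def[of v "word_elem ws" x])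
  have contr: "hnorm H (Q z) \<le> hnorm H z" if z: "z \<in> carrier H" for z
  proof (rule H.hnorm_le_of_hinner[OF z Q[OF z]])
    show "hinner H (Q z) (Q z) = hinner H (Q z) z"
      using corner_word_projection(2)[OF v ns ws Q[OF z] z] corner_word_projection(1)[OF v ns ws z]
      unfolding Q_def by simp
  qed
  have "hnorm H (Q x \<ominus>\<^bsub>H\<^esub> x) \<le> 0 + e" if e: "e > 0" for e
  proof -
    obtain a where a: "a \<in> word_span" "hnorm H (x \<ominus>\<^bsub>H\<^esub> \<pi> a y) < e/2"
      using irreducible_cyclic[OF irr p_closed[OF v] y(1) _ x(1), of "e/2"] y e by auto
    \<comment> \<open>Compressing the approximant keeps it close, because \<open>P v x = x\<close>,
      and puts it into the range of \<open>Q\<close>.\<close>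
    define w where "w = corner v a y"
    have aA: "a \<in> carrier A" using a word_span_closed by simp
    have w: "w \<in> carrier H" using aA y v by (simp add: w_def)
    have "hnorm H (x \<ominus>\<^bsub>H\<^esub> w) = hnorm H (P v (x \<ominus>\<^bsub>H\<^esub> \<pi> a y))"
      using aA x y v by (simp add: w_def corner_def rep_minus_arg)
    also have "\<dots> \<le> hnorm H (x \<ominus>\<^bsub>H\<^esub> \<pi> a y)" using aA x y v by (intro hnorm_P_le) auto
    finally have 1: "hnorm H (x \<ominus>\<^bsub>H\<^esub> w) < e/2" using a by simp
    have Qw: "Q w = w"
      using corner_word_span_commute[OF v ns ws y(1) a(1)] y(3) by (simp add: w_def Q_def)
    have "hnorm H (Q (x \<ominus>\<^bsub>H\<^esub> w)) \<le> hnorm H (x \<ominus>\<^bsub>H\<^esub> w)" using x w by (intro contr) auto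
    also have "Q (x \<ominus>\<^bsub>H\<^esub> w) = Q x \<ominus>\<^bsub>H\<^esub> w"
      using x w v ws Qw by (simp add: Q_def corner_def rep_minus_arg)
    finally have 2: "hnorm H (Q x \<ominus>\<^bsub>H\<^esub> w) < e/2" using 1 by simp
    have "hnorm H (Q x \<ominus>\<^bsub>H\<^esub> x) \<le> hnorm H (Q x \<ominus>\<^bsub>H\<^esub> w) + hnorm H (w \<ominus>\<^bsub>H\<^esub> x)"
      using x w Q by (intro H.nrm_triangle) auto
    also have "hnorm H (w \<ominus>\<^bsub>H\<^esub> x) = hnorm H (x \<ominus>\<^bsub>H\<^esub> w)" using x w by (intro H.nrm_minus_commute)
    finally show ?thesis using 1 2 by simp
  qed
  then have "hnorm H (Q x \<ominus>\<^bsub>H\<^esub> x) \<le> 0" by (rule field_le_epsilon)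
  then have "hnorm H (Q x \<ominus>\<^bsub>H\<^esub> x) = 0"
    using H.hnorm_nonneg[of "Q x \<ominus>\<^bsub>H\<^esub> x"] Q x by (meson H.minus_closed antisym)
  then have "Q x = x" using Q x by (simp add: H.hnorm_eq_0 H.minus_zero_iff)
  then show ?thesis using x by (intro exI[of _ 1]) (simp add: Q_def)
qed

lemma corner_scalar:
  assumes irr: "irreducible_rep A H \<pi>"
    and v: "v \<in> verts E" and ns: "splitting_edges E v = {}"
    and a: "a \<in> word_span" and x: "x \<in> carrier H" "P v x = x"
  shows "\<exists>c. corner v a x = c \<odot>\<^bsub>H\<^esub> x"
  using a
proof (induction rule: word_span.induct)
  case zero
  then show ?case using v x by (intro exI[of _ 0]) (simp add: corner_def)
next
  case (word ws)
  then show ?case using corner_word_scalar[OF irr v ns _ _ x] by blast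
next
  case (add a b)
  then obtain c d where "corner v a x = c \<odot>\<^bsub>H\<^esub> x" "corner v b x = d \<odot>\<^bsub>H\<^esub> x" by blast
  then show ?case using add word_span_closed v x
    by (intro exI[of _ "c + d"]) (simp add: corner_def rep_add rep_add_arg H.smul_add_left)
next
  case (smul a d)
  then obtain c where "corner v a x = c \<odot>\<^bsub>H\<^esub> x" by blast
  then show ?case using smul word_span_closed v x
    by (intro exI[of _ "d * c"]) (simp add: corner_def rep_smul rep_smul_arg H.smul_smul)
qed

text \<open>Every \<open>y\<close> in the range of \<open>P v\<close> is a limit of vectors
  \<open>corner v a x\<close>, which are multiples of \<open>x\<close>. The part of \<open>y\<close>
  orthogonal to \<open>x\<close> is no longer than the distance of \<open>y\<close> to any such
  multiple, so it vanishes.\<close>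

lemma rank_one_vertex:
  assumes irr: "irreducible_rep A H \<pi>"
    and v: "v \<in> verts E" and ns: "splitting_edges E v = {}"
    and nz: "\<exists>x\<in>carrier H. P v x \<noteq> \<zero>\<^bsub>H\<^esub>"
  shows "rank_one_projection H (P v)"
proof -
  obtain x0 where x0: "x0 \<in> carrier H" "P v x0 \<noteq> \<zero>\<^bsub>H\<^esub>" using nz by blast
  define x where "x = P v x0"
  have x: "x \<in> carrier H" "P v x = x" "x \<noteq> \<zero>\<^bsub>H\<^esub>" using x0 v by (auto simp: x_def PP)
  have nx: "(hnorm H x)\<^sup>2 > 0" using x H.hnorm_eq_0[of x] by simp
  have mult: "\<exists>c. y = c \<odot>\<^bsub>H\<^esub> x" if y: "y \<in> carrier H" "P v y = y" for y
  proof -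
    \<comment> \<open>The coefficient of the orthogonal projection of \<open>y\<close> onto
      \<open>x\<close>.\<close>
    define c where "c = hinner H y x / complex_of_real ((hnorm H x)\<^sup>2)"
    define z where "z = y \<ominus>\<^bsub>H\<^esub> c \<odot>\<^bsub>H\<^esub> x"
    have z: "z \<in> carrier H" using x y by (simp add: z_def)
    have zx: "hinner H z x = 0"
      using x y nx by (simp add: z_def H.hinner_minus_left H.hinner_smult c_def H.hinner_self)
    have "hnorm H z \<le> 0 + e" if e: "e > 0" for e
    proof (cases "hnorm H z = 0")
      case False
      then have zpos: "hnorm H z > 0" using H.hnorm_nonneg[OF z] by linarith
      obtain a where a: "a \<in> word_span" "hnorm H (y \<ominus>\<^bsub>H\<^esub> \<pi> a x) < e"
        using irreducible_cyclic[OF irr p_closed[OF v] x(1) _ y(1) e] x by auto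
      have aA: "a \<in> carrier A" using a word_span_closed by simp
      obtain d where d: "corner v a x = d \<odot>\<^bsub>H\<^esub> x" using corner_scalar[OF irr v ns a(1) x(1,2)] by blast
      have "hnorm H (y \<ominus>\<^bsub>H\<^esub> d \<odot>\<^bsub>H\<^esub> x) = hnorm H (P v (y \<ominus>\<^bsub>H\<^esub> \<pi> a x))"
        using aA x y v by (simp add: d[symmetric] corner_def rep_minus_arg)
      also have "\<dots> \<le> hnorm H (y \<ominus>\<^bsub>H\<^esub> \<pi> a x)" using aA x y v by (intro hnorm_P_le) auto
      finally have small: "hnorm H (y \<ominus>\<^bsub>H\<^esub> d \<odot>\<^bsub>H\<^esub> x) < e" using a by simp
      have "hinner H z z = hinner H z (y \<ominus>\<^bsub>H\<^esub> d \<odot>\<^bsub>H\<^esub> x)"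
        using z x y zx by (subst (2) z_def) (simp add: H.hinner_minus_right H.hinner_smult_right)
      then have "hnorm H z * hnorm H z \<le> hnorm H z * hnorm H (y \<ominus>\<^bsub>H\<^esub> d \<odot>\<^bsub>H\<^esub> x)"
        using H.Cauchy_Schwarz[of z "y \<ominus>\<^bsub>H\<^esub> d \<odot>\<^bsub>H\<^esub> x"] z x y H.hnorm_sq[of z]
          complex_Re_le_cmod[of "hinner H z z"] by (simp add: power2_eq_square)
      then show ?thesis using zpos small by simp
    qed (use e in simp)
    then have "hnorm H z \<le> 0" by (rule field_le_epsilon)
    then have "hnorm H z = 0" using H.hnorm_nonneg[OF z] by linarith
    then have "y = c \<odot>\<^bsub>H\<^esub> x" using z x y by (simp add: H.hnorm_eq_0 z_def H.minus_zero_iff)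
    then show ?thesis by blast
  qed
  have "P v ` carrier H = {c \<odot>\<^bsub>H\<^esub> x | c. True}"
  proof (intro equalityI subsetI)
    fix y assume "y \<in> P v ` carrier H"
    then obtain u where "u \<in> carrier H" "y = P v u" by blast
    then show "y \<in> {c \<odot>\<^bsub>H\<^esub> x | c. True}" using mult[of y] v by (auto simp: PP)
  next
    fix y assume "y \<in> {c \<odot>\<^bsub>H\<^esub> x | c. True}"
    then obtain c where c: "y = c \<odot>\<^bsub>H\<^esub> x" by blast
    then have "y = P v y" using x v by (simp add: rep_smul_arg)
    then show "y \<in> P v ` carrier H" using c x by blast
  qed
  then show ?thesis
    unfolding rank_one_projection_def using bop[OF p_closed[OF v]] v x by (auto simp: PP P_adjoint)
qed

text \<open>If all \<open>P v\<close> vanish, then so do \<open>S f\<close>, \<open>T f\<close>, all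
  words and, by density, the whole representation, contrary to the non-degeneracy clause of
  irreducibility.\<close>

lemma nonzero_vertex_exists:
  assumes irr: "irreducible_rep A H \<pi>"
  shows "\<exists>v\<in>verts E. \<exists>x\<in>carrier H. P v x \<noteq> \<zero>\<^bsub>H\<^esub>"
proof (rule ccontr)
  assume "\<not> ?thesis"
  then have P0: "P v x = \<zero>\<^bsub>H\<^esub>" if "v \<in> verts E" "x \<in> carrier H" for v x using that by blast
  have gen: "\<pi> (gen_elem g) x = \<zero>\<^bsub>H\<^esub>" if "g \<in> generators E" "x \<in> carrier H" for g x
    using that P0 SP[of _ x] PT[of _ x] by (auto simp: generators_def)
  have word: "\<pi> a x = \<zero>\<^bsub>H\<^esub>" if "a \<in> word_span" and x: "x \<in> carrier H" for a x
    using that(1)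
  proof (induction rule: word_span.induct)
    case (word ws)
    then obtain g vs where "ws = g # vs" by (cases ws) auto
    then show ?case using word gen x by (simp add: rep_word)
  qed (use x word_span_closed in \<open>auto simp: rep_add rep_smul\<close>)
  obtain a x where ax: "a \<in> carrier A" "x \<in> carrier H" "\<pi> a x \<noteq> \<zero>\<^bsub>H\<^esub>"
    using irr unfolding irreducible_rep_def by blast
  then have pos: "hnorm H (\<pi> a x) > 0" using H.hnorm_eq_0[of "\<pi> a x"] H.hnorm_nonneg[of "\<pi> a x"] by (simp add: less_le)
  obtain b where "b \<in> word_span" "hnorm H (\<pi> a x \<ominus>\<^bsub>H\<^esub> \<pi> b x) < hnorm H (\<pi> a x)"
    using irreducible_cyclic[OF irr ax(1,2,3) rep_closed[OF ax(1,2)] pos] by blast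
  then show False using word ax by (simp add: H.minus_zero)
qed

lemma good_vertex_exists:
  assumes irr: "irreducible_rep A H \<pi>"
    and good: "\<And>f. InfPath f \<in> infinite_paths E \<Longrightarrow> \<exists>n. splitting_edges E (head E (f n)) = {}"
  shows "\<exists>v\<in>verts E. splitting_edges E v = {} \<and> (\<exists>x\<in>carrier H. P v x \<noteq> \<zero>\<^bsub>H\<^esub>)"
proof (rule ccontr)
  assume no: "\<not> ?thesis"
  \<comment> \<open>By \<open>no\<close>, splitting edges can be reached from every member of
    \<open>G\<close>, which keeps the construction going.\<close>
  define G where "G = {v \<in> verts E. \<exists>x\<in>carrier H. P v x \<noteq> \<zero>\<^bsub>H\<^esub>}"
  have step: "\<exists>f\<in>arcs E. head E f = v \<and> tail E f \<in> G" if vG: "v \<in> G" for v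
  proof -
    obtain x where x: "x \<in> carrier H" "P v x \<noteq> \<zero>\<^bsub>H\<^esub>" and v: "v \<in> verts E" using vG by (auto simp: G_def)
    \<comment> \<open>A reachable splitting edge forces an edge with range \<open>v\<close>, so
      \<open>v\<close> is not a source and the Cuntz-Krieger sum is available there.\<close>
    obtain e where "e \<in> splitting_edges E v" using no v x by blast
    then obtain xs where "path_between E v (xs @ [e]) (tail E e)"
      by (auto simp: splitting_edges_def edge_reachable_def)
    then have "\<exists>f. f \<in> in_arcs E v" by (cases xs) auto
    then have ns: "\<not> is_source E v" by (auto simp: is_source_def)
    show ?thesis
    proof (rule ccontr)
      assume "\<not> ?thesis"
      \<comment> \<open>The vector \<open>T f x\<close> lies in the range of
        \<open>P (tail E f)\<close>, which is zero if the source of \<open>f\<close> is outside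
        \<open>G\<close>.\<close>
      then have "T f x = \<zero>\<^bsub>H\<^esub>" if "f \<in> in_arcs E v" for f
        using that x PT[of f x] by (force simp: G_def in_arcs_def)
      then have "(hnorm H (P v x))\<^sup>2 = 0" using hnorm_P_sum[OF v ns x(1)] by simp
      then show False using x v H.hnorm_eq_0[of "P v x"] by simp
    qed
  qed
  then obtain c where c: "\<And>v. v \<in> G \<Longrightarrow> c v \<in> arcs E \<and> head E (c v) = v \<and> tail E (c v) \<in> G" by metis
  obtain v0 where v0: "v0 \<in> G" using nonzero_vertex_exists[OF irr] by (auto simp: G_def)
  define vx where "vx i = ((\<lambda>v. tail E (c v)) ^^ i) v0" for i
  have vx: "vx i \<in> G" for i by (induction i) (auto simp: vx_def v0 c)
  have "tail E (c (vx i)) = vx (Suc i)" for i by (simp add: vx_def)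
  then have "InfPath (\<lambda>i. c (vx i)) \<in> infinite_paths E"
    using c[OF vx] by (auto simp: infinite_paths_def)
  then obtain n where "splitting_edges E (vx n) = {}" using good c[OF vx] by metis
  then show False using no vx[of n] by (auto simp: G_def)
qed

end

context graph_algebra
begin

lemma irrep_interpretation: "\<pi> \<in> irreps A \<Longrightarrow> graph_algebra_rep E A p s (fst \<pi>) (snd \<pi>)"
  using graph_algebra_axioms
  by (auto simp: graph_algebra_rep_def cstar_representation_def cstar_representation_axioms_def
      irreps_def irreducible_rep_def representation_def A.cstar_algebra_axioms)

lemma Fell_if_no_splitting:
  assumes good: "\<And>f. InfPath f \<in> infinite_paths E \<Longrightarrow> \<exists>n. splitting_edges E (head E (f n)) = {}"
  shows "Fell A"
  unfolding Fell_def
proof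
  fix c assume "c \<in> spectrum A"
  then obtain \<pi> where \<pi>: "\<pi> \<in> irreps A" and ker: "class_kernel A c = rep_kernel A \<pi>"
    using spectrum_class(1) by blast
  interpret R: graph_algebra_rep E A p s "fst \<pi>" "snd \<pi>" by (rule irrep_interpretation[OF \<pi>])
  obtain v where v: "v \<in> verts E" "splitting_edges E v = {}" "\<exists>x\<in>carrier (fst \<pi>). snd \<pi> (p v) x \<noteq> \<zero>\<^bsub>fst \<pi>\<^esub>"
    using R.good_vertex_exists[OF _ good] \<pi> by (auto simp: irreps_def)
  define V where "V = {d \<in> spectrum A. p v \<notin> class_kernel A d}"
  \<comment> \<open>The closed ideal generated by \<open>p v\<close>. A kernel contains it exactly
    when it contains \<open>p v\<close>, so \<open>V\<close> is the inverse image of a basic open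
    set.\<close>
  define J where "J = \<Inter>{I. closed_ideal A I \<and> p v \<in> I}"
  have J: "closed_ideal A J"
    unfolding J_def using closed_ideal_carrier[OF A.cstar_algebra_axioms] v
    by (intro closed_ideal_Inter[OF A.cstar_algebra_axioms]) auto
  have in_J: "J \<subseteq> rep_kernel A \<rho> \<longleftrightarrow> p v \<in> rep_kernel A \<rho>" if "\<rho> \<in> irreps A" for \<rho>
    using rep_kernel_closed_ideal[OF A.cstar_algebra_axioms that] unfolding J_def by blast
  have "V = class_kernel A -` {P \<in> primitive_ideals A. \<not> J \<subseteq> P} \<inter> spectrum A"
  proof (intro equalityI subsetI)
    fix d assume d: "d \<in> V"
    then obtain \<rho> where "\<rho> \<in> irreps A" "class_kernel A d = rep_kernel A \<rho>"
      using spectrum_class(1)[of d A] unfolding V_def by blast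
    then show "d \<in> class_kernel A -` {P \<in> primitive_ideals A. \<not> J \<subseteq> P} \<inter> spectrum A"
      using d in_J by (auto simp: V_def primitive_ideals_def)
  next
    fix d assume d: "d \<in> class_kernel A -` {P \<in> primitive_ideals A. \<not> J \<subseteq> P} \<inter> spectrum A"
    then obtain \<rho> where "\<rho> \<in> irreps A" "class_kernel A d = rep_kernel A \<rho>"
      using spectrum_class(1)[of d A] by blast
    then show "d \<in> V" using d in_J by (auto simp: V_def)
  qed
  moreover have "openin (hull_kernel_topology A) {P \<in> primitive_ideals A. \<not> J \<subseteq> P}"
    unfolding hull_kernel_topology_def using J by (intro topology_generated_by_Basis) blast
  ultimately have "openin (spectrum_topology A) V"
    unfolding spectrum_topology_def openin_pullback_topology by blast
  moreover have "c \<in> V" using \<open>c \<in> spectrum A\<close> ker v by (auto simp: V_def rep_kernel_def)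
  moreover have "rank_one_projection (fst \<sigma>) (snd \<sigma> (p v))" if "d \<in> V" "\<sigma> \<in> d" for d \<sigma>
  proof -
    have \<sigma>: "\<sigma> \<in> irreps A" "rep_kernel A \<sigma> = class_kernel A d"
      using that spectrum_class(2)[of d A \<sigma>] unfolding V_def by simp_all
    interpret S: graph_algebra_rep E A p s "fst \<sigma>" "snd \<sigma>" by (rule irrep_interpretation[OF \<sigma>(1)])
    have "p v \<notin> rep_kernel A \<sigma>" using that \<sigma> by (simp add: V_def)
    then show ?thesis
      using \<sigma>(1) v by (intro S.rank_one_vertex) (auto simp: irreps_def rep_kernel_def)
  qed
  moreover have "positive A (p v)"
    unfolding positive_def using v by (intro bexI[of _ "p v"]) (simp_all add: p_idem)
  ultimately show "\<exists>a\<in>carrier A. \<exists>V\<subseteq>spectrum A. positive A a \<and>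
      (\<exists>U. openin (spectrum_topology A) U \<and> c \<in> U \<and> U \<subseteq> V) \<and>
      (\<forall>d\<in>V. \<forall>\<sigma>\<in>d. rank_one_projection (fst \<sigma>) (snd \<sigma> a))"
    using v by (intro bexI[of _ "p v"] exI[of _ V] conjI) (auto simp: V_def)
qed

end

section \<open>The C*-algebra of adjointable operators\<close>

definition is_adjoint :: "'h hilbert \<Rightarrow> ('h \<Rightarrow> 'h) \<Rightarrow> ('h \<Rightarrow> 'h) \<Rightarrow> bool" where
  "is_adjoint H T T' \<longleftrightarrow> (\<forall>x\<in>carrier H. \<forall>y\<in>carrier H. hinner H (T x) y = hinner H x (T' y))"

text \<open>
  Every bounded operator has an adjoint; requiring one spares us the Riesz representation theorem.
\<close>

definition adjointable_operators :: "'h hilbert \<Rightarrow> ('h \<Rightarrow> 'h) set" where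
  "adjointable_operators H = {T \<in> extensional (carrier H). bounded_operator H T \<and>
     (\<exists>T'\<in>extensional (carrier H). bounded_operator H T' \<and> is_adjoint H T T')}"

text \<open>The restriction to extensional functions makes the adjoint unique, so the choice is
  determined; see \<open>adjointableI\<close>.\<close>

definition operator_adjoint :: "'h hilbert \<Rightarrow> ('h \<Rightarrow> 'h) \<Rightarrow> 'h \<Rightarrow> 'h" where
  "operator_adjoint H T = (SOME T'. T' \<in> extensional (carrier H) \<and> bounded_operator H T' \<and> is_adjoint H T T')"

text \<open>Demanding \<open>0 \<le> K\<close> keeps the set bounded below even on the zero space,
  where every real number would be a bound.\<close>

definition operator_norm :: "'h hilbert \<Rightarrow> ('h \<Rightarrow> 'h) \<Rightarrow> real" where
  "operator_norm H T = Inf {K. 0 \<le> K \<and> (\<forall>x\<in>carrier H. hnorm H (T x) \<le> K * hnorm H x)}"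

definition operator_algebra :: "'h hilbert \<Rightarrow> ('h \<Rightarrow> 'h) cstar" where
  "operator_algebra H = \<lparr>
     carrier = adjointable_operators H,
     mult = (\<lambda>S T. \<lambda>x\<in>carrier H. S (T x)),
     one = (\<lambda>x\<in>carrier H. x),
     zero = (\<lambda>x\<in>carrier H. \<zero>\<^bsub>H\<^esub>),
     add = (\<lambda>S T. \<lambda>x\<in>carrier H. S x \<oplus>\<^bsub>H\<^esub> T x),
     smult = (\<lambda>c T. \<lambda>x\<in>carrier H. c \<odot>\<^bsub>H\<^esub> T x),
     star = operator_adjoint H,
     cnorm = operator_norm H\<rparr>"

lemma operator_algebra_simps [simp]:
  "carrier (operator_algebra H) = adjointable_operators H"
  "mult (operator_algebra H) S T = (\<lambda>x\<in>carrier H. S (T x))"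
  "zero (operator_algebra H) = (\<lambda>x\<in>carrier H. \<zero>\<^bsub>H\<^esub>)"
  "add (operator_algebra H) S T = (\<lambda>x\<in>carrier H. S x \<oplus>\<^bsub>H\<^esub> T x)"
  "smult (operator_algebra H) c T = (\<lambda>x\<in>carrier H. c \<odot>\<^bsub>H\<^esub> T x)"
  "star (operator_algebra H) T = operator_adjoint H T"
  "cnorm (operator_algebra H) T = operator_norm H T"
  by (simp_all add: operator_algebra_def)

context hilbert_space
begin

lemma hinner_tendsto:
  assumes f: "\<And>n. f n \<in> carrier H" and l: "l \<in> carrier H" and y: "y \<in> carrier H"
    and lim: "(\<lambda>n. hnorm H (f n \<ominus> l)) \<longlonglongrightarrow> 0"
  shows "(\<lambda>n. hinner H (f n) y) \<longlonglongrightarrow> hinner H l y"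
proof -
  have "(\<lambda>n. hinner H (f n) y - hinner H l y) \<longlonglongrightarrow> 0"
  proof (rule Lim_null_comparison)
    show "\<forall>\<^sub>F n in sequentially. norm (hinner H (f n) y - hinner H l y) \<le> hnorm H (f n \<ominus> l) * hnorm H y"
      using Cauchy_Schwarz[of "f _ \<ominus> l" y] f l y by (auto simp: hinner_minus_left)
    show "(\<lambda>n. hnorm H (f n \<ominus> l) * hnorm H y) \<longlonglongrightarrow> 0"
      using tendsto_mult_right[OF lim, of "hnorm H y"] by simp
  qed
  then show ?thesis by (simp add: LIM_zero_iff)
qed

lemma adjointable_boundedE:
  assumes "T \<in> adjointable_operators H"
  obtains K where "0 \<le> K" "\<And>x. x \<in> carrier H \<Longrightarrow> hnorm H (T x) \<le> K * hnorm H x"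
proof -
  obtain K where K: "\<And>x. x \<in> carrier H \<Longrightarrow> hnorm H (T x) \<le> K * hnorm H x"
    using assms by (auto simp: adjointable_operators_def bounded_operator_def)
  have "hnorm H (T x) \<le> max K 0 * hnorm H x" if "x \<in> carrier H" for x
    using K[OF that] that by (meson hnorm_nonneg max.cobounded1 mult_right_mono order_trans)
  then show ?thesis using that[of "max K 0"] by simp
qed

lemma adjointable_imp_linear_on: "T \<in> adjointable_operators H \<Longrightarrow> linear_on H H T"
  by (simp add: adjointable_operators_def bounded_operator_def)

lemma adjointable_closed [simp]: "T \<in> adjointable_operators H \<Longrightarrow> x \<in> carrier H \<Longrightarrow> T x \<in> carrier H"
  using adjointable_imp_linear_on[of T] by (auto simp: linear_on_def)

lemma adjointable_linear:
  "T \<in> adjointable_operators H \<Longrightarrow> x \<in> carrier H \<Longrightarrow> y \<in> carrier H \<Longrightarrow> T (x \<oplus> y) = T x \<oplus> T y"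
  "T \<in> adjointable_operators H \<Longrightarrow> x \<in> carrier H \<Longrightarrow> T (c \<odot> x) = c \<odot> T x"
  using adjointable_imp_linear_on[of T] unfolding linear_on_def by blast+

lemma adjointable_eqI:
  assumes "S \<in> extensional (carrier H)" "T \<in> extensional (carrier H)"
    "\<And>x. x \<in> carrier H \<Longrightarrow> S x \<in> carrier H" "\<And>x. x \<in> carrier H \<Longrightarrow> T x \<in> carrier H"
    "\<And>x y. x \<in> carrier H \<Longrightarrow> y \<in> carrier H \<Longrightarrow> hinner H x (S y) = hinner H x (T y)"
  shows "S = T"
proof (rule extensionalityI[OF assms(1,2)])
  fix x assume x: "x \<in> carrier H"
  show "S x = T x"
  proof (rule hinner_eqI)
    fix z assume z: "z \<in> carrier H"
    show "hinner H (S x) z = hinner H (T x) z"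
      using assms(5)[OF z x] hinner_cnj[of z "S x"] hinner_cnj[of z "T x"] assms(3,4) x z by simp
  qed (use assms x in auto)
qed

lemma operator_adjoint_props:
  assumes "T \<in> adjointable_operators H"
  shows "operator_adjoint H T \<in> extensional (carrier H)" "bounded_operator H (operator_adjoint H T)"
    "is_adjoint H T (operator_adjoint H T)"
proof -
  have "\<exists>T'. T' \<in> extensional (carrier H) \<and> bounded_operator H T' \<and> is_adjoint H T T'"
    using assms by (auto simp: adjointable_operators_def)
  from someI_ex[OF this]
  show "operator_adjoint H T \<in> extensional (carrier H)" "bounded_operator H (operator_adjoint H T)"
    "is_adjoint H T (operator_adjoint H T)"
    unfolding operator_adjoint_def by auto
qed

lemma is_adjoint_sym:
  assumes "is_adjoint H S T" and "\<And>x. x \<in> carrier H \<Longrightarrow> S x \<in> carrier H" "\<And>x. x \<in> carrier H \<Longrightarrow> T x \<in> carrier H"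
  shows "is_adjoint H T S"
  unfolding is_adjoint_def
proof (intro ballI)
  fix x y assume "x \<in> carrier H" "y \<in> carrier H"
  then show "hinner H (T x) y = hinner H x (S y)"
    using assms hinner_cnj[of y "T x"] hinner_cnj[of "S y" x] unfolding is_adjoint_def by simp
qed

lemma bounded_operator_closed: "bounded_operator H T \<Longrightarrow> x \<in> carrier H \<Longrightarrow> T x \<in> carrier H"
  by (auto simp: bounded_operator_def linear_on_def)

lemma adjointableI:
  assumes "S \<in> extensional (carrier H)" "T \<in> extensional (carrier H)"
    "bounded_operator H S" "bounded_operator H T" "is_adjoint H S T"
  shows "S \<in> adjointable_operators H" and "operator_adjoint H S = T"
proof -
  show S: "S \<in> adjointable_operators H" using assms by (auto simp: adjointable_operators_def)
  note adj = operator_adjoint_props[OF S]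
  show "operator_adjoint H S = T"
  proof (rule adjointable_eqI[OF adj(1) assms(2)])
    fix x y assume "x \<in> carrier H" "y \<in> carrier H"
    then show "hinner H x (operator_adjoint H S y) = hinner H x (T y)"
      using adj(3) assms(5) unfolding is_adjoint_def by metis
  qed (use adj assms bounded_operator_closed in auto)
qed

lemma operator_adjoint_adjointable [simp]:
  assumes "T \<in> adjointable_operators H"
  shows "operator_adjoint H T \<in> adjointable_operators H"
    and "operator_adjoint H (operator_adjoint H T) = T"
proof -
  note adj = operator_adjoint_props[OF assms]
  have T: "T \<in> extensional (carrier H)" "bounded_operator H T"
    using assms by (auto simp: adjointable_operators_def)
  have sym: "is_adjoint H (operator_adjoint H T) T"
    using is_adjoint_sym[OF adj(3)] bounded_operator_closed T(2) adj(2) by blast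
  show "operator_adjoint H T \<in> adjointable_operators H"
    "operator_adjoint H (operator_adjoint H T) = T"
    using adjointableI[OF adj(1) T(1) adj(2) T(2) sym] by simp_all
qed

lemma operator_adjoint_eq:
  "T \<in> adjointable_operators H \<Longrightarrow> x \<in> carrier H \<Longrightarrow> y \<in> carrier H \<Longrightarrow>
   hinner H (T x) y = hinner H x (operator_adjoint H T y)"
  using operator_adjoint_props(3) by (auto simp: is_adjoint_def)

lemma operator_adjoint_eq':
  "T \<in> adjointable_operators H \<Longrightarrow> x \<in> carrier H \<Longrightarrow> y \<in> carrier H \<Longrightarrow>
   hinner H (operator_adjoint H T x) y = hinner H x (T y)"
  using operator_adjoint_eq[of "operator_adjoint H T" x y] by simp

lemma linear_onI:
  assumes "\<And>x. x \<in> carrier H \<Longrightarrow> T x \<in> carrier H"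
    "\<And>x y. x \<in> carrier H \<Longrightarrow> y \<in> carrier H \<Longrightarrow> T (x \<oplus> y) = T x \<oplus> T y"
    "\<And>c x. x \<in> carrier H \<Longrightarrow> T (c \<odot> x) = c \<odot> T x"
  shows "linear_on H H T"
  using assms by (auto simp: linear_on_def)

lemma adjointable_comp:
  assumes S: "S \<in> adjointable_operators H" and T: "T \<in> adjointable_operators H"
  shows "(\<lambda>x\<in>carrier H. S (T x)) \<in> adjointable_operators H"
    and "operator_adjoint H (\<lambda>x\<in>carrier H. S (T x))
      = (\<lambda>x\<in>carrier H. operator_adjoint H T (operator_adjoint H S x))"
proof -
  have bdd: "bounded_operator H (\<lambda>x\<in>carrier H. S (T x))"
    if S: "S \<in> adjointable_operators H" and T: "T \<in> adjointable_operators H" for S T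
  proof -
    obtain K where K: "0 \<le> K" "\<And>x. x \<in> carrier H \<Longrightarrow> hnorm H (S x) \<le> K * hnorm H x"
      using S by (rule adjointable_boundedE) blast
    obtain L where L: "0 \<le> L" "\<And>x. x \<in> carrier H \<Longrightarrow> hnorm H (T x) \<le> L * hnorm H x"
      using T by (rule adjointable_boundedE) blast
    have "hnorm H (S (T x)) \<le> (K * L) * hnorm H x" if x: "x \<in> carrier H" for x
      using K(2)[of "T x"] mult_left_mono[OF L(2)[OF x] K(1)] x T by (simp add: mult.assoc)
    then show ?thesis unfolding bounded_operator_def using S T
      by (intro conjI linear_onI exI[of _ "K * L"]) (auto simp: adjointable_linear)
  qed
  note * = adjointableI[of "\<lambda>x\<in>carrier H. S (T x)" "\<lambda>x\<in>carrier H. operator_adjoint H T (operator_adjoint H S x)"]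
  have "is_adjoint H (\<lambda>x\<in>carrier H. S (T x)) (\<lambda>x\<in>carrier H. operator_adjoint H T (operator_adjoint H S x))"
    using S T by (simp add: is_adjoint_def operator_adjoint_eq)
  then show "(\<lambda>x\<in>carrier H. S (T x)) \<in> adjointable_operators H"
    "operator_adjoint H (\<lambda>x\<in>carrier H. S (T x)) = (\<lambda>x\<in>carrier H. operator_adjoint H T (operator_adjoint H S x))"
    using * bdd S T by auto
qed

lemma adjointable_add:
  assumes S: "S \<in> adjointable_operators H" and T: "T \<in> adjointable_operators H"
  shows "(\<lambda>x\<in>carrier H. S x \<oplus> T x) \<in> adjointable_operators H"
    and "operator_adjoint H (\<lambda>x\<in>carrier H. S x \<oplus> T x)
      = (\<lambda>x\<in>carrier H. operator_adjoint H S x \<oplus> operator_adjoint H T x)"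
proof -
  have bdd: "bounded_operator H (\<lambda>x\<in>carrier H. S x \<oplus> T x)"
    if S: "S \<in> adjointable_operators H" and T: "T \<in> adjointable_operators H" for S T
  proof -
    obtain K where K: "0 \<le> K" "\<And>x. x \<in> carrier H \<Longrightarrow> hnorm H (S x) \<le> K * hnorm H x"
      using S by (rule adjointable_boundedE) blast
    obtain L where L: "0 \<le> L" "\<And>x. x \<in> carrier H \<Longrightarrow> hnorm H (T x) \<le> L * hnorm H x"
      using T by (rule adjointable_boundedE) blast
    have "hnorm H (S x \<oplus> T x) \<le> (K + L) * hnorm H x" if x: "x \<in> carrier H" for x
      using hnorm_add[of "S x" "T x"] K(2)[OF x] L(2)[OF x] x S T by (simp add: algebra_simps)
    then show ?thesis unfolding bounded_operator_def using S T
      by (intro conjI linear_onI exI[of _ "K + L"]) (auto simp: adjointable_linear smul_add_right M.a_ac)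
  qed
  have "is_adjoint H (\<lambda>x\<in>carrier H. S x \<oplus> T x) (\<lambda>x\<in>carrier H. operator_adjoint H S x \<oplus> operator_adjoint H T x)"
    using S T by (simp add: is_adjoint_def operator_adjoint_eq hinner_add hinner_add_right)
  then show "(\<lambda>x\<in>carrier H. S x \<oplus> T x) \<in> adjointable_operators H"
    "operator_adjoint H (\<lambda>x\<in>carrier H. S x \<oplus> T x) = (\<lambda>x\<in>carrier H. operator_adjoint H S x \<oplus> operator_adjoint H T x)"
    using adjointableI[of "\<lambda>x\<in>carrier H. S x \<oplus> T x" "\<lambda>x\<in>carrier H. operator_adjoint H S x \<oplus> operator_adjoint H T x"]
      bdd S T by auto
qed

lemma adjointable_smul:
  assumes T: "T \<in> adjointable_operators H"
  shows "(\<lambda>x\<in>carrier H. c \<odot> T x) \<in> adjointable_operators H"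
    and "operator_adjoint H (\<lambda>x\<in>carrier H. c \<odot> T x) = (\<lambda>x\<in>carrier H. cnj c \<odot> operator_adjoint H T x)"
proof -
  have bdd: "bounded_operator H (\<lambda>x\<in>carrier H. c \<odot> T x)"
    if T: "T \<in> adjointable_operators H" for c T
  proof -
    obtain L where L: "0 \<le> L" "\<And>x. x \<in> carrier H \<Longrightarrow> hnorm H (T x) \<le> L * hnorm H x"
      using T by (rule adjointable_boundedE) blast
    have "hnorm H (c \<odot> T x) \<le> (cmod c * L) * hnorm H x" if x: "x \<in> carrier H" for x
      using mult_left_mono[OF L(2)[OF x], of "cmod c"] x T by (simp add: hnorm_smul mult.assoc)
    then show ?thesis unfolding bounded_operator_def using T
      by (intro conjI linear_onI exI[of _ "cmod c * L"])
         (auto simp: adjointable_linear smul_add_right smul_smul mult.commute)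
  qed
  have "is_adjoint H (\<lambda>x\<in>carrier H. c \<odot> T x) (\<lambda>x\<in>carrier H. cnj c \<odot> operator_adjoint H T x)"
    using T by (simp add: is_adjoint_def operator_adjoint_eq hinner_smult hinner_smult_right)
  then show "(\<lambda>x\<in>carrier H. c \<odot> T x) \<in> adjointable_operators H"
    "operator_adjoint H (\<lambda>x\<in>carrier H. c \<odot> T x) = (\<lambda>x\<in>carrier H. cnj c \<odot> operator_adjoint H T x)"
    using adjointableI[of "\<lambda>x\<in>carrier H. c \<odot> T x" "\<lambda>x\<in>carrier H. cnj c \<odot> operator_adjoint H T x"]
      bdd T by auto
qed

lemma adjointable_zero: "(\<lambda>x\<in>carrier H. \<zero>) \<in> adjointable_operators H"
proof -
  have "bounded_operator H (\<lambda>x\<in>carrier H. \<zero>)"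
    unfolding bounded_operator_def by (intro conjI linear_onI exI[of _ 0]) auto
  moreover have "is_adjoint H (\<lambda>x\<in>carrier H. \<zero>) (\<lambda>x\<in>carrier H. \<zero>)" by (simp add: is_adjoint_def)
  ultimately show ?thesis by (intro adjointableI) auto
qed

lemma operator_norm_bound:
  assumes T: "T \<in> adjointable_operators H" and x: "x \<in> carrier H"
  shows "hnorm H (T x) \<le> operator_norm H T * hnorm H x"
proof (cases "hnorm H x = 0")
  case True
  then have "x = \<zero>" using x hnorm_eq_0 by simp
  then have "T x = \<zero>" using adjointable_linear(2)[OF T, of \<zero> 0] T by simp
  then show ?thesis using True by simp
next
  case False
  then have pos: "hnorm H x > 0" using hnorm_nonneg[OF x] by linarith
  obtain K0 where K0: "0 \<le> K0" "\<And>x. x \<in> carrier H \<Longrightarrow> hnorm H (T x) \<le> K0 * hnorm H x"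
    using T by (rule adjointable_boundedE) blast
  have "hnorm H (T x) / hnorm H x \<le> operator_norm H T"
    unfolding operator_norm_def
  proof (rule cInf_greatest)
    show "{K. 0 \<le> K \<and> (\<forall>x\<in>carrier H. hnorm H (T x) \<le> K * hnorm H x)} \<noteq> {}" using K0 by blast
  qed (use x pos in \<open>auto simp: pos_divide_le_eq\<close>)
  then show ?thesis using pos by (simp add: pos_divide_le_eq)
qed

lemma operator_norm_le:
  assumes "0 \<le> K" "\<And>x. x \<in> carrier H \<Longrightarrow> hnorm H (T x) \<le> K * hnorm H x"
  shows "operator_norm H T \<le> K"
  unfolding operator_norm_def by (rule cInf_lower) (use assms in \<open>auto intro: bdd_belowI[of _ 0]\<close>)

lemma operator_norm_nonneg:
  assumes "T \<in> adjointable_operators H" shows "0 \<le> operator_norm H T"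
proof -
  obtain K0 where K0: "0 \<le> K0" "\<And>x. x \<in> carrier H \<Longrightarrow> hnorm H (T x) \<le> K0 * hnorm H x"
    using assms by (rule adjointable_boundedE) blast
  show ?thesis unfolding operator_norm_def by (rule cInf_greatest) (use K0 in auto)
qed

text \<open>For \<open>y = T* x\<close>, Cauchy-Schwarz applied to
  \<open>\<langle>x, T y\<rangle>\<close> bounds the square of the norm of \<open>y\<close>, and one
  factor cancels.\<close>

lemma operator_norm_adjoint_le:
  assumes T: "T \<in> adjointable_operators H"
  shows "operator_norm H (operator_adjoint H T) \<le> operator_norm H T"
proof (rule operator_norm_le[OF operator_norm_nonneg[OF T]])
  fix x assume x: "x \<in> carrier H"
  let ?y = "operator_adjoint H T x"
  have y: "?y \<in> carrier H" using T x by simp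
  show "hnorm H ?y \<le> operator_norm H T * hnorm H x"
  proof (cases "hnorm H ?y = 0")
    case True
    then show ?thesis using operator_norm_nonneg[OF T] x by simp
  next
    case False
    have "hnorm H ?y * hnorm H ?y = Re (hinner H ?y ?y)" using hnorm_sq[OF y] by (simp add: power2_eq_square)
    also have "hinner H ?y ?y = hinner H x (T ?y)" using T x y by (simp add: operator_adjoint_eq')
    also have "Re \<dots> \<le> hnorm H x * hnorm H (T ?y)"
      using Cauchy_Schwarz[of x "T ?y"] complex_Re_le_cmod[of "hinner H x (T ?y)"] T x y by simp
    also have "\<dots> \<le> hnorm H x * (operator_norm H T * hnorm H ?y)"
      using operator_norm_bound[OF T y] x by (intro mult_left_mono) auto
    finally have "hnorm H ?y * hnorm H ?y \<le> (operator_norm H T * hnorm H x) * hnorm H ?y"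
      by (simp add: mult_ac)
    moreover have "hnorm H ?y > 0" using False hnorm_nonneg[OF y] by linarith
    ultimately show ?thesis by (simp only: mult_le_cancel_right_pos)
  qed
qed

lemma module_operator_algebra: "Module.module complex_ring (operator_algebra H)"
proof (rule complex_vector_spaceI)
  have eq: "S = T" if "S \<in> extensional (carrier H)" "T \<in> extensional (carrier H)"
    "\<And>x. x \<in> carrier H \<Longrightarrow> S x = T x" for S T :: "'h \<Rightarrow> 'h"
    using extensionalityI that by blast
  have ext: "T \<in> extensional (carrier H)" if "T \<in> adjointable_operators H" for T
    using that by (simp add: adjointable_operators_def)
  fix S T U c d
  assume S: "S \<in> carrier (operator_algebra H)"
  then have S': "S \<in> adjointable_operators H" by simp
  show "c \<odot>\<^bsub>operator_algebra H\<^esub> S \<in> carrier (operator_algebra H)"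
    using S' adjointable_smul by simp
  show "\<zero>\<^bsub>operator_algebra H\<^esub> \<oplus>\<^bsub>operator_algebra H\<^esub> S = S"
    by (rule eq) (use S' ext in auto)
  show "- 1 \<odot>\<^bsub>operator_algebra H\<^esub> S \<oplus>\<^bsub>operator_algebra H\<^esub> S = \<zero>\<^bsub>operator_algebra H\<^esub>"
  proof (rule eq)
    fix x assume x: "x \<in> carrier H"
    have "(-1) \<odot> S x \<oplus> S x = (-1 + 1) \<odot> S x" using smul_add_left[of "S x" "-1" 1] S' x by simp
    then show "(- 1 \<odot>\<^bsub>operator_algebra H\<^esub> S \<oplus>\<^bsub>operator_algebra H\<^esub> S) x = \<zero>\<^bsub>operator_algebra H\<^esub> x"
      using x S' by simp
  qed (use S' ext in auto)
  show "(c + d) \<odot>\<^bsub>operator_algebra H\<^esub> S = c \<odot>\<^bsub>operator_algebra H\<^esub> S \<oplus>\<^bsub>operator_algebra H\<^esub> d \<odot>\<^bsub>operator_algebra H\<^esub> S"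
    by (rule eq) (use S' ext in \<open>auto simp: smul_add_left\<close>)
  show "(c * d) \<odot>\<^bsub>operator_algebra H\<^esub> S = c \<odot>\<^bsub>operator_algebra H\<^esub> (d \<odot>\<^bsub>operator_algebra H\<^esub> S)"
    by (rule eq) (use S' ext in \<open>auto simp: smul_smul\<close>)
  show "1 \<odot>\<^bsub>operator_algebra H\<^esub> S = S"
    by (rule eq) (use S' ext in auto)
  assume T: "T \<in> carrier (operator_algebra H)"
  then have T': "T \<in> adjointable_operators H" by simp
  show "S \<oplus>\<^bsub>operator_algebra H\<^esub> T \<in> carrier (operator_algebra H)"
    using adjointable_add S' T' by simp
  show "S \<oplus>\<^bsub>operator_algebra H\<^esub> T = T \<oplus>\<^bsub>operator_algebra H\<^esub> S"
    by (rule eq) (use S' T' in \<open>auto simp: M.a_comm\<close>)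
  show "c \<odot>\<^bsub>operator_algebra H\<^esub> (S \<oplus>\<^bsub>operator_algebra H\<^esub> T)
      = c \<odot>\<^bsub>operator_algebra H\<^esub> S \<oplus>\<^bsub>operator_algebra H\<^esub> c \<odot>\<^bsub>operator_algebra H\<^esub> T"
    by (rule eq) (use S' T' in \<open>auto simp: smul_add_right\<close>)
  assume U: "U \<in> carrier (operator_algebra H)"
  then have U': "U \<in> adjointable_operators H" by simp
  show "S \<oplus>\<^bsub>operator_algebra H\<^esub> T \<oplus>\<^bsub>operator_algebra H\<^esub> U = S \<oplus>\<^bsub>operator_algebra H\<^esub> (T \<oplus>\<^bsub>operator_algebra H\<^esub> U)"
    by (rule eq) (use S' T' U' in \<open>auto simp: M.a_assoc\<close>)
next
  show "\<zero>\<^bsub>operator_algebra H\<^esub> \<in> carrier (operator_algebra H)" using adjointable_zero by simp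
qed

lemma operator_algebra_minus:
  assumes "S \<in> adjointable_operators H" "T \<in> adjointable_operators H" "x \<in> carrier H"
  shows "(S \<ominus>\<^bsub>operator_algebra H\<^esub> T) x = S x \<ominus> T x"
proof -
  interpret B: complex_vector_space "operator_algebra H"
    by (intro complex_vector_space.intro module_operator_algebra)
  have "S \<ominus>\<^bsub>operator_algebra H\<^esub> T = S \<oplus>\<^bsub>operator_algebra H\<^esub> (-1) \<odot>\<^bsub>operator_algebra H\<^esub> T"
    using assms B.minus_eq_smul by simp
  then show ?thesis using assms by (simp add: minus_eq_smul)
qed

lemma operator_minus_adjointable:
  assumes "S \<in> adjointable_operators H" "T \<in> adjointable_operators H"
  shows "S \<ominus>\<^bsub>operator_algebra H\<^esub> T \<in> adjointable_operators H"
proof -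
  interpret B: complex_vector_space "operator_algebra H"
    by (intro complex_vector_space.intro module_operator_algebra)
  show ?thesis using B.minus_closed[of S T] assms by simp
qed

lemma operator_sequence_pointwise:
  assumes T: "\<And>n. T n \<in> adjointable_operators H"
    and cau: "\<forall>\<epsilon>>0. \<exists>N. \<forall>m\<ge>N. \<forall>n\<ge>N. operator_norm H (T m \<ominus>\<^bsub>operator_algebra H\<^esub> T n) < \<epsilon>"
  shows "\<exists>L\<in>extensional (carrier H). \<forall>x\<in>carrier H. L x \<in> carrier H \<and> (\<lambda>n. hnorm H (T n x \<ominus> L x)) \<longlonglongrightarrow> 0"
proof -
  have "\<exists>l\<in>carrier H. (\<lambda>n. hnorm H (T n x \<ominus> l)) \<longlonglongrightarrow> 0" if x: "x \<in> carrier H" for x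
  proof -
    have "\<exists>N. \<forall>m\<ge>N. \<forall>n\<ge>N. hnorm H (T m x \<ominus> T n x) < \<epsilon>" if e: "\<epsilon> > 0" for \<epsilon>
    proof -
      have pos: "hnorm H x + 1 > 0" using hnorm_nonneg[OF x] by linarith
      obtain N where N: "\<And>m n. m \<ge> N \<Longrightarrow> n \<ge> N \<Longrightarrow> operator_norm H (T m \<ominus>\<^bsub>operator_algebra H\<^esub> T n) < \<epsilon> / (hnorm H x + 1)"
        using cau divide_pos_pos[OF e pos] by blast
      have "hnorm H (T m x \<ominus> T n x) < \<epsilon>" if "m \<ge> N" "n \<ge> N" for m n
      proof -
        let ?D = "T m \<ominus>\<^bsub>operator_algebra H\<^esub> T n"
        have D: "?D \<in> adjointable_operators H" using T operator_minus_adjointable by blast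
        have "hnorm H (T m x \<ominus> T n x) \<le> operator_norm H ?D * hnorm H x"
          using operator_norm_bound[OF D x] operator_algebra_minus[OF T T x] by simp
        also have "\<dots> \<le> operator_norm H ?D * (hnorm H x + 1)"
          using operator_norm_nonneg[OF D] by (intro mult_left_mono) auto
        also have "\<dots> < \<epsilon>" using N[OF that] pos by (simp add: pos_less_divide_eq)
        finally show ?thesis .
      qed
      then show ?thesis by blast
    qed
    then show ?thesis
      using hnorm_complete T x unfolding complete_wrt_def by (auto dest!: spec[of _ "\<lambda>n. T n x"])
  qed
  then obtain L where L: "\<And>x. x \<in> carrier H \<Longrightarrow> L x \<in> carrier H \<and> (\<lambda>n. hnorm H (T n x \<ominus> L x)) \<longlonglongrightarrow> 0"
    by metis
  then show ?thesis by (intro bexI[of _ "restrict L (carrier H)"]) auto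
qed

text \<open>Makes the adjoints of a Cauchy sequence a Cauchy sequence, whose limit will be the
  adjoint of the limit.\<close>

lemma operator_adjoint_minus_norm:
  assumes "S \<in> adjointable_operators H" "T \<in> adjointable_operators H"
  shows "operator_norm H (operator_adjoint H S \<ominus>\<^bsub>operator_algebra H\<^esub> operator_adjoint H T)
    \<le> operator_norm H (S \<ominus>\<^bsub>operator_algebra H\<^esub> T)"
proof -
  let ?D = "S \<ominus>\<^bsub>operator_algebra H\<^esub> T"
  let ?D' = "operator_adjoint H S \<ominus>\<^bsub>operator_algebra H\<^esub> operator_adjoint H T"
  have D: "?D \<in> adjointable_operators H" "?D' \<in> adjointable_operators H"
    using assms operator_minus_adjointable by simp_all
  have "operator_adjoint H ?D = ?D'"
  proof (rule adjointable_eqI)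
    fix x y assume xy: "x \<in> carrier H" "y \<in> carrier H"
    have "hinner H x (operator_adjoint H ?D y) = hinner H (?D x) y"
      using D xy by (simp add: operator_adjoint_eq)
    also have "\<dots> = hinner H x (?D' y)"
      using xy assms by (simp add: operator_algebra_minus hinner_minus_left hinner_minus_right operator_adjoint_eq)
    finally show "hinner H x (operator_adjoint H ?D y) = hinner H x (?D' y)" .
  qed (use D operator_adjoint_adjointable(1)[OF D(1)] in \<open>auto simp: adjointable_operators_def bounded_operator_closed\<close>)
  then show ?thesis using operator_norm_adjoint_le[OF D(1)] by simp
qed

lemma complete_operator_algebra: "complete_wrt (operator_algebra H) (operator_norm H)"
  unfolding complete_wrt_def
proof (intro allI impI, elim conjE)
  fix T :: "nat \<Rightarrow> 'h \<Rightarrow> 'h"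
  assume "range T \<subseteq> carrier (operator_algebra H)"
    and cau: "\<forall>\<epsilon>>0. \<exists>N. \<forall>m\<ge>N. \<forall>n\<ge>N. operator_norm H (T m \<ominus>\<^bsub>operator_algebra H\<^esub> T n) < \<epsilon>"
  then have T: "T n \<in> adjointable_operators H" for n by auto
  define T' where "T' n = operator_adjoint H (T n)" for n
  have T': "T' n \<in> adjointable_operators H" for n using T by (simp add: T'_def)
  have cau': "\<forall>\<epsilon>>0. \<exists>N. \<forall>m\<ge>N. \<forall>n\<ge>N. operator_norm H (T' m \<ominus>\<^bsub>operator_algebra H\<^esub> T' n) < \<epsilon>"
    using cau operator_adjoint_minus_norm[OF T T] unfolding T'_def by (meson order_le_less_trans)
  obtain L where L: "L \<in> extensional (carrier H)" "\<And>x. x \<in> carrier H \<Longrightarrow> L x \<in> carrier H"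
      "\<And>x. x \<in> carrier H \<Longrightarrow> (\<lambda>n. hnorm H (T n x \<ominus> L x)) \<longlonglongrightarrow> 0"
    using operator_sequence_pointwise[OF T cau] by blast
  obtain L' where L': "L' \<in> extensional (carrier H)" "\<And>x. x \<in> carrier H \<Longrightarrow> L' x \<in> carrier H"
      "\<And>x. x \<in> carrier H \<Longrightarrow> (\<lambda>n. hnorm H (T' n x \<ominus> L' x)) \<longlonglongrightarrow> 0"
    using operator_sequence_pointwise[OF T' cau'] by blast
  \<comment> \<open>Tested weakly against every \<open>z\<close>, where the limits are those of
    complex sequences.\<close>
  have linear: "linear_on H H L"
    if T: "\<And>n. T n \<in> adjointable_operators H" and Lc: "\<And>x. x \<in> carrier H \<Longrightarrow> L x \<in> carrier H"
      and lim: "\<And>x. x \<in> carrier H \<Longrightarrow> (\<lambda>n. hnorm H (T n x \<ominus> L x)) \<longlonglongrightarrow> 0" for T L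
  proof (rule linear_onI[OF Lc])
    have hlim: "(\<lambda>n. hinner H (T n x) z) \<longlonglongrightarrow> hinner H (L x) z" if "x \<in> carrier H" "z \<in> carrier H" for x z
      using that T Lc by (intro hinner_tendsto lim) auto
    fix x y c assume x: "x \<in> carrier H"
    show "L (c \<odot> x) = c \<odot> L x"
    proof (rule hinner_eqI)
      fix z assume z: "z \<in> carrier H"
      have "(\<lambda>n. hinner H (T n (c \<odot> x)) z) \<longlonglongrightarrow> c * hinner H (L x) z"
        using tendsto_mult_left[OF hlim[OF x z], of c] T x z by (simp add: adjointable_linear hinner_smult)
      then show "hinner H (L (c \<odot> x)) z = hinner H (c \<odot> L x) z"
        using LIMSEQ_unique[OF hlim[of "c \<odot> x" z]] x z Lc by (simp add: hinner_smult)
    qed (use x Lc in auto)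
    assume y: "y \<in> carrier H"
    show "L (x \<oplus> y) = L x \<oplus> L y"
    proof (rule hinner_eqI)
      fix z assume z: "z \<in> carrier H"
      have "(\<lambda>n. hinner H (T n (x \<oplus> y)) z) \<longlonglongrightarrow> hinner H (L x) z + hinner H (L y) z"
        using tendsto_add[OF hlim[OF x z] hlim[OF y z]] T x y z by (simp add: adjointable_linear hinner_add)
      then show "hinner H (L (x \<oplus> y)) z = hinner H (L x \<oplus> L y) z"
        using LIMSEQ_unique[OF hlim[of "x \<oplus> y" z]] x y z Lc by (simp add: hinner_add)
    qed (use x y Lc in auto)
  qed
  \<comment> \<open>Upgrades pointwise to uniform convergence: keep \<open>n\<close> fixed and let
    \<open>m\<close> tend to infinity in the Cauchy estimate.\<close>
  have close: "\<exists>N. \<forall>n\<ge>N. \<forall>x\<in>carrier H. hnorm H (T n x \<ominus> L x) \<le> \<epsilon> * hnorm H x"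
    if e: "\<epsilon> > 0" and T: "\<And>n. T n \<in> adjointable_operators H"
      and cau: "\<forall>\<epsilon>>0. \<exists>N. \<forall>m\<ge>N. \<forall>n\<ge>N. operator_norm H (T m \<ominus>\<^bsub>operator_algebra H\<^esub> T n) < \<epsilon>"
      and Lc: "\<And>x. x \<in> carrier H \<Longrightarrow> L x \<in> carrier H"
      and lim: "\<And>x. x \<in> carrier H \<Longrightarrow> (\<lambda>n. hnorm H (T n x \<ominus> L x)) \<longlonglongrightarrow> 0" for T L and \<epsilon> :: real
  proof -
    obtain N where N: "\<And>m n. m \<ge> N \<Longrightarrow> n \<ge> N \<Longrightarrow> operator_norm H (T m \<ominus>\<^bsub>operator_algebra H\<^esub> T n) < \<epsilon>"
      using cau e by blast
    have "hnorm H (T n x \<ominus> L x) \<le> \<epsilon> * hnorm H x" if n: "n \<ge> N" and x: "x \<in> carrier H" for n x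
    proof (rule LIMSEQ_le_const)
      show "(\<lambda>m. \<epsilon> * hnorm H x + hnorm H (T m x \<ominus> L x)) \<longlonglongrightarrow> \<epsilon> * hnorm H x"
        using tendsto_add[OF tendsto_const lim[OF x], of "\<epsilon> * hnorm H x"] by simp
      have "hnorm H (T n x \<ominus> L x) \<le> \<epsilon> * hnorm H x + hnorm H (T m x \<ominus> L x)" if m: "m \<ge> N" for m
      proof -
        let ?D = "T n \<ominus>\<^bsub>operator_algebra H\<^esub> T m"
        have D: "?D \<in> adjointable_operators H" using T operator_minus_adjointable by blast
        have "hnorm H (T n x \<ominus> L x) \<le> hnorm H (T n x \<ominus> T m x) + hnorm H (T m x \<ominus> L x)"
          using T x Lc by (intro nrm_triangle) auto
        also have "hnorm H (T n x \<ominus> T m x) \<le> operator_norm H ?D * hnorm H x"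
          using operator_norm_bound[OF D x] operator_algebra_minus[OF T T x] by simp
        also have "\<dots> \<le> \<epsilon> * hnorm H x" using N[OF n m] x by (intro mult_right_mono) auto
        finally show ?thesis by simp
      qed
      then show "\<exists>N. \<forall>m\<ge>N. hnorm H (T n x \<ominus> L x) \<le> \<epsilon> * hnorm H x + hnorm H (T m x \<ominus> L x)" by blast
    qed
    then show ?thesis by blast
  qed
  have bounded: "bounded_operator H L"
    if T: "\<And>n. T n \<in> adjointable_operators H" and Lc: "\<And>x. x \<in> carrier H \<Longrightarrow> L x \<in> carrier H"
      and lim: "\<And>x. x \<in> carrier H \<Longrightarrow> (\<lambda>n. hnorm H (T n x \<ominus> L x)) \<longlonglongrightarrow> 0"
      and cau: "\<forall>\<epsilon>>0. \<exists>N. \<forall>m\<ge>N. \<forall>n\<ge>N. operator_norm H (T m \<ominus>\<^bsub>operator_algebra H\<^esub> T n) < \<epsilon>" for T L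
  proof -
    obtain n where n: "\<And>x. x \<in> carrier H \<Longrightarrow> hnorm H (T n x \<ominus> L x) \<le> 1 * hnorm H x"
      using close[OF zero_less_one T cau Lc lim] by blast
    have "hnorm H (L x) \<le> (operator_norm H (T n) + 1) * hnorm H x" if x: "x \<in> carrier H" for x
    proof -
      have "hnorm H (L x) \<le> hnorm H (T n x) + hnorm H (L x \<ominus> T n x)"
        using T x Lc by (intro nrm_le_add_minus) auto
      also have "hnorm H (L x \<ominus> T n x) = hnorm H (T n x \<ominus> L x)"
        using T x Lc by (intro nrm_minus_commute) auto
      finally show ?thesis using n[OF x] operator_norm_bound[OF T x, of n] by (simp add: algebra_simps)
    qed
    then show ?thesis unfolding bounded_operator_def using linear[OF T Lc lim] by blast
  qed
  have adj: "is_adjoint H L L'"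
    unfolding is_adjoint_def
  proof (intro ballI)
    fix x y assume x: "x \<in> carrier H" and y: "y \<in> carrier H"
    have 1: "(\<lambda>n. hinner H (T n x) y) \<longlonglongrightarrow> hinner H (L x) y"
      using x y T L by (intro hinner_tendsto) auto
    have "(\<lambda>n. hinner H (T' n y) x) \<longlonglongrightarrow> hinner H (L' y) x"
      using x y T' L' by (intro hinner_tendsto) auto
    then have "(\<lambda>n. cnj (hinner H (T' n y) x)) \<longlonglongrightarrow> cnj (hinner H (L' y) x)"
      by (rule tendsto_cnj)
    moreover have "cnj (hinner H (T' n y) x) = hinner H (T n x) y" for n
      using hinner_cnj[of "T' n y" x] x y T T' by (simp add: operator_adjoint_eq T'_def)
    moreover have "cnj (hinner H (L' y) x) = hinner H x (L' y)"
      using hinner_cnj[of "L' y" x] x y L' by simp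
    ultimately show "hinner H (L x) y = hinner H x (L' y)"
      using LIMSEQ_unique[OF 1] by simp
  qed
  have LA: "L \<in> adjointable_operators H"
    using adjointableI(1)[OF L(1) L'(1) bounded[OF T L(2,3) cau] bounded[OF T' L'(2,3) cau'] adj] .
  have "(\<lambda>n. operator_norm H (T n \<ominus>\<^bsub>operator_algebra H\<^esub> L)) \<longlonglongrightarrow> 0"
  proof (rule LIMSEQ_I)
    fix r :: real assume "r > 0"
    then obtain N where N: "\<And>n x. n \<ge> N \<Longrightarrow> x \<in> carrier H \<Longrightarrow> hnorm H (T n x \<ominus> L x) \<le> r/2 * hnorm H x"
      using close[OF _ T cau L(2,3), of "r/2"] by auto
    have "norm (operator_norm H (T n \<ominus>\<^bsub>operator_algebra H\<^esub> L) - 0) < r" if "n \<ge> N" for n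
    proof -
      have "operator_norm H (T n \<ominus>\<^bsub>operator_algebra H\<^esub> L) \<le> r/2"
        using \<open>r > 0\<close> N[OF that] T LA by (intro operator_norm_le) (auto simp: operator_algebra_minus)
      moreover have "operator_norm H (T n \<ominus>\<^bsub>operator_algebra H\<^esub> L) \<ge> 0"
        using operator_norm_nonneg operator_minus_adjointable[OF T LA] by blast
      ultimately show ?thesis using \<open>r > 0\<close> by simp
    qed
    then show "\<exists>N. \<forall>n\<ge>N. norm (operator_norm H (T n \<ominus>\<^bsub>operator_algebra H\<^esub> L) - 0) < r" by blast
  qed
  then show "\<exists>L\<in>carrier (operator_algebra H). (\<lambda>n. operator_norm H (T n \<ominus>\<^bsub>operator_algebra H\<^esub> L)) \<longlonglongrightarrow> 0"
    using LA by auto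
qed

lemma cstar_operator_algebra: "cstar_algebra (operator_algebra H)"
proof (intro cstar_algebra.intro cstar_algebra_axioms.intro module_operator_algebra)
  have ext: "T \<in> extensional (carrier H)" if "T \<in> adjointable_operators H" for T
    using that by (simp add: adjointable_operators_def)
  have eq: "S = T" if "S \<in> extensional (carrier H)" "T \<in> extensional (carrier H)"
    "\<And>x. x \<in> carrier H \<Longrightarrow> S x = T x" for S T :: "'h \<Rightarrow> 'h"
    using extensionalityI that by blast
  fix S T U c
  assume S: "S \<in> carrier (operator_algebra H)"
  then have S': "S \<in> adjointable_operators H" by simp
  show "star (operator_algebra H) S \<in> carrier (operator_algebra H)" using S' by simp
  show "star (operator_algebra H) (star (operator_algebra H) S) = S" using S' by simp
  show "star (operator_algebra H) (c \<odot>\<^bsub>operator_algebra H\<^esub> S) = cnj c \<odot>\<^bsub>operator_algebra H\<^esub> star (operator_algebra H) S"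
    using S' adjointable_smul by simp
  show "0 \<le> cnorm (operator_algebra H) S" using S' operator_norm_nonneg by simp
  show "cnorm (operator_algebra H) S = 0 \<longleftrightarrow> S = \<zero>\<^bsub>operator_algebra H\<^esub>"
  proof
    assume 0: "cnorm (operator_algebra H) S = 0"
    show "S = \<zero>\<^bsub>operator_algebra H\<^esub>"
    proof (rule eq)
      fix x assume x: "x \<in> carrier H"
      then have "hnorm H (S x) \<le> 0" using operator_norm_bound[OF S' x] 0 by simp
      then have "hnorm H (S x) = 0" using hnorm_nonneg[OF adjointable_closed[OF S' x]] by linarith
      then show "S x = \<zero>\<^bsub>operator_algebra H\<^esub> x" using x S' hnorm_eq_0[of "S x"] by simp
    qed (use S' ext in auto)
  next
    assume "S = \<zero>\<^bsub>operator_algebra H\<^esub>"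
    then have "operator_norm H S \<le> 0" by (intro operator_norm_le) auto
    then show "cnorm (operator_algebra H) S = 0" using operator_norm_nonneg[OF S'] by simp
  qed
  have smul_le: "operator_norm H (\<lambda>x\<in>carrier H. c \<odot> T x) \<le> cmod c * operator_norm H T"
    if T: "T \<in> adjointable_operators H" for c T
    using T operator_norm_nonneg[OF T] mult_left_mono[OF operator_norm_bound[OF T], of _ "cmod c"]
    by (intro operator_norm_le) (auto simp: hnorm_smul mult.assoc)
  show "cnorm (operator_algebra H) (c \<odot>\<^bsub>operator_algebra H\<^esub> S) = cmod c * cnorm (operator_algebra H) S"
  proof (cases "c = 0")
    case True
    have "operator_norm H (\<lambda>x\<in>carrier H. c \<odot> S x) \<le> 0" using smul_le[OF S', of c] True by simp
    then show ?thesis using True operator_norm_nonneg[OF adjointable_smul(1)[OF S', of c]] by simp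
  next
    case False
    let ?T = "\<lambda>x\<in>carrier H. c \<odot> S x"
    \<comment> \<open>Undoing the scaling turns \<open>smul_le\<close> for \<open>inverse c\<close>
      into the reverse inequality.\<close>
    have "(\<lambda>x\<in>carrier H. inverse c \<odot> ?T x) = S"
      using S' False ext by (intro eq) (auto simp: smul_smul)
    then have "operator_norm H S \<le> cmod (inverse c) * operator_norm H ?T"
      using smul_le[OF adjointable_smul(1)[OF S', of c], of "inverse c"] by simp
    then have "cmod c * operator_norm H S \<le> cmod c * (cmod (inverse c) * operator_norm H ?T)"
      by (rule mult_left_mono) simp
    also have "\<dots> = operator_norm H ?T" using False by (simp add: norm_inverse)
    finally have "cmod c * operator_norm H S \<le> operator_norm H ?T" .
    then show ?thesis using smul_le[OF S', of c] by simp
  qed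
  show "cnorm (operator_algebra H) (star (operator_algebra H) S \<otimes>\<^bsub>operator_algebra H\<^esub> S) = (cnorm (operator_algebra H) S)\<^sup>2"
  proof (rule antisym)
    let ?T = "\<lambda>x\<in>carrier H. operator_adjoint H S (S x)"
    have T: "?T \<in> adjointable_operators H" using adjointable_comp(1) S' by simp
    have "operator_norm H ?T \<le> (operator_norm H S)\<^sup>2"
    proof (rule operator_norm_le)
      fix x assume x: "x \<in> carrier H"
      have "hnorm H (operator_adjoint H S (S x)) \<le> operator_norm H (operator_adjoint H S) * hnorm H (S x)"
        using x S' by (intro operator_norm_bound) auto
      also have "\<dots> \<le> operator_norm H S * (operator_norm H S * hnorm H x)"
        using x S' operator_norm_bound[OF S' x] operator_norm_adjoint_le[OF S'] operator_norm_nonneg[OF S']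
        by (intro mult_mono) auto
      finally show "hnorm H (?T x) \<le> (operator_norm H S)\<^sup>2 * hnorm H x" using x by (simp add: power2_eq_square mult.assoc)
    qed simp
    then show "cnorm (operator_algebra H) (star (operator_algebra H) S \<otimes>\<^bsub>operator_algebra H\<^esub> S) \<le> (cnorm (operator_algebra H) S)\<^sup>2"
      by simp
    have T0: "operator_norm H ?T \<ge> 0" using operator_norm_nonneg[OF T] .
    \<comment> \<open>The lower estimate of the C*-identity:
      \<open>\<langle>S x, S x\<rangle> = \<langle>x, S* S x\<rangle>\<close> with
      Cauchy-Schwarz.\<close>
    have "operator_norm H S \<le> sqrt (operator_norm H ?T)"
    proof (rule operator_norm_le)
      fix x assume x: "x \<in> carrier H"
      have "(hnorm H (S x))\<^sup>2 = Re (hinner H (S x) (S x))" using S' x by (simp add: hnorm_sq)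
      also have "hinner H (S x) (S x) = hinner H x (?T x)" using S' x by (simp add: operator_adjoint_eq)
      also have "Re \<dots> \<le> hnorm H x * hnorm H (?T x)"
        using Cauchy_Schwarz[of x "?T x"] complex_Re_le_cmod[of "hinner H x (?T x)"] x adjointable_closed[OF T x]
        by linarith
      also have "\<dots> \<le> hnorm H x * (operator_norm H ?T * hnorm H x)"
        using operator_norm_bound[OF T x] x by (intro mult_left_mono) auto
      also have "\<dots> = (sqrt (operator_norm H ?T) * hnorm H x)\<^sup>2"
        using T0 by (simp add: power_mult_distrib power2_eq_square[of "hnorm H x"] mult.left_commute)
      finally show "hnorm H (S x) \<le> sqrt (operator_norm H ?T) * hnorm H x"
        by (rule power2_le_imp_le) (use T0 x in simp)
    qed (use T0 in simp)
    then have "(operator_norm H S)\<^sup>2 \<le> (sqrt (operator_norm H ?T))\<^sup>2"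
      using operator_norm_nonneg[OF S'] by (rule power_mono)
    then show "(cnorm (operator_algebra H) S)\<^sup>2 \<le> cnorm (operator_algebra H) (star (operator_algebra H) S \<otimes>\<^bsub>operator_algebra H\<^esub> S)"
      using T0 by simp
  qed
  assume T: "T \<in> carrier (operator_algebra H)"
  then have T': "T \<in> adjointable_operators H" by simp
  show "S \<otimes>\<^bsub>operator_algebra H\<^esub> T \<in> carrier (operator_algebra H)" using adjointable_comp S' T' by simp
  show "(c \<odot>\<^bsub>operator_algebra H\<^esub> S) \<otimes>\<^bsub>operator_algebra H\<^esub> T = c \<odot>\<^bsub>operator_algebra H\<^esub> (S \<otimes>\<^bsub>operator_algebra H\<^esub> T)"
    by (rule eq) (use S' T' in auto)
  show "S \<otimes>\<^bsub>operator_algebra H\<^esub> (c \<odot>\<^bsub>operator_algebra H\<^esub> T) = c \<odot>\<^bsub>operator_algebra H\<^esub> (S \<otimes>\<^bsub>operator_algebra H\<^esub> T)"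
    by (rule eq) (use S' T' in \<open>auto simp: adjointable_linear\<close>)
  show "star (operator_algebra H) (S \<oplus>\<^bsub>operator_algebra H\<^esub> T)
      = star (operator_algebra H) S \<oplus>\<^bsub>operator_algebra H\<^esub> star (operator_algebra H) T"
    using adjointable_add S' T' by simp
  show "star (operator_algebra H) (S \<otimes>\<^bsub>operator_algebra H\<^esub> T)
      = star (operator_algebra H) T \<otimes>\<^bsub>operator_algebra H\<^esub> star (operator_algebra H) S"
    using adjointable_comp S' T' by simp
  show "cnorm (operator_algebra H) (S \<oplus>\<^bsub>operator_algebra H\<^esub> T) \<le> cnorm (operator_algebra H) S + cnorm (operator_algebra H) T"
  proof -
    have "operator_norm H (\<lambda>x\<in>carrier H. S x \<oplus> T x) \<le> operator_norm H S + operator_norm H T"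
    proof (rule operator_norm_le)
      fix x assume x: "x \<in> carrier H"
      show "hnorm H ((\<lambda>x\<in>carrier H. S x \<oplus> T x) x) \<le> (operator_norm H S + operator_norm H T) * hnorm H x"
        using hnorm_add[of "S x" "T x"] operator_norm_bound[OF S' x] operator_norm_bound[OF T' x] x S' T'
        by (simp add: algebra_simps)
    qed (use S' T' operator_norm_nonneg in auto)
    then show ?thesis by simp
  qed
  show "cnorm (operator_algebra H) (S \<otimes>\<^bsub>operator_algebra H\<^esub> T) \<le> cnorm (operator_algebra H) S * cnorm (operator_algebra H) T"
  proof -
    have "operator_norm H (\<lambda>x\<in>carrier H. S (T x)) \<le> operator_norm H S * operator_norm H T"
    proof (rule operator_norm_le)
      fix x assume x: "x \<in> carrier H"
      show "hnorm H ((\<lambda>x\<in>carrier H. S (T x)) x) \<le> operator_norm H S * operator_norm H T * hnorm H x"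
        using operator_norm_bound[OF S', of "T x"] mult_left_mono[OF operator_norm_bound[OF T' x] operator_norm_nonneg[OF S']]
          x T' by (simp add: mult.assoc)
    qed (use S' T' operator_norm_nonneg in auto)
    then show ?thesis by simp
  qed
  assume U: "U \<in> carrier (operator_algebra H)"
  then have U': "U \<in> adjointable_operators H" by simp
  show "(S \<otimes>\<^bsub>operator_algebra H\<^esub> T) \<otimes>\<^bsub>operator_algebra H\<^esub> U = S \<otimes>\<^bsub>operator_algebra H\<^esub> (T \<otimes>\<^bsub>operator_algebra H\<^esub> U)"
    by (rule eq) (use S' T' U' in auto)
  show "(S \<oplus>\<^bsub>operator_algebra H\<^esub> T) \<otimes>\<^bsub>operator_algebra H\<^esub> U
      = S \<otimes>\<^bsub>operator_algebra H\<^esub> U \<oplus>\<^bsub>operator_algebra H\<^esub> T \<otimes>\<^bsub>operator_algebra H\<^esub> U"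
    by (rule eq) (use S' T' U' in auto)
  show "U \<otimes>\<^bsub>operator_algebra H\<^esub> (S \<oplus>\<^bsub>operator_algebra H\<^esub> T)
      = U \<otimes>\<^bsub>operator_algebra H\<^esub> S \<oplus>\<^bsub>operator_algebra H\<^esub> U \<otimes>\<^bsub>operator_algebra H\<^esub> T"
    by (rule eq) (use S' T' U' in \<open>auto simp: adjointable_linear\<close>)
next
  show "complete_wrt (operator_algebra H) (cnorm (operator_algebra H))"
    using complete_operator_algebra by (simp add: operator_algebra_def)
qed

end

section \<open>Square-summable functions\<close>

text \<open>Vectors are functions on the whole type supported in \<open>I\<close>. Thus equality is
  equality of functions and all sums run over \<open>UNIV\<close>.\<close>

definition ell2 :: "'i set \<Rightarrow> ('i \<Rightarrow> complex) hilbert" where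
  "ell2 I = \<lparr>
     carrier = {f. (\<forall>i. i \<notin> I \<longrightarrow> f i = 0) \<and> (\<lambda>i. (cmod (f i))\<^sup>2) summable_on UNIV},
     mult = (\<lambda>f g i. f i * g i), one = (\<lambda>i. 1), zero = (\<lambda>i. 0), add = (\<lambda>f g i. f i + g i),
     smult = (\<lambda>c f i. c * f i), hinner = (\<lambda>f g. \<Sum>\<^sub>\<infinity>i. f i * cnj (g i))\<rparr>"

lemma ell2_simps [simp]:
  "zero (ell2 I) = (\<lambda>i. 0)" "add (ell2 I) f g = (\<lambda>i. f i + g i)"
  "smult (ell2 I) c f = (\<lambda>i. c * f i)" "hinner (ell2 I) f g = (\<Sum>\<^sub>\<infinity>i. f i * cnj (g i))"
  by (simp_all add: ell2_def)

lemma carrier_ell2: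
  "f \<in> carrier (ell2 I) \<longleftrightarrow> (\<forall>i. i \<notin> I \<longrightarrow> f i = 0) \<and> (\<lambda>i. (cmod (f i))\<^sup>2) summable_on UNIV"
  by (simp add: ell2_def)

lemma summable_on_comparison_real:
  fixes f g :: "'i \<Rightarrow> real"
  assumes "g summable_on A" "\<And>i. i \<in> A \<Longrightarrow> 0 \<le> f i" "\<And>i. i \<in> A \<Longrightarrow> f i \<le> g i"
  shows "f summable_on A"
proof -
  have "(\<lambda>i. norm (g i)) summable_on A" using assms(1) summable_on_iff_abs_summable_on_real by blast
  then have "(\<lambda>i. norm (f i)) summable_on A"
    by (rule Infinite_Sum.abs_summable_on_comparison_test) (use assms(2,3) in force)
  then show ?thesis using summable_on_iff_abs_summable_on_real by blast
qed

lemma ell2_add: "f \<in> carrier (ell2 I) \<Longrightarrow> g \<in> carrier (ell2 I) \<Longrightarrow> (\<lambda>i. f i + g i) \<in> carrier (ell2 I)"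
proof -
  assume f: "f \<in> carrier (ell2 I)" and g: "g \<in> carrier (ell2 I)"
  have "(\<lambda>i. 2 * (cmod (f i))\<^sup>2 + 2 * (cmod (g i))\<^sup>2) summable_on UNIV"
    using f g by (intro summable_on_add summable_on_cmult_right) (auto simp: carrier_ell2)
  then have "(\<lambda>i. (cmod (f i + g i))\<^sup>2) summable_on UNIV"
  proof (rule summable_on_comparison_real)
    fix i
    have "(cmod (f i + g i))\<^sup>2 \<le> (cmod (f i) + cmod (g i))\<^sup>2"
      by (intro power_mono norm_triangle_ineq) simp
    also have "\<dots> \<le> 2 * (cmod (f i))\<^sup>2 + 2 * (cmod (g i))\<^sup>2"
      using sum_squares_ge_zero[of "cmod (f i) - cmod (g i)" 0] by (simp add: power2_eq_square algebra_simps)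
    finally show "(cmod (f i + g i))\<^sup>2 \<le> 2 * (cmod (f i))\<^sup>2 + 2 * (cmod (g i))\<^sup>2" .
  qed simp
  then show ?thesis using f g by (auto simp: carrier_ell2)
qed

lemma ell2_smul: "f \<in> carrier (ell2 I) \<Longrightarrow> (\<lambda>i. c * f i) \<in> carrier (ell2 I)"
  by (auto simp: carrier_ell2 norm_mult power_mult_distrib intro: summable_on_cmult_right)

lemma ell2_hinner_summable:
  assumes "f \<in> carrier (ell2 I)" "g \<in> carrier (ell2 I)"
  shows "(\<lambda>i. f i * cnj (g i)) summable_on UNIV"
proof (rule abs_summable_summable)
  have "(\<lambda>i. (cmod (f i))\<^sup>2 + (cmod (g i))\<^sup>2) summable_on UNIV"
    using assms by (intro summable_on_add) (auto simp: carrier_ell2)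
  then show "(\<lambda>i. norm (f i * cnj (g i))) summable_on UNIV"
  proof (rule summable_on_comparison_real)
    fix i
    have "2 * (cmod (f i) * cmod (g i)) \<le> (cmod (f i))\<^sup>2 + (cmod (g i))\<^sup>2"
      using sum_squares_ge_zero[of "cmod (f i) - cmod (g i)" 0] by (simp add: power2_eq_square algebra_simps)
    moreover have "0 \<le> cmod (f i) * cmod (g i)" by simp
    moreover have "norm (f i * cnj (g i)) = cmod (f i) * cmod (g i)" by (simp add: norm_mult)
    ultimately show "norm (f i * cnj (g i)) \<le> (cmod (f i))\<^sup>2 + (cmod (g i))\<^sup>2"
      by linarith
  qed simp
qed

lemma ell2_hinner_self:
  "f \<in> carrier (ell2 I) \<Longrightarrow> hinner (ell2 I) f f = complex_of_real (\<Sum>\<^sub>\<infinity>i. (cmod (f i))\<^sup>2)"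
proof -
  assume f: "f \<in> carrier (ell2 I)"
  have "((\<lambda>i. complex_of_real ((cmod (f i))\<^sup>2)) has_sum complex_of_real (\<Sum>\<^sub>\<infinity>i. (cmod (f i))\<^sup>2)) UNIV"
    using f by (intro has_sum_of_real has_sum_infsum) (simp add: carrier_ell2)
  then show ?thesis by (simp add: infsumI complex_norm_square del: of_real_power)
qed

lemma ell2_hnorm: "f \<in> carrier (ell2 I) \<Longrightarrow> hnorm (ell2 I) f = sqrt (\<Sum>\<^sub>\<infinity>i. (cmod (f i))\<^sup>2)"
  unfolding hnorm_def by (simp add: ell2_hinner_self del: ell2_simps)

lemma module_ell2: "Module.module complex_ring (ell2 I)"
  by (rule complex_vector_spaceI) (auto simp: ell2_add ell2_smul algebra_simps carrier_ell2[of "\<lambda>i. 0"])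

lemma ell2_minus:
  assumes "f \<in> carrier (ell2 I)" "g \<in> carrier (ell2 I)"
  shows "f \<ominus>\<^bsub>ell2 I\<^esub> g = (\<lambda>i. f i - g i)"
proof -
  interpret complex_vector_space "ell2 I" by (intro complex_vector_space.intro module_ell2)
  show ?thesis using minus_eq_smul[of g f] assms by simp
qed

lemma ell2_minus_closed:
  assumes "f \<in> carrier (ell2 I)" "g \<in> carrier (ell2 I)"
  shows "(\<lambda>i. f i - g i) \<in> carrier (ell2 I)"
  using ell2_add[OF assms(1) ell2_smul[OF assms(2), of "-1"]] by simp

lemma ell2_finite_sum_le:
  assumes f: "f \<in> carrier (ell2 I)" and F: "finite F"
  shows "(\<Sum>i\<in>F. (cmod (f i))\<^sup>2) \<le> (hnorm (ell2 I) f)\<^sup>2"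
proof -
  have "(\<Sum>i\<in>F. (cmod (f i))\<^sup>2) \<le> (\<Sum>\<^sub>\<infinity>i. (cmod (f i))\<^sup>2)"
    using f F by (intro finite_sum_le_infsum) (auto simp: carrier_ell2)
  also have "\<dots> = (hnorm (ell2 I) f)\<^sup>2" using f by (simp add: ell2_hnorm infsum_nonneg)
  finally show ?thesis .
qed

text \<open>Finite partial sums control membership and norm at once, which suits pointwise limits,
  truncations and partial maps.\<close>

lemma ell2_normI:
  assumes supp: "\<And>i. i \<notin> I \<Longrightarrow> f i = 0" and "0 \<le> K"
    and bound: "\<And>F. finite F \<Longrightarrow> (\<Sum>i\<in>F. (cmod (f i))\<^sup>2) \<le> K\<^sup>2"
  shows "f \<in> carrier (ell2 I)" "hnorm (ell2 I) f \<le> K"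
proof -
  have sm: "(\<lambda>i. (cmod (f i))\<^sup>2) summable_on UNIV"
  proof (rule nonneg_bdd_above_summable_on)
    show "bdd_above (sum (\<lambda>i. (cmod (f i))\<^sup>2) ` {F. F \<subseteq> UNIV \<and> finite F})"
      using bound by (auto intro!: bdd_aboveI[of _ "K\<^sup>2"])
  qed simp
  then show f: "f \<in> carrier (ell2 I)" using supp by (auto simp: carrier_ell2)
  have "(\<Sum>\<^sub>\<infinity>i. (cmod (f i))\<^sup>2) \<le> K\<^sup>2" using sm bound by (intro infsum_le_finite_sums) auto
  then show "hnorm (ell2 I) f \<le> K" using \<open>0 \<le> K\<close> unfolding ell2_hnorm[OF f] by (intro real_le_lsqrt) auto
qed

lemma complete_ell2: "complete_wrt (ell2 I) (hnorm (ell2 I))"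
  unfolding complete_wrt_def
proof (intro allI impI, elim conjE)
  fix f :: "nat \<Rightarrow> 'a \<Rightarrow> complex"
  assume "range f \<subseteq> carrier (ell2 I)"
    and cau: "\<forall>\<epsilon>>0. \<exists>N. \<forall>m\<ge>N. \<forall>n\<ge>N. hnorm (ell2 I) (f m \<ominus>\<^bsub>ell2 I\<^esub> f n) < \<epsilon>"
  then have f: "f n \<in> carrier (ell2 I)" for n by auto
  have diff: "(\<lambda>i. f m i - f n i) \<in> carrier (ell2 I)" for m n using f by (intro ell2_minus_closed)
  have cau': "\<exists>N. \<forall>m\<ge>N. \<forall>n\<ge>N. hnorm (ell2 I) (\<lambda>i. f m i - f n i) < \<epsilon>" if "\<epsilon> > 0" for \<epsilon>
    using cau that by (simp add: ell2_minus[OF f f])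
  have "Cauchy (\<lambda>n. f n i)" for i
  proof (rule CauchyI)
    fix e :: real assume "e > 0"
    then obtain N where N: "\<And>m n. m \<ge> N \<Longrightarrow> n \<ge> N \<Longrightarrow> hnorm (ell2 I) (\<lambda>i. f m i - f n i) < e" using cau' by blast
    have "cmod (f m i - f n i) < e" if "m \<ge> N" "n \<ge> N" for m n
    proof -
      have h0: "hnorm (ell2 I) (\<lambda>i. f m i - f n i) \<ge> 0"
        unfolding ell2_hnorm[OF diff] by (simp add: infsum_nonneg)
      have "(cmod (f m i - f n i))\<^sup>2 \<le> (hnorm (ell2 I) (\<lambda>i. f m i - f n i))\<^sup>2"
        using ell2_finite_sum_le[OF diff, of "{i}" m n] by simp
      then have "cmod (f m i - f n i) \<le> hnorm (ell2 I) (\<lambda>i. f m i - f n i)"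
        using h0 by (rule power2_le_imp_le)
      then show ?thesis using N[OF that] by simp
    qed
    then show "\<exists>M. \<forall>m\<ge>M. \<forall>n\<ge>M. norm (f m i - f n i) < e" by blast
  qed
  then have "\<forall>i. \<exists>l. (\<lambda>n. f n i) \<longlonglongrightarrow> l" using Cauchy_convergent_iff convergent_def by metis
  then obtain l where l: "\<And>i. (\<lambda>n. f n i) \<longlonglongrightarrow> l i" by metis
  have l0: "l i = 0" if "i \<notin> I" for i
    using l[of i] f that LIMSEQ_unique[OF l[of i]] by (simp add: carrier_ell2 LIMSEQ_const_iff)
  \<comment> \<open>The pointwise limit is taken inside a finite sum, where it is harmless;
    \<open>ell2_normI\<close> then passes to the full sum.\<close>
  have close: "(\<lambda>i. f n i - l i) \<in> carrier (ell2 I) \<and> hnorm (ell2 I) (\<lambda>i. f n i - l i) \<le> \<epsilon>"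
    if e: "\<epsilon> > 0" and N: "\<And>m. m \<ge> N \<Longrightarrow> hnorm (ell2 I) (\<lambda>i. f n i - f m i) < \<epsilon>" for \<epsilon> N n
  proof -
    have "(\<Sum>i\<in>F. (cmod (f n i - l i))\<^sup>2) \<le> \<epsilon>\<^sup>2" if F: "finite F" for F
    proof (rule LIMSEQ_le_const2)
      show "(\<lambda>m. \<Sum>i\<in>F. (cmod (f n i - f m i))\<^sup>2) \<longlonglongrightarrow> (\<Sum>i\<in>F. (cmod (f n i - l i))\<^sup>2)"
        by (intro tendsto_intros l)
      have "(\<Sum>i\<in>F. (cmod (f n i - f m i))\<^sup>2) \<le> \<epsilon>\<^sup>2" if "m \<ge> N" for m
      proof -
        have "(\<Sum>i\<in>F. (cmod (f n i - f m i))\<^sup>2) \<le> (hnorm (ell2 I) (\<lambda>i. f n i - f m i))\<^sup>2"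
          using ell2_finite_sum_le[OF diff F] .
        also have "\<dots> \<le> \<epsilon>\<^sup>2" using N[OF that]
          by (intro power_mono) (auto simp: ell2_hnorm[OF diff] infsum_nonneg)
        finally show ?thesis .
      qed
      then show "\<exists>N. \<forall>m\<ge>N. (\<Sum>i\<in>F. (cmod (f n i - f m i))\<^sup>2) \<le> \<epsilon>\<^sup>2" by blast
    qed
    then show ?thesis
      using ell2_normI[of I "\<lambda>i. f n i - l i" \<epsilon>] l0 f e by (auto simp: carrier_ell2)
  qed
  obtain N1 where N1: "\<And>m n. m \<ge> N1 \<Longrightarrow> n \<ge> N1 \<Longrightarrow> hnorm (ell2 I) (\<lambda>i. f m i - f n i) < 1"
    using cau'[of 1] by auto
  have "(\<lambda>i. f N1 i - l i) \<in> carrier (ell2 I)" using close[of 1 N1 N1] N1 by simp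
  then have lc: "l \<in> carrier (ell2 I)" using ell2_minus_closed[OF f[of N1]] by fastforce
  have "(\<lambda>n. hnorm (ell2 I) (\<lambda>i. f n i - l i)) \<longlonglongrightarrow> 0"
  proof (rule LIMSEQ_I)
    fix r :: real assume r: "r > 0"
    then obtain N where N: "\<And>m n. m \<ge> N \<Longrightarrow> n \<ge> N \<Longrightarrow> hnorm (ell2 I) (\<lambda>i. f m i - f n i) < r/2"
      using cau'[of "r/2"] by auto
    have "norm (hnorm (ell2 I) (\<lambda>i. f n i - l i) - 0) < r" if "n \<ge> N" for n
      using close[of "r/2" N n] N that r ell2_hnorm[OF ell2_minus_closed[OF f lc]] by (simp add: infsum_nonneg)
    then show "\<exists>no. \<forall>n\<ge>no. norm (hnorm (ell2 I) (\<lambda>i. f n i - l i) - 0) < r" by blast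
  qed
  then show "\<exists>l\<in>carrier (ell2 I). (\<lambda>n. hnorm (ell2 I) (f n \<ominus>\<^bsub>ell2 I\<^esub> l)) \<longlonglongrightarrow> 0"
    using lc by (intro bexI[of _ l]) (simp_all add: ell2_minus[OF f])
qed

lemma hilbert_space_ell2: "hilbert_space (ell2 I)"
proof (intro hilbert_space.intro hilbert_space_axioms.intro module_ell2 complete_ell2)
  fix f g h :: "'a \<Rightarrow> complex" and c
  assume f: "f \<in> carrier (ell2 I)"
  show "0 \<le> Re (hinner (ell2 I) f f)" by (subst ell2_hinner_self[OF f]) (simp add: infsum_nonneg)
  show "f = \<zero>\<^bsub>ell2 I\<^esub>" if "hinner (ell2 I) f f = 0"
  proof -
    have "(\<Sum>\<^sub>\<infinity>i. (cmod (f i))\<^sup>2) = 0" using that unfolding ell2_hinner_self[OF f] by simp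
    then have "(cmod (f i))\<^sup>2 = 0" for i
      using f by (intro nonneg_infsum_le_0D[of "\<lambda>i. (cmod (f i))\<^sup>2" UNIV]) (auto simp: carrier_ell2)
    then show ?thesis by (simp add: fun_eq_iff)
  qed
  assume g: "g \<in> carrier (ell2 I)"
  show "hinner (ell2 I) (c \<odot>\<^bsub>ell2 I\<^esub> f) g = c * hinner (ell2 I) f g"
    by (simp add: mult.assoc infsum_cmult_right')
  show "hinner (ell2 I) g f = cnj (hinner (ell2 I) f g)"
    by (simp flip: infsum_cnj add: mult.commute)
  assume h: "h \<in> carrier (ell2 I)"
  show "hinner (ell2 I) (f \<oplus>\<^bsub>ell2 I\<^esub> g) h = hinner (ell2 I) f h + hinner (ell2 I) g h"
    using f g h by (simp add: distrib_right infsum_add ell2_hinner_summable)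
qed

definition unit_vector :: "'i \<Rightarrow> 'i \<Rightarrow> complex" where
  "unit_vector i = (\<lambda>j. if j = i then 1 else 0)"

lemma infsum_single_point:
  fixes f :: "'i \<Rightarrow> 'b :: {comm_monoid_add, t2_space}"
  assumes "\<And>j. j \<noteq> i \<Longrightarrow> f j = 0" shows "infsum f UNIV = f i"
  using infsum_cong_neutral[of "{i}" UNIV f f] assms by auto

lemma unit_vector_ell2:
  assumes "i \<in> I" shows "unit_vector i \<in> carrier (ell2 I)"
proof -
  have "(\<lambda>j. (cmod (unit_vector i j))\<^sup>2) summable_on UNIV \<longleftrightarrow> (\<lambda>j. (cmod (unit_vector i j))\<^sup>2) summable_on {i}"
    by (rule summable_on_cong_neutral) (auto simp: unit_vector_def)
  then show ?thesis using assms by (auto simp: carrier_ell2 unit_vector_def)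
qed

lemma hinner_unit_vector: "hinner (ell2 I) f (unit_vector i) = f i"
  by (simp add: unit_vector_def if_distrib[of cnj] if_distrib[of "\<lambda>x. _ * x"] cong: if_cong)
     (subst infsum_single_point[of i]; simp)

text \<open>Stated for every \<open>d\<close> that agrees with \<open>\<xi>\<close> or vanishes at
  each index, so that it covers plain truncations as well as the cylinder cut-offs below.\<close>

lemma ell2_tail:
  assumes \<xi>: "\<xi> \<in> carrier (ell2 I)" and e: "\<epsilon> > 0"
  shows "\<exists>F. finite F \<and> (\<forall>d. (\<forall>i. d i = 0 \<or> d i = \<xi> i) \<and> (\<forall>i\<in>F. d i = 0) \<longrightarrow>
     d \<in> carrier (ell2 I) \<and> hnorm (ell2 I) d < \<epsilon>)"
proof -
  let ?q = "\<lambda>f i. (cmod (f i))\<^sup>2"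
  define s where "s = infsum (?q \<xi>) UNIV"
  have sm: "?q \<xi> summable_on UNIV" using \<xi> by (simp add: carrier_ell2)
  then have "(sum (?q \<xi>) \<longlongrightarrow> s) (finite_subsets_at_top UNIV)"
    using has_sum_infsum unfolding has_sum_def s_def by blast
  then have "\<forall>\<^sub>F F in finite_subsets_at_top UNIV. sum (?q \<xi>) F > s - (\<epsilon>/2)\<^sup>2"
    by (rule order_tendstoD) (use e in simp)
  then obtain F where F: "finite F" "sum (?q \<xi>) F > s - (\<epsilon>/2)\<^sup>2"
    unfolding eventually_finite_subsets_at_top by blast
  have "d \<in> carrier (ell2 I) \<and> hnorm (ell2 I) d \<le> \<epsilon>/2"
    if d: "\<And>i. d i = 0 \<or> d i = \<xi> i" and dF: "\<And>i. i \<in> F \<Longrightarrow> d i = 0" for d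
  proof -
    have "(\<Sum>i\<in>G. ?q d i) \<le> (\<epsilon>/2)\<^sup>2" if G: "finite G" for G
    proof -
      have "(\<Sum>i\<in>G. ?q d i) = (\<Sum>i\<in>G - F. ?q d i)"
        using G dF by (intro sum.mono_neutral_right) auto
      also have "\<dots> \<le> (\<Sum>i\<in>G - F. ?q \<xi> i)" using d by (intro sum_mono) (metis norm_zero power_zero_numeral zero_le_power2 order_refl)
      also have "\<dots> = (\<Sum>i\<in>(G - F) \<union> F. ?q \<xi> i) - (\<Sum>i\<in>F. ?q \<xi> i)"
        using G F(1) by (subst sum.union_disjoint) auto
      also have "(\<Sum>i\<in>(G - F) \<union> F. ?q \<xi> i) \<le> s"
        unfolding s_def using G F(1) sm by (intro finite_sum_le_infsum) auto
      finally show ?thesis using F(2) by simp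
    qed
    moreover have "d i = 0" if "i \<notin> I" for i using d[of i] \<xi> that by (auto simp: carrier_ell2)
    ultimately show ?thesis using ell2_normI[of I d "\<epsilon>/2"] e by auto
  qed
  moreover have "\<epsilon>/2 < \<epsilon>" using e by simp
  ultimately show ?thesis using F(1) by (meson order_le_less_trans)
qed

text \<open>Composition with \<open>\<theta>\<close>, hence contravariant: if
  \<open>\<theta>\<close> is a partial injection, the unit vector at \<open>j\<close> goes to the
  unit vector at the \<open>i\<close> with \<open>\<theta> i = Some j\<close>.\<close>

definition partial_map_operator ::
    "'i set \<Rightarrow> ('i \<Rightarrow> 'i option) \<Rightarrow> ('i \<Rightarrow> complex) \<Rightarrow> 'i \<Rightarrow> complex" where
  "partial_map_operator I \<theta> = (\<lambda>\<xi>\<in>carrier (ell2 I). \<lambda>i. case \<theta> i of None \<Rightarrow> 0 | Some j \<Rightarrow> \<xi> j)"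

locale partial_bijection =
  fixes I :: "'i set" and \<theta> \<theta>' :: "'i \<Rightarrow> 'i option"
  assumes inverse: "\<theta> i = Some j \<longleftrightarrow> \<theta>' j = Some i"
    and dom: "\<theta> i = Some j \<Longrightarrow> i \<in> I \<and> j \<in> I"
begin

lemma bij_dom: "bij_betw (\<lambda>i. the (\<theta> i)) {i. \<theta> i \<noteq> None} {j. \<theta>' j \<noteq> None}"
  by (rule bij_betw_byWitness[where f'="\<lambda>j. the (\<theta>' j)"]) (auto simp: inverse, (metis inverse option.sel option.distinct(1))+)

lemma operator_closed:
  assumes \<xi>: "\<xi> \<in> carrier (ell2 I)"
  shows "partial_map_operator I \<theta> \<xi> \<in> carrier (ell2 I)"
    and "hnorm (ell2 I) (partial_map_operator I \<theta> \<xi>) \<le> hnorm (ell2 I) \<xi>"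
proof -
  have "(\<Sum>i\<in>F. (cmod (partial_map_operator I \<theta> \<xi> i))\<^sup>2) \<le> (hnorm (ell2 I) \<xi>)\<^sup>2" if F: "finite F" for F
  proof -
    let ?D = "F \<inter> {i. \<theta> i \<noteq> None}"
    have inj: "inj_on (\<lambda>i. the (\<theta> i)) ?D"
      using bij_betw_imp_inj_on[OF bij_dom] by (rule inj_on_subset) auto
    have "(\<Sum>i\<in>F. (cmod (partial_map_operator I \<theta> \<xi> i))\<^sup>2) = (\<Sum>i\<in>?D. (cmod (\<xi> (the (\<theta> i))))\<^sup>2)"
      using F \<xi> by (intro sum.mono_neutral_cong_right) (auto simp: partial_map_operator_def)
    also have "\<dots> = (\<Sum>j\<in>(\<lambda>i. the (\<theta> i)) ` ?D. (cmod (\<xi> j))\<^sup>2)"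
      using inj by (simp add: sum.reindex)
    also have "\<dots> \<le> (hnorm (ell2 I) \<xi>)\<^sup>2" using F \<xi> by (intro ell2_finite_sum_le) auto
    finally show ?thesis .
  qed
  moreover have "partial_map_operator I \<theta> \<xi> i = 0" if "i \<notin> I" for i
    using that dom \<xi> by (auto simp: partial_map_operator_def split: option.split)
  moreover have "0 \<le> hnorm (ell2 I) \<xi>" using \<xi> by (simp add: ell2_hnorm infsum_nonneg)
  ultimately show "partial_map_operator I \<theta> \<xi> \<in> carrier (ell2 I)"
    "hnorm (ell2 I) (partial_map_operator I \<theta> \<xi>) \<le> hnorm (ell2 I) \<xi>"
    using ell2_normI[of I "partial_map_operator I \<theta> \<xi>" "hnorm (ell2 I) \<xi>"] by blast+
qed

lemma bounded_operator: "bounded_operator (ell2 I) (partial_map_operator I \<theta>)"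
  unfolding bounded_operator_def linear_on_def
proof (intro conjI ballI allI exI[of _ 1])
  show "partial_map_operator I \<theta> \<in> carrier (ell2 I) \<rightarrow> carrier (ell2 I)" using operator_closed(1) by blast
  fix \<xi> assume \<xi>: "\<xi> \<in> carrier (ell2 I)"
  show "hnorm (ell2 I) (partial_map_operator I \<theta> \<xi>) \<le> 1 * hnorm (ell2 I) \<xi>" using operator_closed(2)[OF \<xi>] by simp
  show "partial_map_operator I \<theta> (c \<odot>\<^bsub>ell2 I\<^esub> \<xi>) = c \<odot>\<^bsub>ell2 I\<^esub> partial_map_operator I \<theta> \<xi>" for c
    using \<xi> ell2_smul[OF \<xi>, of c] by (auto simp: partial_map_operator_def split: option.split)
  fix \<eta> assume \<eta>: "\<eta> \<in> carrier (ell2 I)"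
  show "partial_map_operator I \<theta> (\<xi> \<oplus>\<^bsub>ell2 I\<^esub> \<eta>) = partial_map_operator I \<theta> \<xi> \<oplus>\<^bsub>ell2 I\<^esub> partial_map_operator I \<theta> \<eta>"
    using \<xi> \<eta> ell2_add[OF \<xi> \<eta>] by (auto simp: partial_map_operator_def split: option.split)
qed

text \<open>Only the domain of \<open>\<theta>\<close> contributes on the left and only that of
  \<open>\<theta>'\<close> on the right; \<open>\<theta>\<close> maps the first bijectively onto the
  second.\<close>

lemma is_adjoint: "is_adjoint (ell2 I) (partial_map_operator I \<theta>) (partial_map_operator I \<theta>')"
  unfolding is_adjoint_def
proof (intro ballI)
  fix \<xi> \<eta> assume \<xi>: "\<xi> \<in> carrier (ell2 I)" and \<eta>: "\<eta> \<in> carrier (ell2 I)"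
  let ?D = "{i. \<theta> i \<noteq> None}" and ?R = "{j. \<theta>' j \<noteq> None}"
  have "hinner (ell2 I) (partial_map_operator I \<theta> \<xi>) \<eta> = (\<Sum>\<^sub>\<infinity>i\<in>?D. \<xi> (the (\<theta> i)) * cnj (\<eta> (the (\<theta>' (the (\<theta> i))))))"
    unfolding ell2_simps
  proof (rule infsum_cong_neutral)
    fix i assume "i \<in> UNIV \<inter> ?D"
    then obtain j where "\<theta> i = Some j" "\<theta>' j = Some i" using inverse by auto
    then show "partial_map_operator I \<theta> \<xi> i * cnj (\<eta> i) = \<xi> (the (\<theta> i)) * cnj (\<eta> (the (\<theta>' (the (\<theta> i)))))"
      using \<xi> by (simp add: partial_map_operator_def)
  qed (use \<xi> in \<open>auto simp: partial_map_operator_def\<close>)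
  also have "\<dots> = (\<Sum>\<^sub>\<infinity>j\<in>?R. \<xi> j * cnj (\<eta> (the (\<theta>' j))))"
    by (rule infsum_reindex_bij_betw[OF bij_dom])
  also have "\<dots> = hinner (ell2 I) \<xi> (partial_map_operator I \<theta>' \<eta>)"
    unfolding ell2_simps
    by (rule infsum_cong_neutral) (use \<eta> in \<open>auto simp: partial_map_operator_def split: option.splits\<close>)
  finally show "hinner (ell2 I) (partial_map_operator I \<theta> \<xi>) \<eta> = hinner (ell2 I) \<xi> (partial_map_operator I \<theta>' \<eta>)" .
qed

end

lemma partial_bijection_operator:
  assumes "partial_bijection I \<theta> \<theta>'"
  shows "partial_map_operator I \<theta> \<in> adjointable_operators (ell2 I)"
    and "operator_adjoint (ell2 I) (partial_map_operator I \<theta>) = partial_map_operator I \<theta>'"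
proof -
  interpret A: partial_bijection I \<theta> \<theta>' by fact
  interpret B: partial_bijection I \<theta>' \<theta> using A.inverse A.dom by unfold_locales blast+
  interpret hilbert_space "ell2 I" by (rule hilbert_space_ell2)
  show "partial_map_operator I \<theta> \<in> adjointable_operators (ell2 I)"
    "operator_adjoint (ell2 I) (partial_map_operator I \<theta>) = partial_map_operator I \<theta>'"
    using adjointableI[of "partial_map_operator I \<theta>" "partial_map_operator I \<theta>'"]
      A.bounded_operator B.bounded_operator A.is_adjoint by (simp_all add: partial_map_operator_def)
qed

section \<open>Representations on path orbits\<close>

text \<open>The value \<open>None\<close> stands for the zero vector in the representation. Loops
  are never removed by an adjoint, since they are not edges of the graph.\<close>

definition generator_action ::
    "('v, 'e) pre_digraph \<Rightarrow> ('v, 'e) generator \<Rightarrow> (nat \<Rightarrow> 'e + 'v) \<Rightarrow> (nat \<Rightarrow> 'e + 'v) option" where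
  "generator_action E g y = (case g of
     Vertex v \<Rightarrow> if ext_head E (y 0) = v then Some y else None
   | Edge f \<Rightarrow> if ext_head E (y 0) = tail E f then Some (case_nat (Inl f) y) else None
   | Edge_star f \<Rightarrow> if y 0 = Inl f then Some (\<lambda>i. y (Suc i)) else None)"

text \<open>The shift class. A path that has run into a loop is fixed by further shifts, so one
  formula covers finite and infinite boundary paths.\<close>

definition path_orbit :: "('v, 'e) pre_digraph \<Rightarrow> (nat \<Rightarrow> 'e + 'v) \<Rightarrow> (nat \<Rightarrow> 'e + 'v) set" where
  "path_orbit E x = {y. ext_path E y \<and> (\<exists>m l. (\<lambda>i. y (i + m)) = (\<lambda>i. x (i + l)))}"

context wf_digraph
begin

lemma ext_path_shift: "ext_path G y \<Longrightarrow> ext_path G (\<lambda>i. y (i + m))"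
  by (auto simp: ext_path_def)

lemma ext_path_Suc: "ext_path G y \<Longrightarrow> ext_path G (\<lambda>i. y (Suc i))"
  using ext_path_shift[of y 1] by simp

lemma ext_path_cons:
  assumes "a \<in> ext_arcs G" "ext_tail G a = ext_head G (y 0)" "ext_path G y"
  shows "ext_path G (case_nat a y)"
  using assms by (auto simp: ext_path_def image_subset_iff split: nat.splits)

lemma ext_path_in_ext_arcs: "ext_path G y \<Longrightarrow> y i \<in> ext_arcs G"
  by (auto simp: ext_path_def)

lemma ext_path_verts: "ext_path G y \<Longrightarrow> ext_head G (y i) \<in> verts G"
  using ext_path_in_ext_arcs[of y i] by (auto simp: ext_arcs_def is_source_def)

lemma ext_path_source:
  assumes "ext_path G y" "ext_head G (y i) = u" "is_source G u"
  shows "y i = Inr u"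
  using ext_path_in_ext_arcs[OF assms(1), of i] assms(2,3) by (auto simp: ext_arcs_def is_source_def)

text \<open>A loop sits at a source, where no edge arrives, so only the same loop can
  follow.\<close>

lemma ext_path_loop:
  assumes y: "ext_path G y" and "y i = Inr u"
  shows "y (i + k) = Inr u"
proof (induction k)
  case (Suc k)
  have "is_source G u" using ext_path_in_ext_arcs[OF y, of i] assms(2) by (auto simp: ext_arcs_def)
  moreover have "ext_head G (y (i + Suc k)) = u" using y Suc by (simp add: ext_path_def) (metis ext_tail_simps(2))
  ultimately show ?case using ext_path_source[OF y] by blast
qed (use assms in simp)

lemma ext_path_loop_eq: "ext_path G y \<Longrightarrow> y 0 = Inr u \<Longrightarrow> y = (\<lambda>i. Inr u)"
  using ext_path_loop[of y 0 u] by (simp add: fun_eq_iff)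

lemma path_orbit_self: "ext_path G x \<Longrightarrow> x \<in> path_orbit G x"
  by (auto simp: path_orbit_def)

lemma path_orbit_ext_path: "y \<in> path_orbit G x \<Longrightarrow> ext_path G y"
  by (simp add: path_orbit_def)

lemma path_orbit_Suc:
  assumes "y \<in> path_orbit G x" shows "(\<lambda>i. y (Suc i)) \<in> path_orbit G x"
proof -
  obtain m l where ml: "(\<lambda>i. y (i + m)) = (\<lambda>i. x (i + l))" using assms by (auto simp: path_orbit_def)
  then have "(\<lambda>i. y (Suc (i + m))) = (\<lambda>i. x (i + Suc l))"
    by (auto simp: fun_eq_iff) (metis add_Suc add_Suc_right)
  then show ?thesis using assms ext_path_Suc unfolding path_orbit_def by blast
qed

lemma path_orbit_cons:
  assumes "y \<in> path_orbit G x" "a \<in> ext_arcs G" "ext_tail G a = ext_head G (y 0)"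
  shows "case_nat a y \<in> path_orbit G x"
proof -
  obtain m l where "(\<lambda>i. y (i + m)) = (\<lambda>i. x (i + l))" using assms by (auto simp: path_orbit_def)
  then have "(\<lambda>i. case_nat a y (i + Suc m)) = (\<lambda>i. x (i + l))" by simp
  then show ?thesis using assms ext_path_cons unfolding path_orbit_def by blast
qed

lemma generator_action_orbit:
  assumes "g \<in> generators G" "y \<in> path_orbit G x" "generator_action G g y = Some y'"
  shows "y' \<in> path_orbit G x"
  using assms path_orbit_Suc[OF assms(2)] path_orbit_cons[OF assms(2)]
  by (auto simp: generators_def generator_action_def ext_arcs_def split: if_splits)

lemma generator_action_star:
  assumes "g \<in> generators G" "ext_path G y" "generator_action G g y = Some y'"
  shows "generator_action G (generator_star g) y' = Some y"
proof -
  from assms(1) consider v where "g = Vertex v" | f where "g = Edge f" | f where "g = Edge_star f"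
    by (auto simp: generators_def)
  then show ?thesis
  proof cases
    case 3
    then have y: "y 0 = Inl f" "y' = (\<lambda>i. y (Suc i))" using assms by (auto simp: generator_action_def split: if_splits)
    then have "ext_head G (y' 0) = tail G f" using assms(2) by (metis ext_path_def ext_tail_simps(1))
    moreover have "case_nat (Inl f) y' = y" using y by (auto simp: fun_eq_iff split: nat.split)
    ultimately show ?thesis using 3 by (simp add: generator_action_def)
  qed (use assms in \<open>auto simp: generator_action_def split: if_splits\<close>)
qed

text \<open>Each member is a finite word over a countable alphabet followed by a tail of
  \<open>x\<close>.\<close>

lemma countable_path_orbit:
  assumes "countable (verts G)" "countable (arcs G)"
  shows "countable (path_orbit G x)"
proof -
  let ?c = "\<lambda>(as, l). \<lambda>i. if i < length as then as ! i else x (i - length as + l)"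
  have "countable {v. is_source G v}" using assms(1) by (rule countable_subset[rotated]) (auto simp: is_source_def)
  then have "countable (lists (ext_arcs G))" using assms unfolding ext_arcs_def by (intro countable_lists) auto
  then have "countable (?c ` (lists (ext_arcs G) \<times> UNIV))" by (intro countable_image countable_SIGMA) auto
  moreover have "path_orbit G x \<subseteq> ?c ` (lists (ext_arcs G) \<times> UNIV)"
  proof
    fix y assume y: "y \<in> path_orbit G x"
    then obtain m l where ml: "(\<lambda>i. y (i + m)) = (\<lambda>i. x (i + l))" by (auto simp: path_orbit_def)
    have "y = ?c (map y [0..<m], l)"
    proof
      fix i
      show "y i = ?c (map y [0..<m], l) i"
        using fun_cong[OF ml, of "i - m"] by (cases "i < m") simp_all
    qed
    moreover have "map y [0..<m] \<in> lists (ext_arcs G)"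
      using ext_path_in_ext_arcs[OF path_orbit_ext_path[OF y]] by auto
    ultimately show "y \<in> ?c ` (lists (ext_arcs G) \<times> UNIV)" by blast
  qed
  ultimately show ?thesis using countable_subset by blast
qed

end

section \<open>The representation on a single orbit\<close>

locale orbit_representation = wf_digraph E for E :: "('v, 'e) pre_digraph" +
  fixes x :: "nat \<Rightarrow> 'e + 'v"
  assumes base: "ext_path E x"
    and countable_graph: "countable (verts E)" "countable (arcs E)"
    and row_fin: "row_finite E"
begin

abbreviation "X \<equiv> path_orbit E x"

text \<open>Naturals serve as coordinates because the universal property is tested on algebras of
  operators over \<open>nat \<Rightarrow> complex\<close>.\<close>

definition index :: "(nat \<Rightarrow> 'e + 'v) \<Rightarrow> nat" where "index = to_nat_on X"

definition indices :: "nat set" where "indices = index ` X"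

abbreviation "L \<equiv> ell2 indices"

sublocale L: hilbert_space L by (rule hilbert_space_ell2)

lemma inj_index: "inj_on index X"
  unfolding index_def by (rule inj_on_to_nat_on[OF countable_path_orbit[OF countable_graph]])

lemma index_eq_iff [simp]: "y \<in> X \<Longrightarrow> y' \<in> X \<Longrightarrow> index y = index y' \<longleftrightarrow> y = y'"
  using inj_index by (auto simp: inj_on_def)

lemma index_in [simp]: "y \<in> X \<Longrightarrow> index y \<in> indices"
  by (simp add: indices_def)

text \<open>Uses the action of the adjoint letter, because \<open>partial_map_operator\<close> moves
  basis vectors along the inverse of its map.\<close>

definition index_map :: "('v, 'e) generator \<Rightarrow> nat \<Rightarrow> nat option" where
  "index_map g i = (if i \<in> indices
     then map_option index (generator_action E (generator_star g) (inv_into X index i)) else None)"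

lemma index_map_index:
  "y \<in> X \<Longrightarrow> index_map g (index y) = map_option index (generator_action E (generator_star g) y)"
  by (simp add: index_map_def inv_into_f_f[OF inj_index])

lemma index_map_SomeD:
  assumes "g \<in> generators E" "index_map g i = Some j"
  shows "\<exists>y\<in>X. \<exists>y'\<in>X. i = index y \<and> j = index y' \<and> generator_action E (generator_star g) y = Some y'"
proof -
  have "i \<in> indices" using assms(2) by (simp add: index_map_def split: if_splits)
  then obtain y where y: "y \<in> X" "i = index y" by (auto simp: indices_def)
  then obtain y' where "generator_action E (generator_star g) y = Some y'" "j = index y'"
    using assms(2) index_map_index by auto
  moreover have "generator_star g \<in> generators E" using assms(1) by (auto simp: generators_def)
  ultimately show ?thesis using y generator_action_orbit by blast
qed

lemma generator_star_star [simp]: "generator_star (generator_star g) = g"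
  by (cases g) auto

lemma generator_star_in [simp]: "generator_star g \<in> generators E \<longleftrightarrow> g \<in> generators E"
  by (cases g) (auto simp: generators_def)

lemma partial_bijection_index_map:
  assumes g: "g \<in> generators E"
  shows "partial_bijection indices (index_map g) (index_map (generator_star g))"
proof
  have *: "index_map (generator_star g) j = Some i" if g: "g \<in> generators E" and ij: "index_map g i = Some j" for g i j
  proof -
    obtain y y' where y: "y \<in> X" "y' \<in> X" "i = index y" "j = index y'"
        "generator_action E (generator_star g) y = Some y'"
      using index_map_SomeD[OF g ij] by blast
    then have "generator_action E g y' = Some y"
      using generator_action_star[of "generator_star g" y y'] g path_orbit_ext_path by simp
    then show ?thesis using y index_map_index by simp
  qed
  show "index_map g i = Some j \<longleftrightarrow> index_map (generator_star g) j = Some i" for i j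
    using *[OF g, of i j] *[of "generator_star g" j i] g by auto
  show "index_map g i = Some j \<Longrightarrow> i \<in> indices \<and> j \<in> indices" for i j
    using index_map_SomeD[OF g, of i j] by auto
qed

definition shift_operator :: "('v, 'e) generator \<Rightarrow> (nat \<Rightarrow> complex) \<Rightarrow> nat \<Rightarrow> complex" where
  "shift_operator g = partial_map_operator indices (index_map g)"

lemma shift_operator_adjointable [simp]:
  "g \<in> generators E \<Longrightarrow> shift_operator g \<in> adjointable_operators L"
  and shift_operator_adjoint [simp]:
  "g \<in> generators E \<Longrightarrow> operator_adjoint L (shift_operator g) = shift_operator (generator_star g)"
  using partial_bijection_operator[OF partial_bijection_index_map, of g] by (simp_all add: shift_operator_def)

lemma shift_operator_index:
  "\<xi> \<in> carrier L \<Longrightarrow> y \<in> X \<Longrightarrow> shift_operator g \<xi> (index y) =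
    (case generator_action E (generator_star g) y of None \<Rightarrow> 0 | Some y' \<Rightarrow> \<xi> (index y'))"
  by (auto simp: shift_operator_def partial_map_operator_def index_map_index split: option.split)

lemma L_eqI:
  assumes "\<xi> \<in> carrier L" "\<eta> \<in> carrier L" "\<And>y. y \<in> X \<Longrightarrow> \<xi> (index y) = \<eta> (index y)"
  shows "\<xi> = \<eta>"
proof
  fix i show "\<xi> i = \<eta> i"
    using assms by (cases "i \<in> indices") (auto simp: carrier_ell2 indices_def)
qed

lemma shift_operator_closed [simp]: "g \<in> generators E \<Longrightarrow> \<xi> \<in> carrier L \<Longrightarrow> shift_operator g \<xi> \<in> carrier L"
  using L.adjointable_closed by simp

lemma operator_eqI:
  assumes "S \<in> extensional (carrier L)" "T \<in> extensional (carrier L)"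
    "\<And>\<xi>. \<xi> \<in> carrier L \<Longrightarrow> S \<xi> \<in> carrier L" "\<And>\<xi>. \<xi> \<in> carrier L \<Longrightarrow> T \<xi> \<in> carrier L"
    "\<And>\<xi> y. \<xi> \<in> carrier L \<Longrightarrow> y \<in> X \<Longrightarrow> S \<xi> (index y) = T \<xi> (index y)"
  shows "S = T"
  by (rule extensionalityI[OF assms(1,2)], rule L_eqI) (use assms(3-5) in auto)

lemma adjointable_extensional: "T \<in> adjointable_operators L \<Longrightarrow> T \<in> extensional (carrier L)"
  by (simp add: adjointable_operators_def)

abbreviation "BL \<equiv> operator_algebra L"

sublocale BL: cstar_algebra BL by (rule L.cstar_operator_algebra)

lemma finsum_operator:
  assumes "finite F" "\<And>f. f \<in> F \<Longrightarrow> T f \<in> adjointable_operators L" "\<xi> \<in> carrier L"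
  shows "(\<Oplus>\<^bsub>BL\<^esub>f\<in>F. T f) \<xi> i = (\<Sum>f\<in>F. T f \<xi> i)"
  using assms
proof (induction rule: finite_induct)
  case (insert f F)
  have "T \<in> F \<rightarrow> carrier BL" "T f \<in> carrier BL" using insert by auto
  then have "(\<Oplus>\<^bsub>BL\<^esub>f\<in>insert f F. T f) = T f \<oplus>\<^bsub>BL\<^esub> (\<Oplus>\<^bsub>BL\<^esub>f\<in>F. T f)"
    using insert by (intro BL.M.finsum_insert) auto
  then show ?case using insert by simp
qed simp

lemma generators_in [simp]:
  "Vertex v \<in> generators E \<longleftrightarrow> v \<in> verts E" "Edge f \<in> generators E \<longleftrightarrow> f \<in> arcs E"
  "Edge_star f \<in> generators E \<longleftrightarrow> f \<in> arcs E"
  by (auto simp: generators_def)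

lemma X_cons: "y \<in> X \<Longrightarrow> f \<in> arcs E \<Longrightarrow> ext_head E (y 0) = tail E f \<Longrightarrow> case_nat (Inl f) y \<in> X"
  using path_orbit_cons[of y x "Inl f"] by (simp add: ext_arcs_def)

lemma X_tail: "y \<in> X \<Longrightarrow> y 0 = Inl f \<Longrightarrow> ext_head E (y (Suc 0)) = tail E f"
  using path_orbit_ext_path[of y x] by (metis ext_path_def ext_tail_simps(1))

lemma case_nat_Suc_eq: "y 0 = a \<Longrightarrow> case_nat a (\<lambda>i. y (Suc i)) = y"
  by (auto simp: fun_eq_iff split: nat.split)

lemma orbit_ck_family: "ck_family E BL (\<lambda>v. shift_operator (Vertex v)) (\<lambda>f. shift_operator (Edge f))"
  unfolding ck_family_def
proof (intro conjI ballI impI)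
  fix v assume v: "v \<in> verts E"
  show "shift_operator (Vertex v) \<in> carrier BL" using v by simp
  show "star BL (shift_operator (Vertex v)) = shift_operator (Vertex v)" using v by simp
  show "shift_operator (Vertex v) \<otimes>\<^bsub>BL\<^esub> shift_operator (Vertex v) = shift_operator (Vertex v)"
    by (rule operator_eqI)
       (use v in \<open>auto simp: adjointable_extensional shift_operator_index generator_action_def\<close>)
  show "shift_operator (Vertex v) \<otimes>\<^bsub>BL\<^esub> shift_operator (Vertex w) = \<zero>\<^bsub>BL\<^esub>" if "w \<in> verts E" "v \<noteq> w" for w
    by (rule operator_eqI)
       (use v that BL.M.zero_closed L.M.zero_closed in \<open>auto simp: shift_operator_index generator_action_def\<close>)
  assume ns: "\<not> is_source E v"
  let ?T = "\<lambda>f. shift_operator (Edge f) \<otimes>\<^bsub>BL\<^esub> star BL (shift_operator (Edge f))"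
  have fin: "finite (in_arcs E v)" using row_fin v by (auto simp: row_finite_def)
  have T: "?T f \<in> adjointable_operators L" if "f \<in> in_arcs E v" for f
    using that BL.mult_closed[of "shift_operator (Edge f)" "star BL (shift_operator (Edge f))"] by simp
  have sum: "(\<Oplus>\<^bsub>BL\<^esub>f\<in>in_arcs E v. ?T f) \<in> adjointable_operators L"
    using BL.M.finsum_closed[of ?T "in_arcs E v"] T by auto
  show "shift_operator (Vertex v) = (\<Oplus>\<^bsub>BL\<^esub>f\<in>in_arcs E v. ?T f)"
  proof (rule operator_eqI)
    fix \<xi> y assume \<xi>: "\<xi> \<in> carrier L" and y: "y \<in> X"
    \<comment> \<open>The product of an edge operator with its adjoint is the coordinate projection
      onto the paths that begin with \<open>f\<close>.\<close>
    have Tf: "?T f \<xi> (index y) = (if y 0 = Inl f then \<xi> (index y) else 0)" if f: "f \<in> arcs E" for f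
      using f \<xi> y path_orbit_Suc[OF y] X_tail[OF y]
      by (auto simp: shift_operator_index generator_action_def case_nat_Suc_eq)
    have "(\<Oplus>\<^bsub>BL\<^esub>f\<in>in_arcs E v. ?T f) \<xi> (index y) = (\<Sum>f\<in>in_arcs E v. ?T f \<xi> (index y))"
      using fin T \<xi> by (rule finsum_operator)
    also have "\<dots> = (\<Sum>f\<in>in_arcs E v. if y 0 = Inl f then \<xi> (index y) else 0)"
      by (intro sum.cong refl Tf) auto
    \<comment> \<open>A path with range \<open>v\<close> begins with exactly one edge of the sum; it
      cannot begin with a loop, because \<open>v\<close> is not a source.\<close>
    also have "\<dots> = (if ext_head E (y 0) = v then \<xi> (index y) else 0)"
    proof (cases "y 0")
      case (Inl e)
      then have "e \<in> arcs E" using ext_path_in_ext_arcs[OF path_orbit_ext_path[OF y], of 0] by (auto simp: ext_arcs_def)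
      then show ?thesis using Inl fin by (simp add: sum.delta' in_arcs_def)
    next
      case (Inr u)
      then have "is_source E u" using ext_path_in_ext_arcs[OF path_orbit_ext_path[OF y], of 0] by (auto simp: ext_arcs_def)
      then show ?thesis using Inr ns by auto
    qed
    finally show "shift_operator (Vertex v) \<xi> (index y) = (\<Oplus>\<^bsub>BL\<^esub>f\<in>in_arcs E v. ?T f) \<xi> (index y)"
      using \<xi> y by (simp add: shift_operator_index generator_action_def)
  qed (use v sum L.adjointable_closed[OF sum] in \<open>auto intro: adjointable_extensional\<close>)
next
  fix f assume f: "f \<in> arcs E"
  show "shift_operator (Edge f) \<in> carrier BL" using f by simp
  show "shift_operator (Edge f) \<otimes>\<^bsub>BL\<^esub> star BL (shift_operator (Edge f)) \<otimes>\<^bsub>BL\<^esub> shift_operator (Edge f)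
      = shift_operator (Edge f)"
  proof (rule operator_eqI)
    fix \<xi> y assume "\<xi> \<in> carrier L" and y: "y \<in> X"
    then show "(shift_operator (Edge f) \<otimes>\<^bsub>BL\<^esub> star BL (shift_operator (Edge f)) \<otimes>\<^bsub>BL\<^esub> shift_operator (Edge f)) \<xi> (index y)
      = shift_operator (Edge f) \<xi> (index y)"
      using f path_orbit_Suc[OF y] X_tail[OF y]
      by (auto simp: shift_operator_index generator_action_def case_nat_Suc_eq)
  qed (use f in \<open>auto intro: adjointable_extensional\<close>)
  show "star BL (shift_operator (Edge f)) \<otimes>\<^bsub>BL\<^esub> shift_operator (Edge f) = shift_operator (Vertex (tail E f))"
  proof (rule operator_eqI)
    fix \<xi> y assume "\<xi> \<in> carrier L" and y: "y \<in> X"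
    then show "(star BL (shift_operator (Edge f)) \<otimes>\<^bsub>BL\<^esub> shift_operator (Edge f)) \<xi> (index y)
        = shift_operator (Vertex (tail E f)) \<xi> (index y)"
      using f X_cons[OF y f] by (auto simp: shift_operator_index generator_action_def)
  qed (use f in \<open>auto intro: adjointable_extensional\<close>)
qed

definition basis_vector :: "(nat \<Rightarrow> 'e + 'v) \<Rightarrow> nat \<Rightarrow> complex" where
  "basis_vector y = unit_vector (index y)"

lemma basis_vector_closed [simp]: "y \<in> X \<Longrightarrow> basis_vector y \<in> carrier L"
  by (simp add: basis_vector_def unit_vector_ell2)

lemma hinner_basis_vector: "hinner L \<xi> (basis_vector y) = \<xi> (index y)"
  unfolding basis_vector_def by (rule hinner_unit_vector)

lemma basis_vector_orthonormal:
  "y \<in> X \<Longrightarrow> y' \<in> X \<Longrightarrow> hinner L (basis_vector y) (basis_vector y') = (if y = y' then 1 else 0)"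
  unfolding hinner_basis_vector by (auto simp: basis_vector_def unit_vector_def)

lemma shift_operator_basis_vector:
  assumes g: "g \<in> generators E" and y: "y \<in> X"
  shows "shift_operator g (basis_vector y) =
    (case generator_action E g y of None \<Rightarrow> \<zero>\<^bsub>L\<^esub> | Some y' \<Rightarrow> basis_vector y')"
proof (rule L_eqI)
  fix w assume w: "w \<in> X"
  have iff: "generator_action E (generator_star g) w = Some y \<longleftrightarrow> generator_action E g y = Some w"
    using generator_action_star[of g y w] generator_action_star[of "generator_star g" w y] g
      path_orbit_ext_path y w by auto
  have lhs: "shift_operator g (basis_vector y) (index w) = (if generator_action E g y = Some w then 1 else 0)"
  proof (cases "generator_action E (generator_star g) w")
    case None
    then show ?thesis using iff y w by (auto simp: shift_operator_index)
  next
    case (Some w')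
    then have "w' \<in> X" using generator_action_orbit[of "generator_star g" w x w'] g w by simp
    then show ?thesis using Some iff y w
      by (simp add: shift_operator_index) (auto simp: basis_vector_def unit_vector_def)
  qed
  show "shift_operator g (basis_vector y) (index w) =
    (case generator_action E g y of None \<Rightarrow> \<zero>\<^bsub>L\<^esub> | Some y' \<Rightarrow> basis_vector y') (index w)"
  proof (cases "generator_action E g y")
    case None
    then show ?thesis using lhs by simp
  next
    case (Some y')
    then have "y' \<in> X" using generator_action_orbit g y by blast
    then show ?thesis using Some lhs w by (simp add: basis_vector_def unit_vector_def)
  qed
next
  show "(case generator_action E g y of None \<Rightarrow> \<zero>\<^bsub>L\<^esub> | Some y' \<Rightarrow> basis_vector y') \<in> carrier L"
    using generator_action_orbit[OF g y] L.M.zero_closed by (auto split: option.split)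
qed (use g y in simp)

text \<open>For a word of edges this is the action of
  \<open>s\<^sub>\<alpha> s\<^sub>\<alpha>\<^sup>*\<close> with \<open>\<alpha>\<close> the first
  \<open>n\<close> edges of \<open>y\<close>, written as a cut-off of coordinates.\<close>

definition cylinder :: "(nat \<Rightarrow> 'e + 'v) \<Rightarrow> nat \<Rightarrow> (nat \<Rightarrow> complex) \<Rightarrow> nat \<Rightarrow> complex" where
  "cylinder y n \<xi> = (\<lambda>i. if \<exists>w\<in>X. i = index w \<and> (\<forall>k<n. w k = y k) then \<xi> i else 0)"

lemma cylinder_closed: "\<xi> \<in> carrier L \<Longrightarrow> cylinder y n \<xi> \<in> carrier L"
proof -
  assume \<xi>: "\<xi> \<in> carrier L"
  have "(\<lambda>i. (cmod (cylinder y n \<xi> i))\<^sup>2) summable_on UNIV"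
    by (rule summable_on_comparison_real[where g="\<lambda>i. (cmod (\<xi> i))\<^sup>2"])
       (use \<xi> in \<open>auto simp: carrier_ell2 cylinder_def\<close>)
  then show ?thesis using \<xi> by (auto simp: carrier_ell2 cylinder_def)
qed

lemma cylinder_index:
  "w \<in> X \<Longrightarrow> cylinder y n \<xi> (index w) = (if \<forall>k<n. w k = y k then \<xi> (index w) else 0)"
  by (auto simp: cylinder_def)

text \<open>Remove the first edge by its adjoint, cut off along the shifted path, and put the edge
  back. At a loop the vertex operator alone isolates \<open>y\<close>, since only one path has a
  given source as its range.\<close>

lemma cylinder_in_invariant:
  assumes N: "N \<subseteq> carrier L" and inv: "\<And>g \<xi>. g \<in> generators E \<Longrightarrow> \<xi> \<in> N \<Longrightarrow> shift_operator g \<xi> \<in> N"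
    and "\<xi> \<in> N" and "y \<in> X"
  shows "cylinder y n \<xi> \<in> N"
  using assms(3,4)
proof (induction n arbitrary: y \<xi>)
  case 0
  then have "cylinder y 0 \<xi> = \<xi>" using N by (intro L_eqI) (auto simp: cylinder_index intro: cylinder_closed)
  then show ?case using 0 by simp
next
  case (Suc n)
  note y = \<open>y \<in> X\<close>
  have \<xi>: "\<xi> \<in> carrier L" using Suc N by auto
  show ?case
  proof (cases "y 0")
    case (Inl f)
    have f: "f \<in> arcs E" using ext_path_in_ext_arcs[OF path_orbit_ext_path[OF y], of 0] Inl by (auto simp: ext_arcs_def)
    let ?\<eta> = "cylinder (\<lambda>i. y (Suc i)) n (shift_operator (Edge_star f) \<xi>)"
    have "?\<eta> \<in> N" using Suc.IH[OF inv path_orbit_Suc[OF y]] Suc.prems f by simp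
    moreover have "cylinder y (Suc n) \<xi> = shift_operator (Edge f) ?\<eta>"
    proof (rule L_eqI)
      fix w assume w: "w \<in> X"
      have \<eta>: "?\<eta> \<in> carrier L" using \<xi> f by (intro cylinder_closed) simp
      show "cylinder y (Suc n) \<xi> (index w) = shift_operator (Edge f) ?\<eta> (index w)"
      proof (cases "w 0 = Inl f")
        case True
        have "(\<forall>k<Suc n. w k = y k) \<longleftrightarrow> (\<forall>k<n. w (Suc k) = y (Suc k))"
          using True Inl by (auto simp: less_Suc_eq_0_disj)
        then have "cylinder y (Suc n) \<xi> (index w) = (if \<forall>k<n. w (Suc k) = y (Suc k) then \<xi> (index w) else 0)"
          using w by (simp only: cylinder_index)
        moreover have "shift_operator (Edge f) ?\<eta> (index w) = ?\<eta> (index (\<lambda>i. w (Suc i)))"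
          using True w \<eta> by (simp add: shift_operator_index generator_action_def)
        moreover have "shift_operator (Edge_star f) \<xi> (index (\<lambda>i. w (Suc i))) = \<xi> (index w)"
          using True w \<xi> path_orbit_Suc[OF w] X_tail[OF w True]
          by (simp add: shift_operator_index generator_action_def case_nat_Suc_eq)
        ultimately show ?thesis using path_orbit_Suc[OF w] by (auto simp: cylinder_index)
      next
        case False
        then show ?thesis using w \<xi> \<eta> Inl
          by (auto simp: cylinder_index shift_operator_index generator_action_def)
      qed
    qed (use \<xi> f in \<open>auto intro!: cylinder_closed shift_operator_closed\<close>)
    ultimately show ?thesis using inv f by simp
  next
    case (Inr u)
    have u: "is_source E u" using ext_path_in_ext_arcs[OF path_orbit_ext_path[OF y], of 0] Inr by (auto simp: ext_arcs_def)
    then have uv: "u \<in> verts E" by (simp add: is_source_def)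
    have "cylinder y (Suc n) \<xi> = shift_operator (Vertex u) \<xi>"
    proof (rule L_eqI)
      fix w assume w: "w \<in> X"
      have "(\<forall>k<Suc n. w k = y k) \<longleftrightarrow> ext_head E (w 0) = u"
      proof
        assume "\<forall>k<Suc n. w k = y k"
        then show "ext_head E (w 0) = u" using Inr by auto
      next
        assume "ext_head E (w 0) = u"
        then have "w 0 = Inr u" using ext_path_source path_orbit_ext_path[OF w] u by blast
        then have "w = y" using ext_path_loop_eq path_orbit_ext_path w y Inr by metis
        then show "\<forall>k<Suc n. w k = y k" by simp
      qed
      then show "cylinder y (Suc n) \<xi> (index w) = shift_operator (Vertex u) \<xi> (index w)"
        using w \<xi> by (simp add: cylinder_index shift_operator_index generator_action_def)
    qed (use \<xi> uv in \<open>auto intro!: cylinder_closed shift_operator_closed\<close>)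
    then show ?thesis using inv uv Suc.prems by simp
  qed
qed

text \<open>Shrinking cylinders isolate a coordinate at which some vector of \<open>N\<close> is
  non-zero, so \<open>N\<close> contains a basis vector. The generators move it through the whole
  orbit, and the basis vectors span a dense subspace.\<close>

lemma invariant_subspace:
  assumes sub: "submodule N complex_ring L" and cl: "closed_wrt L (hnorm L) N"
    and inv: "\<And>g \<xi>. g \<in> generators E \<Longrightarrow> \<xi> \<in> N \<Longrightarrow> shift_operator g \<xi> \<in> N"
  shows "N = {\<zero>\<^bsub>L\<^esub>} \<or> N = carrier L"
proof (cases "N = {\<zero>\<^bsub>L\<^esub>}")
  case False
  note N = sub[unfolded L.submodule_iff]
  then have Nc: "N \<subseteq> carrier L" by blast
  obtain \<xi> where \<xi>: "\<xi> \<in> N" "\<xi> \<noteq> \<zero>\<^bsub>L\<^esub>" using False N by blast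
  then have \<xi>c: "\<xi> \<in> carrier L" using Nc by blast
  have "\<exists>y\<in>X. \<xi> (index y) \<noteq> 0"
  proof (rule ccontr)
    assume "\<not> ?thesis"
    then have "\<xi> = \<zero>\<^bsub>L\<^esub>" using \<xi>c L.M.zero_closed by (intro L_eqI) auto
    then show False using \<xi> by simp
  qed
  then obtain y where y: "y \<in> X" "\<xi> (index y) \<noteq> 0" by blast
  have smul_by: "(\<lambda>i. \<xi> (index y) * basis_vector y i) \<in> N"
  proof (rule L.closed_wrtD[OF cl Nc])
    show "(\<lambda>i. \<xi> (index y) * basis_vector y i) \<in> carrier L" using y by (intro ell2_smul) simp
    fix \<epsilon> :: real assume "\<epsilon> > 0"
    from ell2_tail[OF \<xi>c this] obtain F where F: "finite F" and tail0: "\<forall>d. (\<forall>i. d i = 0 \<or> d i = \<xi> i) \<and> (\<forall>i\<in>F. d i = 0) \<longrightarrow>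
        d \<in> carrier L \<and> hnorm L d < \<epsilon>"
      by (elim exE conjE)
    have tail: "d \<in> carrier L \<and> hnorm L d < \<epsilon>"
      if "\<And>i. d i = 0 \<or> d i = \<xi> i" "\<And>i. i \<in> F \<Longrightarrow> d i = 0" for d
      by (intro tail0[rule_format] conjI allI ballI that)
    \<comment> \<open>The finitely many competitors of \<open>y\<close> with a coordinate in
      \<open>F\<close>. Each of them leaves \<open>y\<close> at some letter, and \<open>n\<close> is
      chosen beyond these letters, so the cylinder excludes them all.\<close>
    define W where "W = {w \<in> X. index w \<in> F \<and> w \<noteq> y}"
    have "finite W"
      by (rule inj_on_finite[of index _ F]) (use F inj_index in \<open>auto simp: W_def intro: inj_on_subset\<close>)
    have "\<exists>k. w k \<noteq> y k" if "w \<in> W" for w using that by (auto simp: W_def fun_eq_iff)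
    then obtain k where k: "\<And>w. w \<in> W \<Longrightarrow> w (k w) \<noteq> y (k w)" by metis
    define n where "n = Suc (Max (insert 0 (k ` W)))"
    have n: "k w < n" if "w \<in> W" for w
      unfolding n_def using \<open>finite W\<close> that by (simp add: less_Suc_eq_le)
    have c: "cylinder y n \<xi> \<in> N" by (rule cylinder_in_invariant[OF Nc inv \<xi>(1) y(1)])
    define d where "d i = cylinder y n \<xi> i - \<xi> (index y) * basis_vector y i" for i
    have "d \<in> carrier L \<and> hnorm L d < \<epsilon>"
    proof (rule tail)
      fix i
      have supp: "d i = 0 \<or> d i = \<xi> i \<and> (\<exists>w\<in>X. i = index w \<and> w \<noteq> y \<and> (\<forall>k<n. w k = y k))"
        using y(1) by (auto simp: d_def cylinder_def basis_vector_def unit_vector_def)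
      then show "d i = 0 \<or> d i = \<xi> i" by blast
      assume i: "i \<in> F"
      show "d i = 0"
      proof (rule ccontr)
        assume "d i \<noteq> 0"
        then obtain w where "w \<in> X" "i = index w" "w \<noteq> y" "\<forall>k<n. w k = y k" using supp by blast
        then show False using k[of w] n[of w] i by (auto simp: W_def)
      qed
    qed
    moreover have "cylinder y n \<xi> \<ominus>\<^bsub>L\<^esub> (\<lambda>i. \<xi> (index y) * basis_vector y i) = d"
      using c Nc y ell2_smul[OF basis_vector_closed[OF y(1)]] by (subst ell2_minus) (auto simp: d_def fun_eq_iff)
    ultimately have "hnorm L ((\<lambda>i. \<xi> (index y) * basis_vector y i) \<ominus>\<^bsub>L\<^esub> cylinder y n \<xi>) < \<epsilon>"
      using c Nc ell2_smul[OF basis_vector_closed[OF y(1)], of "\<xi> (index y)"]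
        L.nrm_minus_commute[of "cylinder y n \<xi>" "\<lambda>i. \<xi> (index y) * basis_vector y i"] by auto
    then show "\<exists>\<eta>\<in>N. hnorm L ((\<lambda>i. \<xi> (index y) * basis_vector y i) \<ominus>\<^bsub>L\<^esub> \<eta>) < \<epsilon>" using c by blast
  qed
  have "inverse (\<xi> (index y)) \<odot>\<^bsub>L\<^esub> (\<lambda>i. \<xi> (index y) * basis_vector y i) = basis_vector y"
    using y(2) by (simp add: fun_eq_iff)
  then have yN: "basis_vector y \<in> N" using N smul_by by metis
  have act: "basis_vector w' \<in> N" if "basis_vector w \<in> N" "w \<in> X" "g \<in> generators E" "generator_action E g w = Some w'" for w w' g
    using inv[OF that(3,1)] shift_operator_basis_vector[OF that(3,2)] that(4) by simp
  \<comment> \<open>An edge operator and its adjoint carry the basis vectors into each other; a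
    shift of a loop changes nothing.\<close>
  have shift: "basis_vector (\<lambda>i. w (i + m)) \<in> N \<longleftrightarrow> basis_vector w \<in> N" if "w \<in> X" for w m
    using that
  proof (induction m arbitrary: w)
    case (Suc m)
    let ?w = "\<lambda>i. w (Suc i)"
    have w: "?w \<in> X" using path_orbit_Suc[OF Suc.prems] .
    have "basis_vector ?w \<in> N \<longleftrightarrow> basis_vector w \<in> N"
    proof (cases "w 0")
      case (Inl f)
      have f: "f \<in> arcs E" using ext_path_in_ext_arcs[OF path_orbit_ext_path[OF Suc.prems], of 0] Inl by (auto simp: ext_arcs_def)
      have "generator_action E (Edge_star f) w = Some ?w" "generator_action E (Edge f) ?w = Some w"
        using Inl X_tail[OF Suc.prems Inl] case_nat_Suc_eq[of w, OF Inl] by (simp_all add: generator_action_def)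
      then show ?thesis using act[of w "Edge_star f" ?w] act[of ?w "Edge f" w] w Suc.prems f by auto
    next
      case (Inr u)
      then have "w = (\<lambda>i. Inr u)" using ext_path_loop_eq path_orbit_ext_path Suc.prems by blast
      then show ?thesis by simp
    qed
    then show ?case using Suc.IH[OF w] by simp
  qed simp
  have all: "basis_vector w \<in> N" if w: "w \<in> X" for w
  proof -
    obtain m l where 1: "(\<lambda>i. y (i + m)) = (\<lambda>i. x (i + l))" using y(1) by (auto simp: path_orbit_def)
    obtain m' l' where 2: "(\<lambda>i. w (i + m')) = (\<lambda>i. x (i + l'))" using w by (auto simp: path_orbit_def)
    \<comment> \<open>The offsets are crossed over so that both sides become the tail of
      \<open>x\<close> from position \<open>l + l'\<close> on.\<close>
    have "(\<lambda>i. y (i + (m + l'))) = (\<lambda>i. w (i + (m' + l)))"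
    proof
      fix i
      have "y (i + l' + m) = x (i + l' + l)" "w (i + l + m') = x (i + l + l')"
        using fun_cong[OF 1, of "i + l'"] fun_cong[OF 2, of "i + l"] by auto
      then show "y (i + (m + l')) = w (i + (m' + l))" by (simp add: ac_simps)
    qed
    then show ?thesis using shift[OF y(1), of "m + l'"] shift[OF w, of "m' + l"] yN by simp
  qed
  have "carrier L \<subseteq> N"
  proof
    fix \<eta> assume \<eta>: "\<eta> \<in> carrier L"
    have fin: "(\<lambda>i. if i \<in> F then \<eta> i else 0) \<in> N" if "finite F" for F
      using that
    proof (induction rule: finite_induct)
      case empty
      then show ?case using N by simp
    next
      case (insert j F)
      have "(\<lambda>i. if i = j then \<eta> i else 0) \<in> N"
      proof (cases "j \<in> indices")
        case True
        then obtain w where w: "w \<in> X" "j = index w" by (auto simp: indices_def)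
        have "(\<lambda>i. if i = j then \<eta> i else 0) = \<eta> j \<odot>\<^bsub>L\<^esub> basis_vector w"
          using w by (auto simp: basis_vector_def unit_vector_def)
        then show ?thesis using N all[OF w(1)] by metis
      next
        case False
        then have "(\<lambda>i. if i = j then \<eta> i else 0) = \<zero>\<^bsub>L\<^esub>" using \<eta> by (auto simp: carrier_ell2)
        then show ?thesis using N by metis
      qed
      then have "(\<lambda>i. if i = j then \<eta> i else 0) \<oplus>\<^bsub>L\<^esub> (\<lambda>i. if i \<in> F then \<eta> i else 0) \<in> N"
        using insert N by blast
      moreover have "(\<lambda>i. if i = j then \<eta> i else 0) \<oplus>\<^bsub>L\<^esub> (\<lambda>i. if i \<in> F then \<eta> i else 0)
          = (\<lambda>i. if i \<in> insert j F then \<eta> i else 0)"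
        using insert by (auto simp: fun_eq_iff)
      ultimately show ?case by simp
    qed
    show "\<eta> \<in> N"
    proof (rule L.closed_wrtD[OF cl Nc \<eta>])
      fix \<epsilon> :: real assume "\<epsilon> > 0"
      from ell2_tail[OF \<eta> this] obtain F where F: "finite F" and tail0: "\<forall>d. (\<forall>i. d i = 0 \<or> d i = \<eta> i) \<and> (\<forall>i\<in>F. d i = 0) \<longrightarrow>
          d \<in> carrier L \<and> hnorm L d < \<epsilon>"
        by (elim exE conjE)
      have tail: "d \<in> carrier L \<and> hnorm L d < \<epsilon>"
        if "\<And>i. d i = 0 \<or> d i = \<eta> i" "\<And>i. i \<in> F \<Longrightarrow> d i = 0" for d
        by (intro tail0[rule_format] conjI allI ballI that)
      let ?f = "\<lambda>i. if i \<in> F then \<eta> i else 0"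
      have "hnorm L (\<lambda>i. \<eta> i - ?f i) < \<epsilon>" using tail[of "\<lambda>i. \<eta> i - ?f i"] by simp
      moreover have "\<eta> \<ominus>\<^bsub>L\<^esub> ?f = (\<lambda>i. \<eta> i - ?f i)" using \<eta> fin[OF F] Nc by (intro ell2_minus) auto
      ultimately show "\<exists>\<zeta>\<in>N. hnorm L (\<eta> \<ominus>\<^bsub>L\<^esub> \<zeta>) < \<epsilon>" using fin[OF F] by (intro bexI[of _ ?f]) simp
    qed
  qed
  then show ?thesis using Nc by blast
qed simp

end

context orbit_representation
begin

lemma irreducible_of_shift:
  assumes rep: "representation A L \<pi>"
    and gens: "\<And>g. g \<in> generators E \<Longrightarrow> a g \<in> carrier A"
    and act: "\<And>g \<xi>. g \<in> generators E \<Longrightarrow> \<xi> \<in> carrier L \<Longrightarrow> \<pi> (a g) \<xi> = shift_operator g \<xi>"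
  shows "irreducible_rep A L \<pi>"
  unfolding irreducible_rep_def
proof (intro conjI allI impI rep)
  let ?v = "ext_head E (x 0)"
  have x: "x \<in> X" using base by (rule path_orbit_self)
  have v: "?v \<in> verts E" by (rule ext_path_verts[OF base])
  then have g: "Vertex ?v \<in> generators E" by simp
  have "shift_operator (Vertex ?v) (basis_vector x) = basis_vector x"
    using shift_operator_basis_vector[OF g x] by (simp add: generator_action_def)
  then have "\<pi> (a (Vertex ?v)) (basis_vector x) = basis_vector x"
    using act[OF g] x by simp
  moreover have "basis_vector x \<noteq> \<zero>\<^bsub>L\<^esub>"
    by (auto simp: basis_vector_def unit_vector_def fun_eq_iff)
  ultimately show "\<exists>a\<in>carrier A. \<exists>\<xi>\<in>carrier L. \<pi> a \<xi> \<noteq> \<zero>\<^bsub>L\<^esub>"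
    using gens[OF g] x by (metis basis_vector_closed)
next
  fix N assume N: "submodule N complex_ring L \<and> closed_wrt L (hnorm L) N \<and> (\<forall>b\<in>carrier A. \<forall>\<xi>\<in>N. \<pi> b \<xi> \<in> N)"
  from N[THEN conjunct1] have Nc: "N \<subseteq> carrier L" unfolding L.submodule_iff by (rule conjunct1)
  have inv: "shift_operator g \<xi> \<in> N" if "g \<in> generators E" "\<xi> \<in> N" for g \<xi>
    using N[THEN conjunct2, THEN conjunct2, rule_format, OF gens[OF that(1)] that(2)]
      act[OF that(1) subsetD[OF Nc that(2)]] by (simp only:)
  show "N = {\<zero>\<^bsub>L\<^esub>} \<or> N = carrier L"
    by (rule invariant_subspace[OF N[THEN conjunct1] N[THEN conjunct2, THEN conjunct1] inv])
qed

lemma basis_vector_total: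
  assumes "\<xi> \<in> carrier L" "\<And>y. y \<in> X \<Longrightarrow> hinner L \<xi> (basis_vector y) = 0"
  shows "\<xi> = \<zero>\<^bsub>L\<^esub>"
  by (rule L_eqI) (use assms(1) assms(2)[unfolded hinner_basis_vector] L.M.zero_closed in auto)

end

section \<open>Transport to the vector type prescribed by \<open>irreps\<close>\<close>

lemma irreducible_rep_transport:
  assumes irr: "irreducible_rep A H \<pi>" and K: "hilbert_space K"
    and lin: "linear_on H K U" and bij: "bij_betw U (carrier H) (carrier K)"
    and iso: "\<And>x y. x \<in> carrier H \<Longrightarrow> y \<in> carrier H \<Longrightarrow> hinner K (U x) (U y) = hinner H x y"
    and A: "cstar_algebra A"
  shows "irreducible_rep A K (\<lambda>a y. U (\<pi> a (inv_into (carrier H) U y)))"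
proof -
  have repH: "representation A H \<pi>" using irr by (simp add: irreducible_rep_def)
  interpret cstar_representation A H \<pi>
    using A repH by (simp add: cstar_representation_def cstar_representation_axioms_def representation_def)
  interpret K: hilbert_space K by (rule K)
  define V where "V = inv_into (carrier H) U"
  have U: "U x \<in> carrier K" if "x \<in> carrier H" for x using lin that by (auto simp: linear_on_def)
  have Uadd: "U (x \<oplus>\<^bsub>H\<^esub> y) = U x \<oplus>\<^bsub>K\<^esub> U y" if "x \<in> carrier H" "y \<in> carrier H" for x y
    using lin that unfolding linear_on_def by blast
  have Usmul: "U (c \<odot>\<^bsub>H\<^esub> x) = c \<odot>\<^bsub>K\<^esub> U x" if "x \<in> carrier H" for x c
    using lin that unfolding linear_on_def by blast
  have Uminus: "U (x \<ominus>\<^bsub>H\<^esub> y) = U x \<ominus>\<^bsub>K\<^esub> U y" if "x \<in> carrier H" "y \<in> carrier H" for x y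
    using that by (simp add: H.minus_eq_smul K.minus_eq_smul Uadd Usmul U)
  have Uzero: "U \<zero>\<^bsub>H\<^esub> = \<zero>\<^bsub>K\<^esub>" using Usmul[of "\<zero>\<^bsub>H\<^esub>" 0] U by simp
  have V: "V y \<in> carrier H" "U (V y) = y" if "y \<in> carrier K" for y
    using that bij bij_betw_imp_surj_on[OF bij] unfolding V_def
    by (auto intro: inv_into_into f_inv_into_f)
  have VU: "V (U x) = x" if "x \<in> carrier H" for x
    using that bij unfolding V_def bij_betw_def by (simp add: inv_into_f_f)
  have Vadd: "V (x \<oplus>\<^bsub>K\<^esub> y) = V x \<oplus>\<^bsub>H\<^esub> V y" if "x \<in> carrier K" "y \<in> carrier K" for x y
    using VU[of "V x \<oplus>\<^bsub>H\<^esub> V y"] Uadd V that by simp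
  have Vsmul: "V (c \<odot>\<^bsub>K\<^esub> x) = c \<odot>\<^bsub>H\<^esub> V x" if "x \<in> carrier K" for x c
    using VU[of "c \<odot>\<^bsub>H\<^esub> V x"] Usmul V that by simp
  have norm: "hnorm K (U x) = hnorm H x" if "x \<in> carrier H" for x
    using iso[OF that that] by (simp add: hnorm_def)
  have normV: "hnorm H (V y) = hnorm K y" if "y \<in> carrier K" for y
    using norm[of "V y"] V that by simp
  have rep: "representation A K (\<lambda>a y. U (\<pi> a (V y)))"
    unfolding representation_def
  proof (intro conjI ballI allI K)
    fix a assume a: "a \<in> carrier A"
    show "bounded_operator K (\<lambda>y. U (\<pi> a (V y)))"
      unfolding bounded_operator_def linear_on_def
    proof (intro conjI ballI allI exI[of _ "2 * cnorm A a"])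
      show "(\<lambda>y. U (\<pi> a (V y))) \<in> carrier K \<rightarrow> carrier K" using a U V by auto
      fix y c assume y: "y \<in> carrier K"
      show "U (\<pi> a (V (c \<odot>\<^bsub>K\<^esub> y))) = c \<odot>\<^bsub>K\<^esub> U (\<pi> a (V y))"
        using a y V by (simp add: Vsmul rep_smul_arg Usmul)
      show "hnorm K (U (\<pi> a (V y))) \<le> 2 * cnorm A a * hnorm K y"
        using a y V rep_bound[of a "V y"] by (simp add: norm normV)
      fix z assume z: "z \<in> carrier K"
      show "U (\<pi> a (V (y \<oplus>\<^bsub>K\<^esub> z))) = U (\<pi> a (V y)) \<oplus>\<^bsub>K\<^esub> U (\<pi> a (V z))"
        using a y z V by (simp add: Vadd rep_add_arg Uadd)
    qed
    show "U (\<pi> (c \<odot>\<^bsub>A\<^esub> a) (V y)) = c \<odot>\<^bsub>K\<^esub> U (\<pi> a (V y))" if "y \<in> carrier K" for c y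
      using a that V by (simp add: rep_smul Usmul)
    show "hinner K (U (\<pi> a (V y))) z = hinner K y (U (\<pi> (star A a) (V z)))"
      if "y \<in> carrier K" "z \<in> carrier K" for y z
      using iso[of "\<pi> a (V y)" "V z"] iso[of "V y" "\<pi> (star A a) (V z)"] that a V
      by (simp add: rep_adjoint)
    fix b assume b: "b \<in> carrier A"
    show "U (\<pi> (a \<oplus>\<^bsub>A\<^esub> b) (V y)) = U (\<pi> a (V y)) \<oplus>\<^bsub>K\<^esub> U (\<pi> b (V y))" if "y \<in> carrier K" for y
      using a b that V by (simp add: rep_add Uadd)
    show "U (\<pi> (a \<otimes>\<^bsub>A\<^esub> b) (V y)) = U (\<pi> a (V (U (\<pi> b (V y)))))" if "y \<in> carrier K" for y
      using a b that V by (simp add: rep_mult VU)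
  qed
  show ?thesis
    unfolding irreducible_rep_def V_def[symmetric]
  proof (intro conjI allI impI rep)
    obtain a x where ax: "a \<in> carrier A" "x \<in> carrier H" "\<pi> a x \<noteq> \<zero>\<^bsub>H\<^esub>"
      using irr by (auto simp: irreducible_rep_def)
    then have "U (\<pi> a (V (U x))) \<noteq> \<zero>\<^bsub>K\<^esub>"
      using VU[OF ax(2)] VU[of "\<pi> a x"] VU[of "\<zero>\<^bsub>H\<^esub>"] Uzero by auto
    then show "\<exists>a\<in>carrier A. \<exists>x\<in>carrier K. U (\<pi> a (V x)) \<noteq> \<zero>\<^bsub>K\<^esub>" using ax U by blast
  next
    fix N assume *: "submodule N complex_ring K \<and> closed_wrt K (hnorm K) N \<and>
      (\<forall>a\<in>carrier A. \<forall>x\<in>N. U (\<pi> a (V x)) \<in> N)"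
    note N = *[THEN conjunct1, unfolded K.submodule_iff]
    \<comment> \<open>Pulls the invariant subspace back along the unitary, where irreducibility
      applies.\<close>
    define M where "M = {x \<in> carrier H. U x \<in> N}"
    have "submodule M complex_ring H"
      using N unfolding H.submodule_iff M_def by (auto simp: Uzero Uadd Usmul)
    moreover have "closed_wrt H (hnorm H) M"
      unfolding closed_wrt_def
    proof (intro allI impI, elim conjE)
      fix f :: "nat \<Rightarrow> 'b" and l
      assume f: "range f \<subseteq> M" and l: "l \<in> carrier H" and lim: "(\<lambda>n. hnorm H (f n \<ominus>\<^bsub>H\<^esub> l)) \<longlonglongrightarrow> 0"
      have fM: "f n \<in> carrier H" "U (f n) \<in> N" for n using f by (auto simp: M_def)
      have "hnorm K (U (f n) \<ominus>\<^bsub>K\<^esub> U l) = hnorm H (f n \<ominus>\<^bsub>H\<^esub> l)" for n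
        using norm[of "f n \<ominus>\<^bsub>H\<^esub> l"] fM l by (simp add: Uminus)
      then have "(\<lambda>n. hnorm K (U (f n) \<ominus>\<^bsub>K\<^esub> U l)) \<longlonglongrightarrow> 0" using lim by simp
      moreover have "range (\<lambda>n. U (f n)) \<subseteq> N" using fM by auto
      ultimately have "U l \<in> N"
        using *[THEN conjunct2, THEN conjunct1] U[OF l] unfolding closed_wrt_def by blast
      then show "l \<in> M" using l by (simp add: M_def)
    qed
    moreover have "\<pi> a x \<in> M" if "a \<in> carrier A" "x \<in> M" for a x
      using *[THEN conjunct2, THEN conjunct2, rule_format, of a "U x"] that VU[of x] by (auto simp: M_def)
    ultimately have M: "M = {\<zero>\<^bsub>H\<^esub>} \<or> M = carrier H" using irr unfolding irreducible_rep_def by blast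
    have NM: "y \<in> N \<longleftrightarrow> y \<in> carrier K \<and> V y \<in> M" for y using N V by (auto simp: M_def)
    from M show "N = {\<zero>\<^bsub>K\<^esub>} \<or> N = carrier K"
    proof
      assume M0: "M = {\<zero>\<^bsub>H\<^esub>}"
      have "y = \<zero>\<^bsub>K\<^esub>" if "y \<in> N" for y
        using NM[of y] that V(2)[of y] M0 Uzero by auto
      then show ?thesis using N by blast
    next
      assume "M = carrier H"
      then have "N = carrier K" using NM V by auto
      then show ?thesis by blast
    qed
  qed
qed

lemma ell2_relabel:
  assumes inj: "inj_on \<kappa> I"
  defines "U \<equiv> (\<lambda>\<xi> j. if j \<in> \<kappa> ` I then \<xi> (inv_into I \<kappa> j) else 0)"
  shows "linear_on (ell2 I) (ell2 (\<kappa> ` I)) U"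
    and "bij_betw U (carrier (ell2 I)) (carrier (ell2 (\<kappa> ` I)))"
    and "\<And>\<xi> \<eta>. \<xi> \<in> carrier (ell2 I) \<Longrightarrow> \<eta> \<in> carrier (ell2 I) \<Longrightarrow>
      hinner (ell2 (\<kappa> ` I)) (U \<xi>) (U \<eta>) = hinner (ell2 I) \<xi> \<eta>"
proof -
  have inv: "inv_into I \<kappa> (\<kappa> i) = i" if "i \<in> I" for i using inj that by (rule inv_into_f_f)
  have bij: "bij_betw \<kappa> I (\<kappa> ` I)" using inj by (simp add: bij_betw_def)
  \<comment> \<open>A general \<open>h\<close> with \<open>h 0 0 = 0\<close> treats the sums of
    squares and the inner products together.\<close>
  have transfer: "(\<lambda>j. h (U \<xi> j) (U \<eta> j)) summable_on UNIV \<longleftrightarrow> (\<lambda>i. h (\<xi> i) (\<eta> i)) summable_on UNIV"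
    "infsum (\<lambda>j. h (U \<xi> j) (U \<eta> j)) UNIV = infsum (\<lambda>i. h (\<xi> i) (\<eta> i)) UNIV"
    if \<xi>: "\<And>i. i \<notin> I \<Longrightarrow> \<xi> i = 0" and \<eta>: "\<And>i. i \<notin> I \<Longrightarrow> \<eta> i = 0" and h: "h 0 0 = 0"
    for \<xi> \<eta> and h :: "complex \<Rightarrow> complex \<Rightarrow> 'c :: {comm_monoid_add, t2_space}"
  proof -
    have 1: "(\<lambda>j. h (U \<xi> j) (U \<eta> j)) summable_on UNIV \<longleftrightarrow> (\<lambda>j. h (U \<xi> j) (U \<eta> j)) summable_on \<kappa> ` I"
      by (rule summable_on_cong_neutral) (auto simp: U_def h)
    have 2: "infsum (\<lambda>j. h (U \<xi> j) (U \<eta> j)) UNIV = infsum (\<lambda>j. h (U \<xi> j) (U \<eta> j)) (\<kappa> ` I)"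
      by (rule infsum_cong_neutral) (auto simp: U_def h)
    have 3: "(\<lambda>i. h (\<xi> i) (\<eta> i)) summable_on UNIV \<longleftrightarrow> (\<lambda>i. h (U \<xi> (\<kappa> i)) (U \<eta> (\<kappa> i))) summable_on I"
      by (rule summable_on_cong_neutral) (auto simp: U_def h \<xi> \<eta> inv)
    have 4: "infsum (\<lambda>i. h (\<xi> i) (\<eta> i)) UNIV = infsum (\<lambda>i. h (U \<xi> (\<kappa> i)) (U \<eta> (\<kappa> i))) I"
      by (rule infsum_cong_neutral) (auto simp: U_def h \<xi> \<eta> inv)
    show "(\<lambda>j. h (U \<xi> j) (U \<eta> j)) summable_on UNIV \<longleftrightarrow> (\<lambda>i. h (\<xi> i) (\<eta> i)) summable_on UNIV"
      unfolding 1 3 by (rule summable_on_reindex_bij_betw[OF bij, symmetric])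
    show "infsum (\<lambda>j. h (U \<xi> j) (U \<eta> j)) UNIV = infsum (\<lambda>i. h (\<xi> i) (\<eta> i)) UNIV"
      unfolding 2 4 by (rule infsum_reindex_bij_betw[OF bij, symmetric])
  qed
  have closed: "U \<xi> \<in> carrier (ell2 (\<kappa> ` I))" if "\<xi> \<in> carrier (ell2 I)" for \<xi>
    using that transfer(1)[of \<xi> \<xi> "\<lambda>a b. (cmod a)\<^sup>2"] by (auto simp: carrier_ell2 U_def)
  show "linear_on (ell2 I) (ell2 (\<kappa> ` I)) U"
    unfolding linear_on_def using closed by (auto simp: U_def fun_eq_iff)
  show "hinner (ell2 (\<kappa> ` I)) (U \<xi>) (U \<eta>) = hinner (ell2 I) \<xi> \<eta>"
    if "\<xi> \<in> carrier (ell2 I)" "\<eta> \<in> carrier (ell2 I)" for \<xi> \<eta>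
    using that transfer(2)[of \<xi> \<eta> "\<lambda>a b. a * cnj b"] by (simp add: carrier_ell2)
  define W where "W \<eta> i = (if i \<in> I then \<eta> (\<kappa> i) else 0)" for \<eta> :: "'b \<Rightarrow> complex" and i
  have UW: "U (W \<eta>) = \<eta>" if "\<eta> \<in> carrier (ell2 (\<kappa> ` I))" for \<eta>
    using that by (auto simp: U_def W_def carrier_ell2 fun_eq_iff inv)
  have WU: "W (U \<xi>) = \<xi>" if "\<xi> \<in> carrier (ell2 I)" for \<xi>
    using that by (auto simp: U_def W_def carrier_ell2 fun_eq_iff inv)
  have Wc: "W \<eta> \<in> carrier (ell2 I)" if "\<eta> \<in> carrier (ell2 (\<kappa> ` I))" for \<eta>
    using that UW[OF that] transfer(1)[of "W \<eta>" "W \<eta>" "\<lambda>a b. (cmod a)\<^sup>2"]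
    by (auto simp: carrier_ell2 W_def)
  show "bij_betw U (carrier (ell2 I)) (carrier (ell2 (\<kappa> ` I)))"
    by (rule bij_betw_byWitness[where f'=W]) (use UW WU Wc closed in auto)
qed

section \<open>Action of words near a given path\<close>

fun word_action ::
    "('v, 'e) pre_digraph \<Rightarrow> ('v, 'e) generator list \<Rightarrow> (nat \<Rightarrow> 'e + 'v) \<Rightarrow> (nat \<Rightarrow> 'e + 'v) option" where
  "word_action E [] y = Some y"
| "word_action E (g # ws) y = (case word_action E ws y of None \<Rightarrow> None | Some y' \<Rightarrow> generator_action E g y')"

definition prepend :: "'e list \<Rightarrow> (nat \<Rightarrow> 'e + 'v) \<Rightarrow> nat \<Rightarrow> 'e + 'v" where
  "prepend es y = (\<lambda>i. if i < length es then Inl (es ! i) else y (i - length es))"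

lemma prepend_simps [simp]: "prepend [] y = y" "prepend (e # es) y = case_nat (Inl e) (prepend es y)"
  by (auto simp: prepend_def fun_eq_iff split: nat.split)

lemma prepend_0: "prepend es y 0 = (if es = [] then y 0 else Inl (hd es))"
  by (cases es) auto

context acyclic_digraph
begin

lemma ext_path_no_repeat:
  assumes y: "ext_path E y" and ij: "i < j" and real: "\<And>k. i \<le> k \<Longrightarrow> k < j \<Longrightarrow> \<exists>e. y k = Inl e"
    and eq: "ext_head E (y i) = ext_head E (y j)"
  shows False
proof -
  have "\<forall>k. \<exists>e. k < j - i \<longrightarrow> y (i + k) = Inl e" using real by auto
  then obtain e where "\<And>k. k < j - i \<Longrightarrow> y (i + k) = Inl (e k)" by metis
  from ext_path_segment[OF y this, of "j - i"] have "path_between E (ext_head E (y i)) (map e [0..<j - i]) (ext_head E (y i))"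
    using eq ij by simp
  from closed_path_empty[OF this] show False using ij by simp
qed

text \<open>A word inspects only finitely many letters: near \<open>w\<close> it is undefined or
  replaces the first \<open>m\<close> edges by \<open>\<beta>\<close>. The condition
  \<open>m < n\<close> fixes also the letter at position \<open>m\<close>, which the next generator
  meets when \<open>\<beta>\<close> is empty.\<close>

lemma word_action_local:
  assumes "set ws \<subseteq> generators E"
  shows "\<exists>n. (\<forall>y. (\<forall>i<n. y i = w i) \<longrightarrow> word_action E ws y = None) \<or>
    (\<exists>m \<beta>. m < n \<and> (\<forall>i<m. \<exists>e. w i = Inl e) \<and>
       (\<forall>y. (\<forall>i<n. y i = w i) \<longrightarrow> word_action E ws y = Some (prepend \<beta> (\<lambda>i. y (i + m)))))"
  using assms
proof (induction ws)
  case Nil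
  show ?case by (intro exI[of _ 1] disjI2 exI[of _ 0] exI[of _ "[]"]) simp
next
  case (Cons g ws)
  then obtain n where "(\<forall>y. (\<forall>i<n. y i = w i) \<longrightarrow> word_action E ws y = None) \<or>
    (\<exists>m \<beta>. m < n \<and> (\<forall>i<m. \<exists>e. w i = Inl e) \<and>
       (\<forall>y. (\<forall>i<n. y i = w i) \<longrightarrow> word_action E ws y = Some (prepend \<beta> (\<lambda>i. y (i + m)))))" by auto
  then show ?case
  proof (elim disjE exE conjE)
    assume "\<forall>y. (\<forall>i<n. y i = w i) \<longrightarrow> word_action E ws y = None"
    then show ?thesis by (intro exI[of _ n] disjI1) auto
  next
    fix m \<beta> assume m: "m < n" "\<forall>i<m. \<exists>e. w i = Inl e"
      and act: "\<forall>y. (\<forall>i<n. y i = w i) \<longrightarrow> word_action E ws y = Some (prepend \<beta> (\<lambda>i. y (i + m)))"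
    \<comment> \<open>The first letter of the image, the same for all paths near \<open>w\<close>;
      it decides whether the next generator applies.\<close>
    define a where "a = prepend \<beta> (\<lambda>i. w (i + m)) 0"
    have a: "prepend \<beta> (\<lambda>i. y (i + m)) 0 = a" if "\<forall>i<n. y i = w i" for y
      using that m by (simp add: a_def prepend_0)
    have none: ?thesis if "\<And>y. y 0 = a \<Longrightarrow> generator_action E g y = None"
      using that a act by (intro exI[of _ n] disjI1) simp
    show ?thesis
    proof (cases g)
      case (Vertex v)
      show ?thesis
      proof (cases "ext_head E a = v")
        case True
        then show ?thesis using a act m Vertex
          by (intro exI[of _ n] disjI2 exI[of _ m] exI[of _ \<beta>]) (simp add: generator_action_def)
      qed (use none Vertex in \<open>simp add: generator_action_def\<close>)
    next
      case (Edge f)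
      show ?thesis
      proof (cases "ext_head E a = tail E f")
        case True
        then show ?thesis using a act m Edge
          by (intro exI[of _ n] disjI2 exI[of _ m] exI[of _ "f # \<beta>"]) (simp add: generator_action_def)
      qed (use none Edge in \<open>simp add: generator_action_def\<close>)
    next
      case (Edge_star f)
      show ?thesis
      proof (cases "a = Inl f")
        case True
        show ?thesis
        proof (cases \<beta>)
          case Nil
          \<comment> \<open>Nothing of \<open>\<beta>\<close> is left to cancel, so the adjoint
            removes one more edge of the path itself and both \<open>m\<close> and \<open>n\<close>
            grow by one.\<close>
          then have wm: "w m = Inl f" using True by (simp add: a_def)
          have "\<forall>i<Suc m. \<exists>e. w i = Inl e" using m wm by (auto simp: less_Suc_eq)
          then show ?thesis using a act m Edge_star Nil True
            by (intro exI[of _ "Suc n"] disjI2 exI[of _ "Suc m"] exI[of _ "[]"]) (auto simp: generator_action_def)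
        next
          case (Cons b \<beta>')
          then show ?thesis using a act m Edge_star True
            by (intro exI[of _ n] disjI2 exI[of _ m] exI[of _ \<beta>']) (auto simp: generator_action_def)
        qed
      qed (use none Edge_star in \<open>simp add: generator_action_def\<close>)
    qed
  qed
qed

text \<open>
  Since there are no cycles, a word which maps a path close to \<open>w\<close> to a path close to \<open>w\<close> replaces
  a segment by itself.
\<close>

lemma word_action_near:
  assumes ws: "set ws \<subseteq> generators E" and w: "ext_path E w"
  shows "\<exists>N. \<forall>y y'. (\<forall>i<N. y i = w i) \<longrightarrow> (\<forall>i<N. y' i = w i) \<longrightarrow>
    (word_action E ws y = Some y' \<longleftrightarrow> word_action E ws w = Some w \<and> y = y')"
proof -
  obtain n where "(\<forall>y. (\<forall>i<n. y i = w i) \<longrightarrow> word_action E ws y = None) \<or>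
    (\<exists>m \<beta>. m < n \<and> (\<forall>i<m. \<exists>e. w i = Inl e) \<and>
       (\<forall>y. (\<forall>i<n. y i = w i) \<longrightarrow> word_action E ws y = Some (prepend \<beta> (\<lambda>i. y (i + m)))))"
    by (rule exE[OF word_action_local[OF ws, of w]])
  then show ?thesis
  proof (elim disjE exE conjE)
    assume "\<forall>y. (\<forall>i<n. y i = w i) \<longrightarrow> word_action E ws y = None"
    then show ?thesis by (intro exI[of _ n]) simp
  next
    fix m \<beta> assume m: "m < n" and real: "\<forall>i<m. \<exists>e. w i = Inl e"
      and act: "\<forall>y. (\<forall>i<n. y i = w i) \<longrightarrow> word_action E ws y = Some (prepend \<beta> (\<lambda>i. y (i + m)))"
    \<comment> \<open>Agreement up to \<open>N\<close> covers the \<open>n\<close> letters above as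
      well as the positions \<open>m\<close> and \<open>length \<beta>\<close> compared
      below.\<close>
    define N where "N = n + m + length \<beta> + 1"
    have act: "word_action E ws y = Some (prepend \<beta> (\<lambda>i. y (i + m)))" if "\<forall>i<N. y i = w i" for y
      by (rule act[rule_format]) (use that in \<open>simp add: N_def\<close>)
    show ?thesis
    proof (cases "length \<beta> = m \<and> (\<forall>i<m. Inl (\<beta> ! i) = w i)")
      case True
      have "prepend \<beta> (\<lambda>i. y (i + m)) = y" if "\<forall>i<N. y i = w i" for y
        using that True by (auto simp: prepend_def fun_eq_iff N_def)
      then have "word_action E ws y = Some y" if "\<forall>i<N. y i = w i" for y
        using act[OF that] that by simp
      then show ?thesis by (intro exI[of _ N] allI impI) auto
    next
      case False
      have no: "prepend \<beta> (\<lambda>i. y (i + m)) \<noteq> y'" if y: "\<forall>i<N. y i = w i" and y': "\<forall>i<N. y' i = w i" for y y'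
      proof
        assume eq: "prepend \<beta> (\<lambda>i. y (i + m)) = y'"
        let ?b = "length \<beta>"
        have pre: "w i = Inl (\<beta> ! i)" if "i < ?b" for i
          using fun_cong[OF eq, of i] y' that by (simp add: prepend_def N_def)
        have "y m = y' ?b" using fun_cong[OF eq, of ?b] by (simp add: prepend_def)
        moreover have "y m = w m" "y' ?b = w ?b" using y y' by (simp_all add: N_def)
        \<comment> \<open>If the removed and the inserted segment differ in length, \<open>w\<close>
          shows the same letter at two positions with only edges from the first to just before the
          second, that is, a closed path.\<close>
        ultimately have wm: "w m = w ?b" by simp
        consider "?b = m" | "?b < m" | "m < ?b" by linarith
        then show False
        proof cases
          case 1
          then show ?thesis using pre False by auto
        next
          case 2
          then show ?thesis using ext_path_no_repeat[OF w 2] real wm by auto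
        next
          case 3
          then show ?thesis using ext_path_no_repeat[OF w 3] pre wm by auto
        qed
      qed
      have "word_action E ws y \<noteq> Some y'" if "\<forall>i<N. y i = w i" "\<forall>i<N. y' i = w i" for y y'
        using act[OF that(1)] no[OF that] by simp
      then show ?thesis by (intro exI[of _ N] allI impI) auto
    qed
  qed
qed

lemma ext_path_prepend:
  assumes "path_between E v xs (ext_head E (y 0))" "ext_path E y"
  shows "ext_path E (prepend xs y)" "ext_head E (prepend xs y 0) = v"
proof -
  have "ext_path E (prepend xs y) \<and> ext_head E (prepend xs y 0) = v"
    using assms(1)
  proof (induction xs arbitrary: v)
    case (Cons e xs)
    then have "e \<in> arcs E" "head E e = v" and IH: "ext_path E (prepend xs y)" "ext_head E (prepend xs y 0) = tail E e"
      by auto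
    then show ?case using ext_path_cons[OF _ _ IH(1), of "Inl e"] by (simp add: ext_arcs_def)
  qed (use assms(2) in simp)
  then show "ext_path E (prepend xs y)" "ext_head E (prepend xs y 0) = v" by auto
qed

text \<open>If one prefix were shorter, the longer one would pass through the range of
  \<open>y\<close> at the end of the shorter and again at its own end.\<close>

lemma prepend_eq_iff:
  assumes xs: "path_between E v xs (ext_head E (y 0))" and ys: "path_between E v ys (ext_head E (y 0))"
    and y: "ext_path E y"
  shows "prepend xs y = prepend ys y \<longleftrightarrow> xs = ys"
proof
  have *: False
    if eq: "prepend xs y = prepend ys y" and lt: "length xs < length ys"
      and ys: "path_between E v ys (ext_head E (y 0))" for xs ys
  proof (rule ext_path_no_repeat[OF ext_path_prepend(1)[OF ys y] lt])
    show "\<exists>e. prepend ys y k = Inl e" if "k < length ys" for k using that by (simp add: prepend_def)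
    have "prepend ys y (length xs) = y 0" using fun_cong[OF eq, of "length xs"] by (simp add: prepend_def)
    then show "ext_head E (prepend ys y (length xs)) = ext_head E (prepend ys y (length ys))"
      by (simp add: prepend_def)
  qed
  assume eq: "prepend xs y = prepend ys y"
  have len: "length xs = length ys"
    using *[OF eq _ ys] *[OF eq[symmetric] _ xs] by (meson linorder_neqE_nat)
  show "xs = ys"
  proof (rule nth_equalityI[OF len])
    fix i assume "i < length xs"
    then show "xs ! i = ys ! i" using fun_cong[OF eq, of i] len by (simp add: prepend_def)
  qed
qed simp

lemma prepend_orbit:
  assumes "path_between E v xs (ext_head E (y 0))" "ext_path E y"
  shows "prepend xs y \<in> path_orbit E y"
proof -
  have "(\<lambda>i. prepend xs y (i + length xs)) = (\<lambda>i. y (i + 0))" by (simp add: prepend_def)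
  then show ?thesis using ext_path_prepend(1)[OF assms] unfolding path_orbit_def by blast
qed

lemma splice_orbit:
  assumes w: "ext_path E w" and y: "y \<in> path_orbit E x" and eq: "ext_head E (w k) = ext_head E (y 0)"
  shows "(\<lambda>i. if i < k then w i else y (i - k)) \<in> path_orbit E x"
proof -
  let ?s = "\<lambda>i. if i < k then w i else y (i - k)"
  have yp: "ext_path E y" using y by (rule path_orbit_ext_path)
  obtain m l where "(\<lambda>i. y (i + m)) = (\<lambda>i. x (i + l))" using y by (auto simp: path_orbit_def)
  then have "(\<lambda>i. ?s (i + (m + k))) = (\<lambda>i. x (i + l))" by (auto simp: fun_eq_iff)
  moreover have "ext_path E ?s"
    unfolding ext_path_def
  proof (intro conjI allI)
    show "range ?s \<subseteq> ext_arcs E" using ext_path_in_ext_arcs w yp by auto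
    fix i
    consider "Suc i < k" | "Suc i = k" | "k < Suc i" by linarith
    then show "ext_tail E (?s i) = ext_head E (?s (Suc i))"
    proof cases
      case 3
      then have "Suc i - k = Suc (i - k)" by simp
      then show ?thesis using 3 yp by (simp add: ext_path_def)
    qed (use w eq in \<open>auto simp: ext_path_def\<close>)
  qed
  ultimately show ?thesis unfolding path_orbit_def by blast
qed

end

section \<open>Path representations as points of the spectrum and their limits\<close>

locale universal_graph_algebra = graph_algebra E A p s
  for E :: "('v, 'e) pre_digraph" and A :: "'a cstar" and p s +
  assumes countable_verts: "countable (verts E)" and countable_arcs: "countable (arcs E)"
    and universal: "\<And>(B :: ((nat \<Rightarrow> complex) \<Rightarrow> nat \<Rightarrow> complex) cstar) q t.
      cstar_algebra B \<Longrightarrow> ck_family E B q t \<Longrightarrow>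
      \<exists>\<phi>. star_hom A B \<phi> \<and> (\<forall>v\<in>verts E. \<phi> (p v) = q v) \<and> (\<forall>f\<in>arcs E. \<phi> (s f) = t f)"
begin

text \<open>Keeps only what the limit argument uses: an irreducible representation of the prescribed
  type with a total orthonormal family, indexed by paths, that the generators permute partially. The
  two coordinate systems stay hidden.\<close>

definition path_rep :: "(nat \<Rightarrow> 'e + 'v) \<Rightarrow> 'a rep \<Rightarrow> ((nat \<Rightarrow> 'e + 'v) \<Rightarrow> 'a \<Rightarrow> complex) \<Rightarrow> bool" where
  "path_rep x \<pi> e \<longleftrightarrow> ext_path E x \<and> \<pi> \<in> irreps A \<and>
     (\<forall>y\<in>path_orbit E x. e y \<in> carrier (fst \<pi>)) \<and>
     (\<forall>y\<in>path_orbit E x. \<forall>y'\<in>path_orbit E x. hinner (fst \<pi>) (e y) (e y') = (if y = y' then 1 else 0)) \<and>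
     (\<forall>\<xi>\<in>carrier (fst \<pi>). (\<forall>y\<in>path_orbit E x. hinner (fst \<pi>) \<xi> (e y) = 0) \<longrightarrow> \<xi> = \<zero>\<^bsub>fst \<pi>\<^esub>) \<and>
     (\<forall>g\<in>generators E. \<forall>y\<in>path_orbit E x. snd \<pi> (gen_elem g) (e y) =
        (case generator_action E g y of None \<Rightarrow> \<zero>\<^bsub>fst \<pi>\<^esub> | Some y' \<Rightarrow> e y'))"

lemma path_rep_exists:
  assumes x: "ext_path E x"
  shows "\<exists>\<pi> e. path_rep x \<pi> e"
proof -
  interpret O: orbit_representation E x
    using x countable_verts countable_arcs row_fin G.wf_digraph_axioms
    by (simp add: orbit_representation_def orbit_representation_axioms_def)
  obtain \<phi> where hom: "star_hom A O.BL \<phi>"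
    and v: "\<And>v. v \<in> verts E \<Longrightarrow> \<phi> (p v) = O.shift_operator (Vertex v)"
    and f: "\<And>f. f \<in> arcs E \<Longrightarrow> \<phi> (s f) = O.shift_operator (Edge f)"
    using universal[OF O.BL.cstar_algebra_axioms O.orbit_ck_family] by blast
  have \<phi>c: "\<phi> a \<in> adjointable_operators O.L" if "a \<in> carrier A" for a
    using hom that by (auto simp: star_hom_def)
  have \<phi>star: "\<phi> (star A a) = operator_adjoint O.L (\<phi> a)" if "a \<in> carrier A" for a
    using hom that by (simp add: star_hom_def)
  have act: "\<phi> (gen_elem g) = O.shift_operator g" if "g \<in> generators E" for g
    using that v f by (cases g) (auto simp: \<phi>star)
  have rep: "representation A O.L \<phi>"
    unfolding representation_def
  proof (intro conjI ballI allI O.L.hilbert_space_axioms)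
    fix a assume a: "a \<in> carrier A"
    show "bounded_operator O.L (\<phi> a)" using \<phi>c[OF a] by (simp add: adjointable_operators_def)
    show "\<phi> (c \<odot>\<^bsub>A\<^esub> a) \<xi> = c \<odot>\<^bsub>O.L\<^esub> \<phi> a \<xi>" if "\<xi> \<in> carrier O.L" for c \<xi>
    proof -
      have "\<phi> (c \<odot>\<^bsub>A\<^esub> a) = c \<odot>\<^bsub>O.BL\<^esub> \<phi> a" using hom a unfolding star_hom_def by blast
      then show ?thesis using that by simp
    qed
    show "hinner O.L (\<phi> a \<xi>) \<eta> = hinner O.L \<xi> (\<phi> (star A a) \<eta>)" if "\<xi> \<in> carrier O.L" "\<eta> \<in> carrier O.L" for \<xi> \<eta>
      unfolding \<phi>star[OF a] using O.L.operator_adjoint_eq[OF \<phi>c[OF a] that] .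
    fix b assume b: "b \<in> carrier A"
    show "\<phi> (a \<oplus>\<^bsub>A\<^esub> b) \<xi> = \<phi> a \<xi> \<oplus>\<^bsub>O.L\<^esub> \<phi> b \<xi>" if "\<xi> \<in> carrier O.L" for \<xi>
    proof -
      have "\<phi> (a \<oplus>\<^bsub>A\<^esub> b) = \<phi> a \<oplus>\<^bsub>O.BL\<^esub> \<phi> b" using hom a b unfolding star_hom_def by blast
      then show ?thesis using that by simp
    qed
    show "\<phi> (a \<otimes>\<^bsub>A\<^esub> b) \<xi> = \<phi> a (\<phi> b \<xi>)" if "\<xi> \<in> carrier O.L" for \<xi>
    proof -
      have "\<phi> (a \<otimes>\<^bsub>A\<^esub> b) = \<phi> a \<otimes>\<^bsub>O.BL\<^esub> \<phi> b" using hom a b unfolding star_hom_def by blast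
      then show ?thesis using that by simp
    qed
  qed
  have irr: "irreducible_rep A O.L \<phi>"
  proof (rule O.irreducible_of_shift[OF rep gen_elem_closed])
    show "\<phi> (gen_elem g) \<xi> = O.shift_operator g \<xi>" if "g \<in> generators E" for g \<xi>
      by (simp only: act[OF that])
  qed
  define u where "u = ext_head E (x 0)"
  have u: "u \<in> verts E" using G.ext_path_verts[OF x] by (simp add: u_def)
  \<comment> \<open>It fixes the basis vector of \<open>x\<close>. A non-zero element has infinitely
    many distinct multiples, enough to label countably many coordinates.\<close>
  have "p u \<noteq> \<zero>\<^bsub>A\<^esub>"
  proof
    assume "p u = \<zero>\<^bsub>A\<^esub>"
    then have "p u = 0 \<odot>\<^bsub>A\<^esub> p u" using u by simp
    also have "\<phi> \<dots> = 0 \<odot>\<^bsub>O.BL\<^esub> \<phi> (p u)" using hom p_closed[OF u] unfolding star_hom_def by blast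
    finally have "O.shift_operator (Vertex u) (O.basis_vector x) = 0 \<odot>\<^bsub>O.L\<^esub> O.shift_operator (Vertex u) (O.basis_vector x)"
      using v[OF u] G.path_orbit_self[OF x] by simp
    moreover have "O.shift_operator (Vertex u) (O.basis_vector x) = O.basis_vector x"
      using O.shift_operator_basis_vector[of "Vertex u" x] u G.path_orbit_self[OF x]
      by (simp add: generator_action_def u_def)
    ultimately have "O.basis_vector x (O.index x) = 0" by (metis ell2_simps(3) mult_zero_left)
    then show False by (simp add: O.basis_vector_def unit_vector_def)
  qed
  then have pos: "cnorm A (p u) \<noteq> 0" using u by (simp add: A.norm_eq_zero)
  \<comment> \<open>The vectors of an \<open>'a rep\<close> are functions on \<open>'a\<close>; multiples of \<open>p u\<close> serve as indices.\<close>
  define \<kappa> :: "nat \<Rightarrow> 'a" where "\<kappa> n = complex_of_nat n \<odot>\<^bsub>A\<^esub> p u" for n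
  have inj: "inj_on \<kappa> O.indices"
  proof (rule inj_onI)
    fix m n assume "\<kappa> m = \<kappa> n"
    have "cnorm A (\<kappa> m \<ominus>\<^bsub>A\<^esub> \<kappa> n) = cmod (complex_of_nat m - complex_of_nat n) * cnorm A (p u)"
    proof -
      have "\<kappa> m \<ominus>\<^bsub>A\<^esub> \<kappa> n = (complex_of_nat m - complex_of_nat n) \<odot>\<^bsub>A\<^esub> p u"
        using A.smul_add_left[of "p u" "of_nat m" "- of_nat n"] u
        by (simp add: \<kappa>_def A.minus_eq_smul A.smul_smul)
      then show ?thesis using u by (simp add: A.norm_smult)
    qed
    moreover have "cnorm A (\<kappa> m \<ominus>\<^bsub>A\<^esub> \<kappa> n) = 0"
      unfolding \<open>\<kappa> m = \<kappa> n\<close> using u by (simp add: \<kappa>_def A.minus_zero_iff[THEN iffD2])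
    ultimately show "m = n" using pos by simp
  qed
  define U where "U = (\<lambda>\<xi> j. if j \<in> \<kappa> ` O.indices then \<xi> (inv_into O.indices \<kappa> j) else (0::complex))"
  define K where "K = ell2 (\<kappa> ` O.indices)"
  have U: "linear_on O.L K U" "bij_betw U (carrier O.L) (carrier K)"
    "\<And>\<xi> \<eta>. \<xi> \<in> carrier O.L \<Longrightarrow> \<eta> \<in> carrier O.L \<Longrightarrow> hinner K (U \<xi>) (U \<eta>) = hinner O.L \<xi> \<eta>"
    unfolding U_def K_def using ell2_relabel[OF inj] by blast+
  define \<rho> where "\<rho> = (\<lambda>a y. U (\<phi> a (inv_into (carrier O.L) U y)))"
  have irr': "irreducible_rep A K \<rho>"
    unfolding \<rho>_def
    by (rule irreducible_rep_transport[OF irr _ U A.cstar_algebra_axioms]) (auto simp: K_def hilbert_space_ell2)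
  have Uzero: "U \<zero>\<^bsub>O.L\<^esub> = \<zero>\<^bsub>K\<^esub>" by (simp add: U_def K_def fun_eq_iff)
  have Uinv: "inv_into (carrier O.L) U (U \<xi>) = \<xi>" if "\<xi> \<in> carrier O.L" for \<xi>
    using U(2) that by (auto simp: bij_betw_def)
  define e where "e y = U (O.basis_vector y)" for y
  have "path_rep x (K, \<rho>) e"
    unfolding path_rep_def fst_conv snd_conv
  proof (intro conjI ballI impI x)
    show "(K, \<rho>) \<in> irreps A" using irr' by (simp add: irreps_def)
    fix y assume y: "y \<in> path_orbit E x"
    show "e y \<in> carrier K" using U(1) y by (auto simp: e_def linear_on_def)
    show "hinner K (e y) (e y') = (if y = y' then 1 else 0)" if "y' \<in> path_orbit E x" for y'
      unfolding e_def using U(3) O.basis_vector_orthonormal[OF y that] y that by (simp del: ell2_simps)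
  next
    fix \<xi> assume \<xi>: "\<xi> \<in> carrier K" and 0: "\<forall>y\<in>path_orbit E x. hinner K \<xi> (e y) = 0"
    obtain \<eta> where \<eta>: "\<eta> \<in> carrier O.L" "\<xi> = U \<eta>" using U(2) \<xi> by (auto simp: bij_betw_def)
    have "\<eta> = \<zero>\<^bsub>O.L\<^esub>"
    proof (rule O.basis_vector_total[OF \<eta>(1)])
      fix y assume y: "y \<in> path_orbit E x"
      then show "hinner O.L \<eta> (O.basis_vector y) = 0"
        using 0 U(3)[OF \<eta>(1), of "O.basis_vector y"] \<eta>(2) by (simp add: e_def del: ell2_simps)
    qed
    then show "\<xi> = \<zero>\<^bsub>K\<^esub>" using \<eta> Uzero by simp
  next
    fix g y assume g: "g \<in> generators E" and y: "y \<in> path_orbit E x"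
    show "\<rho> (gen_elem g) (e y) = (case generator_action E g y of None \<Rightarrow> \<zero>\<^bsub>K\<^esub> | Some y' \<Rightarrow> e y')"
      using O.shift_operator_basis_vector[OF g y] Uinv[of "O.basis_vector y"] y Uzero
      by (simp add: \<rho>_def e_def act[OF g] split: option.split)
  qed
  then show ?thesis by blast
qed

lemma path_rep_word:
  assumes pr: "path_rep x \<pi> e" and ws: "set ws \<subseteq> generators E" "ws \<noteq> []" and y: "y \<in> path_orbit E x"
  shows "snd \<pi> (word_elem ws) (e y) = (case word_action E ws y of None \<Rightarrow> \<zero>\<^bsub>fst \<pi>\<^esub> | Some y' \<Rightarrow> e y')"
proof -
  interpret R: graph_algebra_rep E A p s "fst \<pi>" "snd \<pi>"
    using pr by (intro irrep_interpretation) (simp add: path_rep_def)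
  have ey: "e y' \<in> carrier (fst \<pi>)" if "y' \<in> path_orbit E x" for y' using pr that by (simp add: path_rep_def)
  have gen: "snd \<pi> (gen_elem g) (e y') = (case generator_action E g y' of None \<Rightarrow> \<zero>\<^bsub>fst \<pi>\<^esub> | Some y'' \<Rightarrow> e y'')"
    if "g \<in> generators E" "y' \<in> path_orbit E x" for g y' using pr that by (simp add: path_rep_def)
  have "R.word_op ws (e y) = (case word_action E ws y of None \<Rightarrow> \<zero>\<^bsub>fst \<pi>\<^esub> | Some y' \<Rightarrow> e y') \<and>
    (\<forall>y'. word_action E ws y = Some y' \<longrightarrow> y' \<in> path_orbit E x)"
    using ws(1)
  proof (induction ws)
    case (Cons g ws)
    then have g: "g \<in> generators E" and ws: "set ws \<subseteq> generators E" by auto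
    show ?case
    proof (cases "word_action E ws y")
      case None
      then show ?thesis using Cons.IH[OF ws] g by simp
    next
      case (Some y')
      then have "y' \<in> path_orbit E x" using Cons.IH[OF ws] by blast
      then show ?thesis using Cons.IH[OF ws] Some gen[OF g, of y'] G.generator_action_orbit[OF g, of y' x] by simp
    qed
  qed (use y in simp)
  then show ?thesis using R.rep_word[OF ws ey[OF y]] by simp
qed

text \<open>A single \<open>c\<close> and a single \<open>N\<close> serve all path representations,
  so the representation may vary along a sequence.\<close>

definition locally_scalar :: "(nat \<Rightarrow> 'e + 'v) \<Rightarrow> 'a \<Rightarrow> complex \<Rightarrow> real \<Rightarrow> nat \<Rightarrow> bool" where
  "locally_scalar w a c \<epsilon> N \<longleftrightarrow>
     (\<forall>x \<pi> e y y'. path_rep x \<pi> e \<longrightarrow> y \<in> path_orbit E x \<longrightarrow> y' \<in> path_orbit E x \<longrightarrow>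
        (\<forall>i<N. y i = w i) \<longrightarrow> (\<forall>i<N. y' i = w i) \<longrightarrow>
        cmod (hinner (fst \<pi>) (snd \<pi> a (e y)) (e y') - (if y = y' then c else 0)) \<le> \<epsilon>)"

lemma locally_scalarI:
  assumes "\<And>x \<pi> e y y'. path_rep x \<pi> e \<Longrightarrow> y \<in> path_orbit E x \<Longrightarrow> y' \<in> path_orbit E x \<Longrightarrow>
    \<forall>i<N. y i = w i \<Longrightarrow> \<forall>i<N. y' i = w i \<Longrightarrow>
    cmod (hinner (fst \<pi>) (snd \<pi> a (e y)) (e y') - (if y = y' then c else 0)) \<le> \<epsilon>"
  shows "locally_scalar w a c \<epsilon> N"
  unfolding locally_scalar_def by (intro allI impI, rule assms, assumption+)

lemma locally_scalarD:
  assumes "locally_scalar w a c \<epsilon> N" "path_rep x \<pi> e" "y \<in> path_orbit E x" "y' \<in> path_orbit E x"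
    "\<forall>i<N. y i = w i" "\<forall>i<N. y' i = w i"
  shows "cmod (hinner (fst \<pi>) (snd \<pi> a (e y)) (e y') - (if y = y' then c else 0)) \<le> \<epsilon>"
  using assms(1)[unfolded locally_scalar_def, THEN spec, THEN spec, THEN spec, THEN spec, THEN spec,
    THEN mp, THEN mp, THEN mp, THEN mp, THEN mp, OF assms(2-6)] .

text \<open>For a word, \<open>word_action_near\<close> gives the constant 1 or 0 according to
  whether the word fixes \<open>w\<close>. The error is exactly zero and stays so under linear
  combinations.\<close>

lemma locally_scalar_word_span:
  assumes w: "ext_path E w" and a: "a \<in> word_span"
  shows "\<exists>c N. locally_scalar w a c 0 N"
  using a
proof (induction rule: word_span.induct)
  case zero
  have "locally_scalar w \<zero>\<^bsub>A\<^esub> 0 0 0"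
  proof (rule locally_scalarI)
    fix x \<pi> e y y'
    assume pr: "path_rep x \<pi> e" and y: "y \<in> path_orbit E x" "y' \<in> path_orbit E x"
    interpret R: graph_algebra_rep E A p s "fst \<pi>" "snd \<pi>"
      using pr by (intro irrep_interpretation) (simp add: path_rep_def)
    have ey: "e y \<in> carrier (fst \<pi>)" "e y' \<in> carrier (fst \<pi>)" using pr y by (simp_all add: path_rep_def)
    show "cmod (hinner (fst \<pi>) (snd \<pi> \<zero>\<^bsub>A\<^esub> (e y)) (e y') - (if y = y' then 0 else 0)) \<le> 0" using ey by simp
  qed
  then show ?case by blast
next
  case (word ws)
  obtain N where N: "\<forall>y y'. (\<forall>i<N. y i = w i) \<longrightarrow> (\<forall>i<N. y' i = w i) \<longrightarrow>
    (word_action E ws y = Some y' \<longleftrightarrow> word_action E ws w = Some w \<and> y = y')"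
    by (rule exE[OF G.word_action_near[OF word(1) w]])
  have "locally_scalar w (word_elem ws) (if word_action E ws w = Some w then 1 else 0) 0 N"
  proof (rule locally_scalarI)
    fix x \<pi> e y y'
    assume pr: "path_rep x \<pi> e" and y: "y \<in> path_orbit E x" "y' \<in> path_orbit E x"
      and near: "\<forall>i<N. y i = w i" "\<forall>i<N. y' i = w i"
    interpret R: graph_algebra_rep E A p s "fst \<pi>" "snd \<pi>"
      using pr by (intro irrep_interpretation) (simp add: path_rep_def)
    note N' = N[THEN spec, THEN spec, THEN mp, THEN mp, OF near]
    have orb: "z \<in> path_orbit E x" if "word_action E vs y = Some z" "set vs \<subseteq> generators E" for z vs
      using that
    proof (induction vs arbitrary: z)
      case (Cons g vs)
      then show ?case using G.generator_action_orbit by (auto split: option.splits)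
    qed (use y in simp)
    have ortho: "hinner (fst \<pi>) (e z) (e y') = (if z = y' then 1 else 0)" if "z \<in> path_orbit E x" for z
      using pr y that by (simp add: path_rep_def)
    have ey: "e y' \<in> carrier (fst \<pi>)" using pr y by (simp add: path_rep_def)
    have "hinner (fst \<pi>) (snd \<pi> (word_elem ws) (e y)) (e y') = (if word_action E ws y = Some y' then 1 else 0)"
    proof (cases "word_action E ws y")
      case None
      then show ?thesis using path_rep_word[OF pr word(1,2) y(1)] ey by simp
    next
      case (Some z)
      then show ?thesis using path_rep_word[OF pr word(1,2) y(1)] ortho[OF orb[OF Some word(1)]] by simp
    qed
    then show "cmod (hinner (fst \<pi>) (snd \<pi> (word_elem ws) (e y)) (e y')
        - (if y = y' then if word_action E ws w = Some w then 1 else 0 else 0)) \<le> 0"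
      unfolding N' by simp
  qed
  then show ?case by blast
next
  case (add a b)
  obtain c N where a: "locally_scalar w a c 0 N" using add.IH(1) by blast
  obtain d M where b: "locally_scalar w b d 0 M" using add.IH(2) by blast
  have "locally_scalar w (a \<oplus>\<^bsub>A\<^esub> b) (c + d) 0 (max N M)"
  proof (rule locally_scalarI)
    fix x \<pi> e y y'
    assume pr: "path_rep x \<pi> e" and y: "y \<in> path_orbit E x" "y' \<in> path_orbit E x"
      and near: "\<forall>i<max N M. y i = w i" "\<forall>i<max N M. y' i = w i"
    interpret R: graph_algebra_rep E A p s "fst \<pi>" "snd \<pi>"
      using pr by (intro irrep_interpretation) (simp add: path_rep_def)
    have ey: "e y \<in> carrier (fst \<pi>)" "e y' \<in> carrier (fst \<pi>)" using pr y by (simp_all add: path_rep_def)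
    have "hinner (fst \<pi>) (snd \<pi> a (e y)) (e y') = (if y = y' then c else 0)"
      "hinner (fst \<pi>) (snd \<pi> b (e y)) (e y') = (if y = y' then d else 0)"
      using locally_scalarD[OF a pr y] locally_scalarD[OF b pr y] near by simp_all
    then show "cmod (hinner (fst \<pi>) (snd \<pi> (a \<oplus>\<^bsub>A\<^esub> b) (e y)) (e y') - (if y = y' then c + d else 0)) \<le> 0"
      using add(1,2) word_span_closed ey by (simp add: R.rep_add R.H.hinner_add)
  qed
  then show ?case by blast
next
  case (smul a d)
  obtain c N where a: "locally_scalar w a c 0 N" using smul.IH by blast
  have "locally_scalar w (d \<odot>\<^bsub>A\<^esub> a) (d * c) 0 N"
  proof (rule locally_scalarI)
    fix x \<pi> e y y'
    assume pr: "path_rep x \<pi> e" and y: "y \<in> path_orbit E x" "y' \<in> path_orbit E x"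
      and near: "\<forall>i<N. y i = w i" "\<forall>i<N. y' i = w i"
    interpret R: graph_algebra_rep E A p s "fst \<pi>" "snd \<pi>"
      using pr by (intro irrep_interpretation) (simp add: path_rep_def)
    have ey: "e y \<in> carrier (fst \<pi>)" "e y' \<in> carrier (fst \<pi>)" using pr y by (simp_all add: path_rep_def)
    have "hinner (fst \<pi>) (snd \<pi> a (e y)) (e y') = (if y = y' then c else 0)"
      using locally_scalarD[OF a pr y near] by simp
    then show "cmod (hinner (fst \<pi>) (snd \<pi> (d \<odot>\<^bsub>A\<^esub> a) (e y)) (e y') - (if y = y' then d * c else 0)) \<le> 0"
      using smul(1) word_span_closed ey by (simp add: R.rep_smul R.H.hinner_smult)
  qed
  then show ?case by blast
qed

lemma coefficient_close:
  assumes pr: "path_rep x \<pi> e" and y: "y \<in> path_orbit E x" "y' \<in> path_orbit E x"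
    and a: "a \<in> carrier A" and b: "b \<in> carrier A"
  shows "cmod (hinner (fst \<pi>) (snd \<pi> a (e y)) (e y') - hinner (fst \<pi>) (snd \<pi> b (e y)) (e y')) \<le> 2 * cnorm A (a \<ominus>\<^bsub>A\<^esub> b)"
proof -
  interpret R: graph_algebra_rep E A p s "fst \<pi>" "snd \<pi>"
    using pr by (intro irrep_interpretation) (simp add: path_rep_def)
  have ey: "e y \<in> carrier (fst \<pi>)" "e y' \<in> carrier (fst \<pi>)" using pr y by (simp_all add: path_rep_def)
  have n: "hnorm (fst \<pi>) (e y) = 1" "hnorm (fst \<pi>) (e y') = 1"
    using pr y by (simp_all add: path_rep_def hnorm_def)
  have "cmod (hinner (fst \<pi>) (snd \<pi> a (e y)) (e y') - hinner (fst \<pi>) (snd \<pi> b (e y)) (e y'))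
      = cmod (hinner (fst \<pi>) (snd \<pi> (a \<ominus>\<^bsub>A\<^esub> b) (e y)) (e y'))"
    using ey a b by (simp add: R.rep_minus R.H.hinner_minus_left)
  also have "\<dots> \<le> hnorm (fst \<pi>) (snd \<pi> (a \<ominus>\<^bsub>A\<^esub> b) (e y)) * hnorm (fst \<pi>) (e y')"
    using ey a b by (intro R.H.Cauchy_Schwarz) auto
  also have "\<dots> \<le> 2 * cnorm A (a \<ominus>\<^bsub>A\<^esub> b)"
    using R.rep_bound[of "a \<ominus>\<^bsub>A\<^esub> b" "e y"] ey a b n by simp
  finally show ?thesis .
qed

text \<open>The choice \<open>y = y' = w\<close> in the representation at hand identifies the
  constant of an approximant with the diagonal coefficient of \<open>a\<close> at \<open>w\<close>,
  up to the approximation error.\<close>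

lemma locally_scalar_coefficients:
  assumes w: "w \<in> path_orbit E x0" and pr0: "path_rep x0 \<pi>0 e0" and a: "a \<in> carrier A" and \<epsilon>: "\<epsilon> > 0"
  shows "\<exists>N. locally_scalar w a (hinner (fst \<pi>0) (snd \<pi>0 a (e0 w)) (e0 w)) \<epsilon> N"
proof -
  \<comment> \<open>Two comparisons are made, each costing twice the distance, so
    \<open>\<epsilon> / 4\<close> adds up to \<open>\<epsilon>\<close>.\<close>
  obtain b where b: "b \<in> word_span" "cnorm A (a \<ominus>\<^bsub>A\<^esub> b) < \<epsilon> / 4"
    using word_span_dense[OF a, of "\<epsilon> / 4"] \<epsilon> by auto
  have bA: "b \<in> carrier A" using b word_span_closed by simp
  obtain c N where N: "locally_scalar w b c 0 N"
    using locally_scalar_word_span[OF G.path_orbit_ext_path[OF w] b(1)] by blast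
  let ?k = "hinner (fst \<pi>0) (snd \<pi>0 a (e0 w)) (e0 w)"
  have c0: "cmod (?k - c) \<le> 2 * cnorm A (a \<ominus>\<^bsub>A\<^esub> b)"
    using coefficient_close[OF pr0 w w a bA] locally_scalarD[OF N pr0 w w] by simp
  have "cmod (hinner (fst \<pi>) (snd \<pi> a (e y)) (e y') - (if y = y' then ?k else 0)) \<le> \<epsilon>"
    if pr: "path_rep x \<pi> e" and y: "y \<in> path_orbit E x" "y' \<in> path_orbit E x"
      and near: "\<forall>i<N. y i = w i" "\<forall>i<N. y' i = w i" for x \<pi> e y y'
  proof -
    let ?h = "hinner (fst \<pi>) (snd \<pi> a (e y)) (e y')"
    have 1: "cmod (?h - (if y = y' then c else 0)) \<le> 2 * cnorm A (a \<ominus>\<^bsub>A\<^esub> b)"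
      using coefficient_close[OF pr y a bA] locally_scalarD[OF N pr y near] by simp
    show "cmod (?h - (if y = y' then ?k else 0)) \<le> \<epsilon>"
    proof (cases "y = y'")
      case True
      have "cmod (?h - ?k) \<le> cmod (?h - c) + cmod (?k - c)"
        using norm_triangle_ineq4[of "?h - c" "?k - c"] by simp
      also have "cmod (?h - c) \<le> 2 * cnorm A (a \<ominus>\<^bsub>A\<^esub> b)" using 1 True by simp
      finally have "cmod (?h - ?k) \<le> \<epsilon>" using c0 b(2) by linarith
      then show ?thesis using True by simp
    next
      case False
      then have "cmod ?h \<le> 2 * cnorm A (a \<ominus>\<^bsub>A\<^esub> b)" using 1 by simp
      then have "cmod ?h \<le> \<epsilon>" using b(2) \<epsilon> by linarith
      then show ?thesis using False by simp
    qed
  qed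
  then have "locally_scalar w a ?k \<epsilon> N" by (rule locally_scalarI)
  then show ?thesis by blast
qed

text \<open>Otherwise \<open>\<pi> a \<xi>\<close> is orthogonal to the total family, by moving
  \<open>a\<close> to the other side of the inner product.\<close>

lemma path_rep_nonzero_coefficient:
  assumes pr: "path_rep x \<pi> e" and a: "a \<in> carrier A" and nz: "\<xi> \<in> carrier (fst \<pi>)" "snd \<pi> a \<xi> \<noteq> \<zero>\<^bsub>fst \<pi>\<^esub>"
  shows "\<exists>w\<in>path_orbit E x. snd \<pi> (star A a) (e w) \<noteq> \<zero>\<^bsub>fst \<pi>\<^esub>"
proof (rule ccontr)
  assume no: "\<not> ?thesis"
  interpret R: graph_algebra_rep E A p s "fst \<pi>" "snd \<pi>"
    using pr by (intro irrep_interpretation) (simp add: path_rep_def)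
  have "hinner (fst \<pi>) (snd \<pi> a \<xi>) (e w) = 0" if w: "w \<in> path_orbit E x" for w
  proof -
    have "e w \<in> carrier (fst \<pi>)" using pr w by (simp add: path_rep_def)
    moreover have "snd \<pi> (star A a) (e w) = \<zero>\<^bsub>fst \<pi>\<^esub>" using no w by blast
    ultimately show ?thesis using R.rep_adjoint[OF a nz(1), of "e w"] nz(1) by simp
  qed
  moreover have "snd \<pi> a \<xi> \<in> carrier (fst \<pi>)" using a nz(1) by (rule R.rep_closed)
  ultimately have "snd \<pi> a \<xi> = \<zero>\<^bsub>fst \<pi>\<^esub>" using pr by (simp add: path_rep_def)
  then show False using nz by simp
qed

text \<open>The vectors \<open>T x\<close> and \<open>T y\<close> are parallel, so their Gram
  matrix, which is the matrix of \<open>T\<close> at \<open>x\<close> and \<open>y\<close>, has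
  determinant zero.\<close>

lemma rank_one_coefficients:
  assumes H: "hilbert_space H" and T: "rank_one_projection H T" and x: "x \<in> carrier H" and y: "y \<in> carrier H"
  shows "(cmod (hinner H (T x) y))\<^sup>2 = cmod (hinner H (T x) x) * cmod (hinner H (T y) y)"
proof -
  interpret hilbert_space H by fact
  have Tc: "T u \<in> carrier H" if "u \<in> carrier H" for u
    using T that by (auto simp: rank_one_projection_def bounded_operator_def linear_on_def)
  have TT: "hinner H (T u) v = hinner H (T u) (T v)" if "u \<in> carrier H" "v \<in> carrier H" for u v
  proof -
    have "hinner H (T (T u)) v = hinner H (T u) (T v)" "T (T u) = T u"
      using T that Tc[of u] unfolding rank_one_projection_def by blast+
    then show ?thesis by simp
  qed
  obtain \<xi> where \<xi>: "\<xi> \<in> carrier H" "T ` carrier H = {c \<odot>\<^bsub>H\<^esub> \<xi> | c. True}"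
    using T unfolding rank_one_projection_def by blast
  obtain c where c: "T x = c \<odot>\<^bsub>H\<^esub> \<xi>" using \<xi>(2) x by blast
  obtain d where d: "T y = d \<odot>\<^bsub>H\<^esub> \<xi>" using \<xi>(2) y by blast
  have "hinner H (T x) y = c * cnj d * hinner H \<xi> \<xi>" "hinner H (T x) x = c * cnj c * hinner H \<xi> \<xi>"
    "hinner H (T y) y = d * cnj d * hinner H \<xi> \<xi>"
    using TT[OF x y] TT[OF x x] TT[OF y y] \<xi>(1)
    by (simp_all add: c d hinner_smult hinner_smult_right)
  then show ?thesis by (simp add: norm_mult power2_eq_square)
qed

lemma Fell_imp_no_splitting:
  assumes fell: "Fell A" and f: "InfPath f \<in> infinite_paths E"
  shows "\<exists>n. splitting_edges E (head E (f n)) = {}"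
proof (rule ccontr)
  assume "\<not> ?thesis"
  then have split: "splitting_edges E (head E (f n)) \<noteq> {}" for n by blast
  define z where "z i = (Inl (f i) :: 'e + 'v)" for i
  have z: "ext_path E z" using f by (auto simp: ext_path_def z_def ext_arcs_def infinite_paths_def)
  have "\<exists>xs ys u. path_between E (head E (f n)) xs u \<and> path_between E (head E (f n)) ys u \<and> xs \<noteq> ys" for n
  proof -
    obtain g where "g \<in> splitting_edges E (head E (f n))" using split by blast
    then obtain h where gh: "edge_reachable E (head E (f n)) g" "edge_reachable E (head E (f n)) h"
        "tail E g = tail E h" "g \<noteq> h"
      by (auto simp: splitting_edges_def)
    then obtain xs ys where "path_between E (head E (f n)) (xs @ [g]) (tail E g)"
        "path_between E (head E (f n)) (ys @ [h]) (tail E g)"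
      by (auto simp: edge_reachable_def)
    then show ?thesis using gh(4) by (intro exI[of _ "xs @ [g]"] exI[of _ "ys @ [h]"]) auto
  qed
  then obtain xs ys u where xs: "\<And>n. path_between E (head E (f n)) (xs n) (u n)"
    and ys: "\<And>n. path_between E (head E (f n)) (ys n) (u n)" and ne: "\<And>n. xs n \<noteq> ys n" by metis
  have "\<exists>y. ext_path E y \<and> ext_head E (y 0) = u n" for n
    using G.ext_path_exists G.path_between_verts[OF xs] by blast
  then obtain x where x: "\<And>n. ext_path E (x n)" "\<And>n. ext_head E (x n 0) = u n" by metis
  have "\<exists>\<pi> e. path_rep (x n) \<pi> e" for n using path_rep_exists[OF x(1)] .
  then obtain \<pi> e where pr: "\<And>n. path_rep (x n) (\<pi> n) (e n)" by metis
  obtain \<pi>z ez where prz: "path_rep z \<pi>z ez" using path_rep_exists[OF z] by blast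
  have irz: "\<pi>z \<in> irreps A" using prz by (simp add: path_rep_def)
  have irn: "\<pi> n \<in> irreps A" for n using pr[of n] by (simp add: path_rep_def)
  interpret Z: graph_algebra_rep E A p s "fst \<pi>z" "snd \<pi>z" by (rule irrep_interpretation[OF irz])
  \<comment> \<open>From some position on \<open>w\<close> runs along \<open>z\<close>. There it is
    continued by one of the two paths to \<open>u n\<close> and then by \<open>x n\<close>; far out
    along \<open>z\<close> this leaves the first \<open>N\<close> letters untouched.\<close>
  have near: "\<exists>n0. \<forall>n\<ge>n0. \<exists>y\<in>path_orbit E (x n). \<exists>y'\<in>path_orbit E (x n). y \<noteq> y' \<and>
      (\<forall>i<N. y i = w i) \<and> (\<forall>i<N. y' i = w i)" if w: "w \<in> path_orbit E z" for w N
  proof -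
    obtain m l where ml: "(\<lambda>i. w (i + m)) = (\<lambda>i. z (i + l))" using w by (auto simp: path_orbit_def)
    have "\<exists>y\<in>path_orbit E (x n). \<exists>y'\<in>path_orbit E (x n). y \<noteq> y' \<and>
      (\<forall>i<N. y i = w i) \<and> (\<forall>i<N. y' i = w i)" if n: "n \<ge> l + N" for n
    proof -
      \<comment> \<open>The position at which \<open>w\<close> passes through the vertex
        \<open>z(n)\<close>, because \<open>w (i + m) = z (i + l)\<close>.\<close>
      define k where "k = n - l + m"
      have kN: "k \<ge> N" using n by (simp add: k_def)
      have wk: "ext_head E (w k) = head E (f n)"
        using fun_cong[OF ml, of "n - l"] n by (simp add: k_def z_def)
      define y0 where "y0 es = prepend es (x n)" for es
      define y where "y es = (\<lambda>i. if i < k then w i else y0 es (i - k))" for es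
      have orb: "y es \<in> path_orbit E (x n)" if "path_between E (head E (f n)) es (u n)" for es
        unfolding y_def
      proof (rule G.splice_orbit[OF G.path_orbit_ext_path[OF w]])
        show "y0 es \<in> path_orbit E (x n)" "ext_head E (w k) = ext_head E (y0 es 0)"
          unfolding y0_def wk using G.prepend_orbit G.ext_path_prepend(2) that x by metis+
      qed
      have "y (xs n) \<noteq> y (ys n)"
      proof
        assume eq: "y (xs n) = y (ys n)"
        have "y0 (xs n) = y0 (ys n)"
        proof
          fix i show "y0 (xs n) i = y0 (ys n) i" using fun_cong[OF eq, of "k + i"] by (simp add: y_def)
        qed
        then show False using G.prepend_eq_iff[of _ "xs n" "x n" "ys n"] xs ys ne x unfolding y0_def by metis
      qed
      moreover have "\<forall>i<N. y es i = w i" for es using kN by (simp add: y_def)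
      ultimately show ?thesis using orb[OF xs] orb[OF ys] by blast
    qed
    then show ?thesis by blast
  qed
  \<comment> \<open>Convergence of the representations, checked on the generating sets and
    propagated through finite intersections and unions.\<close>
  have open_kernel: "\<exists>n0. \<forall>n\<ge>n0. rep_kernel A (\<pi> n) \<in> W"
    if "openin (hull_kernel_topology A) W" "rep_kernel A \<pi>z \<in> W" for W
  proof -
    have "generate_topology_on {{P \<in> primitive_ideals A. \<not> J \<subseteq> P} | J. closed_ideal A J} W"
      using that(1) unfolding hull_kernel_topology_def by (rule openin_topology_generated_by)
    then show ?thesis using that(2)
    proof (induction rule: generate_topology_on.induct)
      case (Int W1 W2)
      then obtain n1 n2 where "\<forall>n\<ge>n1. rep_kernel A (\<pi> n) \<in> W1" "\<forall>n\<ge>n2. rep_kernel A (\<pi> n) \<in> W2" by blast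
      then show ?case by (intro exI[of _ "max n1 n2"]) simp
    next
      case (UN K)
      then show ?case by blast
    next
      case (Basis W)
      then obtain J where J: "closed_ideal A J" and W: "W = {P \<in> primitive_ideals A. \<not> J \<subseteq> P}" by blast
      obtain j where j: "j \<in> J" "j \<notin> rep_kernel A \<pi>z" using Basis W by blast
      have "J \<subseteq> carrier A" using J unfolding closed_ideal_def A.submodule_iff by (elim conjE)
      then have jA: "j \<in> carrier A" using j(1) by (rule subsetD)
      obtain \<xi> where \<xi>: "\<xi> \<in> carrier (fst \<pi>z)" "snd \<pi>z j \<xi> \<noteq> \<zero>\<^bsub>fst \<pi>z\<^esub>"
        using j jA by (auto simp: rep_kernel_def)
      obtain w where w: "w \<in> path_orbit E z" "snd \<pi>z (star A j) (ez w) \<noteq> \<zero>\<^bsub>fst \<pi>z\<^esub>"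
        using path_rep_nonzero_coefficient[OF prz jA \<xi>] by blast
      \<comment> \<open>Still in the ideal, and its diagonal coefficient at \<open>w\<close> is the
        squared norm of the image of \<open>ez w\<close> under \<open>star A j\<close>, hence
        non-zero.\<close>
      define b where "b = j \<otimes>\<^bsub>A\<^esub> star A j"
      have "b \<in> J"
        unfolding b_def
        using J[unfolded closed_ideal_def, THEN conjunct2, THEN conjunct1] j(1) A.star_closed[OF jA] by simp
      then have b: "b \<in> J" "b \<in> carrier A" using jA by (simp_all add: b_def)
      define c where "c = hinner (fst \<pi>z) (snd \<pi>z b (ez w)) (ez w)"
      have ew: "ez w \<in> carrier (fst \<pi>z)" using prz w by (simp add: path_rep_def)
      have "c = hinner (fst \<pi>z) (snd \<pi>z (star A j) (ez w)) (snd \<pi>z (star A j) (ez w))"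
        unfolding c_def b_def using jA ew by (simp add: Z.rep_mult Z.rep_adjoint)
      then have c: "c \<noteq> 0" using Z.H.hinner_eq_zero[of "snd \<pi>z (star A j) (ez w)"] w(2) jA ew by auto
      \<comment> \<open>Half of the modulus keeps the nearby diagonal coefficients away from
        zero.\<close>
      have "cmod c / 2 > 0" using c by simp
      from locally_scalar_coefficients[OF w(1) prz b(2) this, folded c_def]
      obtain N where N: "locally_scalar w b c (cmod c / 2) N" by (elim exE)
      from near[OF w(1), of N] obtain n0 where n0: "\<forall>n\<ge>n0. \<exists>y\<in>path_orbit E (x n). \<exists>y'\<in>path_orbit E (x n).
          y \<noteq> y' \<and> (\<forall>i<N. y i = w i) \<and> (\<forall>i<N. y' i = w i)" by (elim exE)
      have "rep_kernel A (\<pi> n) \<in> W" if n: "n \<ge> n0" for n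
      proof -
        interpret R: graph_algebra_rep E A p s "fst (\<pi> n)" "snd (\<pi> n)" by (rule irrep_interpretation[OF irn])
        obtain y where y: "y \<in> path_orbit E (x n)" "\<forall>i<N. y i = w i" using n0[THEN spec, THEN mp, OF n] by blast
        have ey: "e n y \<in> carrier (fst (\<pi> n))" using pr[of n] y by (simp add: path_rep_def)
        have "snd (\<pi> n) b (e n y) \<noteq> \<zero>\<^bsub>fst (\<pi> n)\<^esub>"
          using locally_scalarD[OF N pr[of n] y(1) y(1) y(2) y(2)] c ey by auto
        then have "b \<notin> rep_kernel A (\<pi> n)" using ey by (auto simp: rep_kernel_def)
        then show ?thesis using b irn unfolding W primitive_ideals_def by blast
      qed
      then show ?case by blast
    qed simp
  qed
  obtain c where c: "c \<in> spectrum A" "\<pi>z \<in> c" "class_kernel A c = rep_kernel A \<pi>z"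
    using irz by (rule spectrum_classI)
  from fell[unfolded Fell_def, THEN bspec, OF c(1)]
  obtain a V U where a: "a \<in> carrier A" and U: "openin (spectrum_topology A) U" "c \<in> U" "U \<subseteq> V"
    and V0: "\<forall>d\<in>V. \<forall>\<sigma>\<in>d. rank_one_projection (fst \<sigma>) (snd \<sigma> a)"
    by (elim bexE exE conjE) (rule that)
  have V: "rank_one_projection (fst \<sigma>) (snd \<sigma> a)" if "d \<in> V" "\<sigma> \<in> d" for d \<sigma>
    using V0[THEN bspec, THEN bspec, OF that] .
  obtain W where W: "openin (hull_kernel_topology A) W" "U = class_kernel A -` W \<inter> spectrum A"
    using U(1) unfolding spectrum_topology_def openin_pullback_topology by blast
  have "rep_kernel A \<pi>z \<in> W" using U(2) W(2) c(3) by auto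
  then obtain n1 where n1: "\<And>n. n \<ge> n1 \<Longrightarrow> rep_kernel A (\<pi> n) \<in> W" using open_kernel[OF W(1)] by blast
  have rank: "rank_one_projection (fst (\<pi> n)) (snd (\<pi> n) a)" if "n \<ge> n1" for n
  proof -
    obtain d where d: "d \<in> spectrum A" "\<pi> n \<in> d" "class_kernel A d = rep_kernel A (\<pi> n)"
      using irn by (rule spectrum_classI)
    then have "d \<in> U" using n1[OF that] W(2) by simp
    then show ?thesis using V[OF subsetD[OF U(3)] d(2)] by simp
  qed
  have rankz: "rank_one_projection (fst \<pi>z) (snd \<pi>z a)" using V[OF subsetD[OF U(3,2)] c(2)] .
  let ?T = "snd \<pi>z a" and ?H = "fst \<pi>z"
  have sa: "hinner ?H (?T \<xi>) \<eta> = hinner ?H \<xi> (?T \<eta>)" "?T (?T \<xi>) = ?T \<xi>"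
    if "\<xi> \<in> carrier ?H" "\<eta> \<in> carrier ?H" for \<xi> \<eta>
    using rankz that unfolding rank_one_projection_def by blast+
  have "\<exists>\<xi>\<in>carrier ?H. ?T \<xi> \<noteq> \<zero>\<^bsub>?H\<^esub>"
  proof -
    obtain \<zeta> where \<zeta>: "\<zeta> \<in> carrier ?H" "\<zeta> \<noteq> \<zero>\<^bsub>?H\<^esub>" "?T ` carrier ?H = {c \<odot>\<^bsub>?H\<^esub> \<zeta> | c. True}"
      using rankz unfolding rank_one_projection_def by blast
    have "1 \<odot>\<^bsub>?H\<^esub> \<zeta> \<in> ?T ` carrier ?H" unfolding \<zeta>(3) by blast
    then have "\<zeta> \<in> ?T ` carrier ?H" unfolding Z.H.smul_one[OF \<zeta>(1)] .
    then obtain u where "u \<in> carrier ?H" "\<zeta> = ?T u" by blast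
    then show ?thesis using \<zeta>(2) by blast
  qed
  then obtain \<xi> where \<xi>: "\<xi> \<in> carrier ?H" "?T \<xi> \<noteq> \<zero>\<^bsub>?H\<^esub>" by blast
  obtain w where w: "w \<in> path_orbit E z" "snd \<pi>z (star A a) (ez w) \<noteq> \<zero>\<^bsub>?H\<^esub>"
    using path_rep_nonzero_coefficient[OF prz a \<xi>] by blast
  have ew: "ez w \<in> carrier ?H" using prz w by (simp add: path_rep_def)
  \<comment> \<open>The image of \<open>a\<close> is a self-adjoint projection in this
    representation, so \<open>a\<close> and its adjoint act alike.\<close>
  have "snd \<pi>z (star A a) (ez w) = ?T (ez w)"
  proof (rule Z.H.hinner_eqI)
    fix \<eta> assume \<eta>: "\<eta> \<in> carrier ?H"
    show "hinner ?H (snd \<pi>z (star A a) (ez w)) \<eta> = hinner ?H (?T (ez w)) \<eta>"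
      using Z.rep_adjoint[of "star A a" "ez w" \<eta>] sa(1)[OF ew \<eta>] a ew \<eta> by simp
  qed (use a ew in auto)
  then have Tw: "?T (ez w) \<noteq> \<zero>\<^bsub>?H\<^esub>" using w by simp
  define k where "k = hinner ?H (?T (ez w)) (ez w)"
  have "k = hinner ?H (?T (ez w)) (?T (ez w))"
    unfolding k_def using sa(1)[of "?T (ez w)" "ez w"] sa(2)[OF ew ew] a ew by simp
  then have k: "k \<noteq> 0" using Z.H.hinner_eq_zero[of "?T (ez w)"] Tw a ew by auto
  \<comment> \<open>With this tolerance the diagonal entries have modulus at least
    \<open>3/4 * cmod k\<close> and the off-diagonal one at most \<open>1/4 * cmod k\<close>; a
    vanishing determinant would require 9/16 to be at most 1/16.\<close>
  have "cmod k / 4 > 0" using k by simp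
  from locally_scalar_coefficients[OF w(1) prz a this, folded k_def]
  obtain N where N: "locally_scalar w a k (cmod k / 4) N" by (elim exE)
  from near[OF w(1), of N] obtain n2 where n2: "\<forall>n\<ge>n2. \<exists>y\<in>path_orbit E (x n). \<exists>y'\<in>path_orbit E (x n).
      y \<noteq> y' \<and> (\<forall>i<N. y i = w i) \<and> (\<forall>i<N. y' i = w i)" by (elim exE)
  define n where "n = max n1 n2"
  obtain y y' where y: "y \<in> path_orbit E (x n)" "y' \<in> path_orbit E (x n)" "y \<noteq> y'"
      "\<forall>i<N. y i = w i" "\<forall>i<N. y' i = w i"
    using n2[THEN spec, THEN mp, of n] by (auto simp: n_def)
  have ey: "e n y \<in> carrier (fst (\<pi> n))" "e n y' \<in> carrier (fst (\<pi> n))"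
    using pr[of n] y by (simp_all add: path_rep_def)
  let ?h = "\<lambda>y y'. hinner (fst (\<pi> n)) (snd (\<pi> n) a (e n y)) (e n y')"
  have off: "cmod (?h y y') \<le> cmod k / 4"
    using locally_scalarD[OF N pr[of n] y(1,2,4,5)] y(3) by simp
  have diag: "cmod (?h v v) \<ge> 3/4 * cmod k" if "cmod (?h v v - k) \<le> cmod k / 4" for v
    using that norm_triangle_ineq2[of k "k - ?h v v"] by (simp add: norm_minus_commute)
  have "3/4 * cmod k \<le> cmod (?h y y)" "3/4 * cmod k \<le> cmod (?h y' y')"
    using locally_scalarD[OF N pr[of n] y(1) y(1) y(4) y(4)] locally_scalarD[OF N pr[of n] y(2) y(2) y(5) y(5)]
    by (intro diag; simp)+
  then have "(3/4 * cmod k) * (3/4 * cmod k) \<le> cmod (?h y y) * cmod (?h y' y')"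
    by (intro mult_mono) auto
  also have "\<dots> = (cmod (?h y y'))\<^sup>2"
    using rank_one_coefficients[OF hilbert_space_irrep[OF irn] rank ey] by (simp add: n_def)
  also have "\<dots> \<le> (cmod k / 4)\<^sup>2" using off by (intro power_mono) auto
  finally show False using k by (simp add: power2_eq_square)
qed

end

theorem theorem6p5p20:
  fixes E :: "('v, 'e) pre_digraph"
    and A :: "'a cstar" and p :: "'v \<Rightarrow> 'a" and s :: "'e \<Rightarrow> 'a"
  assumes "countable_digraph E"
    and "row_finite E"
    and "\<nexists>\<alpha>. is_cycle E \<alpha>"
    and "graph_cstar_algebra E A p s"
  shows
    "(Fell A \<longleftrightarrow>
       (\<forall>z \<in> infinite_paths E. \<exists>n.
          finite (splitting_pairs (path_subgraph E (boundary_paths_at E (path_vertex E z n)))))) \<and>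
     ((\<forall>z \<in> infinite_paths E. \<exists>n.
          finite (splitting_pairs (path_subgraph E (boundary_paths_at E (path_vertex E z n))))) \<longleftrightarrow>
      (\<forall>z \<in> infinite_paths E. \<exists>n. \<exists>F \<subseteq> finite_paths E. finite F \<and>
          (\<forall>x \<in> boundary_paths_at E (path_vertex E z n).
           \<forall>y \<in> boundary_paths_at E (path_vertex E z n).
             shift_equivalent E x y \<longrightarrow>
             (\<exists>\<alpha> \<in> F. \<exists>\<beta> \<in> F. monolithic_extension E (x, y) (\<alpha>, \<beta>)))))"
proof -
  have G: "wf_digraph E" "countable (verts E)" "countable (arcs E)"
    using assms(1) by (auto simp: countable_digraph_def)
  interpret G: acyclic_digraph E
    using G(1) assms(3) by (simp add: acyclic_digraph_def acyclic_digraph_axioms_def)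
  note A = assms(4)[unfolded graph_cstar_algebra_def]
  interpret U: universal_graph_algebra E A p s
  proof (intro universal_graph_algebra.intro graph_algebra.intro graph_algebra_axioms.intro
      universal_graph_algebra_axioms.intro G.acyclic_digraph_axioms)
    show "cstar_algebra A" "ck_family E A p s" using A by simp_all
    show "row_finite E" "countable (verts E)" "countable (arcs E)" using assms(2) G by simp_all
    show "S = carrier A" if "cstar_subalgebra A S" "p ` verts E \<subseteq> S" "s ` arcs E \<subseteq> S" for S
      using A that by simp
    show "\<exists>\<phi>. star_hom A B \<phi> \<and> (\<forall>v\<in>verts E. \<phi> (p v) = q v) \<and> (\<forall>f\<in>arcs E. \<phi> (s f) = t f)"
      if "cstar_algebra B" "ck_family E B q t" for B :: "((nat \<Rightarrow> complex) \<Rightarrow> nat \<Rightarrow> complex) cstar" and q t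
      using A that by simp
  qed
  have "Fell A \<longleftrightarrow> (\<forall>f. InfPath f \<in> infinite_paths E \<longrightarrow> (\<exists>n. splitting_edges E (head E (f n)) = {}))"
    using U.Fell_if_no_splitting U.Fell_imp_no_splitting by blast
  \<comment> \<open>The equivalence \<open>monolithic_iff\<close> is stated for vertices of the
    graph.\<close>
  moreover have "path_vertex E z n \<in> verts E" if z: "z \<in> infinite_paths E" for z n
  proof -
    obtain f where f: "z = InfPath f" using z by (auto simp: infinite_paths_def)
    then have "f n \<in> arcs E" using z by (auto simp: infinite_paths_def)
    then show ?thesis using G.path_vertex_InfPath[of f n] z f by simp
  qed
  ultimately show ?thesis
    unfolding G.no_splitting_iff[symmetric] using G.monolithic_iff by (simp cong: ball_cong)
qed

end
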